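(* For every $d\ge2$, every extended pointed metric $(d+1)$-ended ribbon tree $(\mathcal{T},p,d_{\mathcal{T}})$ is realizable.
   Context: For a finite tree, ends $\epsilon(\mathcal{T})$ are vertices whose removal leaves it connected, branch points $\beta(\mathcal{T})$ are vertices whose removal leaves $\ge3$ components, $\mathrm{Int}(\mathcal{T})=\mathcal{T}\setminus\epsilon(\mathcal{T})$. A marked $(d+1)$-ended ribbon tree is a finite tree with planar embedding up to isotopy, vertex set $\beta\cup\epsilon$, exactly $d+1$ ends and one marked end. Its modified edge metric gives edges between branch points length $1$ and edges incident to ends infinite length, extended linearly. An extended pointed metric $(d+1)$-ended ribbon tree $(\mathcal{T},p,d_{\mathcal{T}})$ is a tree with a distinguished vertex $p$ of valence $2$ such that forgetting $p$ as a vertex yields a marked $(d+1)$-ended ribbon tree, and $d_{\mathcal{T}}$ is the linear extension of its modified edge metric; $d^s_{\mathcal{T}}=s\,d_{\mathcal{T}}$. $\mathcal{B}^-_d=\{\bar z\prod_{i=1}^{d-1}\frac{\bar z-a_i}{1-\overline{a_iz}}:|a_i|<1\}$; with $\mathbb{S}^1=\mathbb{R}/\mathbb{Z}$, $m_{-d}(t)=-dt$, $\eta_f$ is the unique quasisymmetric conjugacy $\eta_f\circ m_{-d}=f\circ\eta_f$, continuous in $f$, $\eta_{m_{-d}}=\mathrm{id}$; $\mathcal{B}^-_d(K)$ consists of $f$ with $\log|\partial_{\bar z}f(\eta_f(x))|\le K$ at all fixed points $x$ of $m_{-d}$; $F(f)$ is the set of repelling fixed points on $\mathbb{S}^1$,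 marked point $\eta_f(1)$. Realizable means: there exist $K,M,R>0$, a family $f_s\in\mathcal{B}^-_d(K)$, $s\in(0,\infty)$, and $M$-quasi-isometric embeddings $\phi_s:(\mathrm{Int}(\mathcal{T}),p,d^s_{\mathcal{T}})\to(\mathbb{D},0,d_{\mathbb{D}})$ ($d_{\mathbb{D}}$ hyperbolic metric) such that $\phi_s$ extends continuously to $\mathcal{T}\to\mathbb{D}\cup\mathbb{S}^1$ with a marking-preserving bijection $\epsilon(\mathcal{T})\to F(f_s)$; edges map to hyperbolic geodesics joining the images of endpoints; for each $v\in\beta(\mathcal{T})$ exactly $\mathrm{val}(v)-2$ critical points of $f_s$ (with multiplicity) lie in $B_{\mathbb{D}}(\phi_s(v),R)$; and $d_{\mathbb{D}}(f_s(\phi_s(x)),\phi_s(x))\le M$ for all $x\in\mathrm{Int}(\mathcal{T})$ and all $s$. *)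

theory Defs
  imports "HOL-Complex_Analysis.Complex_Analysis"
begin

section \<open>Finite trees (combinatorial)\<close>

text \<open>A graph is given by a vertex set V and a set E of 2-element edges.\<close>

definition adj :: "'v set set \<Rightarrow> ('v \<times> 'v) set" where
  "adj E = {(x, y). {x, y} \<in> E}"

definition graph_connected :: "'v set \<Rightarrow> 'v set set \<Rightarrow> bool" where
  "graph_connected V E \<longleftrightarrow> (\<forall>x\<in>V. \<forall>y\<in>V. (x, y) \<in> (adj E)\<^sup>*)"

definition is_graph :: "'v set \<Rightarrow> 'v set set \<Rightarrow> bool" where
  "is_graph V E \<longleftrightarrow> E \<subseteq> {{x, y} | x y. x \<in> V \<and> y \<in> V \<and> x \<noteq> y}"

text \<open>Tree: finite, nonempty, connected, acyclic (every edge is a bridge).\<close>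
definition is_tree :: "'v set \<Rightarrow> 'v set set \<Rightarrow> bool" where
  "is_tree V E \<longleftrightarrow> finite V \<and> V \<noteq> {} \<and> is_graph V E \<and> graph_connected V E \<and>
     (\<forall>x y. {x, y} \<in> E \<longrightarrow> (x, y) \<notin> (adj (E - {{x, y}}))\<^sup>*)"

text \<open>Removing a vertex and all incident edges.\<close>
definition del_vertex_E :: "'v \<Rightarrow> 'v set set \<Rightarrow> 'v set set" where
  "del_vertex_E v E = {e \<in> E. v \<notin> e}"

definition num_components :: "'v set \<Rightarrow> 'v set set \<Rightarrow> nat" where
  "num_components V E = card (V // {(x, y). x \<in> V \<and> y \<in> V \<and> (x, y) \<in> (adj E)\<^sup>*})"

text \<open>Ends: removal leaves the tree connected. Branch points: removal leaves \<ge> 3 components.\<close>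
definition tree_ends :: "'v set \<Rightarrow> 'v set set \<Rightarrow> 'v set" where
  "tree_ends V E = {v \<in> V. graph_connected (V - {v}) (del_vertex_E v E)}"

definition branch_points :: "'v set \<Rightarrow> 'v set set \<Rightarrow> 'v set" where
  "branch_points V E = {v \<in> V. num_components (V - {v}) (del_vertex_E v E) \<ge> 3}"

definition nbrs :: "'v set set \<Rightarrow> 'v \<Rightarrow> 'v set" where
  "nbrs E v = {w. {v, w} \<in> E}"

definition valence :: "'v set set \<Rightarrow> 'v \<Rightarrow> nat" where
  "valence E v = card {e \<in> E. v \<in> e}"

text \<open>Ribbon structure (planar embedding): a cyclic ordering of the neighbours at each vertex,
  given by a successor map acting as a single cycle on the neighbours.\<close>
definition ribbon_structure :: "'v set \<Rightarrow> 'v set set \<Rightarrow> ('v \<Rightarrow> 'v \<Rightarrow> 'v) \<Rightarrow> bool" where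
  "ribbon_structure V E rot \<longleftrightarrow> (\<forall>v\<in>V. bij_betw (rot v) (nbrs E v) (nbrs E v) \<and>
      (\<forall>u\<in>nbrs E v. \<forall>w\<in>nbrs E v. \<exists>k. (rot v ^^ k) u = w))"

text \<open>Marked (d+1)-ended ribbon tree with marked end m.\<close>
definition marked_ribbon_tree ::
  "nat \<Rightarrow> 'v set \<Rightarrow> 'v set set \<Rightarrow> ('v \<Rightarrow> 'v \<Rightarrow> 'v) \<Rightarrow> 'v \<Rightarrow> bool" where
  "marked_ribbon_tree d V E rot m \<longleftrightarrow> is_tree V E \<and> ribbon_structure V E rot \<and>
     V = branch_points V E \<union> tree_ends V E \<and> card (tree_ends V E) = d + 1 \<and>
     m \<in> tree_ends V E"

section \<open>Geometric realisation of Int(T) with the modified edge metric\<close>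

text \<open>A point of Int(T) is represented by a triple (u, v, t): the point on the edge {u,v},
  u a branch point, at distance t from u (t \<in> [0,1] if v is a branch point,
  t \<in> [0,\<infinity>) if v is an end, the end itself lying at infinite distance).
  Different triples may represent the same point (exactly when their distance is 0).\<close>

type_synonym 'v tpt = "'v \<times> 'v \<times> real"

definition int_pts :: "'v set \<Rightarrow> 'v set set \<Rightarrow> 'v tpt set" where
  "int_pts V E = {(u, v, t). {u, v} \<in> E \<and> u \<in> branch_points V E \<and> 0 \<le> t \<and>
       (v \<in> branch_points V E \<longrightarrow> t \<le> 1)}"

text \<open>Combinatorial distance (number of edges on the path).\<close>
definition graph_dist :: "'v set set \<Rightarrow> 'v \<Rightarrow> 'v \<Rightarrow> nat" where
  "graph_dist E a b = (LEAST n. (a, b) \<in> (adj E) ^^ n)"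

text \<open>Branch-point endpoints of the edge carrying a point, with distances to them.\<close>
definition end_dists :: "'v set \<Rightarrow> 'v set set \<Rightarrow> 'v tpt \<Rightarrow> ('v \<times> real) set" where
  "end_dists V E x = (case x of (u, v, t) \<Rightarrow>
      {(u, t)} \<union> (if v \<in> branch_points V E then {(v, 1 - t)} else {}))"

text \<open>Linear extension of the modified edge metric (edges between branch points length 1,
  edges incident to ends infinite length).\<close>
definition tree_dist :: "'v set \<Rightarrow> 'v set set \<Rightarrow> 'v tpt \<Rightarrow> 'v tpt \<Rightarrow> real" where
  "tree_dist V E x y = (case x of (u, v, t) \<Rightarrow> case y of (u', v', t') \<Rightarrow>
     if {u, v} = {u', v'} then (if u = u' then \<bar>t - t'\<bar> else \<bar>t - (1 - t')\<bar>)
     else Min {ta + real (graph_dist E a b) + tb | a ta b tb.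
                 (a, ta) \<in> end_dists V E x \<and> (b, tb) \<in> end_dists V E y})"

text \<open>Extended pointed metric (d+1)-ended ribbon tree: the marked ribbon tree obtained by
  forgetting p, together with the point p = (pu, pv, pt) lying in the interior of the edge
  {pu, pv} (a valence-2 vertex of the extended tree).\<close>
definition ext_pointed_tree ::
  "nat \<Rightarrow> 'v set \<Rightarrow> 'v set set \<Rightarrow> ('v \<Rightarrow> 'v \<Rightarrow> 'v) \<Rightarrow> 'v \<Rightarrow> 'v tpt \<Rightarrow> bool" where
  "ext_pointed_tree d V E rot m p \<longleftrightarrow> marked_ribbon_tree d V E rot m \<and>
     (case p of (pu, pv, pt) \<Rightarrow> {pu, pv} \<in> E \<and> pu \<in> branch_points V E \<and> 0 < pt \<and>
        (pv \<in> branch_points V E \<longrightarrow> pt < 1))"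

section \<open>Hyperbolic disk\<close>

definition hdist :: "complex \<Rightarrow> complex \<Rightarrow> real" where
  "hdist z w = 2 * artanh (cmod ((z - w) / (1 - cnj w * z)))"

definition hball :: "complex \<Rightarrow> real \<Rightarrow> complex set" where
  "hball c r = {z \<in> ball 0 1. hdist c z < r}"

definition mob_inv :: "complex \<Rightarrow> complex \<Rightarrow> complex" where
  "mob_inv a w = (w + a) / (1 + cnj a * w)"

text \<open>Hyperbolic geodesic segment from a to b (both in the disk).\<close>
definition hseg :: "complex \<Rightarrow> complex \<Rightarrow> complex set" where
  "hseg a b = (\<lambda>r. mob_inv a (of_real r * ((b - a) / (1 - cnj a * b)))) ` {0..1}"

text \<open>Hyperbolic geodesic ray from a in the disk to the boundary point \<xi> (excluding \<xi>).\<close>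
definition hray :: "complex \<Rightarrow> complex \<Rightarrow> complex set" where
  "hray a \<xi> = (\<lambda>r. mob_inv a (of_real r * ((\<xi> - a) / (1 - cnj a * \<xi>)))) ` {0..<1}"

section \<open>Anti-Blaschke products\<close>

definition bparams :: "nat \<Rightarrow> (nat \<Rightarrow> complex) set" where
  "bparams d = {a. (\<forall>i<d - 1. cmod (a i) < 1) \<and> (\<forall>i\<ge>d - 1. a i = 0)}"

definition antiblaschke :: "nat \<Rightarrow> (nat \<Rightarrow> complex) \<Rightarrow> complex \<Rightarrow> complex" where
  "antiblaschke d a z = cnj z * (\<Prod>i<d - 1. (cnj z - a i) / (1 - cnj (a i * z)))"

text \<open>S^1 = R/Z, realised in the complex plane via t \<mapsto> exp(2 \<pi> i t).\<close>
definition circ :: "real \<Rightarrow> complex" where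
  "circ t = cis (2 * pi * t)"

text \<open>Quasisymmetric conjugacy h : R/Z \<rightarrow> S^1 (a 1-periodic function on R) between
  m_{-d}(t) = -d t and f: a homeomorphism R/Z \<rightarrow> S^1, quasisymmetric, with
  h \<circ> m_{-d} = f \<circ> h.\<close>
definition qs_conjugacy :: "nat \<Rightarrow> (complex \<Rightarrow> complex) \<Rightarrow> (real \<Rightarrow> complex) \<Rightarrow> bool" where
  "qs_conjugacy d f h \<longleftrightarrow>
     (\<forall>t. h (t + 1) = h t) \<and> continuous_on UNIV h \<and> inj_on h {0..<1} \<and>
     h ` UNIV = sphere 0 1 \<and>
     (\<exists>M. \<forall>x t. 0 < t \<longrightarrow> t < 1/2 \<longrightarrow>
          cmod (h (x + t) - h x) \<le> M * cmod (h x - h (x - t))) \<and>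
     (\<forall>t. h (- real d * t) = f (h t))"

text \<open>The family f \<mapsto> \<eta>_f: conjugacies, continuous in f (parameters), \<eta>_{m_{-d}} = id.\<close>
definition eta_family :: "nat \<Rightarrow> ((nat \<Rightarrow> complex) \<Rightarrow> real \<Rightarrow> complex) \<Rightarrow> bool" where
  "eta_family d Eta \<longleftrightarrow>
     (\<forall>a\<in>bparams d. qs_conjugacy d (antiblaschke d a) (Eta a)) \<and>
     (\<forall>a. a \<notin> bparams d \<longrightarrow> Eta a = (\<lambda>_. 0)) \<and>
     (\<forall>a\<in>bparams d. \<forall>\<epsilon>>0. \<exists>\<delta>>0. \<forall>b\<in>bparams d.
         (\<forall>i<d - 1. cmod (b i - a i) < \<delta>) \<longrightarrow> (\<forall>t. cmod (Eta b t - Eta a t) < \<epsilon>)) \<and>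
     Eta (\<lambda>_. 0) = circ"

definition eta :: "nat \<Rightarrow> (nat \<Rightarrow> complex) \<Rightarrow> real \<Rightarrow> complex" where
  "eta d a = (THE Eta. eta_family d Eta) a"

text \<open>Wirtinger derivative \<partial>/\<partial>zbar = (\<partial>_x + i \<partial>_y)/2.\<close>
definition dbar :: "(complex \<Rightarrow> complex) \<Rightarrow> complex \<Rightarrow> complex" where
  "dbar f z = (vector_derivative (\<lambda>x::real. f (z + of_real x)) (at 0) +
               \<i> * vector_derivative (\<lambda>y::real. f (z + \<i> * of_real y)) (at 0)) / 2"

text \<open>B^-_d(K) (via parameters): log |\<partial>_zbar f(\<eta>_f(x))| \<le> K at all fixed points x of m_{-d}.\<close>
definition in_BK :: "nat \<Rightarrow> real \<Rightarrow> (nat \<Rightarrow> complex) \<Rightarrow> bool" where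
  "in_BK d K a \<longleftrightarrow> a \<in> bparams d \<and>
     (\<forall>x::real. (\<exists>n::int. - real d * x = x + of_int n) \<longrightarrow>
        ln (cmod (dbar (antiblaschke d a) (eta d a x))) \<le> K)"

text \<open>Repelling fixed points on S^1 of an anti-holomorphic map.\<close>
definition rep_fix_circle :: "(complex \<Rightarrow> complex) \<Rightarrow> complex set" where
  "rep_fix_circle f = {z. cmod z = 1 \<and> f z = z \<and> cmod (dbar f z) > 1}"

text \<open>Number of critical points, with multiplicity, of an anti-holomorphic f in a set S.\<close>
definition num_crit :: "(complex \<Rightarrow> complex) \<Rightarrow> complex set \<Rightarrow> nat" where
  "num_crit f S = (\<Sum>z\<in>{z \<in> S. dbar f z = 0}. nat (zorder (\<lambda>w. cnj (dbar f w)) z))"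

section \<open>Realizability\<close>

definition vpt :: "'v set set \<Rightarrow> 'v \<Rightarrow> 'v tpt" where
  "vpt E v = (v, SOME w. {v, w} \<in> E, 0)"

definition realizes ::
  "nat \<Rightarrow> 'v set \<Rightarrow> 'v set set \<Rightarrow> 'v \<Rightarrow> 'v tpt \<Rightarrow> real \<Rightarrow> real \<Rightarrow> real \<Rightarrow>
   (nat \<Rightarrow> complex) \<Rightarrow> ('v tpt \<Rightarrow> complex) \<Rightarrow> ('v \<Rightarrow> complex) \<Rightarrow> bool" where
  "realizes d V E m p s M R a \<phi> \<psi> \<longleftrightarrow>
    (let B = branch_points V E; Ends = tree_ends V E; P = int_pts V E;
         f = antiblaschke d a in
     case p of (pu, pv, pt) \<Rightarrow>
     \<comment> \<open>well-defined map Int(T) \<rightarrow> D, pointed\<close>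
     (\<forall>x\<in>P. \<phi> x \<in> ball 0 1) \<and>
     (\<forall>x\<in>P. \<forall>y\<in>P. tree_dist V E x y = 0 \<longrightarrow> \<phi> x = \<phi> y) \<and>
     \<phi> p = 0 \<and>
     \<comment> \<open>M-quasi-isometric embedding (Int(T), s d_T) \<rightarrow> (D, d_D)\<close>
     (\<forall>x\<in>P. \<forall>y\<in>P. s * tree_dist V E x y / M - M \<le> hdist (\<phi> x) (\<phi> y) \<and>
                   hdist (\<phi> x) (\<phi> y) \<le> M * (s * tree_dist V E x y) + M) \<and>
     \<comment> \<open>continuous extension to T \<rightarrow> D \<union> S^1, ends going to \<psi>\<close>
     (\<forall>u v. continuous_on {t. (u, v, t) \<in> P} (\<lambda>t. \<phi> (u, v, t))) \<and>
     (\<forall>u e. e \<in> Ends \<longrightarrow> {u, e} \<in> E \<longrightarrow> ((\<lambda>t. \<phi> (u, e, t)) \<longlongrightarrow> \<psi> e) at_top) \<and>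
     \<comment> \<open>marking-preserving bijection ends \<rightarrow> F(f)\<close>
     bij_betw \<psi> Ends (rep_fix_circle f) \<and> \<psi> m = eta d a 0 \<and>
     \<comment> \<open>edges of the extended tree map onto geodesics\<close>
     (\<forall>u v. {u, v} \<in> E \<longrightarrow> u \<in> B \<longrightarrow> {u, v} \<noteq> {pu, pv} \<longrightarrow>
        (v \<in> B \<longrightarrow> (\<lambda>t. \<phi> (u, v, t)) ` {0..1} = hseg (\<phi> (u, v, 0)) (\<phi> (u, v, 1))) \<and>
        (v \<in> Ends \<longrightarrow> (\<lambda>t. \<phi> (u, v, t)) ` {0..} = hray (\<phi> (u, v, 0)) (\<psi> v))) \<and>
     (\<lambda>t. \<phi> (pu, pv, t)) ` {0..pt} = hseg (\<phi> (pu, pv, 0)) 0 \<and>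
     (pv \<in> B \<longrightarrow> (\<lambda>t. \<phi> (pu, pv, t)) ` {pt..1} = hseg 0 (\<phi> (pu, pv, 1))) \<and>
     (pv \<in> Ends \<longrightarrow> (\<lambda>t. \<phi> (pu, pv, t)) ` {pt..} = hray 0 (\<psi> pv)) \<and>
     \<comment> \<open>critical points near branch points\<close>
     (\<forall>v\<in>B. num_crit f (hball (\<phi> (vpt E v)) R) = valence E v - 2) \<and>
     \<comment> \<open>bounded displacement\<close>
     (\<forall>x\<in>P. hdist (f (\<phi> x)) (\<phi> x) \<le> M))"

definition realizable :: "nat \<Rightarrow> 'v set \<Rightarrow> 'v set set \<Rightarrow> 'v \<Rightarrow> 'v tpt \<Rightarrow> bool" where
  "realizable d V E m p \<longleftrightarrow> (\<exists>K M R. K > 0 \<and> M > 0 \<and> R > 0 \<and>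
     (\<forall>s>0. \<exists>a \<phi> \<psi>. in_BK d K a \<and> realizes d V E m p s M R a \<phi> \<psi>))"

end

theory Submission
  imports Defs "HOL-Computational_Algebra.Fundamental_Theorem_Algebra"
begin

text \<open>Probability measures on the circle with \<open>d + 1\<close> atoms of masses \<open>w\<^sub>e\<close> and barycentre \<open>0\<close> yield, up to rotation,
  anti-Blaschke products \<open>f\<close> whose fixed points on the circle are the atoms, with multiplier
  \<open>1 / w\<^sub>e - 1\<close>. Seen from a point \<open>x\<close> of the disc, \<open>f x\<close> is the barycentre of the measure, so \<open>f\<close> moves \<open>x\<close> by a
  bounded amount as soon as two atoms of definite weight are separated seen from \<open>x\<close>; and the derivative
  of \<open>f\<close> is governed by a variance which has \<open>k - 2\<close> zeros near \<open>x\<close> when the measure seen from \<open>x\<close> consists of \<open>k\<close>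
  tight clusters of definite weight. It therefore suffices to place the vertices and ends of the tree
  in the disc such that from every branch point the ends are seen in clusters, one for each edge. A
  self-similar placement at scale \<open>exp (- s)\<close> does this with constants independent of \<open>s\<close>, and Busemann
  functions of the ends give the quasi-isometry bounds.\<close>

section \<open>The hyperbolic metric, Poisson kernels and Busemann functions\<close>

text \<open>All constants have to be fixed before \<open>s\<close> is known. In the limit of tight
  clusters a branch point sees a configuration \<open>dir\<close> that depends on the digits
  assigned to the tree but on no scale. Its gaps give the separation constant, and the zero count
  for it gives one radius \<open>r\<close> with tolerances, hence an upper bound
  \<open>\<kappa>\<close> for every scale in use. Small values of \<open>s\<close> would violate
  that bound; therefore the tree is placed at scale exp (- \<sigma>) with \<sigma> = max s s0, and
  the bounded excess of \<sigma> over s is absorbed by the additive errors. The weights have a lower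
  bound in terms of the number of ends alone, which bounds K through the multipliers. The barycentre
  is 0 because 0, the image of the base point, has to be fixed: an anti-Blaschke product has the
  factor \<open>cnj z\<close>. Since \<open>eta\<close> is a definite description, nothing can be
  said about the marking until the conjugacies are known to exist and to form the only continuous
  family starting at \<open>circ\<close>.\<close>

definition mob :: "complex \<Rightarrow> complex \<Rightarrow> complex" where
  "mob a z = (z - a) / (1 - cnj a * z)"

definition pker :: "complex \<Rightarrow> complex \<Rightarrow> real" where
  "pker z \<zeta> = (1 - (cmod z)\<^sup>2) / (cmod (\<zeta> - z))\<^sup>2"

definition bus :: "complex \<Rightarrow> complex \<Rightarrow> real" where
  "bus \<zeta> z = ln (pker z \<zeta>)"

lemma one_minus_cnj_mult_nz: 
  assumes "cmod a < 1" "cmod z \<le> 1" shows "1 - cnj a * z \<noteq> 0" "1 + cnj a * z \<noteq> 0"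
proof -
  have "cmod (cnj a * z) < 1"
    using assms by (metis complex_mod_cnj mult_le_one norm_ge_zero norm_mult order_less_le_trans
        linorder_not_less mult.commute mult_left_le order_trans)
  then show "1 - cnj a * z \<noteq> 0" "1 + cnj a * z \<noteq> 0"
    by (auto simp: add_eq_0_iff)
qed

lemma mob_0 [simp]: "mob 0 z = z" "mob a a = 0"
  by (auto simp: mob_def)

lemma mob_mob_inv:
  assumes "cmod a < 1" "cmod w \<le> 1" shows "mob a (mob_inv a w) = w"
proof -
  have n: "1 + cnj a * w \<noteq> 0" using one_minus_cnj_mult_nz[OF assms] by simp
  have n2: "1 - cnj a * a \<noteq> 0" using one_minus_cnj_mult_nz[OF assms(1), of a] assms(1) by simp
  have "(w + a) / (1 + cnj a * w) - a = w * (1 - cnj a * a) / (1 + cnj a * w)"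
    using n by (simp add: field_simps)
  moreover have "1 - cnj a * ((w + a) / (1 + cnj a * w)) = (1 - cnj a * a) / (1 + cnj a * w)"
    using n by (simp add: field_simps)
  ultimately show ?thesis unfolding mob_def mob_inv_def using n n2 by simp
qed

lemma mob_inv_mob:
  assumes "cmod a < 1" "cmod z \<le> 1" shows "mob_inv a (mob a z) = z"
proof -
  have n: "1 - cnj a * z \<noteq> 0" using one_minus_cnj_mult_nz[OF assms] by simp
  have n2: "1 - cnj a * a \<noteq> 0" using one_minus_cnj_mult_nz[OF assms(1), of a] assms(1) by simp
  have "(z - a) / (1 - cnj a * z) + a = z * (1 - cnj a * a) / (1 - cnj a * z)"
    using n by (simp add: field_simps)
  moreover have "1 + cnj a * ((z - a) / (1 - cnj a * z)) = (1 - cnj a * a) / (1 - cnj a * z)"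
    using n by (simp add: field_simps)
  ultimately show ?thesis unfolding mob_def mob_inv_def using n n2 by simp
qed

lemma mob_inv_eq_mob: "mob_inv a w = mob (-a) w"
  by (simp add: mob_inv_def mob_def)

lemma norm_sq_diff:
  "(cmod (1 - cnj a * z))\<^sup>2 - (cmod (z - a))\<^sup>2 = (1 - (cmod a)\<^sup>2) * (1 - (cmod z)\<^sup>2)"
  unfolding cmod_power2 by (simp add: algebra_simps power2_eq_square)

lemma one_minus_norm_mob:
  assumes "cmod a < 1" "cmod z \<le> 1"
  shows "1 - (cmod (mob a z))\<^sup>2 = (1 - (cmod a)\<^sup>2) * (1 - (cmod z)\<^sup>2) / (cmod (1 - cnj a * z))\<^sup>2"
proof -
  have n: "cmod (1 - cnj a * z) \<noteq> 0" using one_minus_cnj_mult_nz[OF assms] by simp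
  show ?thesis unfolding mob_def norm_divide power_divide norm_sq_diff[symmetric]
    using n by (simp add: field_simps)
qed

lemma norm_mob_less:
  assumes "cmod a < 1" "cmod z < 1" shows "cmod (mob a z) < 1"
proof -
  have "cmod (1 - cnj a * z) \<noteq> 0" using one_minus_cnj_mult_nz[OF assms(1)] assms by simp
  then have "1 - (cmod (mob a z))\<^sup>2 > 0"
    using assms one_minus_norm_mob[of a z] by (simp add: abs_square_less_1)
  then show ?thesis by (simp add: power_less_one_iff abs_square_less_1)
qed

lemma norm_mob_eq:
  assumes "cmod a < 1" "cmod z = 1" shows "cmod (mob a z) = 1"
  using one_minus_norm_mob[of a z] assms by (simp add: power2_eq_1_iff) (smt (verit) norm_ge_zero)

lemma norm_mob_inv_less:
  assumes "cmod a < 1" "cmod z < 1" shows "cmod (mob_inv a z) < 1"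
  using norm_mob_less[of "-a" z] assms by (simp add: mob_inv_eq_mob)

lemma mob_diff:
  assumes "cmod a < 1" "cmod z \<le> 1" "cmod w \<le> 1"
  shows "mob a z - mob a w = (z - w) * (1 - cnj a * a) / ((1 - cnj a * z) * (1 - cnj a * w))"
proof -
  have "1 - cnj a * z \<noteq> 0" "1 - cnj a * w \<noteq> 0" using one_minus_cnj_mult_nz assms by auto
  then show ?thesis unfolding mob_def by (simp add: diff_frac_eq algebra_simps)
qed

lemma mob_conj_prod:
  assumes "cmod a < 1" "cmod z \<le> 1" "cmod w \<le> 1"
  shows "1 - cnj (mob a w) * mob a z = (1 - cnj w * z) * (1 - cnj a * a) / ((1 - a * cnj w) * (1 - cnj a * z))"
proof -
  have "1 - cnj a * z \<noteq> 0" "1 - cnj a * w \<noteq> 0" using one_minus_cnj_mult_nz assms by auto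
  moreover from this have "1 - a * cnj w \<noteq> 0"
    by (metis complex_cnj_cnj complex_cnj_diff complex_cnj_mult complex_cnj_one complex_cnj_zero_iff)
  ultimately show ?thesis unfolding mob_def
    by (simp add: divide_simps) (simp add: algebra_simps)
qed

lemma one_minus_aa_pos: assumes "cmod a < 1" shows "cmod (1 - cnj a * a) = 1 - (cmod a)\<^sup>2" "1 - (cmod a)\<^sup>2 > 0"
proof -
  show *: "1 - (cmod a)\<^sup>2 > 0" using assms by (simp add: abs_square_less_1)
  have "1 - cnj a * a = of_real (1 - (cmod a)\<^sup>2)"
    using complex_norm_square[of a] by (simp add: mult.commute)
  then show "cmod (1 - cnj a * a) = 1 - (cmod a)\<^sup>2" using * by (metis abs_of_pos norm_of_real)
qed

lemma norm_one_minus_commute: "cmod (1 - a * cnj w) = cmod (1 - cnj a * w)"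
  by (metis complex_cnj_cnj complex_cnj_diff complex_cnj_mult complex_cnj_one complex_mod_cnj)

lemma hdist_mob_eq: "hdist z w = 2 * artanh (cmod (mob w z))"
  by (simp add: hdist_def mob_def)

text \<open>The difference of the images and their conjugate product both carry the factor
  \<open>1 - cnj a * a\<close> over denominators of equal modulus, so these cancel in the
  quotient.\<close>

lemma norm_mob_mob:
  assumes "cmod a < 1" "cmod z < 1" "cmod w < 1"
  shows "cmod (mob (mob a w) (mob a z)) = cmod (mob w z)"
proof -
  have nz: "cmod (1 - cnj a * z) \<noteq> 0" "cmod (1 - cnj a * w) \<noteq> 0" "cmod (1 - cnj w * z) \<noteq> 0"
    using one_minus_cnj_mult_nz assms by auto
  have p: "1 - (cmod a)\<^sup>2 \<noteq> 0" using one_minus_aa_pos(2)[OF assms(1)] by simp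
  have *: "(D * q / (A * B)) / (C * q / (B * A)) = D / C" if "q \<noteq> 0" "A \<noteq> 0" "B \<noteq> 0" for A B C D q :: real
    using that by simp
  have "cmod (mob (mob a w) (mob a z)) = cmod (mob a z - mob a w) / cmod (1 - cnj (mob a w) * mob a z)"
    by (simp add: mob_def[of "mob a w"] norm_divide)
  also have "\<dots> = (cmod (z - w) * (1 - (cmod a)\<^sup>2) / (cmod (1 - cnj a * z) * cmod (1 - cnj a * w)))
      / (cmod (1 - cnj w * z) * (1 - (cmod a)\<^sup>2) / (cmod (1 - cnj a * w) * cmod (1 - cnj a * z)))"
    using mob_diff[of a z w] mob_conj_prod[of a z w] assms
    by (simp only: less_imp_le norm_divide norm_mult one_minus_aa_pos(1)[OF assms(1)] norm_one_minus_commute)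
  also have "\<dots> = cmod (z - w) / cmod (1 - cnj w * z)"
    by (rule *) (use nz p in auto)
  finally show ?thesis by (simp add: mob_def norm_divide)
qed

lemma hdist_mob:
  assumes "cmod a < 1" "cmod z < 1" "cmod w < 1"
  shows "hdist (mob a z) (mob a w) = hdist z w"
  by (simp add: hdist_mob_eq norm_mob_mob assms)

lemma hdist_mob_inv:
  assumes "cmod a < 1" "cmod z < 1" "cmod w < 1"
  shows "hdist (mob_inv a z) (mob_inv a w) = hdist z w"
  using assms by (simp add: mob_inv_eq_mob hdist_mob)

lemma tanh_artanh: assumes "\<bar>x\<bar> < (1::real)" shows "tanh (artanh x) = x"
proof -
  have p: "(1 + x) / (1 - x) > 0" "1 - x > 0" "1 + x > 0" using assms by auto
  have e: "exp (- 2 * artanh x) = (1 - x) / (1 + x)"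
    using p by (simp add: artanh_def exp_minus)
  have "1 - (1 - x) / (1 + x) = 2 * x / (1 + x)" "1 + (1 - x) / (1 + x) = 2 / (1 + x)"
    using p by (simp_all add: field_simps)
  then show ?thesis using p by (simp add: tanh_real_altdef e[simplified])
qed

lemma hdist_commute: "hdist z w = hdist w z"
proof -
  have "cmod (mob w z) = cmod (mob z w)"
    by (simp add: mob_def norm_divide norm_minus_commute) 
      (metis complex_cnj_cnj norm_one_minus_commute mult.commute)
  then show ?thesis by (simp add: hdist_mob_eq)
qed

lemma artanh_mono: assumes "0 \<le> x" "x \<le> y" "y < (1::real)" shows "artanh x \<le> artanh y"
proof -
  have "(1 + x) / (1 - x) \<le> (1 + y) / (1 - y)" using assms by (intro frac_le) auto
  then show ?thesis unfolding artanh_def using assms by (simp add: divide_right_mono)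
qed

lemma hdist_nonneg: assumes "cmod z < 1" "cmod w < 1" shows "hdist z w \<ge> 0"
  using artanh_mono[of 0 "cmod (mob w z)"] norm_mob_less[OF assms(2,1)] by (simp add: hdist_mob_eq)

lemma hdist_same [simp]: "hdist z z = 0" by (simp add: hdist_def)

lemma tanh_half_hdist:
  assumes "cmod z < 1" "cmod w < 1" shows "tanh (hdist z w / 2) = cmod (mob w z)"
  using norm_mob_less[OF assms(2,1)] by (simp add: hdist_mob_eq tanh_artanh abs_if)

lemma artanh_tanh [simp]: "artanh (tanh (x::real)) = x"
  by (simp add: artanh_tanh_real)

lemma hdist_0: "hdist z 0 = 2 * artanh (cmod z)" "hdist 0 z = 2 * artanh (cmod z)"
  by (simp_all add: hdist_def)

lemma hdist_less_iff:
  assumes "cmod z < 1" "cmod w < 1" "0 < r" "r < 1"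
  shows "hdist z w < 2 * artanh r \<longleftrightarrow> cmod (mob w z) < r"
proof -
  have "hdist z w < 2 * artanh r \<longleftrightarrow> tanh (hdist z w / 2) < tanh (artanh r)"
    by (simp only: tanh_real_less_iff) auto
  then show ?thesis using assms by (simp add: tanh_half_hdist tanh_artanh abs_if)
qed

text \<open>The triangle inequality through 0 for the pseudohyperbolic metric:
  \<open>one_minus_norm_mob\<close> is smallest when its denominator takes the largest possible
  value 1 + |z| |w|. The bound is the addition formula of tanh.\<close>

lemma norm_mob_le:
  assumes "cmod z < 1" "cmod w < 1"
  shows "cmod (mob w z) \<le> (cmod z + cmod w) / (1 + cmod z * cmod w)"
proof -
  let ?a = "cmod z" and ?b = "cmod w"
  have n: "cmod (1 - cnj w * z) > 0" using one_minus_cnj_mult_nz[of w z] assms by simp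
  have n2: "1 + ?a * ?b > 0" by (simp add: add_pos_nonneg)
  have le: "cmod (1 - cnj w * z) \<le> 1 + ?a * ?b"
    by (metis complex_mod_cnj mult.commute norm_mult norm_one norm_triangle_ineq4)
  have pp: "(1 - ?b\<^sup>2) * (1 - ?a\<^sup>2) \<ge> 0" using one_minus_aa_pos assms by (simp add: less_imp_le)
  have "(1 - ?b\<^sup>2) * (1 - ?a\<^sup>2) / (1 + ?a*?b)\<^sup>2 \<le> 1 - (cmod (mob w z))\<^sup>2"
    unfolding one_minus_norm_mob[OF assms(2) less_imp_le[OF assms(1)]]
    using pp n n2 le by (intro divide_left_mono power_mono) auto
  then have "(cmod (mob w z))\<^sup>2 \<le> 1 - (1 - ?b\<^sup>2) * (1 - ?a\<^sup>2) / (1 + ?a*?b)\<^sup>2" by simp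
  also have "\<dots> = ((?a + ?b) / (1 + ?a * ?b))\<^sup>2"
    using n2 by (simp add: power_divide field_simps) (simp add: algebra_simps power2_eq_square)
  finally show ?thesis by (rule power2_le_imp_le) (use n2 in \<open>simp add: divide_nonneg_nonneg\<close>)
qed

lemma hdist_triangle0:
  assumes "cmod z < 1" "cmod w < 1" shows "hdist z w \<le> hdist z 0 + hdist 0 w"
proof -
  let ?x = "artanh (cmod z)" and ?y = "artanh (cmod w)"
  have t: "tanh ?x = cmod z" "tanh ?y = cmod w" using assms by (simp_all add: tanh_artanh abs_if)
  have "cosh ?x \<noteq> 0" "cosh ?y \<noteq> 0" by simp_all
  then have "tanh (?x + ?y) = (cmod z + cmod w) / (1 + cmod z * cmod w)"
    using tanh_add[of ?x ?y] t by simp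
  then have "cmod (mob w z) \<le> tanh (?x + ?y)" using norm_mob_le[OF assms] by simp
  then have "tanh (hdist z w / 2) \<le> tanh (?x + ?y)" using assms by (simp add: tanh_half_hdist)
  then show ?thesis by (simp add: hdist_0)
qed

lemma hdist_triangle:
  assumes "cmod z < 1" "cmod w < 1" "cmod c < 1" shows "hdist z w \<le> hdist z c + hdist c w"
proof -
  have "hdist (mob c z) (mob c w) \<le> hdist (mob c z) (mob c c) + hdist (mob c c) (mob c w)"
    using hdist_triangle0[of "mob c z" "mob c w"] assms norm_mob_less by auto
  then show ?thesis using assms by (simp only: hdist_mob)
qed

lemma exp_hdist:
  assumes "cmod z < 1" "cmod w < 1" 
  shows "exp (hdist z w) = (1 + cmod (mob w z)) / (1 - cmod (mob w z))"
  using norm_mob_less[OF assms(2,1)] by (simp add: hdist_mob_eq artanh_def add_pos_nonneg)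

text \<open>The exponential of the distance is (1 + r)^2 / (1 - r^2), and (1 + r)^2 is at most 4.
  The bound is written with 1 - r^2 because this quantity is simple in half-plane
  coordinates.\<close>

lemma hdist_le_ln:
  assumes "cmod z < 1" "cmod w < 1"
  shows "hdist z w \<le> ln (4 / (1 - (cmod (mob w z))\<^sup>2))"
proof -
  let ?r = "cmod (mob w z)"
  have r: "?r < 1" "0 \<le> ?r" using norm_mob_less[OF assms(2,1)] by auto
  have r2: "1 - ?r\<^sup>2 > 0" using r by (simp add: abs_square_less_1)
  have "(1 + ?r)\<^sup>2 \<le> 2\<^sup>2" using r by (intro power_mono) auto
  then have "(1 + ?r)\<^sup>2 / (1 - ?r\<^sup>2) \<le> 4 / (1 - ?r\<^sup>2)" using r2 by (intro divide_right_mono) auto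
  moreover have "(1 + ?r) / (1 - ?r) = (1 + ?r)\<^sup>2 / (1 - ?r\<^sup>2)"
    using r r2 by (simp add: field_simps power2_eq_square)
  ultimately have "exp (hdist z w) \<le> 4 / (1 - ?r\<^sup>2)" using exp_hdist[OF assms] by simp
  moreover have "4 / (1 - ?r\<^sup>2) > 0" using r2 by simp
  ultimately show ?thesis by (metis exp_le_cancel_iff exp_ln)
qed

lemma pker_pos: assumes "cmod z < 1" "cmod \<zeta> = 1" shows "pker z \<zeta> > 0"
proof -
  have "\<zeta> \<noteq> z" using assms by auto
  then show ?thesis unfolding pker_def using one_minus_aa_pos(2)[OF assms(1)] by simp
qed

lemma pker_0 [simp]: "cmod \<zeta> = 1 \<Longrightarrow> pker 0 \<zeta> = 1" by (simp add: pker_def)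
lemma bus_0 [simp]: "cmod \<zeta> = 1 \<Longrightarrow> bus \<zeta> 0 = 0" by (simp add: bus_def)

lemma norm_one_minus_circle: assumes "cmod \<zeta> = 1" shows "cmod (1 - cnj a * \<zeta>) = cmod (\<zeta> - a)"
proof -
  have "cnj \<zeta> * \<zeta> = 1" using assms by (simp add: complex_norm_square[symmetric] mult.commute)
  then have "1 - cnj a * \<zeta> = \<zeta> * cnj (\<zeta> - a)" by (simp add: algebra_simps)
  then show ?thesis using assms by (metis complex_mod_cnj mult_1 norm_mult)
qed

lemma pker_mob:
  assumes "cmod a < 1" "cmod z < 1" "cmod \<zeta> = 1"
  shows "pker (mob a z) (mob a \<zeta>) = pker z \<zeta> / pker a \<zeta>"
proof -
  have nz: "cmod (1 - cnj a * z) \<noteq> 0" "cmod (1 - cnj a * \<zeta>) \<noteq> 0"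
    using one_minus_cnj_mult_nz assms by auto
  have ne: "\<zeta> \<noteq> a" using assms by auto
  have *: "(p * q / u\<^sup>2) / (D * p / (A * u))\<^sup>2 = (q / D\<^sup>2) / (p / A\<^sup>2)"
    if "p \<noteq> 0" "u \<noteq> 0" "A \<noteq> 0" for p q u D A :: real
    using that by (simp add: power_divide power_mult_distrib power2_eq_square)
  have p: "1 - (cmod a)\<^sup>2 \<noteq> 0" using one_minus_aa_pos(2)[OF assms(1)] by simp
  have "pker (mob a z) (mob a \<zeta>) = ((1 - (cmod a)\<^sup>2) * (1 - (cmod z)\<^sup>2) / (cmod (1 - cnj a * z))\<^sup>2)
     / (cmod ((\<zeta> - z) * (1 - cnj a * a) / ((1 - cnj a * \<zeta>) * (1 - cnj a * z))))\<^sup>2"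
    unfolding pker_def using one_minus_norm_mob[of a z] mob_diff[of a \<zeta> z] assms by simp
  also have "\<dots> = pker z \<zeta> / pker a \<zeta>"
    unfolding pker_def norm_divide norm_mult one_minus_aa_pos(1)[OF assms(1)]
      norm_one_minus_circle[OF assms(3)]
    by (rule *) (use p nz ne in auto)
  finally show ?thesis .
qed

text \<open>The cocycle rule: moving the base point from 0 to \<open>a\<close> subtracts the value
  at \<open>a\<close>. With the invariance of \<open>hdist\<close> it reduces estimates between two
  points to the case where one of them is 0.\<close>

lemma bus_mob:
  assumes "cmod a < 1" "cmod z < 1" "cmod \<zeta> = 1"
  shows "bus (mob a \<zeta>) (mob a z) = bus \<zeta> z - bus \<zeta> a"
  unfolding bus_def using pker_mob[OF assms] pker_pos[OF assms(1,3)] pker_pos[OF assms(2,3)]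
  by (simp add: ln_div)

text \<open>Harnack's inequality for the Poisson kernel: the chord from the boundary point to
  \<open>z\<close> has length between 1 - |z| and 1 + |z|.\<close>

lemma bus_le_hdist0:
  assumes "cmod z < 1" "cmod \<zeta> = 1" shows "\<bar>bus \<zeta> z\<bar> \<le> hdist z 0"
proof -
  let ?r = "cmod z"
  have r: "0 \<le> ?r" "?r < 1" using assms by auto
  have p: "1 - ?r\<^sup>2 > 0" by (rule one_minus_aa_pos[OF assms(1)])
  have up: "cmod (\<zeta> - z) \<le> 1 + ?r" using norm_triangle_ineq4[of \<zeta> z] assms by simp
  have lo: "cmod (\<zeta> - z) \<ge> 1 - ?r" using norm_triangle_ineq2[of \<zeta> z] assms by simp
  have pos: "cmod (\<zeta> - z) > 0" using lo r by linarith
  have r1: "1 + ?r > 0" using r by linarith+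
  have e: "exp (hdist z 0) = (1 + ?r) / (1 - ?r)" using exp_hdist[of z 0] assms by simp
  have "pker z \<zeta> \<le> (1 - ?r\<^sup>2) / (1 - ?r)\<^sup>2"
    unfolding pker_def using p r pos lo by (intro divide_left_mono power_mono) auto
  also have "\<dots> = ((1 - ?r) * (1 + ?r)) / ((1 - ?r) * (1 - ?r))"
    by (simp add: power2_eq_square algebra_simps)
  also have "\<dots> = (1 + ?r) / (1 - ?r)" using r by simp
  finally have 1: "pker z \<zeta> \<le> exp (hdist z 0)" using e by simp
  have "(1 - ?r\<^sup>2) / (1 + ?r)\<^sup>2 \<le> pker z \<zeta>"
    unfolding pker_def using p r r1 pos up
    by (intro divide_left_mono power_mono mult_pos_pos zero_less_power) (auto simp: add_pos_nonneg)
  moreover have "(1 - ?r\<^sup>2) / (1 + ?r)\<^sup>2 = (1 - ?r) / (1 + ?r)"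
  proof -
    have "(1 - ?r\<^sup>2) / (1 + ?r)\<^sup>2 = ((1 - ?r) * (1 + ?r)) / ((1 + ?r) * (1 + ?r))"
      by (simp add: power2_eq_square algebra_simps)
    then show ?thesis using r1 by simp
  qed
  ultimately have 2: "exp (- hdist z 0) \<le> pker z \<zeta>" by (simp add: exp_minus e)
  have "pker z \<zeta> > 0" using pker_pos assms by blast
  then show ?thesis unfolding bus_def using 1 2
    by (metis abs_le_iff exp_ln exp_le_cancel_iff neg_le_iff_le minus_le_iff)
qed

lemma bus_lipschitz:
  assumes "cmod z < 1" "cmod w < 1" "cmod \<zeta> = 1" shows "\<bar>bus \<zeta> z - bus \<zeta> w\<bar> \<le> hdist z w"
  using bus_le_hdist0[of "mob w z" "mob w \<zeta>"] assms norm_mob_less[of w z] norm_mob_eq[of w \<zeta>]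
    bus_mob[of w z \<zeta>] hdist_mob[of w z w] by simp

text \<open>Seen from \<open>x\<close>, the chord between two ideal points is measured by the two Poisson kernels.\<close>
lemma norm_mob_diff_circle:
  assumes "cmod x < 1" "cmod \<zeta> = 1" "cmod \<xi> = 1"
  shows "(cmod (mob x \<zeta> - mob x \<xi>))\<^sup>2 = (cmod (\<zeta> - \<xi>))\<^sup>2 * (pker x \<zeta> * pker x \<xi>)"
  unfolding mob_diff[OF assms(1) eq_refl[OF assms(2)] eq_refl[OF assms(3)]] norm_divide norm_mult
    one_minus_aa_pos(1)[OF assms(1)] norm_one_minus_circle[OF assms(2)]  norm_one_minus_circle[OF assms(3)] pker_def
  by (simp add: power_divide power_mult_distrib power2_eq_square mult_ac)

section \<open>Geodesics\<close>

text \<open>The point at signed distance \<open>r\<close> from \<open>a\<close> in the direction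
  \<open>u\<close>; as \<open>hdist\<close> is twice an artanh, the Euclidean radius is tanh of half
  the distance.\<close>

definition pt_at :: "complex \<Rightarrow> complex \<Rightarrow> real \<Rightarrow> complex" where
  "pt_at a u r = mob_inv a (of_real (tanh (r / 2)) * u)"

text \<open>Constant speed over the unit interval. For a = b the convention \<open>sgn 0 = 0\<close>
  makes it the constant \<open>a\<close>.\<close>

definition gpt :: "complex \<Rightarrow> complex \<Rightarrow> real \<Rightarrow> complex" where
  "gpt a b r = pt_at a (sgn (mob a b)) (r * hdist a b)"

definition gray :: "complex \<Rightarrow> complex \<Rightarrow> real \<Rightarrow> complex" where
  "gray a \<xi> r = pt_at a (mob a \<xi>) r"

lemma abs_tanh_less: "\<bar>tanh (r::real)\<bar> < 1"
  using tanh_real_lt_1[of r] tanh_real_gt_neg1[of r] by linarith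

lemma norm_tanh_less: "cmod u \<le> 1 \<Longrightarrow> cmod (of_real (tanh r) * u) < 1"
  using abs_tanh_less[of r] mult_left_le[of "cmod u" "\<bar>tanh r\<bar>"] by (simp add: norm_mult)

lemma norm_pt_at: "cmod a < 1 \<Longrightarrow> cmod u \<le> 1 \<Longrightarrow> cmod (pt_at a u r) < 1"
  unfolding pt_at_def by (intro norm_mob_inv_less norm_tanh_less)

lemma mob_pt_at: "cmod a < 1 \<Longrightarrow> cmod u \<le> 1 \<Longrightarrow> mob a (pt_at a u r) = of_real (tanh (r / 2)) * u"
  unfolding pt_at_def by (intro mob_mob_inv less_imp_le[OF norm_tanh_less])

lemma pt_at_0 [simp]: "pt_at a u 0 = a" by (simp add: pt_at_def mob_inv_def)

lemma hdist_pt_at: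
  assumes "cmod a < 1" "cmod u = 1" shows "hdist (pt_at a u r) (pt_at a u q) = \<bar>r - q\<bar>"
proof -
  let ?x = "tanh (r / 2)" and ?y = "tanh (q / 2)"
  have uu: "cnj u * u = 1" using assms(2) complex_norm_square[of u] by (simp add: mult.commute)
  have "hdist (pt_at a u r) (pt_at a u q) = hdist (of_real ?x * u) (of_real ?y * u)"
    unfolding pt_at_def using assms by (intro hdist_mob_inv norm_tanh_less) auto
  moreover have "mob (of_real ?y * u) (of_real ?x * u) = of_real (tanh ((r - q) / 2)) * u"
  proof -
    have "tanh (r / 2 + - (q / 2)) = (?x - ?y) / (1 - ?x * ?y)"
      by (subst tanh_add) (auto simp: cosh_real_nonzero)
    then have t: "tanh ((r - q) / 2) = (?x - ?y) / (1 - ?x * ?y)" by (simp add: diff_divide_distrib)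
    have "cnj (of_real ?y * u) * (of_real ?x * u) = of_real (?x * ?y) * (cnj u * u)" by simp
    then have "mob (of_real ?y * u) (of_real ?x * u) = of_real (?x - ?y) * u / of_real (1 - ?x * ?y)"
      unfolding mob_def uu by (simp add: algebra_simps)
    then show ?thesis unfolding t by simp
  qed
  moreover have "cmod (of_real (tanh ((r - q) / 2)) * u) = tanh \<bar>(r - q) / 2\<bar>"
    using assms by (simp add: norm_mult abs_if)
  ultimately show ?thesis by (simp add: hdist_mob_eq)
qed

lemma continuous_on_pt_at: assumes "cmod a < 1" "cmod u \<le> 1" shows "continuous_on S (pt_at a u)"
proof -
  have "1 + cnj a * (of_real (tanh (r / 2)) * u) \<noteq> 0" for r
    using one_minus_cnj_mult_nz(2)[OF assms(1) less_imp_le[OF norm_tanh_less[OF assms(2)]]] .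
  moreover have "cosh (r / 2) \<noteq> 0" for r :: real by simp
  ultimately show ?thesis unfolding pt_at_def mob_inv_def by (intro continuous_intros) auto
qed

lemma mob_eq_sgn:
  assumes "cmod a < 1" "cmod b < 1" shows "mob a b = of_real (tanh (hdist a b / 2)) * sgn (mob a b)"
proof -
  have "tanh (hdist a b / 2) = cmod (mob a b)"
    using tanh_half_hdist[OF assms(2,1)] hdist_commute[of b a] by simp
  then show ?thesis by (simp add: sgn_eq)
qed

lemma norm_sgn_le: "cmod (sgn z) \<le> 1" by (simp add: norm_sgn)

lemma norm_gpt: "cmod a < 1 \<Longrightarrow> cmod (gpt a b r) < 1"
  unfolding gpt_def by (intro norm_pt_at norm_sgn_le)

lemma mob_eq_0_iff: assumes "cmod a < 1" "cmod b < 1" shows "mob a b = 0 \<longleftrightarrow> a = b"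
  using mob_inv_mob[of a b] assms by (auto simp: mob_inv_def)

lemma hdist_gpt:
  assumes "cmod a < 1" "cmod b < 1"
  shows "hdist (gpt a b r) (gpt a b q) = \<bar>r - q\<bar> * hdist a b"
proof (cases "a = b")
  case True then show ?thesis by (simp add: gpt_def)
next
  case False
  then have "cmod (sgn (mob a b)) = 1" using mob_eq_0_iff[OF assms] by (simp add: norm_sgn)
  then show ?thesis using hdist_pt_at[OF assms(1)] hdist_nonneg[OF assms]
    by (simp add: gpt_def left_diff_distrib[symmetric] abs_mult)
qed

lemma gpt_0 [simp]: "gpt a b 0 = a" by (simp add: gpt_def)

lemma gpt_1: assumes "cmod a < 1" "cmod b < 1" shows "gpt a b 1 = b"
  using mob_eq_sgn[OF assms] mob_inv_mob[of a b] assms by (simp add: gpt_def pt_at_def)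

lemma continuous_on_gpt: assumes "cmod a < 1" shows "continuous_on S (gpt a b)"
  unfolding gpt_def
  by (rule continuous_on_compose2[OF continuous_on_pt_at[OF assms norm_sgn_le, of UNIV]])
    (auto intro!: continuous_intros)

text \<open>Equality in the triangle inequality determines the point. With \<open>a\<close> moved to
  0, equal distances to the image of \<open>b\<close> force |1 - c| = |1 - |c|| for c = conj(b') x',
  so c is real and nonnegative. The purpose is to reverse geodesics.\<close>

lemma gpt_unique:
  assumes "cmod a < 1" "cmod b < 1" "cmod x < 1" "0 \<le> r" "r \<le> 1"
    and "hdist a x = r * hdist a b" "hdist x b = (1 - r) * hdist a b"
  shows "x = gpt a b r"
proof (cases "a = b")
  case True
  then have "hdist x a = 0" using assms hdist_commute[of x a] by simp
  then have "mob a x = 0" using tanh_half_hdist[OF assms(3,1)] by simp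
  then show ?thesis using True assms mob_eq_0_iff[of a x] by (simp add: gpt_def)
next
  case False
  define b' x' u \<rho> \<beta> where d: "b' = mob a b" "x' = mob a x" "u = sgn b'" "\<rho> = tanh (r * hdist a b / 2)" "\<beta> = cmod b'"
  have u: "cmod u = 1" using False mob_eq_0_iff[OF assms(1,2)] by (simp add: d norm_sgn)
  have b'1: "cmod b' < 1" "cmod x' < 1" using assms norm_mob_less by (auto simp: d)
  have b'u: "b' = of_real \<beta> * u" by (simp add: d sgn_eq)
  have \<beta>: "\<beta> > 0" using False mob_eq_0_iff[OF assms(1,2)] by (simp add: d)
  have x\<rho>: "cmod x' = \<rho>" using tanh_half_hdist[of x a] assms hdist_commute[of x a] by (simp add: d)
  define y' where "y' = of_real \<rho> * u"
  have y'1: "cmod y' < 1" "cmod y' = \<rho>" using b'1 x\<rho> u by (auto simp: y'_def norm_mult)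
  have y'g: "mob a (gpt a b r) = y'" by (simp add: gpt_def d y'_def mob_pt_at assms norm_sgn_le)
  have "hdist x' b' = (1 - r) * hdist a b" using hdist_mob[of a x b] assms by (simp add: d)
  moreover have "hdist y' b' = (1 - r) * hdist a b"
    using hdist_mob[of a "gpt a b r" b] assms hdist_gpt[OF assms(1,2), of r 1]
    by (simp add: y'g d norm_gpt gpt_1)
  ultimately have "cmod (mob b' x') = cmod (mob b' y')"
    using tanh_half_hdist[of x' b'] tanh_half_hdist[of y' b'] b'1 y'1 by simp
  then have "(1 - \<beta>\<^sup>2) * (1 - \<rho>\<^sup>2) / (cmod (1 - cnj b' * x'))\<^sup>2 = (1 - \<beta>\<^sup>2) * (1 - \<rho>\<^sup>2) / (cmod (1 - cnj b' * y'))\<^sup>2"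
    using one_minus_norm_mob[of b' x'] one_minus_norm_mob[of b' y'] b'1 y'1 x\<rho> by (simp add: d) (metis (no_types))
  moreover have "1 - \<beta>\<^sup>2 \<noteq> 0" "1 - \<rho>\<^sup>2 \<noteq> 0" using one_minus_aa_pos(2)[OF b'1(1)] one_minus_aa_pos(2)[OF b'1(2)]
    by (auto simp: d(5) x\<rho>)
  moreover have "cmod (1 - cnj b' * x') \<noteq> 0" "cmod (1 - cnj b' * y') \<noteq> 0"
    using one_minus_cnj_mult_nz[of b'] b'1 y'1 by (auto simp: less_imp_le)
  ultimately have eq: "(cmod (1 - cnj b' * x'))\<^sup>2 = (cmod (1 - cnj b' * y'))\<^sup>2" by simp
  define c where "c = cnj b' * x'"
  have uu: "cnj u * u = 1" using u complex_norm_square[of u] by (simp add: mult.commute)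
  have "cnj b' * y' = of_real (\<beta> * \<rho>) * (cnj u * u)" unfolding b'u y'_def by simp
  then have "cnj b' * y' = of_real (\<beta> * \<rho>)" unfolding uu by simp
  moreover have cc: "cmod c = \<beta> * \<rho>" using x\<rho> d(5) by (simp add: c_def norm_mult)
  ultimately have "(cmod (1 - c))\<^sup>2 = (cmod (1 - of_real (cmod c)))\<^sup>2" using eq by (simp add: c_def)
  then have "(1 - Re c)\<^sup>2 + (Im c)\<^sup>2 = (1 - cmod c)\<^sup>2" by (simp add: cmod_power2)
  then have "Re c = cmod c" using cmod_power2[of c] by (simp add: power2_eq_square algebra_simps)
  then have "c = of_real (\<beta> * \<rho>)" using cc cmod_power2[of c] by (simp add: complex_eq_iff)
  then have "of_real \<beta> * (cnj u * x') = of_real \<beta> * of_real \<rho>" by (simp add: c_def b'u)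
  then have "cnj u * x' = of_real \<rho>" using \<beta> by simp
  then have "(cnj u * u) * x' = of_real \<rho> * u" by (metis mult.assoc mult.commute)
  then have "x' = y'" by (simp add: uu y'_def)
  then have "mob_inv a (mob a x) = mob_inv a (mob a (gpt a b r))" by (simp add: y'g d)
  then show ?thesis using mob_inv_mob assms by (metis less_imp_le norm_gpt)
qed

lemma gpt_swap:
  assumes "cmod a < 1" "cmod b < 1" "0 \<le> r" "r \<le> 1" shows "gpt b a (1 - r) = gpt a b r"
proof (rule gpt_unique)
  show "hdist a (gpt b a (1 - r)) = r * hdist a b"
    using hdist_gpt[OF assms(2,1), of 1 "1 - r"] assms hdist_commute[of b a] by (simp add: gpt_1)
  show "hdist (gpt b a (1 - r)) b = (1 - r) * hdist a b"
    using hdist_gpt[OF assms(2,1), of "1 - r" 0] assms hdist_commute[of b a] by simp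
qed (use assms norm_gpt in auto)

text \<open>After \<open>a\<close> is moved to 0, \<open>hseg\<close> runs linearly in the Euclidean
  radius and \<open>gpt\<close> linearly in arc length; artanh and tanh convert the
  parameters.\<close>

lemma hseg_eq_gpt:
  assumes "cmod a < 1" "cmod b < 1" shows "hseg a b = gpt a b ` {0..1}"
proof (cases "a = b")
  case True
  then show ?thesis by (auto simp: hseg_def gpt_def mob_inv_def image_iff intro: exI[of _ 0])
next
  case False
  let ?L = "hdist a b" and ?m = "mob a b"
  have m: "cmod ?m > 0" "cmod ?m < 1" using False mob_eq_0_iff[OF assms] norm_mob_less[OF assms] by auto
  have t: "tanh (?L / 2) = cmod ?m" using tanh_half_hdist[OF assms(2,1)] hdist_commute[of b a] by simp
  then have L: "?L > 0" using m(1) by (metis half_gt_zero_iff tanh_real_pos_iff)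
  have h: "hseg a b = (\<lambda>r. mob_inv a (of_real r * ?m)) ` {0..1}" by (simp add: hseg_def mob_def)
  have g: "gpt a b r = mob_inv a (of_real (tanh (r * ?L / 2) / cmod ?m) * ?m)" for r
    by (simp add: gpt_def pt_at_def sgn_eq)
  show ?thesis
  proof (intro equalityI subsetI)
    fix z assume "z \<in> hseg a b"
    then obtain r where r: "0 \<le> r" "r \<le> 1" "z = mob_inv a (of_real r * ?m)" by (auto simp: h)
    define q where "q = 2 * artanh (r * cmod ?m) / ?L"
    have rm: "0 \<le> r * cmod ?m" "r * cmod ?m \<le> cmod ?m" using r m by (auto intro: mult_left_le_one_le)
    then have "\<bar>r * cmod ?m\<bar> < 1" using m by linarith
    then have tq: "tanh (q * ?L / 2) = r * cmod ?m" using L by (simp add: q_def tanh_artanh)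
    then have "tanh (q * ?L / 2) \<le> tanh (?L / 2)" "tanh (q * ?L / 2) \<ge> 0" using rm t by auto
    then have "q * ?L / 2 \<le> ?L / 2" "q * ?L / 2 \<ge> 0" by (simp_all only: tanh_real_le_iff tanh_real_nonneg_iff)
    then have "0 \<le> q" "q \<le> 1" using L by (auto simp: zero_le_mult_iff)
    moreover have "gpt a b q = z" using m by (simp add: g tq r)
    ultimately show "z \<in> gpt a b ` {0..1}" by auto
  next
    fix z assume "z \<in> gpt a b ` {0..1}"
    then obtain q where q: "0 \<le> q" "q \<le> 1" "z = gpt a b q" by auto
    have "tanh (q * ?L / 2) \<le> tanh (?L / 2)" using q L by (simp add: mult_left_le_one_le)
    moreover have "tanh (q * ?L / 2) \<ge> 0" using q L by simp
    ultimately have "tanh (q * ?L / 2) / cmod ?m \<in> {0..1}" using m t by (simp add: divide_le_eq)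
    then show "z \<in> hseg a b" unfolding h q g by blast
  qed
qed

lemma norm_gray: "cmod a < 1 \<Longrightarrow> cmod \<xi> = 1 \<Longrightarrow> cmod (gray a \<xi> r) < 1"
  unfolding gray_def by (intro norm_pt_at) (simp_all add: norm_mob_eq)

lemma gray_0 [simp]: "gray a \<xi> 0 = a" by (simp add: gray_def)

lemma hdist_gray: "cmod a < 1 \<Longrightarrow> cmod \<xi> = 1 \<Longrightarrow> hdist (gray a \<xi> r) (gray a \<xi> q) = \<bar>r - q\<bar>"
  by (simp add: gray_def hdist_pt_at norm_mob_eq)

lemma continuous_on_gray: "cmod a < 1 \<Longrightarrow> cmod \<xi> = 1 \<Longrightarrow> continuous_on S (gray a \<xi>)"
  unfolding gray_def by (rule continuous_on_pt_at) (simp_all add: norm_mob_eq)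

lemma hray_eq_gray:
  assumes "cmod a < 1" "cmod \<xi> = 1" "s > 0" shows "hray a \<xi> = (\<lambda>t. gray a \<xi> (s * t)) ` {0..}"
proof -
  have h: "hray a \<xi> = (\<lambda>r. mob_inv a (of_real r * mob a \<xi>)) ` {0..<1}" by (simp add: hray_def mob_def)
  have "(\<lambda>t. tanh (s * t / 2)) ` {0..} = {0..<1}"
  proof (intro equalityI subsetI)
    fix r :: real assume r: "r \<in> {0..<1}"
    then have "artanh r \<ge> artanh 0" by (intro artanh_mono) auto
    then have "2 * artanh r / s \<in> {0..}" "r = tanh (s * (2 * artanh r / s) / 2)"
      using assms r by (auto simp: tanh_artanh)
    then show "r \<in> (\<lambda>t. tanh (s * t / 2)) ` {0..}" by blast
  qed (use assms tanh_real_lt_1 in auto)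
  then have "hray a \<xi> = (\<lambda>r. mob_inv a (of_real r * mob a \<xi>)) ` (\<lambda>t. tanh (s * t / 2)) ` {0..}"
    by (simp add: h)
  then show ?thesis by (simp add: image_image gray_def pt_at_def)
qed

lemma gray_tendsto:
  assumes "cmod a < 1" "cmod \<xi> = 1" shows "(gray a \<xi> \<longlongrightarrow> \<xi>) at_top"
proof -
  have "((\<lambda>r::real. tanh (r / 2)) \<longlongrightarrow> 1) at_top"
    by (rule filterlim_compose[OF tanh_real_at_top]) real_asymp
  then have "((\<lambda>r. of_real (tanh (r / 2)) * mob a \<xi>) \<longlongrightarrow> of_real 1 * mob a \<xi>) at_top"
    by (intro tendsto_intros)
  moreover have "isCont (mob_inv a) (of_real 1 * mob a \<xi>)"
    unfolding mob_inv_def using one_minus_cnj_mult_nz(2)[OF assms(1), of "mob a \<xi>"] assms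
    by (intro continuous_intros) (auto simp: norm_mob_eq)
  ultimately have "((\<lambda>r. mob_inv a (of_real (tanh (r / 2)) * mob a \<xi>)) \<longlongrightarrow> mob_inv a (of_real 1 * mob a \<xi>)) at_top"
    by (rule isCont_tendsto_compose[rotated])
  then show ?thesis unfolding gray_def pt_at_def using assms by (simp add: mob_inv_mob)
qed

text \<open>A 1-Lipschitz function that rises by almost the whole length of a segment rises at
  almost unit speed on every part of it: the pieces before \<open>r\<close> and after
  \<open>q\<close> cannot contribute more than their lengths.\<close>

lemma bus_gpt_mono:
  assumes "cmod a < 1" "cmod b < 1" "cmod \<zeta> = 1" "0 \<le> r" "r \<le> q" "q \<le> 1"
    and "bus \<zeta> b - bus \<zeta> a \<ge> hdist a b - C"
  shows "bus \<zeta> (gpt a b q) - bus \<zeta> (gpt a b r) \<ge> (q - r) * hdist a b - C"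
proof -
  have "bus \<zeta> b - bus \<zeta> (gpt a b q) \<le> (1 - q) * hdist a b"
    using bus_lipschitz[of b "gpt a b q" \<zeta>] hdist_gpt[OF assms(1,2), of 1 q] assms
    by (simp add: gpt_1 norm_gpt)
  moreover have "bus \<zeta> (gpt a b r) - bus \<zeta> a \<le> r * hdist a b"
    using bus_lipschitz[of "gpt a b r" a \<zeta>] hdist_gpt[OF assms(1,2), of r 0] assms
    by (simp add: norm_gpt)
  ultimately show ?thesis using assms(7) by (simp add: algebra_simps)
qed

lemma pker_radial: 
  assumes "cmod u = 1" shows "pker (of_real (tanh (r / 2)) * u) u = exp r"
proof -
  let ?x = "tanh (r / 2)"
  have x: "\<bar>?x\<bar> < 1" by (rule abs_tanh_less)
  have "cmod (u - of_real ?x * u) = cmod (of_real (1 - ?x) * u)" by (simp add: algebra_simps)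
  then have "cmod (u - of_real ?x * u) = 1 - ?x" using assms x by (simp only: norm_mult norm_of_real) simp
  then have "pker (of_real ?x * u) u = ((1 - ?x) * (1 + ?x)) / ((1 - ?x) * (1 - ?x))"
  proof -
    assume e: "cmod (u - of_real ?x * u) = 1 - ?x"
    have "pker (of_real ?x * u) u = (1 - ?x\<^sup>2) / (1 - ?x)\<^sup>2"
      unfolding pker_def e using assms by (simp add: norm_mult)
    also have "1 - ?x\<^sup>2 = (1 - ?x) * (1 + ?x)" by (simp add: power2_eq_square algebra_simps)
    finally show ?thesis by (simp add: power2_eq_square)
  qed
  also have "\<dots> = (1 + ?x) / (1 - ?x)" using x by simp
  also have "\<dots> = exp (2 * artanh ?x)" using x unfolding artanh_def by (simp del: artanh_tanh)
  finally show ?thesis by simp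
qed

lemma bus_gray:
  assumes "cmod a < 1" "cmod \<xi> = 1" shows "bus \<xi> (gray a \<xi> r) = bus \<xi> a + r"
proof -
  have "bus (mob a \<xi>) (mob a (gray a \<xi> r)) = r"
    using assms pker_radial[of "mob a \<xi>" r] by (simp add: bus_def gray_def mob_pt_at norm_mob_eq)
  then show ?thesis using bus_mob[of a "gray a \<xi> r" \<xi>] assms by (simp add: norm_gray)
qed

text \<open>With \<open>a\<close> at 0, the chord from the ray to \<open>mob a \<zeta>\<close> stays
  at least c / 2, and 1 - tanh^2 is at most 4 exp (- r). The quotient gives the constant 16 /
  c^2.\<close>

lemma bus_gray_other:
  assumes "cmod a < 1" "cmod \<xi> = 1" "cmod \<zeta> = 1" "0 < c" "c \<le> cmod (mob a \<zeta> - mob a \<xi>)" "0 \<le> r"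
  shows "bus \<zeta> (gray a \<xi> r) \<le> bus \<zeta> a - r + ln (16 / c\<^sup>2)"
proof -
  define x u v where d: "x = tanh (r / 2)" "u = mob a \<xi>" "v = mob a \<zeta>"
  have uv: "cmod u = 1" "cmod v = 1" using assms by (auto simp: d norm_mob_eq)
  have x: "\<bar>x\<bar> < 1" and x0: "x \<ge> 0" using assms abs_tanh_less[of "r / 2"] by (simp_all add: d)
  have "cmod (of_real x * u) = \<bar>x\<bar>" using uv by (simp add: norm_mult)
  then have 1: "cmod (v - of_real x * u) \<ge> 1 - \<bar>x\<bar>" using norm_triangle_ineq2[of v "of_real x * u"] uv by simp
  have p: "cmod (v - of_real x * u) > 0" using 1 x by linarith
  have c2: "c / 2 \<le> cmod (v - of_real x * u)"
  proof -
    have "of_real x * u - u = of_real (x - 1) * u" by (simp add: algebra_simps)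
    then have "cmod (of_real x * u - u) = 1 - x" using x uv by (simp only: norm_mult norm_of_real) simp
    moreover have "c \<le> cmod ((v - of_real x * u) + (of_real x * u - u))" using assms by (simp add: d)
    ultimately show ?thesis using 1 x0 norm_triangle_ineq[of "v - of_real x * u" "of_real x * u - u"] by simp
  qed
  have "(cosh (r / 2))\<^sup>2 \<noteq> 0" "(sinh (r / 2))\<^sup>2 = (cosh (r / 2))\<^sup>2 - 1"
    using cosh_square_eq[of "r / 2"] by auto
  then have "1 - x\<^sup>2 = 1 / (cosh (r / 2))\<^sup>2" by (simp add: d tanh_def power_divide field_simps)
  also have "\<dots> \<le> 1 / (exp (r / 2) / 2)\<^sup>2"
    using cosh_real_pos[of "r / 2"]
    by (intro divide_left_mono power_mono mult_pos_pos zero_less_power) (auto simp: cosh_def)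
  also have "\<dots> = 4 * exp (- r)" by (simp add: power_divide exp_minus field_simps flip: exp_double)
  finally have x2: "1 - x\<^sup>2 \<le> 4 * exp (- r)" .
  have "pker (of_real x * u) v = (1 - x\<^sup>2) / (cmod (v - of_real x * u))\<^sup>2"
    using uv by (simp add: pker_def norm_mult)
  also have "\<dots> \<le> (4 * exp (- r)) / (c / 2)\<^sup>2"
    using x2 c2 assms p by (intro frac_le power_mono zero_less_power) auto
  also have "\<dots> = 16 / c\<^sup>2 * exp (- r)" by (simp add: power_divide)
  finally have "pker (of_real x * u) v \<le> 16 / c\<^sup>2 * exp (- r)" .
  moreover have "pker (of_real x * u) v > 0" using uv x by (intro pker_pos) (auto simp: norm_mult)
  ultimately have "bus v (of_real x * u) \<le> ln (16 / c\<^sup>2 * exp (- r))"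
    unfolding bus_def by (subst ln_le_cancel_iff) auto
  also have "\<dots> = ln (16 / c\<^sup>2) - r" using assms by (subst ln_mult) auto
  finally have "bus (mob a \<zeta>) (mob a (gray a \<xi> r)) \<le> ln (16 / c\<^sup>2) - r"
    using assms by (simp add: gray_def mob_pt_at d norm_mob_eq)
  then show ?thesis using bus_mob[of a "gray a \<xi> r" \<zeta>] assms by (simp add: norm_gray)
qed

text \<open>The supremum M satisfies lam M \<le> M + \<kappa>, which bounds M because M is finite.
  Applied to differences of lifts it yields both uniqueness, for \<kappa> = 0, and continuous
  dependence on parameters.\<close>

lemma expanding_bound:
  fixes v :: "real \<Rightarrow> real"
  assumes "bounded (range v)" "1 < lam" "\<And>t. lam * \<bar>v t\<bar> \<le> \<bar>v (c * t)\<bar> + \<kappa>"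
  shows "\<bar>v t\<bar> \<le> \<kappa> / (lam - 1)"
proof -
  define M where "M = (SUP t. \<bar>v t\<bar>)"
  obtain B where B: "\<And>t. \<bar>v t\<bar> \<le> B" using assms(1) by (auto simp: bounded_iff)
  have bdd: "bdd_above (range (\<lambda>t. \<bar>v t\<bar>))" using B by (intro bdd_aboveI2[where M = B]) auto
  have le: "\<bar>v t\<bar> \<le> M" for t unfolding M_def by (rule cSUP_upper[OF _ bdd]) auto
  have "\<bar>v t\<bar> \<le> (M + \<kappa>) / lam" for t
    using assms(3)[of t] le[of "c * t"] assms(2) by (simp add: field_simps)
  then have "M \<le> (M + \<kappa>) / lam" unfolding M_def by (intro cSUP_least) auto
  then have "M \<le> \<kappa> / (lam - 1)" using assms(2) by (simp add: field_simps)
  then show ?thesis using le[of t] by simp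
qed

section \<open>The quasisymmetric conjugacy\<close>

text \<open>A lift \<open>F\<close> of a degree \<open>-d\<close> expanding circle map with Lipschitz slope. The conjugacy is the limit of
  \<open>F\<^bsup>-n\<^esup> ((-d)\<^bsup>n\<^esup> t)\<close>; its quasisymmetry follows from bounded distortion.\<close>

locale expanding_lift =
  fixes d :: nat and F S :: "real \<Rightarrow> real" and lam K :: real
  assumes d2: "d \<ge> 2"
    and F_shift: "F (t + 1) = F t - real d"
    and F_deriv: "(F has_real_derivative - S t) (at t)"
    and S_ge: "lam \<le> S t" and lam_gt: "1 < lam"
    and S_lip: "\<bar>S t - S u\<bar> \<le> K * \<bar>t - u\<bar>" and K_nonneg: "0 \<le> K"
begin

lemma F_mvt: "\<exists>\<xi>. F x - F y = - S \<xi> * (x - y) \<and> \<xi> \<in> {min x y..max x y}"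
proof -
  have *: "\<exists>\<xi>. F x - F y = - S \<xi> * (x - y) \<and> \<xi> \<in> {y..x}" if "y < x" for x y
  proof -
    have "\<exists>z>y. z < x \<and> F x - F y = (x - y) * - S z"
      by (rule MVT2[OF that]) (rule F_deriv)
    then obtain z where "z > y" "z < x" "F x - F y = (x - y) * - S z" by blast
    then show ?thesis by (intro exI[of _ z]) auto
  qed
  consider "y < x" | "x = y" | "x < y" by linarith
  then show ?thesis
  proof cases
    case 1 then show ?thesis using *[OF 1] by (auto simp: min_def max_def)
  next
    case 2 then show ?thesis by auto
  next
    case 3 
    then obtain \<xi> where "F y - F x = - S \<xi> * (y - x)" "\<xi> \<in> {x..y}" using *[OF 3] by auto
    then show ?thesis using 3 by (intro exI[of _ \<xi>]) (auto simp: algebra_simps)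
  qed
qed

lemma F_expand: "lam * \<bar>x - y\<bar> \<le> \<bar>F x - F y\<bar>"
proof -
  obtain \<xi> where "F x - F y = - S \<xi> * (x - y)" using F_mvt by blast
  moreover have "\<bar>S \<xi>\<bar> \<ge> lam" using S_ge[of \<xi>] by linarith
  ultimately show ?thesis by (simp add: abs_mult mult_right_mono)
qed

lemma F_cont: "isCont F t" using F_deriv DERIV_isCont by blast

lemma F_strict_antimono: "x < y \<Longrightarrow> F y < F x"
proof -
  assume "x < y"
  obtain \<xi> where "F y - F x = - S \<xi> * (y - x)" using F_mvt by blast
  moreover have "S \<xi> > 0" using S_ge[of \<xi>] lam_gt by linarith
  ultimately show "F y < F x" using \<open>x < y\<close> by (smt (verit) mult_pos_pos mult_minus_left)
qed

lemma shift_nat: fixes h :: "real \<Rightarrow> real" assumes "\<And>t. h (t + 1) = h t + c" shows "h (t + real n) = h t + real n * c"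
proof (induction n)
  case (Suc n)
  have "h (t + real (Suc n)) = h ((t + real n) + 1)" by (simp add: algebra_simps)
  also have "\<dots> = h (t + real n) + c" by (rule assms)
  finally show ?case using Suc by (simp add: algebra_simps)
qed simp

lemma shift_int: fixes h :: "real \<Rightarrow> real" assumes "\<And>t. h (t + 1) = h t + c" shows "h (t + of_int k) = h t + of_int k * c"
proof (cases "k \<ge> 0")
  case True then show ?thesis using shift_nat[of h c t "nat k", OF assms] by simp
next
  case False
  then show ?thesis using shift_nat[of h c "t + of_int k" "nat (- k)", OF assms] by (simp add: algebra_simps)
qed

lemma F_shift_int: "F (t + of_int k) = F t - of_int k * real d"
  using shift_int[of F "- real d"] F_shift by simp

lemma F_surj: "\<exists>x. F x = y"
proof -
  obtain n :: nat where n: "real n > \<bar>y - F 0\<bar>" using reals_Archimedean2 by blast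
  have "F (0 + of_int (int n)) = F 0 - real n * real d" "F (0 + of_int (- int n)) = F 0 + real n * real d"
    unfolding F_shift_int by auto
  moreover have "real n * real d \<ge> real n * 1" using d2 by (intro mult_left_mono) auto
  ultimately have "F (real n) \<le> y" "y \<le> F (- real n)" using n by auto
  then show ?thesis using IVT2[of F "real n" y "- real n"] F_cont by auto
qed

definition G :: "real \<Rightarrow> real" where "G y = (SOME x. F x = y)"

lemma FG [simp]: "F (G y) = y" unfolding G_def by (rule someI_ex[OF F_surj])

lemma F_inj: "F x = F y \<Longrightarrow> x = y" using F_strict_antimono[of x y] F_strict_antimono[of y x] by linarith

lemma GF [simp]: "G (F y) = y" using FG F_inj by blast

lemma G_contract: "\<bar>G x - G y\<bar> \<le> \<bar>x - y\<bar> / lam"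
  using F_expand[of "G x" "G y"] lam_gt by (simp add: field_simps)

lemma G_antimono: assumes "x \<le> y" shows "G y \<le> G x"
proof (rule ccontr)
  assume "\<not> G y \<le> G x"
  then show False using F_strict_antimono[of "G x" "G y"] assms by simp
qed

lemma G_cont: "continuous_on UNIV G"
proof (rule continuous_onI)
  fix x e :: real assume "0 < e"
  then show "\<exists>\<delta>>0. \<forall>x'\<in>UNIV. dist x' x < \<delta> \<longrightarrow> dist (G x') (G x) \<le> e"
  proof (intro exI[of _ e] conjI ballI impI)
    fix x' assume "dist x' x < e"
    have "\<bar>G x' - G x\<bar> \<le> \<bar>x' - x\<bar> / lam" by (rule G_contract)
    also have "\<dots> \<le> \<bar>x' - x\<bar> / 1" using lam_gt by (intro divide_left_mono) auto
    finally show "dist (G x') (G x) \<le> e" using \<open>dist x' x < e\<close> by (simp add: dist_real_def)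
  qed
qed

lemma G_shift: "G (y - of_int k * real d) = G y + of_int k"
  by (rule F_inj) (simp add: F_shift_int)

text \<open>G^n ((- d)^n t), unfolded so that the outermost map is always \<open>G\<close>: its
  contraction makes consecutive approximations geometrically close.\<close>

primrec Hn :: "nat \<Rightarrow> real \<Rightarrow> real" where
  "Hn 0 t = t" | "Hn (Suc n) t = G (Hn n (- real d * t))"

lemma Hn_shift: "Hn n (t + 1) = Hn n t + 1"
proof (induction n arbitrary: t)
  case (Suc n)
  have "Hn n (- real d * t + of_int (- int d)) = Hn n (- real d * t) + of_int (- int d) * 1"
    by (rule shift_int) (rule Suc)
  moreover have "- real d * (t + 1) = - real d * t + of_int (- int d)" by (simp add: algebra_simps)
  ultimately show ?case using G_shift[of "Hn n (- real d * t)" 1] by simp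
qed simp

lemma Hn_mono: "x \<le> y \<Longrightarrow> Hn n x \<le> Hn n y"
proof (induction n arbitrary: x y)
  case (Suc n)
  have "- real d * y \<le> - real d * x" using Suc by (simp add: mult_left_mono)
  then show ?case using Suc G_antimono by simp
qed simp

lemma Hn_cont: "continuous_on UNIV (Hn n)"
proof (induction n)
  case (Suc n)
  have "continuous_on UNIV (\<lambda>t. G (Hn n (- real d * t)))"
    by (intro continuous_on_compose2[OF G_cont] continuous_on_compose2[OF Suc] continuous_intros) auto
  moreover have "Hn (Suc n) = (\<lambda>t. G (Hn n (- real d * t)))" by auto
  ultimately show ?case by simp
qed (auto intro: continuous_intros)

lemma F_linear_bound: "\<exists>C\<ge>0. \<forall>t. \<bar>F t + real d * t\<bar> \<le> C"
proof -
  define g where "g = (\<lambda>t. F t + real d * t)"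
  have "continuous_on {0..1} g" unfolding g_def
    by (intro continuous_intros continuous_at_imp_continuous_on ballI F_cont)
  then have "bounded (g ` {0..1})" by (intro compact_imp_bounded compact_continuous_image) auto
  then obtain C where "\<forall>y\<in>g ` {0..1}. norm y \<le> C" unfolding bounded_iff by blast
  then have C: "\<bar>g t\<bar> \<le> C" if "t \<in> {0..1}" for t using that by auto
  have "g (t + 1) = g t + 0" for t using F_shift[of t] by (simp add: g_def algebra_simps)
  then have "g (frac t + of_int \<lfloor>t\<rfloor>) = g (frac t) + of_int \<lfloor>t\<rfloor> * 0" for t by (rule shift_int)
  then have "g t = g (frac t)" for t by (simp add: frac_def)
  then have "\<bar>g t\<bar> \<le> C" for t using C[of "frac t"] frac_lt_1[of t] frac_ge_0[of t] by (simp add: less_imp_le)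
  then show ?thesis unfolding g_def by (intro exI[of _ "\<bar>C\<bar>"]) (auto intro: order_trans[OF _ abs_ge_self])
qed

text \<open>The first step is bounded because F t + d t is periodic; every application of
  \<open>G\<close> gains a factor 1 / lam.\<close>

lemma Hn_step: "\<exists>C\<ge>0. \<forall>n t. \<bar>Hn (Suc n) t - Hn n t\<bar> \<le> C * (1 / lam) ^ n"
proof -
  obtain C where C: "C \<ge> 0" "\<And>t. \<bar>F t + real d * t\<bar> \<le> C" using F_linear_bound by blast
  have "\<bar>Hn (Suc n) t - Hn n t\<bar> \<le> C * (1 / lam) ^ n" for n t
  proof (induction n arbitrary: t)
    case 0
    have "\<bar>G (- real d * t) - G (F t)\<bar> \<le> \<bar>- real d * t - F t\<bar> / lam" by (rule G_contract)
    also have "\<dots> \<le> \<bar>- real d * t - F t\<bar> / 1" using lam_gt by (intro divide_left_mono) auto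
    also have "\<dots> \<le> C" using C(2)[of t] by simp
    finally show ?case by simp
  next
    case (Suc n)
    have "\<bar>Hn (Suc (Suc n)) t - Hn (Suc n) t\<bar> \<le> \<bar>Hn (Suc n) (- real d * t) - Hn n (- real d * t)\<bar> / lam"
      using G_contract by simp
    also have "\<dots> \<le> (C * (1 / lam) ^ n) / lam" using Suc[of "- real d * t"] lam_gt by (intro divide_right_mono) auto
    finally show ?case by simp
  qed
  then show ?thesis using C by blast
qed

definition H :: "real \<Rightarrow> real" where "H t = lim (\<lambda>n. Hn n t)"

lemma Hn_uniform: "uniform_limit UNIV Hn H sequentially" and H_near: "\<exists>C. \<forall>t. \<bar>H t - t\<bar> \<le> C"
proof -
  obtain C where C: "C \<ge> 0" "\<And>n t. \<bar>Hn (Suc n) t - Hn n t\<bar> \<le> C * (1 / lam) ^ n" using Hn_step by blast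
  define f where "f = (\<lambda>n t. Hn (Suc n) t - Hn n t)"
  have summ: "summable (\<lambda>n. C * (1 / lam) ^ n)"
    using lam_gt by (intro summable_mult summable_geometric) auto
  have ul: "uniform_limit UNIV (\<lambda>n t. \<Sum>i<n. f i t) (\<lambda>t. suminf (\<lambda>i. f i t)) sequentially"
    by (rule Weierstrass_m_test[OF _ summ]) (use C in \<open>auto simp: f_def\<close>)
  have tele: "(\<Sum>i<n. f i t) = Hn n t - t" for n t
    using sum_lessThan_telescope[of "\<lambda>n. Hn n t" n] by (simp add: f_def)
  have ul2: "uniform_limit UNIV (\<lambda>n t. (\<Sum>i<n. f i t) + t) (\<lambda>t. suminf (\<lambda>i. f i t) + t) sequentially"
    by (intro uniform_limit_add ul uniform_limit_const)
  have "H t = suminf (\<lambda>i. f i t) + t" for t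
    unfolding H_def using tendsto_uniform_limitI[OF ul2, of t] by (intro limI) (simp add: tele)
  then have He: "H = (\<lambda>t. suminf (\<lambda>i. f i t) + t)" by auto
  show "uniform_limit UNIV Hn H sequentially" using ul2 unfolding He tele by (simp add: fun_eq_iff)
  have "\<bar>H t - t\<bar> \<le> suminf (\<lambda>n. C * (1 / lam) ^ n)" for t
  proof -
    have "norm (suminf (\<lambda>i. f i t)) \<le> suminf (\<lambda>n. C * (1 / lam) ^ n)"
      by (rule norm_suminf_le[OF _ summ]) (use C in \<open>auto simp: f_def\<close>)
    then show ?thesis by (simp add: He)
  qed
  then show "\<exists>C. \<forall>t. \<bar>H t - t\<bar> \<le> C" by blast
qed

lemma Hn_lim: "(\<lambda>n. Hn n t) \<longlonglongrightarrow> H t"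
  using tendsto_uniform_limitI[OF Hn_uniform] by simp

lemma H_cont: "continuous_on UNIV H"
  by (rule uniform_limit_theorem[OF _ Hn_uniform]) (auto simp: Hn_cont)

lemma H_shift: "H (t + 1) = H t + 1"
  using LIMSEQ_unique[OF Hn_lim[of "t + 1"]] tendsto_add[OF Hn_lim[of t] tendsto_const[of 1]]
  by (simp add: Hn_shift)

lemma H_mono: "x \<le> y \<Longrightarrow> H x \<le> H y"
  by (rule LIMSEQ_le[OF Hn_lim Hn_lim]) (auto simp: Hn_mono)

lemma H_conj: "H (- real d * t) = F (H t)"
proof -
  have "(\<lambda>n. Hn (Suc n) t) \<longlonglongrightarrow> H t" using Hn_lim by (rule LIMSEQ_Suc)
  then have "(\<lambda>n. F (Hn (Suc n) t)) \<longlonglongrightarrow> F (H t)" by (rule isCont_tendsto_compose[OF F_cont])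
  then show ?thesis using LIMSEQ_unique[OF Hn_lim[of "- real d * t"]] by simp
qed

lemma H_conj_pow: "H ((- real d) ^ n * t) = (F ^^ n) (H t)"
proof (induction n)
  case (Suc n)
  have "H ((- real d) ^ Suc n * t) = H (- real d * ((- real d) ^ n * t))" by (simp add: mult.assoc)
  then show ?case using H_conj[of "(- real d) ^ n * t"] Suc by simp
qed simp

lemma H_shift_int: "H (t + of_int k) = H t + of_int k"
  using shift_int[of H 1] H_shift by simp

text \<open>If \<open>H\<close> identified x and y, the conjugacy equation would identify their
  images under (- d)^n. These are eventually at least 1 apart, where monotonicity and H (t + 1) = H
  t + 1 forbid it.\<close>

lemma H_strict: assumes "x < y" shows "H x < H y"
proof -
  have "H x \<noteq> H y"
  proof
    assume eq: "H x = H y"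
    obtain n where n: "1 / (y - x) < real d ^ n" using real_arch_pow[of "real d"] d2 by auto
    have eqn: "H ((- real d) ^ n * x) = H ((- real d) ^ n * y)" by (simp add: H_conj_pow eq)
    have "\<bar>(- real d) ^ n * x - (- real d) ^ n * y\<bar> = real d ^ n * (y - x)"
      using assms by (simp add: abs_mult power_abs flip: right_diff_distrib)
    also have "\<dots> \<ge> 1" using n assms by (simp add: field_simps)
    finally have "(- real d) ^ n * x \<ge> (- real d) ^ n * y + 1 \<or> (- real d) ^ n * y \<ge> (- real d) ^ n * x + 1" by linarith
    then show False using H_mono[of "(- real d) ^ n * y + 1" "(- real d) ^ n * x"]
      H_mono[of "(- real d) ^ n * x + 1" "(- real d) ^ n * y"] eqn by (auto simp: H_shift)
  qed
  then show ?thesis using H_mono[of x y] assms by linarith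
qed

lemma H_surj: "\<exists>x. H x = y"
proof -
  obtain C where C: "\<And>t. \<bar>H t - t\<bar> \<le> C" using H_near by blast
  have "H (y - C) \<le> y" "y \<le> H (y + C)" using C[of "y - C"] C[of "y + C"] by auto
  moreover have "y - C \<le> y + C" using C[of 0] by linarith
  ultimately show ?thesis using IVT'[of H "y - C" y "y + C"] H_cont continuous_on_subset by blast
qed

lemma H_gap: assumes "h > 0" shows "\<exists>c>0. \<forall>x. c \<le> H (x + h) - H x"
proof -
  have "continuous_on {0..1} (\<lambda>x. H (x + h) - H x)"
    by (intro continuous_intros continuous_on_compose2[OF H_cont]) auto
  then have "\<exists>x0\<in>{0..1}. \<forall>x\<in>{0..1}. H (x0 + h) - H x0 \<le> H (x + h) - H x"
    by (intro continuous_attains_inf) auto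
  then obtain x0 where x0: "\<And>x. x \<in> {0..1} \<Longrightarrow> H (x0 + h) - H x0 \<le> H (x + h) - H x" by blast
  have "H (x0 + h) - H x0 \<le> H (x + h) - H x" for x
  proof -
    have "H (frac x + of_int \<lfloor>x\<rfloor>) = H (frac x) + of_int \<lfloor>x\<rfloor>"
      "H (frac x + h + of_int \<lfloor>x\<rfloor>) = H (frac x + h) + of_int \<lfloor>x\<rfloor>" by (simp_all only: H_shift_int)
    then have "H (x + h) - H x = H (frac x + h) - H (frac x)" by (simp add: frac_def algebra_simps)
    then show ?thesis using x0[of "frac x"] frac_lt_1[of x] frac_ge_0[of x] by (simp add: less_imp_le)
  qed
  then show ?thesis using H_strict[of x0 "x0 + h"] assms by (intro exI[of _ "H (x0 + h) - H x0"]) auto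
qed

text \<open>The quotient of two slopes is at most exp of K times the size of the triple, since the
  slopes are K-Lipschitz and at least 1. The product form avoids dividing by gaps that may
  vanish.\<close>

lemma distortion1:
  "\<bar>x - y\<bar> * \<bar>F y - F z\<bar> \<le> exp (K * (\<bar>x - y\<bar> + \<bar>y - z\<bar>)) * (\<bar>F x - F y\<bar> * \<bar>y - z\<bar>)"
proof -
  obtain \<xi> where \<xi>: "F x - F y = - S \<xi> * (x - y)" "\<xi> \<in> {min x y..max x y}" using F_mvt by blast
  obtain \<eta> where \<eta>: "F y - F z = - S \<eta> * (y - z)" "\<eta> \<in> {min y z..max y z}" using F_mvt by blast
  have pos: "S \<xi> \<ge> 1" "S \<eta> \<ge> 1" using S_ge[of \<xi>] S_ge[of \<eta>] lam_gt by linarith+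
  let ?D = "\<bar>x - y\<bar> + \<bar>y - z\<bar>"
  have "\<bar>\<eta> - \<xi>\<bar> \<le> ?D" using \<xi>(2) \<eta>(2) by (auto simp: min_def max_def split: if_splits)
  then have "S \<eta> \<le> S \<xi> + K * ?D" using S_lip[of \<eta> \<xi>] mult_left_mono[OF _ K_nonneg, of "\<bar>\<eta> - \<xi>\<bar>" ?D] by linarith
  also have "\<dots> \<le> S \<xi> * (1 + K * ?D)"
    using mult_right_mono[OF pos(1), of "K * ?D"] K_nonneg by (simp add: algebra_simps)
  also have "\<dots> \<le> S \<xi> * exp (K * ?D)" using pos exp_ge_add_one_self by (intro mult_left_mono) auto
  finally have "S \<eta> * (\<bar>x - y\<bar> * \<bar>y - z\<bar>) \<le> S \<xi> * exp (K * ?D) * (\<bar>x - y\<bar> * \<bar>y - z\<bar>)"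
    by (intro mult_right_mono) auto
  then show ?thesis using pos by (simp add: \<xi> \<eta> abs_mult mult_ac)
qed

text \<open>The one-step errors must add up to a bound independent of n. As \<open>D\<close> grows
  at least by the factor lam in each step, K times its current value is at most K / (lam - 1) times
  its increment, so the exponents telescope.\<close>

lemma distortion:
  fixes n defines "D \<equiv> \<lambda>n x y z. \<bar>(F ^^ n) x - (F ^^ n) y\<bar> + \<bar>(F ^^ n) y - (F ^^ n) z\<bar>"
  shows "\<bar>x - y\<bar> * \<bar>(F ^^ n) y - (F ^^ n) z\<bar>
     \<le> exp (K / (lam - 1) * (D n x y z - D 0 x y z)) * (\<bar>(F ^^ n) x - (F ^^ n) y\<bar> * \<bar>y - z\<bar>)"
proof (induction n arbitrary: x y z)
  case (Suc n)
  show ?case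
  proof (cases "x = y \<or> y = z")
    case False
    then have nz: "\<bar>F x - F y\<bar> > 0" "\<bar>F y - F z\<bar> > 0" using F_inj by auto
    let ?E = "\<lambda>t. exp (K / (lam - 1) * t)"
    have "D 1 x y z \<ge> lam * D 0 x y z" using F_expand[of x y] F_expand[of y z] by (simp add: D_def algebra_simps)
    then have "K * D 0 x y z * (lam - 1) \<le> K * (D 1 x y z - D 0 x y z)"
      using mult_left_mono[OF _ K_nonneg, of "lam * D 0 x y z" "D 1 x y z"] by (simp add: algebra_simps)
    then have "K * D 0 x y z \<le> K / (lam - 1) * (D 1 x y z - D 0 x y z)"
      using lam_gt by (simp add: field_simps)
    then have "exp (K * D 0 x y z) \<le> ?E (D 1 x y z - D 0 x y z)" by simp
    then have 1: "\<bar>x - y\<bar> * \<bar>F y - F z\<bar> \<le> ?E (D 1 x y z - D 0 x y z) * (\<bar>F x - F y\<bar> * \<bar>y - z\<bar>)"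
      using distortion1[of x y z] mult_right_mono[of "exp (K * D 0 x y z)" "?E (D 1 x y z - D 0 x y z)" "\<bar>F x - F y\<bar> * \<bar>y - z\<bar>"]
      by (simp add: D_def)
    have D1: "D n (F x) (F y) (F z) = D (Suc n) x y z" "D 0 (F x) (F y) (F z) = D 1 x y z"
      by (simp_all add: D_def funpow_swap1)
    have 2: "\<bar>F x - F y\<bar> * \<bar>(F ^^ n) (F y) - (F ^^ n) (F z)\<bar> \<le>
       ?E (D (Suc n) x y z - D 1 x y z) * (\<bar>(F ^^ n) (F x) - (F ^^ n) (F y)\<bar> * \<bar>F y - F z\<bar>)"
      using Suc[of "F x" "F y" "F z"] by (simp only: D1)
    have "(\<bar>F x - F y\<bar> * \<bar>F y - F z\<bar>) * (\<bar>x - y\<bar> * \<bar>(F ^^ Suc n) y - (F ^^ Suc n) z\<bar>)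
       = (\<bar>x - y\<bar> * \<bar>F y - F z\<bar>) * (\<bar>F x - F y\<bar> * \<bar>(F ^^ n) (F y) - (F ^^ n) (F z)\<bar>)"
      by (simp add: funpow_swap1 mult_ac)
    also have "\<dots> \<le> (?E (D 1 x y z - D 0 x y z) * (\<bar>F x - F y\<bar> * \<bar>y - z\<bar>)) *
       (?E (D (Suc n) x y z - D 1 x y z) * (\<bar>(F ^^ n) (F x) - (F ^^ n) (F y)\<bar> * \<bar>F y - F z\<bar>))"
      by (rule mult_mono[OF 1 2]) auto
    also have "\<dots> = (\<bar>F x - F y\<bar> * \<bar>F y - F z\<bar>) * ((?E (D 1 x y z - D 0 x y z) * ?E (D (Suc n) x y z - D 1 x y z))
        * (\<bar>(F ^^ n) (F x) - (F ^^ n) (F y)\<bar> * \<bar>y - z\<bar>))" by (simp only: mult_ac)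
    also have "?E (D 1 x y z - D 0 x y z) * ?E (D (Suc n) x y z - D 1 x y z) = ?E (D (Suc n) x y z - D 0 x y z)"
      unfolding exp_add[symmetric] distrib_left[symmetric] by (simp del: One_nat_def)
    finally show ?thesis using nz by (simp add: funpow_swap1)
  qed auto
qed (simp add: mult.commute)

text \<open>The conjugacy equation enlarges any step \<open>t\<close> to a definite size, where
  compactness compares the two neighbouring arcs; bounded distortion carries the comparison
  back.\<close>

lemma H_quasisym: "\<exists>M\<ge>0. \<forall>x t. 0 < t \<longrightarrow> t \<le> 1 / 2 \<longrightarrow> H (x + t) - H x \<le> M * (H x - H (x - t))"
proof -
  obtain c where c: "c > 0" "\<And>x. c \<le> H (x + 1 / (2 * real d)) - H x"
    using H_gap[of "1 / (2 * real d)"] d2 by auto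
  let ?E = "exp (K / (lam - 1) * 2)"
  have "H (x + t) - H x \<le> (?E / c) * (H x - H (x - t))" if t: "0 < t" "t \<le> 1 / 2" for x t
  proof -
    \<comment> \<open>The iteration stops just before the step exceeds 1 / 2; being within a factor
      \<open>d\<close> of 1 / 2 gives the lower bound 1 / (2 d).\<close>
    have "\<exists>n. real d ^ n * t \<le> 1 / 2 \<and> 1 / 2 < real d ^ Suc n * t"
    proof -
      obtain k where k: "1 / (2 * t) < real d ^ k" using real_arch_pow[of "real d"] d2 by auto
      define m where "m = (LEAST k. 1 / 2 < real d ^ k * t)"
      have ex: "1 / 2 < real d ^ k * t" using k t by (simp add: field_simps)
      have m: "1 / 2 < real d ^ m * t" unfolding m_def by (rule LeastI[of _ k]) (rule ex)
      then have "m \<noteq> 0" using t by (intro notI) simp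
      then obtain n where n: "m = Suc n" by (cases m) auto
      then have "\<not> 1 / 2 < real d ^ n * t" using not_less_Least[of n "\<lambda>k. 1 / 2 < real d ^ k * t"] by (simp add: m_def)
      then show ?thesis using m n by (intro exI[of _ n]) auto
    qed
    then obtain n where n: "real d ^ n * t \<le> 1 / 2" "1 / 2 < real d ^ Suc n * t" by blast
    define q \<xi> where "q = (- real d) ^ n" and "\<xi> = q * x"
    have aq: "\<bar>q * t\<bar> = real d ^ n * t" using t by (simp add: q_def abs_mult power_abs)
    have qt: "1 / (2 * real d) \<le> \<bar>q * t\<bar>" "\<bar>q * t\<bar> \<le> 1 / 2"
      using n aq d2 by (auto simp: field_simps)
    have Fn: "(F ^^ n) (H x) = H \<xi>" "(F ^^ n) (H (x + t)) = H (\<xi> + q * t)" "(F ^^ n) (H (x - t)) = H (\<xi> - q * t)"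
      unfolding H_conj_pow[symmetric] q_def[symmetric] \<xi>_def by (simp_all add: algebra_simps)
    have up: "\<bar>H (\<xi> + r) - H \<xi>\<bar> \<le> 1" if "\<bar>r\<bar> \<le> 1 / 2" for r
    proof -
      have "H (\<xi> + r) \<le> H (\<xi> + 1)" "H (\<xi> - 1) \<le> H (\<xi> + r)" using that by (auto intro!: H_mono)
      moreover have "H (\<xi> - 1) = H \<xi> - 1" using H_shift[of "\<xi> - 1"] by simp
      ultimately show ?thesis using H_shift[of \<xi>] by linarith
    qed
    \<comment> \<open>The sign of \<open>q\<close> depends on the parity of \<open>n\<close>, so the
      second arc may lie on either side of \<xi>.\<close>
    have lo: "c \<le> \<bar>H \<xi> - H (\<xi> - q * t)\<bar>"
    proof (cases "q * t \<ge> 0")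
      case True
      have "H (\<xi> - q * t + 1 / (2 * real d)) \<le> H \<xi>" using qt True by (intro H_mono) auto
      then show ?thesis using c(2)[of "\<xi> - q * t"] by linarith
    next
      case False
      have "H (\<xi> + 1 / (2 * real d)) \<le> H (\<xi> - q * t)" using qt False by (intro H_mono) auto
      then show ?thesis using c(2)[of "\<xi>"] by linarith
    qed
    let ?X = "H (x + t) - H x" and ?Y = "H x - H (x - t)"
    have XY: "?X > 0" "?Y > 0" using H_strict t by auto
    let ?D = "\<bar>H (\<xi> + q * t) - H \<xi>\<bar> + \<bar>H \<xi> - H (\<xi> - q * t)\<bar>"
    have "\<bar>H (x + t) - H x\<bar> * \<bar>H \<xi> - H (\<xi> - q * t)\<bar> \<le>
       exp (K / (lam - 1) * (?D - (\<bar>H (x + t) - H x\<bar> + \<bar>H x - H (x - t)\<bar>))) * (\<bar>H (\<xi> + q * t) - H \<xi>\<bar> * \<bar>H x - H (x - t)\<bar>)"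
      using distortion[of "H (x + t)" "H x" n "H (x - t)"] by (simp add: Fn)
    also have "\<dots> \<le> ?E * (1 * \<bar>H x - H (x - t)\<bar>)"
    proof (intro mult_mono)
      have "?D \<le> 2" using up[of "q * t"] up[of "- (q * t)"] qt by (simp add: abs_minus_commute)
      then show "exp (K / (lam - 1) * (?D - (\<bar>H (x + t) - H x\<bar> + \<bar>H x - H (x - t)\<bar>))) \<le> ?E"
        unfolding exp_le_cancel_iff using K_nonneg lam_gt by (intro mult_left_mono) auto
      show "\<bar>H (\<xi> + q * t) - H \<xi>\<bar> \<le> 1" using up qt by blast
    qed auto
    finally have "?X * \<bar>H \<xi> - H (\<xi> - q * t)\<bar> \<le> ?E * ?Y" using XY by simp
    moreover have "?X * c \<le> ?X * \<bar>H \<xi> - H (\<xi> - q * t)\<bar>" using lo XY by (intro mult_left_mono) auto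
    ultimately show ?thesis using c by (simp add: field_simps)
  qed
  then show ?thesis using c by (intro exI[of _ "?E / c"]) auto
qed

end

section \<open>The circle as R/Z and lifts of anti-Blaschke products\<close>

lemma circ_add: "circ (s + t) = circ s * circ t" by (simp add: circ_def cis_mult distrib_left)
lemma circ_minus: "circ (- t) = cnj (circ t)" by (simp add: circ_def cis_cnj)
lemma circ_int [simp]: "circ (of_int n) = 1" by (simp add: circ_def cis_multiple_2pi Ints_of_int)
lemma circ_0 [simp]: "circ 0 = 1" by (simp add: circ_def)
lemma norm_circ [simp]: "cmod (circ t) = 1" by (simp add: circ_def)
lemma circ_nz [simp]: "circ t \<noteq> 0" by (metis norm_circ norm_zero zero_neq_one)

lemma circ_eq_1_iff: "circ t = 1 \<longleftrightarrow> (\<exists>n::int. t = of_int n)"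
proof
  assume "circ t = 1"
  then have "cos (2 * pi * t) = 1" unfolding circ_def by (metis cis.simps(1) one_complex.simps(1))
  then obtain n :: int where "2 * pi * t = of_int n * 2 * pi" using cos_one_2pi_int by blast
  then show "\<exists>n::int. t = of_int n" by auto
qed auto

lemma circ_eq_iff: "circ s = circ t \<longleftrightarrow> (\<exists>n::int. s = t + of_int n)"
proof -
  have "circ s = circ t \<longleftrightarrow> circ (s - t) = 1"
    using circ_add[of "s - t" t] by simp
  also have "\<dots> \<longleftrightarrow> (\<exists>n::int. s = t + of_int n)"
    unfolding circ_eq_1_iff by (auto simp: algebra_simps)
  finally show ?thesis .
qed

lemma circ_surj: assumes "cmod z = 1" shows "\<exists>t. circ t = z"
proof -
  have "z \<noteq> 0" using assms by auto
  then have "cis (Arg z) = z" using assms cis_Arg[of z] by (simp add: sgn_eq)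
  then show ?thesis by (intro exI[of _ "Arg z / (2 * pi)"]) (simp add: circ_def)
qed

lemma continuous_circ: "continuous_on S circ"
  unfolding circ_def by (intro continuous_intros)

lemma norm_circ_diff: "cmod (circ u - circ v) = 2 * \<bar>sin (pi * (u - v))\<bar>"
proof -
  have "circ u - circ v = circ v * (circ (u - v) - 1)"
    using circ_add[of v "u - v"] by (simp add: algebra_simps)
  then have "cmod (circ u - circ v) = cmod (circ (u - v) - 1)" by (simp add: norm_mult)
  moreover have "(cmod (cis (2 * x) - 1))\<^sup>2 = (2 * \<bar>sin x\<bar>)\<^sup>2" for x
    unfolding cmod_power2
    by (simp add: cos_double_sin sin_double power_mult_distrib cos_squared_eq)
      (simp add: eval_nat_numeral algebra_simps)
  then have "cmod (circ (u - v) - 1) = 2 * \<bar>sin (pi * (u - v))\<bar>"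
    unfolding circ_def using power2_eq_imp_eq[of "cmod (cis (2 * (pi * (u - v))) - 1)" "2 * \<bar>sin (pi * (u - v))\<bar>"]
    by (simp add: mult.assoc)
  ultimately show ?thesis by simp
qed

lemma norm_circ_diff_le: "cmod (circ u - circ v) \<le> 2 * pi * \<bar>u - v\<bar>"
  using abs_sin_x_le_abs_x[of "pi * (u - v)"] unfolding norm_circ_diff by (simp add: abs_mult)

text \<open>Chords are comparable to arcs while the complementary arc keeps length at least
  \<open>c\<close>. Up to 1 / 3 the mean value theorem applies with a cosine of at least 1 / 2; the
  remaining range is compact.\<close>

lemma sin_pi_lower: assumes "c > 0" shows "\<exists>m>0. \<forall>\<delta>. 0 \<le> \<delta> \<longrightarrow> \<delta> \<le> 1 - c \<longrightarrow> m * \<delta> \<le> sin (pi * \<delta>)"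
proof (cases "1 / 3 \<le> 1 - c")
  case True
  then have "\<exists>x0\<in>{1/3..1-c}. \<forall>x\<in>{1/3..1-c}. sin (pi * x0) \<le> sin (pi * x)"
    by (intro continuous_attains_inf continuous_intros) auto
  then obtain x0 where x0: "x0 \<in> {1/3..1-c}" "\<And>x. x \<in> {1/3..1-c} \<Longrightarrow> sin (pi * x0) \<le> sin (pi * x)" by blast
  have s0: "sin (pi * x0) > 0" using x0(1) assms by (intro sin_gt_zero) (auto simp: mult_less_cancel_left1)
  have "min 1 (sin (pi * x0)) * \<delta> \<le> sin (pi * \<delta>)" if d: "0 \<le> \<delta>" "\<delta> \<le> 1 - c" for \<delta>
  proof (cases "\<delta> \<le> 1 / 3")
    case le: True
    show ?thesis
    proof (cases "\<delta> = 0")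
      case False
      then have "\<exists>z>0. z < pi * \<delta> \<and> sin (pi * \<delta>) - sin 0 = (pi * \<delta> - 0) * cos z"
        using d by (intro MVT2) (auto intro!: derivative_eq_intros)
      then obtain z where z: "0 < z" "z < pi * \<delta>" "sin (pi * \<delta>) = pi * \<delta> * cos z" by auto
      have "pi * \<delta> \<le> pi * (1 / 3)" using le by (intro mult_left_mono) auto
      then have "z \<le> pi / 3" using z by linarith
    then have "cos (pi / 3) \<le> cos z" using z by (intro cos_monotone_0_pi_le) auto
      then have "pi * \<delta> * (1 / 2) \<le> sin (pi * \<delta>)" unfolding z(3) using d
        by (intro mult_left_mono) (auto simp: cos_60)
      moreover have "1 * \<delta> \<le> pi / 2 * \<delta>" using d pi_gt3 by (intro mult_right_mono) auto
      moreover have "min 1 (sin (pi * x0)) * \<delta> \<le> 1 * \<delta>" using d by (intro mult_right_mono) auto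
      ultimately show ?thesis by simp
    qed simp
  next
    case False
    have "min 1 (sin (pi * x0)) * \<delta> \<le> sin (pi * x0) * 1" using d assms s0 by (intro mult_mono) auto
    then show ?thesis using x0(2)[of \<delta>] d False by simp
  qed
  then show ?thesis using s0 by (intro exI[of _ "min 1 (sin (pi * x0))"]) auto
next
  case False
  have "1 * \<delta> \<le> sin (pi * \<delta>)" if d: "0 \<le> \<delta>" "\<delta> \<le> 1 - c" for \<delta>
  proof (cases "\<delta> = 0")
    case nz: False
    then have "\<exists>z>0. z < pi * \<delta> \<and> sin (pi * \<delta>) - sin 0 = (pi * \<delta> - 0) * cos z"
      using d by (intro MVT2) (auto intro!: derivative_eq_intros)
    then obtain z where z: "0 < z" "z < pi * \<delta>" "sin (pi * \<delta>) = pi * \<delta> * cos z" by auto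
    have "pi * \<delta> \<le> pi * (1 / 3)" using d False by (intro mult_left_mono) auto
    then have "z \<le> pi / 3" using z by linarith
    then have "cos (pi / 3) \<le> cos z" using z by (intro cos_monotone_0_pi_le) auto
    then have "pi * \<delta> * (1 / 2) \<le> sin (pi * \<delta>)" unfolding z(3) using d
      by (intro mult_left_mono) (auto simp: cos_60)
    moreover have "1 * \<delta> \<le> pi / 2 * \<delta>" using d pi_gt3 by (intro mult_right_mono) auto
    ultimately show ?thesis by simp
  qed simp
  then show ?thesis by (intro exI[of _ 1]) auto
qed

text \<open>On the circle each factor is \<open>circ (- t)\<close> times q / conj q with q = 1 - a_i
  circ t, which has argument 2 Im Ln q. The principal logarithm is smooth here because Re q >
  0.\<close>

definition bl_lift :: "nat \<Rightarrow> (nat \<Rightarrow> complex) \<Rightarrow> real \<Rightarrow> real" where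
  "bl_lift d a t = - real d * t + (1 / pi) * (\<Sum>i<d - 1. Im (Ln (1 - a i * circ t)))"

text \<open>Minus the derivative of the lift. Each summand is a Poisson kernel, hence positive.\<close>

definition bl_slope :: "nat \<Rightarrow> (nat \<Rightarrow> complex) \<Rightarrow> real \<Rightarrow> real" where
  "bl_slope d a t = 1 + (\<Sum>i<d - 1. Re ((1 + a i * circ t) / (1 - a i * circ t)))"

lemma re_one_minus_pos: "cmod q < 1 \<Longrightarrow> Re (1 - q) > 0"
  using complex_Re_le_cmod[of q] by simp

lemma antiblaschke_circ:
  assumes "d \<ge> 1" "a \<in> bparams d" shows "antiblaschke d a (circ t) = circ (bl_lift d a t)"
proof -
  have f: "(cnj (circ t) - a i) / (1 - cnj (a i * circ t)) = circ (- t) * cis (2 * Im (Ln (1 - a i * circ t)))"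
    if "i < d - 1" for i
  proof -
    define q where "q = 1 - a i * circ t"
    have "cmod (a i * circ t) < 1" using assms that by (simp add: bparams_def norm_mult)
    then have q: "q \<noteq> 0" unfolding q_def using re_one_minus_pos[of "a i * circ t"] by auto
    have "q = exp (Ln q)" using q by simp
    also have "\<dots> = of_real (exp (Re (Ln q))) * cis (Im (Ln q))" by (rule exp_eq_polar)
    finally have "q / cnj q = cis (Im (Ln q)) / cis (- Im (Ln q))"
      by (metis complex_cnj_complex_of_real complex_cnj_mult cis_cnj exp_not_eq_zero mult_divide_mult_cancel_left of_real_eq_0_iff)
    also have "\<dots> = cis (2 * Im (Ln q))" by (simp add: cis_divide)
    finally have "q / cnj q = cis (2 * Im (Ln q))" .
    moreover have "cnj (circ t) - a i = circ (- t) * q"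
      using circ_add[of "-t" t] by (simp add: q_def circ_minus algebra_simps)
    moreover have "(cnj (circ t) - a i) / (1 - cnj (a i * circ t)) = (cnj (circ t) - a i) / cnj q"
      by (simp add: q_def)
    ultimately show ?thesis by (simp add: q_def[symmetric] times_divide_eq_right[symmetric] del: times_divide_eq_right)
  qed
  have "antiblaschke d a (circ t) = circ (- t) * (\<Prod>i<d - 1. circ (- t) * cis (2 * Im (Ln (1 - a i * circ t))))"
  proof -
    have "(\<Prod>i<d - 1. (cnj (circ t) - a i) / (1 - cnj (a i * circ t)))
      = (\<Prod>i<d - 1. circ (- t) * cis (2 * Im (Ln (1 - a i * circ t))))"
      by (rule prod.cong[OF refl]) (rule f, simp)
    then show ?thesis unfolding antiblaschke_def circ_minus by simp
  qed
  also have "\<dots> = circ (- t) ^ d * cis (\<Sum>i<d - 1. 2 * Im (Ln (1 - a i * circ t)))"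
  proof -
    have "(\<Prod>i<d - 1. cis (g i)) = cis (\<Sum>i<d - 1. g i)" for g
      by (induction "d - 1" arbitrary: d) (auto simp: cis_mult[symmetric] atLeast0LessThan[symmetric] cis_conv_exp exp_sum sum_distrib_left sum_distrib_right)
    moreover have "circ (- t) * circ (- t) ^ (d - 1) = circ (- t) ^ d" using assms(1) by (cases d) auto
    ultimately show ?thesis by (simp add: prod.distrib)
  qed
  also have "circ (- t) ^ d = cis (real d * (2 * pi * (- t)))" by (simp only: circ_def Complex.DeMoivre)
  finally have "antiblaschke d a (circ t) = cis (real d * (2 * pi * - t) + 2 * (\<Sum>i<d - 1. Im (Ln (1 - a i * circ t))))"
    by (simp only: cis_mult sum_distrib_left)
  moreover have "real d * (2 * pi * - t) + 2 * X = 2 * pi * (- real d * t + (1 / pi) * X)" for X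
    by (simp add: field_simps)
  ultimately show ?thesis unfolding bl_lift_def circ_def[of "_ + _"] by (simp only:)
qed

lemma bl_lift_shift: "bl_lift d a (t + 1) = bl_lift d a t - real d"
proof -
  have "circ (t + 1) = circ t" using circ_add[of t 1] circ_int[of 1] by simp
  then show ?thesis by (simp add: bl_lift_def algebra_simps)
qed

lemma circ_deriv: "(circ has_vector_derivative (2 * pi * \<i> * circ t)) (at t)"
proof -
  have c: "circ = exp \<circ> (\<lambda>t. \<i> * of_real (2 * pi * t))" by (auto simp: circ_def cis_conv_exp)
  have "((\<lambda>t. of_real (2 * pi * t) :: complex) has_vector_derivative of_real (2 * pi)) (at t)"
    by (intro has_vector_derivative_of_real) (auto intro!: derivative_eq_intros)
  then have "((\<lambda>t. \<i> * of_real (2 * pi * t)) has_vector_derivative \<i> * of_real (2 * pi)) (at t)"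
    by (rule has_vector_derivative_mult_right)
  then have "((exp \<circ> (\<lambda>t. \<i> * of_real (2 * pi * t))) has_vector_derivative
      \<i> * of_real (2 * pi) * exp (\<i> * of_real (2 * pi * t))) (at t)"
    by (rule field_vector_diff_chain_at) (rule DERIV_exp)
  then show ?thesis unfolding c[symmetric] by (simp add: circ_def cis_conv_exp mult_ac)
qed

lemma bl_lift_deriv:
  assumes "d \<ge> 1" "a \<in> bparams d" shows "(bl_lift d a has_real_derivative - bl_slope d a t) (at t)"
proof -
  have D: "((\<lambda>t. Im (Ln (1 - a i * circ t))) has_real_derivative - (2 * pi) * Re (a i * circ t / (1 - a i * circ t))) (at t)"
    if "i < d - 1" for i
  proof -
    let ?q = "a i * circ t"
    have "cmod ?q < 1" using assms that by (simp add: bparams_def norm_mult)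
    then have q: "1 - ?q \<notin> \<real>\<^sub>\<le>\<^sub>0" using re_one_minus_pos[of ?q] by (auto simp: complex_nonpos_Reals_iff)
    have "((\<lambda>t. 1 - a i * circ t) has_vector_derivative (0 - a i * (2 * pi * \<i> * circ t))) (at t)"
      by (intro derivative_intros has_vector_derivative_mult_right circ_deriv)
    then have "((Ln \<circ> (\<lambda>t. 1 - a i * circ t)) has_vector_derivative (0 - a i * (2 * pi * \<i> * circ t)) * inverse (1 - ?q)) (at t)"
      by (rule field_vector_diff_chain_at) (rule has_field_derivative_Ln[OF q])
    from bounded_linear.has_vector_derivative[OF bounded_linear_Im this]
    have "((\<lambda>t. Im (Ln (1 - a i * circ t))) has_vector_derivative Im ((0 - a i * (2 * pi * \<i> * circ t)) * inverse (1 - ?q))) (at t)"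
      by (simp only: o_def)
    moreover have "(0 - a i * (2 * pi * \<i> * circ t)) * inverse (1 - ?q) = of_real (- (2 * pi)) * (\<i> * (?q / (1 - ?q)))"
      by (simp add: divide_inverse mult_ac)
    then have "Im ((0 - a i * (2 * pi * \<i> * circ t)) * inverse (1 - ?q)) = - (2 * pi) * Re (?q / (1 - ?q))"
      by (simp only: Im_complex_of_real Re_complex_of_real times_complex.sel imaginary_unit.sel) simp
    ultimately show ?thesis by (simp only: has_real_derivative_iff_has_vector_derivative)
  qed
  have "(bl_lift d a has_real_derivative (- real d * 1 + (1 / pi) * (\<Sum>i<d - 1. - (2 * pi) * Re (a i * circ t / (1 - a i * circ t))))) (at t)"
    unfolding bl_lift_def[abs_def]
    by (intro DERIV_add DERIV_cmult DERIV_ident DERIV_sum) (use D in auto)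
  moreover have "- real d * 1 + (1 / pi) * (\<Sum>i<d - 1. - (2 * pi) * Re (a i * circ t / (1 - a i * circ t))) = - bl_slope d a t"
  proof -
    have "Re ((1 + a i * circ t) / (1 - a i * circ t)) = 1 + 2 * Re (a i * circ t / (1 - a i * circ t))" if "i < d - 1" for i
    proof -
      let ?q = "a i * circ t"
      have "cmod ?q < 1" using assms that by (simp add: bparams_def norm_mult)
      then have nz: "1 - ?q \<noteq> 0" using re_one_minus_pos[of ?q] by auto
      have "((1 - ?q) + (?q + ?q)) / (1 - ?q) = 1 + (?q / (1 - ?q) + ?q / (1 - ?q))"
        by (simp only: add_divide_distrib divide_self[OF nz])
      moreover have "(1 - ?q) + (?q + ?q) = 1 + ?q" by simp
      ultimately have "(1 + ?q) / (1 - ?q) = 1 + (?q / (1 - ?q) + ?q / (1 - ?q))" by (simp only:)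
      then have "Re ((1 + ?q) / (1 - ?q)) = 1 + (Re (?q / (1 - ?q)) + Re (?q / (1 - ?q)))"
        by (simp only: plus_complex.sel one_complex.sel)
      then show ?thesis by (simp only: mult_2)
    qed
    then have "bl_slope d a t = 1 + (\<Sum>i<d - 1. 1 + 2 * Re (a i * circ t / (1 - a i * circ t)))"
      unfolding bl_slope_def by simp
    also have "\<dots> = real d + 2 * (\<Sum>i<d - 1. Re (a i * circ t / (1 - a i * circ t)))"
      using assms(1) by (simp add: sum.distrib sum_distrib_left of_nat_diff)
    finally show ?thesis by (simp add: sum_distrib_left[symmetric] sum_negf)
  qed
  ultimately show ?thesis by simp
qed

text \<open>Harnack's inequality for the Poisson kernel; it makes the constants of the lift depend
  on \<rho> alone.\<close>

lemma re_cayley_bounds: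
  assumes "cmod q \<le> \<rho>" "\<rho> < 1" 
  shows "(1 - \<rho>) / (1 + \<rho>) \<le> Re ((1 + q) / (1 - q))" "Re ((1 + q) / (1 - q)) \<le> (1 + \<rho>) / (1 - \<rho>)"
proof -
  have \<rho>: "0 \<le> \<rho>" using assms norm_ge_zero[of q] by linarith
  have q: "q \<noteq> 1" using assms by auto
  have lo: "1 - \<rho> \<le> cmod (1 - q)" using norm_triangle_ineq2[of 1 q] assms by simp
  have up: "cmod (1 - q) \<le> 1 + \<rho>" using norm_triangle_ineq4[of 1 q] assms by simp
  have "Re ((1 + q) / (1 - q)) = (1 - (cmod q)\<^sup>2) / (cmod (1 - q))\<^sup>2"
    unfolding Re_divide cmod_power2 by (simp add: power2_eq_square algebra_simps)
  moreover have "(cmod q)\<^sup>2 \<le> \<rho>\<^sup>2" using assms by (intro power_mono) auto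
  moreover have "\<rho>\<^sup>2 < 1" using \<rho> assms by (simp add: power_less_one_iff abs_square_less_1)
  moreover have "(1 - \<rho>\<^sup>2) / (1 + \<rho>)\<^sup>2 \<le> (1 - (cmod q)\<^sup>2) / (cmod (1 - q))\<^sup>2"
    if "(cmod q)\<^sup>2 \<le> \<rho>\<^sup>2" "\<rho>\<^sup>2 < 1"
    using that order_trans[OF that(1) less_imp_le[OF that(2)]] up lo assms(2) \<rho> q
    by (intro frac_le power_mono zero_less_power) auto
  ultimately have 1: "(1 - \<rho>\<^sup>2) / (1 + \<rho>)\<^sup>2 \<le> Re ((1 + q) / (1 - q))" by simp
  have "cmod ((1 + q) / (1 - q)) \<le> (1 + \<rho>) / (1 - \<rho>)"
    unfolding norm_divide using lo assms \<rho> norm_triangle_ineq[of 1 q] by (intro frac_le) auto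
  then show "Re ((1 + q) / (1 - q)) \<le> (1 + \<rho>) / (1 - \<rho>)" using complex_Re_le_cmod order_trans by blast
  have "(1 - \<rho>\<^sup>2) / (1 + \<rho>)\<^sup>2 = ((1 - \<rho>) * (1 + \<rho>)) / ((1 + \<rho>) * (1 + \<rho>))" by (simp add: power2_eq_square algebra_simps)
  also have "\<dots> = (1 - \<rho>) / (1 + \<rho>)" using \<rho> by simp
  finally show "(1 - \<rho>) / (1 + \<rho>) \<le> Re ((1 + q) / (1 - q))" using 1 by simp
qed

lemma bparams_rho:
  assumes "a \<in> bparams d" shows "\<exists>\<rho>\<ge>0. \<rho> < 1 \<and> (\<forall>i<d - 1. cmod (a i) \<le> \<rho>)"
proof -
  let ?A = "insert 0 ((\<lambda>i. cmod (a i)) ` {..<d - 1})"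
  have "Max ?A \<ge> 0" "Max ?A < 1" using assms by (auto simp: bparams_def)
  moreover have "cmod (a i) \<le> Max ?A" if "i < d - 1" for i using that by (intro Max_ge) auto
  ultimately show ?thesis by blast
qed

text \<open>The factor \<open>cnj z\<close> contributes slope 1 and each of the other d - 1 \<ge> 1
  factors a positive Poisson kernel, one of which suffices for uniform expansion. The Lipschitz
  constant comes from the difference quotient of (1 + q) / (1 - q) on |q| \<le> \<rho>.\<close>

lemma bl_expanding:
  assumes "d \<ge> 2" "a \<in> bparams d" "0 \<le> \<rho>" "\<rho> < 1" "\<And>i. i < d - 1 \<Longrightarrow> cmod (a i) \<le> \<rho>"
  shows "expanding_lift d (bl_lift d a) (bl_slope d a) (1 + (1 - \<rho>) / (1 + \<rho>)) (real (d - 1) * (4 * pi / (1 - \<rho>)\<^sup>2))"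
proof
  show "2 \<le> d" by fact
  show "bl_lift d a (t + 1) = bl_lift d a t - real d" for t by (rule bl_lift_shift)
  show "(bl_lift d a has_real_derivative - bl_slope d a t) (at t)" for t
    using bl_lift_deriv assms by simp
  have q: "cmod (a i * circ t) \<le> \<rho>" if "i < d - 1" for i t using assms(5) that by (simp add: norm_mult)
  show "1 + (1 - \<rho>) / (1 + \<rho>) \<le> bl_slope d a t" for t
  proof -
    let ?g = "\<lambda>i. Re ((1 + a i * circ t) / (1 - a i * circ t))"
    have p: "(1 - \<rho>) / (1 + \<rho>) \<ge> 0" using assms by simp
    have g: "(1 - \<rho>) / (1 + \<rho>) \<le> ?g i" if "i < d - 1" for i using re_cayley_bounds(1)[OF q[OF that] assms(4)] .
    have "?g 0 \<le> (\<Sum>i<d - 1. ?g i)"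
      by (rule member_le_sum) (use assms(1) p in \<open>auto intro: order_trans[OF p g]\<close>)
    then show ?thesis unfolding bl_slope_def using g[of 0] assms(1) by simp
  qed
  show "1 < 1 + (1 - \<rho>) / (1 + \<rho>)" using assms by simp
  show "0 \<le> real (d - 1) * (4 * pi / (1 - \<rho>)\<^sup>2)" by simp
  show "\<bar>bl_slope d a t - bl_slope d a u\<bar> \<le> real (d - 1) * (4 * pi / (1 - \<rho>)\<^sup>2) * \<bar>t - u\<bar>" for t u
  proof -
    let ?g = "\<lambda>i t. Re ((1 + a i * circ t) / (1 - a i * circ t))"
    have "\<bar>?g i t - ?g i u\<bar> \<le> 4 * pi / (1 - \<rho>)\<^sup>2 * \<bar>t - u\<bar>" if i: "i < d - 1" for i
    proof -
      define q r where "q = a i * circ t" and "r = a i * circ u"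
      have n: "cmod q \<le> \<rho>" "cmod r \<le> \<rho>" using q i by (auto simp: q_def r_def)
      then have lo: "1 - \<rho> \<le> cmod (1 - q)" "1 - \<rho> \<le> cmod (1 - r)"
        using norm_triangle_ineq2[of 1 q] norm_triangle_ineq2[of 1 r] by auto
      then have nz: "1 - q \<noteq> 0" "1 - r \<noteq> 0" using assms by auto
      have "(1 + q) / (1 - q) - (1 + r) / (1 - r) = 2 * (q - r) / ((1 - q) * (1 - r))"
        using nz by (simp add: diff_frac_eq algebra_simps)
      then have "cmod ((1 + q) / (1 - q) - (1 + r) / (1 - r)) = 2 * cmod (q - r) / (cmod (1 - q) * cmod (1 - r))"
        by (simp only: norm_divide norm_mult norm_numeral)
      also have "\<dots> \<le> 2 * (2 * pi * \<bar>t - u\<bar>) / ((1 - \<rho>) * (1 - \<rho>))"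
      proof (rule frac_le)
        have "cmod (q - r) = cmod (a i) * cmod (circ t - circ u)"
          by (simp add: q_def r_def right_diff_distrib[symmetric] norm_mult)
        also have "\<dots> \<le> 1 * (2 * pi * \<bar>t - u\<bar>)"
          using assms(5)[OF i] assms(4) by (intro mult_mono norm_circ_diff_le) auto
        finally show "2 * cmod (q - r) \<le> 2 * (2 * pi * \<bar>t - u\<bar>)" by simp
        show "(1 - \<rho>) * (1 - \<rho>) \<le> cmod (1 - q) * cmod (1 - r)" using lo assms by (intro mult_mono) auto
      qed (use assms in auto)
      finally have "cmod ((1 + q) / (1 - q) - (1 + r) / (1 - r)) \<le> 4 * pi / (1 - \<rho>)\<^sup>2 * \<bar>t - u\<bar>"
        by (simp add: power2_eq_square)
      then show ?thesis using abs_Re_le_cmod[of "(1 + q) / (1 - q) - (1 + r) / (1 - r)"] by (simp add: q_def r_def)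
    qed
    then have "\<bar>\<Sum>i<d - 1. ?g i t - ?g i u\<bar> \<le> (\<Sum>i<d - 1. 4 * pi / (1 - \<rho>)\<^sup>2 * \<bar>t - u\<bar>)"
      by (intro order_trans[OF sum_abs] sum_mono) auto
    then show ?thesis by (simp add: bl_slope_def sum_subtractf)
  qed
qed

lemma bl_lift_lipschitz:
  assumes "d \<ge> 2" "a \<in> bparams d" "0 \<le> \<rho>" "\<rho> < 1" "\<And>i. i < d - 1 \<Longrightarrow> cmod (a i) \<le> \<rho>"
  shows "\<bar>bl_lift d a t - bl_lift d a u\<bar> \<le> (1 + real (d - 1) * ((1 + \<rho>) / (1 - \<rho>))) * \<bar>t - u\<bar>"
proof -
  interpret expanding_lift d "bl_lift d a" "bl_slope d a" "1 + (1 - \<rho>) / (1 + \<rho>)" "real (d - 1) * (4 * pi / (1 - \<rho>)\<^sup>2)"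
    by (rule bl_expanding) (use assms in auto)
  obtain \<xi> where \<xi>: "bl_lift d a t - bl_lift d a u = - bl_slope d a \<xi> * (t - u)" using F_mvt by blast
  have "(\<Sum>i<d - 1. Re ((1 + a i * circ \<xi>) / (1 - a i * circ \<xi>))) \<le> (\<Sum>i<d - 1. (1 + \<rho>) / (1 - \<rho>))"
    using assms(4,5) by (intro sum_mono re_cayley_bounds) (auto simp: norm_mult)
  then have "bl_slope d a \<xi> \<le> 1 + real (d - 1) * ((1 + \<rho>) / (1 - \<rho>))" by (simp add: bl_slope_def)
  moreover have "bl_slope d a \<xi> \<ge> 0" using S_ge[of \<xi>] lam_gt by linarith
  ultimately show ?thesis unfolding \<xi> by (simp add: abs_mult mult_right_mono)
qed

context expanding_lift begin

text \<open>Passage from arcs to chords. The lower chord estimate needs the arc from H (x - t) to H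
  x to leave room on the circle; it does, because the complementary arc contains the image of
  [x, x + 1/2], whose length is at least \<open>c\<close>.\<close>

lemma circ_H_quasisym:
  "\<exists>M. \<forall>x t. 0 < t \<longrightarrow> t < 1 / 2 \<longrightarrow>
     cmod (circ (H (x + t)) - circ (H x)) \<le> M * cmod (circ (H x) - circ (H (x - t)))"
proof -
  obtain M where M: "M \<ge> 0" "\<And>x t. 0 < t \<Longrightarrow> t \<le> 1 / 2 \<Longrightarrow> H (x + t) - H x \<le> M * (H x - H (x - t))"
    using H_quasisym by blast
  obtain c where c: "c > 0" "\<And>x. c \<le> H (x + 1 / 2) - H x" using H_gap[of "1 / 2"] by auto
  obtain m where m: "m > 0" "\<And>\<delta>. 0 \<le> \<delta> \<Longrightarrow> \<delta> \<le> 1 - c \<Longrightarrow> m * \<delta> \<le> sin (pi * \<delta>)"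
    using sin_pi_lower[OF c(1)] by blast
  have "cmod (circ (H (x + t)) - circ (H x)) \<le> (pi * M / m) * cmod (circ (H x) - circ (H (x - t)))"
    if t: "0 < t" "t < 1 / 2" for x t
  proof -
    let ?\<delta> = "H x - H (x - t)"
    have d0: "?\<delta> > 0" using H_strict t by simp
    have "H (x + 1 / 2) \<le> H (x - t + 1)" using t by (intro H_mono) auto
    then have "?\<delta> \<le> 1 - c" using c(2)[of x] H_shift[of "x - t"] by linarith
    then have "m * ?\<delta> \<le> sin (pi * ?\<delta>)" using m(2) d0 by simp
    also have "\<dots> \<le> \<bar>sin (pi * ?\<delta>)\<bar>" by simp
    also have "\<dots> = cmod (circ (H x) - circ (H (x - t))) / 2" by (simp add: norm_circ_diff)
    finally have 1: "m * ?\<delta> \<le> cmod (circ (H x) - circ (H (x - t))) / 2" .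
    have "cmod (circ (H (x + t)) - circ (H x)) \<le> 2 * pi * \<bar>H (x + t) - H x\<bar>" by (rule norm_circ_diff_le)
    also have "\<bar>H (x + t) - H x\<bar> = H (x + t) - H x" using H_mono[of x "x + t"] t by simp
    also have "2 * pi * (H (x + t) - H x) \<le> 2 * pi * (M * ?\<delta>)" using M(2) t by (intro mult_left_mono) auto
    also have "\<dots> = (2 * pi * M / m) * (m * ?\<delta>)" using m by simp
    also have "\<dots> \<le> (2 * pi * M / m) * (cmod (circ (H x) - circ (H (x - t))) / 2)"
      using 1 m M by (intro mult_left_mono) auto
    finally show ?thesis by simp
  qed
  then show ?thesis by blast
qed

text \<open>Expansion enlarges the difference h - H by lam in each step, up to the defect \<kappa>;
  a bounded difference is therefore small.\<close>

lemma H_unique_approx: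
  assumes "bounded (range (\<lambda>t. h t - t))" "\<And>t. \<bar>F (h t) - h (- real d * t)\<bar> \<le> \<kappa>"
  shows "\<bar>h t - H t\<bar> \<le> \<kappa> / (lam - 1)"
proof (rule expanding_bound[of "\<lambda>t. h t - H t" lam "- real d"])
  obtain C where C: "\<And>t. \<bar>H t - t\<bar> \<le> C" using H_near by blast
  obtain B where "\<forall>y\<in>range (\<lambda>t. h t - t). norm y \<le> B" using assms(1) unfolding bounded_iff by blast
  then have B: "\<bar>h t - t\<bar> \<le> B" for t by auto
  have "\<bar>h t - H t\<bar> \<le> B + C" for t using B[of t] C[of t] by linarith
  then show "bounded (range (\<lambda>t. h t - H t))" unfolding bounded_iff by auto
  show "1 < lam" by (rule lam_gt)
  show "lam * \<bar>h t - H t\<bar> \<le> \<bar>h (- real d * t) - H (- real d * t)\<bar> + \<kappa>" for t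
    using F_expand[of "h t" "H t"] assms(2)[of t] H_conj[of t] by linarith
qed

lemma circ_H_image: "(\<lambda>t. circ (H t)) ` UNIV = sphere 0 1"
proof (intro equalityI subsetI)
  fix z :: complex assume "z \<in> sphere 0 1"
  then obtain t where "circ t = z" using circ_surj[of z] by auto
  moreover obtain x where "H x = t" using H_surj by blast
  ultimately show "z \<in> range (\<lambda>t. circ (H t))" by blast
qed auto

lemma circ_H_eq: assumes "circ (H x) = circ (H y)" shows "\<exists>n::int. x = y + of_int n"
proof -
  obtain n :: int where n: "H x = H y + of_int n" using assms circ_eq_iff by blast
  then have "H x = H (y + of_int n)" by (simp add: H_shift_int)
  then have "x = y + of_int n" using H_strict[of x "y + of_int n"] H_strict[of "y + of_int n" x] by linarith
  then show ?thesis by blast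
qed

end

section \<open>The family of conjugacies and its uniqueness\<close>

definition bl_H :: "nat \<Rightarrow> (nat \<Rightarrow> complex) \<Rightarrow> real \<Rightarrow> real" where
  "bl_H d a = expanding_lift.H d (bl_lift d a)"

text \<open>The value 0 outside the parameter set is the one prescribed by
  \<open>eta_family\<close>, which makes the definite description in \<open>eta\<close> unique as a
  function of all parameters.\<close>

definition eta_std :: "nat \<Rightarrow> (nat \<Rightarrow> complex) \<Rightarrow> real \<Rightarrow> complex" where
  "eta_std d a = (if a \<in> bparams d then \<lambda>t. circ (bl_H d a t) else (\<lambda>_. 0))"

lemma eta_std_qs:
  assumes "d \<ge> 2" "a \<in> bparams d" shows "qs_conjugacy d (antiblaschke d a) (eta_std d a)"
proof -
  obtain \<rho> where \<rho>: "0 \<le> \<rho>" "\<rho> < 1" "\<And>i. i < d - 1 \<Longrightarrow> cmod (a i) \<le> \<rho>" using bparams_rho[OF assms(2)] by blast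
  interpret expanding_lift d "bl_lift d a" "bl_slope d a" "1 + (1 - \<rho>) / (1 + \<rho>)" "real (d - 1) * (4 * pi / (1 - \<rho>)\<^sup>2)"
    by (rule bl_expanding) (use assms \<rho> in auto)
  have e: "eta_std d a = (\<lambda>t. circ (H t))" using assms by (simp add: eta_std_def bl_H_def)
  have "circ (H (t + 1)) = circ (H t)" for t using circ_eq_iff[of "H (t + 1)" "H t"] H_shift[of t] by (metis of_int_1)
  moreover have "continuous_on UNIV (\<lambda>t. circ (H t))"
    by (rule continuous_on_compose2[OF continuous_circ[of UNIV] H_cont]) auto
  moreover have "inj_on (\<lambda>t. circ (H t)) {0..<1}"
  proof (rule inj_onI)
    fix x y :: real assume xy: "x \<in> {0..<1}" "y \<in> {0..<1}" "circ (H x) = circ (H y)"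
    then obtain n :: int where n: "x = y + of_int n" using circ_H_eq by blast
    then have "\<bar>of_int n\<bar> < (1::real)" using xy by auto
    then have "n = 0" by linarith
    then show "x = y" using n by simp
  qed
  moreover have "circ (H (- real d * t)) = antiblaschke d a (circ (H t))" for t
    using assms H_conj[of t] by (simp add: antiblaschke_circ)
  ultimately show ?thesis unfolding qs_conjugacy_def e using circ_H_image circ_H_quasisym by blast
qed

lemma Ln_lipschitz:
  assumes "cmod q \<le> \<rho>" "cmod r \<le> \<rho>" "\<rho> < 1" shows "cmod (Ln (1 - q) - Ln (1 - r)) \<le> 1 / (1 - \<rho>) * cmod (q - r)"
proof (rule field_differentiable_bound[of "cball 0 \<rho>" "\<lambda>z. Ln (1 - z)" "\<lambda>z. - inverse (1 - z)"])
  fix z :: complex assume z: "z \<in> cball 0 \<rho>"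
  have z1: "1 - \<rho> \<le> cmod (1 - z)" using norm_triangle_ineq2[of 1 z] z by simp
  have "Re (1 - z) > 0" using re_one_minus_pos[of z] z assms by simp
  then have "1 - z \<notin> \<real>\<^sub>\<le>\<^sub>0" by (auto simp: complex_nonpos_Reals_iff)
  then show "((\<lambda>z. Ln (1 - z)) has_field_derivative - inverse (1 - z)) (at z within cball 0 \<rho>)"
    by (auto intro!: derivative_eq_intros)
  show "cmod (- inverse (1 - z)) \<le> 1 / (1 - \<rho>)"
    unfolding norm_minus_cancel norm_inverse unfolding inverse_eq_divide
    using z1 assms by (intro frac_le) auto
qed (use assms in auto)

lemma bl_lift_close:
  assumes "\<rho> < 1" "\<And>i. i < d - 1 \<Longrightarrow> cmod (a i) \<le> \<rho>" "\<And>i. i < d - 1 \<Longrightarrow> cmod (b i) \<le> \<rho>"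
    "\<And>i. i < d - 1 \<Longrightarrow> cmod (b i - a i) \<le> \<delta>" "0 \<le> \<delta>"
  shows "\<bar>bl_lift d b t - bl_lift d a t\<bar> \<le> real d * \<delta> / (1 - \<rho>)"
proof -
  let ?g = "\<lambda>a i. Im (Ln (1 - a i * circ t))"
  have "\<bar>?g b i - ?g a i\<bar> \<le> \<delta> / (1 - \<rho>)" if i: "i < d - 1" for i
  proof -
    have "\<bar>?g b i - ?g a i\<bar> \<le> cmod (Ln (1 - b i * circ t) - Ln (1 - a i * circ t))"
      using abs_Im_le_cmod[of "Ln (1 - b i * circ t) - Ln (1 - a i * circ t)"] by simp
    also have "\<dots> \<le> 1 / (1 - \<rho>) * cmod (b i * circ t - a i * circ t)"
      by (rule Ln_lipschitz) (use assms i in \<open>auto simp: norm_mult\<close>)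
    also have "cmod (b i * circ t - a i * circ t) = cmod (b i - a i)"
      by (simp add: left_diff_distrib[symmetric] norm_mult)
    also have "1 / (1 - \<rho>) * cmod (b i - a i) \<le> 1 / (1 - \<rho>) * \<delta>"
      using assms i by (intro mult_left_mono) auto
    finally show ?thesis by simp
  qed
  then have "\<bar>\<Sum>i<d - 1. ?g b i - ?g a i\<bar> \<le> (\<Sum>i<d - 1. \<delta> / (1 - \<rho>))"
    by (intro order_trans[OF sum_abs] sum_mono) auto
  also have "\<dots> = real (d - 1) * (\<delta> / (1 - \<rho>))" by simp
  also have "\<dots> \<le> real d * (\<delta> / (1 - \<rho>))" using assms by (intro mult_right_mono) auto
  finally have *: "\<bar>\<Sum>i<d - 1. ?g b i - ?g a i\<bar> \<le> real d * (\<delta> / (1 - \<rho>))" .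
  have "bl_lift d b t - bl_lift d a t = (1 / pi) * (\<Sum>i<d - 1. ?g b i - ?g a i)"
    by (simp add: bl_lift_def sum_subtractf algebra_simps diff_divide_distrib)
  then have "\<bar>bl_lift d b t - bl_lift d a t\<bar> = (1 / pi) * \<bar>\<Sum>i<d - 1. ?g b i - ?g a i\<bar>"
    by (simp add: abs_mult)
  also have "\<dots> \<le> 1 * \<bar>\<Sum>i<d - 1. ?g b i - ?g a i\<bar>"
    using pi_gt3 by (intro mult_right_mono) auto
  finally show ?thesis using * by simp
qed

lemma bl_H_near: assumes "d \<ge> 2" "a \<in> bparams d" shows "bounded (range (\<lambda>t. bl_H d a t - t))"
proof -
  obtain \<rho> where \<rho>: "0 \<le> \<rho>" "\<rho> < 1" "\<And>i. i < d - 1 \<Longrightarrow> cmod (a i) \<le> \<rho>" using bparams_rho[OF assms(2)] by blast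
  interpret expanding_lift d "bl_lift d a" "bl_slope d a" "1 + (1 - \<rho>) / (1 + \<rho>)" "real (d - 1) * (4 * pi / (1 - \<rho>)\<^sup>2)"
    by (rule bl_expanding) (use assms \<rho> in auto)
  show ?thesis using H_near unfolding bounded_iff bl_H_def by auto
qed

lemma bl_H_conj: assumes "d \<ge> 2" "a \<in> bparams d" shows "bl_H d a (- real d * t) = bl_lift d a (bl_H d a t)"
   "bl_H d a (t + of_int n) = bl_H d a t + of_int n"
proof -
  obtain \<rho> where \<rho>: "0 \<le> \<rho>" "\<rho> < 1" "\<And>i. i < d - 1 \<Longrightarrow> cmod (a i) \<le> \<rho>" using bparams_rho[OF assms(2)] by blast
  interpret expanding_lift d "bl_lift d a" "bl_slope d a" "1 + (1 - \<rho>) / (1 + \<rho>)" "real (d - 1) * (4 * pi / (1 - \<rho>)\<^sup>2)"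
    by (rule bl_expanding) (use assms \<rho> in auto)
  show "bl_H d a (- real d * t) = bl_lift d a (bl_H d a t)" unfolding bl_H_def by (rule H_conj)
  show "bl_H d a (t + of_int n) = bl_H d a t + of_int n" unfolding bl_H_def by (rule H_shift_int)
qed

lemma bl_H_unique_approx:
  assumes "d \<ge> 2" "a \<in> bparams d" "0 \<le> \<rho>" "\<rho> < 1" "\<And>i. i < d - 1 \<Longrightarrow> cmod (a i) \<le> \<rho>"
    and "bounded (range (\<lambda>t. h t - t))" "\<And>t. \<bar>bl_lift d a (h t) - h (- real d * t)\<bar> \<le> \<kappa>"
  shows "\<bar>h t - bl_H d a t\<bar> \<le> \<kappa> * ((1 + \<rho>) / (1 - \<rho>))"
proof -
  interpret expanding_lift d "bl_lift d a" "bl_slope d a" "1 + (1 - \<rho>) / (1 + \<rho>)" "real (d - 1) * (4 * pi / (1 - \<rho>)\<^sup>2)"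
    by (rule bl_expanding) (use assms in auto)
  show ?thesis using H_unique_approx[OF assms(6,7), of t] by (simp add: bl_H_def)
qed

lemma bl_H_unique:
  assumes "d \<ge> 2" "a \<in> bparams d" "bounded (range (\<lambda>t. h t - t))"
    "\<And>t. bl_lift d a (h t) = h (- real d * t)"
  shows "h t = bl_H d a t"
proof -
  obtain \<rho> where \<rho>: "0 \<le> \<rho>" "\<rho> < 1" "\<And>i. i < d - 1 \<Longrightarrow> cmod (a i) \<le> \<rho>" using bparams_rho[OF assms(2)] by blast
  show ?thesis using bl_H_unique_approx[OF assms(1,2) \<rho> assms(3), of 0 t] assms(4) by simp
qed

text \<open>The conjugacy for \<open>b\<close> satisfies the equation for \<open>a\<close> up to the
  distance between the two lifts, so approximate uniqueness applies to it.\<close>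

lemma bl_H_close:
  assumes "d \<ge> 2" "a \<in> bparams d" "b \<in> bparams d" "0 \<le> \<rho>" "\<rho> < 1"
    "\<And>i. i < d - 1 \<Longrightarrow> cmod (a i) \<le> \<rho>" "\<And>i. i < d - 1 \<Longrightarrow> cmod (b i) \<le> \<rho>"
    "\<And>i. i < d - 1 \<Longrightarrow> cmod (b i - a i) \<le> \<delta>" "0 \<le> \<delta>"
  shows "\<bar>bl_H d b t - bl_H d a t\<bar> \<le> (real d * \<delta> / (1 - \<rho>)) * ((1 + \<rho>) / (1 - \<rho>))"
proof (rule bl_H_unique_approx[OF assms(1,2,4,5,6)])
  show "bounded (range (\<lambda>t. bl_H d b t - t))" by (rule bl_H_near[OF assms(1,3)])
  show "\<bar>bl_lift d a (bl_H d b t) - bl_H d b (- real d * t)\<bar> \<le> real d * \<delta> / (1 - \<rho>)" for t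
    unfolding bl_H_conj(1)[OF assms(1,3)] abs_minus_commute[of "bl_lift d a _"]
    by (rule bl_lift_close) (use assms in auto)
qed

lemma bparams_0: "(\<lambda>_. 0) \<in> bparams d" by (simp add: bparams_def)

lemma eta_std_family: assumes "d \<ge> 2" shows "eta_family d (eta_std d)"
proof -
  have "\<exists>\<delta>>0. \<forall>b\<in>bparams d. (\<forall>i<d - 1. cmod (b i - a i) < \<delta>) \<longrightarrow> (\<forall>t. cmod (eta_std d b t - eta_std d a t) < \<epsilon>)"
    if a: "a \<in> bparams d" and \<epsilon>: "\<epsilon> > 0" for a \<epsilon>
  proof -
    obtain r where r: "0 \<le> r" "r < 1" "\<And>i. i < d - 1 \<Longrightarrow> cmod (a i) \<le> r" using bparams_rho[OF a] by blast
    \<comment> \<open>Halfway between r and 1: a common bound for all parameters within (1 - r) / 2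
      of \<open>a\<close>.\<close>
    define \<rho> where "\<rho> = (1 + r) / 2"
    have \<rho>: "0 \<le> \<rho>" "\<rho> < 1" "r \<le> \<rho>" using r by (auto simp: \<rho>_def)
    define A where "A = (real d / (1 - \<rho>)) * ((1 + \<rho>) / (1 - \<rho>))"
    have A: "A > 0" using \<rho> assms by (auto simp: A_def intro!: mult_pos_pos divide_pos_pos)
    \<comment> \<open>The factor 8 leaves a strict inequality, since chords are at most 2 pi times
      arcs and pi < 4.\<close>
    define \<delta> where "\<delta> = min ((1 - r) / 2) (\<epsilon> / (8 * A))"
    have \<delta>: "\<delta> > 0" unfolding \<delta>_def using r \<epsilon> A by simp
    have \<delta>2: "\<delta> \<le> (1 - r) / 2" unfolding \<delta>_def by (rule min.cobounded1)
    have \<delta>3: "\<delta> \<le> \<epsilon> / (8 * A)" unfolding \<delta>_def by (rule min.cobounded2)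
    have "cmod (eta_std d b t - eta_std d a t) < \<epsilon>" if b: "b \<in> bparams d" "\<And>i. i < d - 1 \<Longrightarrow> cmod (b i - a i) < \<delta>" for b t
    proof -
      have br: "cmod (b i) \<le> \<rho>" if "i < d - 1" for i
        using norm_triangle_ineq2[of "b i" "a i"] r(3)[OF that] b(2)[OF that] \<delta>2 by (simp add: \<rho>_def field_simps)
      have ar: "cmod (a i) \<le> \<rho>" if "i < d - 1" for i using r(3)[OF that] \<rho> by linarith
      have "\<bar>bl_H d b t - bl_H d a t\<bar> \<le> (real d * \<delta> / (1 - \<rho>)) * ((1 + \<rho>) / (1 - \<rho>))"
        by (rule bl_H_close) (use assms a b \<rho> ar br \<delta> in \<open>auto intro: less_imp_le\<close>)
      also have "\<dots> = A * \<delta>" by (simp add: A_def)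
      also have "\<dots> \<le> A * (\<epsilon> / (8 * A))" using \<delta>3 A by (intro mult_left_mono) auto
      also have "\<dots> = \<epsilon> / 8" using A by simp
      finally have "2 * pi * \<bar>bl_H d b t - bl_H d a t\<bar> \<le> 2 * pi * (\<epsilon> / 8)" by (intro mult_left_mono) auto
      also have "\<dots> < \<epsilon>" using pi_less_4 \<epsilon> by simp
      finally show ?thesis using norm_circ_diff_le[of "bl_H d b t" "bl_H d a t"] a b by (simp add: eta_std_def)
    qed
    then show ?thesis using \<delta> by blast
  qed
  moreover have "eta_std d (\<lambda>_. 0) = circ"
  proof
    fix t
    have "t = bl_H d (\<lambda>_. 0) t"
      by (rule bl_H_unique[OF assms bparams_0]) (auto simp: bl_lift_def)
    then show "eta_std d (\<lambda>_. 0) t = circ t" using bparams_0 by (simp add: eta_std_def)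
  qed
  ultimately show ?thesis unfolding eta_family_def using eta_std_qs[OF assms] by (simp add: eta_std_def)
qed

text \<open>A conjugacy uniformly close to the standard one is circ (H + v) with v chosen pointwise
  and small. The conjugacy equation holds for H + v up to an integer; the integer has modulus below
  1, so the equation holds exactly and uniqueness of the lift applies. The closeness required
  depends on \<rho> only.\<close>

lemma qs_conjugacy_rigid:
  assumes "d \<ge> 2" "0 \<le> \<rho>" "\<rho> < 1"
  shows "\<exists>\<delta>>0. \<forall>a\<in>bparams d. (\<forall>i<d - 1. cmod (a i) \<le> \<rho>) \<longrightarrow> 
    (\<forall>h. qs_conjugacy d (antiblaschke d a) h \<longrightarrow> (\<forall>t. cmod (h t - eta_std d a t) < \<delta>) \<longrightarrow> h = eta_std d a)"
proof -
  obtain m where m: "m > 0" "\<And>\<delta>. 0 \<le> \<delta> \<Longrightarrow> \<delta> \<le> 1 - 1 / 2 \<Longrightarrow> m * \<delta> \<le> sin (pi * \<delta>)"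
    using sin_pi_lower[of "1 / 2"] by auto
  define L where "L = 1 + real (d - 1) * ((1 + \<rho>) / (1 - \<rho>))"
  have L: "L \<ge> 1" using assms by (simp add: L_def)
  \<comment> \<open>Chosen to make |v| < 1 / (L + 1), so that L |v t| + |v (- d t)| < 1 leaves no
    nonzero integer.\<close>
  define \<delta> where "\<delta> = 2 * m / (L + 1)"
  have \<delta>: "\<delta> > 0" using m L by (simp add: \<delta>_def)
  have "h = eta_std d a"
    if a: "a \<in> bparams d" "\<And>i. i < d - 1 \<Longrightarrow> cmod (a i) \<le> \<rho>" and h: "qs_conjugacy d (antiblaschke d a) h"
      and close: "\<And>t. cmod (h t - eta_std d a t) < \<delta>" for a h
  proof -
    let ?H = "bl_H d a"
    have h1: "cmod (h t) = 1" for t using h unfolding qs_conjugacy_def by (metis mem_sphere_0 rangeI)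
    have hc: "h (- real d * t) = antiblaschke d a (h t)" for t using h unfolding qs_conjugacy_def by blast
    have "\<exists>v. h t = circ (?H t + v) \<and> \<bar>v\<bar> < 1 / (L + 1)" for t
    proof -
      define u where "u = h t / circ (?H t)"
      have u1: "cmod u = 1" by (simp add: u_def norm_divide h1)
      then have "u \<noteq> 0" by auto
      then have uA: "u = cis (Arg u)" using cis_Arg[of u] u1 by (simp add: sgn_eq)
      define v where "v = Arg u / (2 * pi)"
      have uv: "u = circ v" using uA by (simp add: circ_def v_def)
      have v2: "\<bar>v\<bar> \<le> 1 / 2" using Arg_bounded[of u] by (simp add: v_def abs_le_iff field_simps)
      have hu: "h t = circ (?H t + v)" by (simp add: circ_add uv[symmetric] u_def)
      have "m * \<bar>v\<bar> \<le> sin (pi * \<bar>v\<bar>)" using m(2)[of "\<bar>v\<bar>"] v2 by simp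
      also have "\<dots> \<le> \<bar>sin (pi * v)\<bar>" by (cases "v \<ge> 0") auto
      also have "\<dots> = cmod (h t - circ (?H t)) / 2" unfolding hu norm_circ_diff by simp
      also have "\<dots> < \<delta> / 2" using close[of t] a by (simp add: eta_std_def)
      also have "\<delta> / 2 = m * (1 / (L + 1))" using L by (simp add: \<delta>_def field_simps)
      finally have "m * \<bar>v\<bar> < m * (1 / (L + 1))" .
      then have "\<bar>v\<bar> < 1 / (L + 1)" by (simp only: mult_less_cancel_left_pos[OF m(1)])
      then show ?thesis using hu by blast
    qed
    then obtain v where v: "\<And>t. h t = circ (?H t + v t)" "\<And>t. \<bar>v t\<bar> < 1 / (L + 1)" by metis
    have "?H t + v t = bl_H d a t" for t
    proof (rule bl_H_unique[OF assms(1) a(1)])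
      obtain B where "\<forall>y\<in>range (\<lambda>t. ?H t - t). norm y \<le> B" using bl_H_near[OF assms(1) a(1)] unfolding bounded_iff by blast
      then have B: "\<bar>?H t - t\<bar> \<le> B" for t by auto
      have "\<bar>?H t + v t - t\<bar> \<le> B + 1 / (L + 1)" for t using B[of t] v(2)[of t] by linarith
      then show "bounded (range (\<lambda>t. ?H t + v t - t))" unfolding bounded_iff by auto
      fix t
      have "circ (?H (- real d * t) + v (- real d * t)) = circ (bl_lift d a (?H t + v t))"
        using hc[of t] v(1) antiblaschke_circ[OF _ a(1)] assms(1) by simp
      then obtain n :: int where n: "bl_lift d a (?H t + v t) = ?H (- real d * t) + v (- real d * t) + of_int n"
        by (metis circ_eq_iff)
      have "\<bar>bl_lift d a (?H t + v t) - bl_lift d a (?H t)\<bar> \<le> L * \<bar>v t\<bar>"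
        using bl_lift_lipschitz[OF assms(1) a(1) assms(2,3) a(2), of "?H t + v t" "?H t"] by (simp add: L_def)
      moreover have "L * \<bar>v t\<bar> \<le> L * (1 / (L + 1))" using v(2)[of t] L by (intro mult_left_mono) auto
      moreover have "L * (1 / (L + 1)) + 1 / (L + 1) = 1" using L by (simp add: field_simps)
      ultimately have "\<bar>of_int n :: real\<bar> < 1"
        using n bl_H_conj(1)[OF assms(1) a(1), of t] v(2)[of "- real d * t"] by linarith
      then have "n = 0" by linarith
      then show "bl_lift d a (?H t + v t) = ?H (- real d * t) + v (- real d * t)" using n by simp
    qed
    then show ?thesis using v(1) a by (auto simp: eta_std_def)
  qed
  then show ?thesis using \<delta> by blast
qed

text \<open>Two conjugacies of the same map that are uniformly close coincide, by expansion. Hence the set of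
  \<open>\<tau> \<in> {0..1}\<close> for which both families agree at \<open>\<tau> a\<close> is open and closed; it contains \<open>0\<close>.\<close>

lemma eta_family_unique:
  assumes "d \<ge> 2" "eta_family d Eta" shows "Eta = eta_std d"
proof
  fix a
  show "Eta a = eta_std d a"
  proof (cases "a \<in> bparams d")
    case False
    then show ?thesis using assms by (simp add: eta_family_def eta_std_def)
  next
    case True
    obtain \<rho> where \<rho>: "0 \<le> \<rho>" "\<rho> < 1" "\<And>i. i < d - 1 \<Longrightarrow> cmod (a i) \<le> \<rho>" using bparams_rho[OF True] by blast
    define p where "p = (\<lambda>(\<tau>::real) i. of_real \<tau> * a i)"
    have p: "p \<tau> \<in> bparams d" "\<And>i. i < d - 1 \<Longrightarrow> cmod (p \<tau> i) \<le> \<rho>" if "\<tau> \<in> {0..1}" for \<tau>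
    proof -
      show r: "cmod (p \<tau> i) \<le> \<rho>" if "i < d - 1" for i
        using mult_mono[of "\<bar>\<tau>\<bar>" 1 "cmod (a i)" \<rho>] \<open>\<tau> \<in> {0..1}\<close> \<rho>(3)[OF that] by (simp add: p_def norm_mult)
      show "p \<tau> \<in> bparams d" using True r \<rho>(2) by (force simp: bparams_def p_def)
    qed
    \<comment> \<open>One \<delta> serves the whole segment, since all parameters
      \<open>p \<tau>\<close> keep the bound \<rho>.\<close>
    obtain \<delta> where \<delta>: "\<delta> > 0" "\<And>b h. b \<in> bparams d \<Longrightarrow> (\<And>i. i < d - 1 \<Longrightarrow> cmod (b i) \<le> \<rho>) \<Longrightarrow>
       qs_conjugacy d (antiblaschke d b) h \<Longrightarrow> (\<And>t. cmod (h t - eta_std d b t) < \<delta>) \<Longrightarrow> h = eta_std d b"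
      using qs_conjugacy_rigid[OF assms(1) \<rho>(1,2)] by blast
    have cont: "eventually (\<lambda>\<sigma>. \<forall>t. cmod (Et (p \<sigma>) t - Et (p \<tau>) t) < \<delta> / 3) (at \<tau> within {0..1})"
      if \<tau>: "\<tau> \<in> {0..1}" and Et: "eta_family d Et" for \<tau> Et
    proof -
      obtain \<gamma> where \<gamma>: "\<gamma> > 0" "\<And>b. b \<in> bparams d \<Longrightarrow> (\<And>i. i < d - 1 \<Longrightarrow> cmod (b i - p \<tau> i) < \<gamma>) \<Longrightarrow> (\<forall>t. cmod (Et b t - Et (p \<tau>) t) < \<delta> / 3)"
        using Et p(1)[OF \<tau>] \<delta>(1) unfolding eta_family_def by (metis divide_pos_pos zero_less_numeral)
      show ?thesis unfolding eventually_at
      proof (intro exI[of _ \<gamma>] conjI ballI impI)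
        fix \<sigma> assume s: "\<sigma> \<in> {0..1}" "\<sigma> \<noteq> \<tau> \<and> dist \<sigma> \<tau> < \<gamma>"
        show "\<forall>t. cmod (Et (p \<sigma>) t - Et (p \<tau>) t) < \<delta> / 3"
        proof (rule \<gamma>(2)[OF p(1)[OF s(1)]])
          fix i assume i: "i < d - 1"
          have "p \<sigma> i - p \<tau> i = of_real (\<sigma> - \<tau>) * a i" by (simp add: p_def algebra_simps)
          then have "cmod (p \<sigma> i - p \<tau> i) = \<bar>\<sigma> - \<tau>\<bar> * cmod (a i)" by (simp only: norm_mult norm_of_real)
          also have "\<dots> \<le> \<bar>\<sigma> - \<tau>\<bar> * 1" using \<rho>(2) \<rho>(3)[OF i] by (intro mult_left_mono) auto
          finally show "cmod (p \<sigma> i - p \<tau> i) < \<gamma>" using s by (simp add: dist_real_def)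
        qed
      qed (use \<gamma> in auto)
    qed
    have loc: "eventually (\<lambda>\<sigma>. (Eta (p \<tau>) = eta_std d (p \<tau>)) = (Eta (p \<sigma>) = eta_std d (p \<sigma>))) (at \<tau> within {0..1})"
      if \<tau>: "\<tau> \<in> {0..1}" for \<tau>
    proof -
      have w: "eventually (\<lambda>\<sigma>. \<sigma> \<in> {0..1}) (at \<tau> within {0..1})" by (simp add: eventually_at_filter)
      have rig: "Eta (p \<sigma>) = eta_std d (p \<sigma>)" if "\<sigma> \<in> {0..1}" "\<And>t. cmod (Eta (p \<sigma>) t - eta_std d (p \<sigma>) t) < \<delta>" for \<sigma>
        using \<delta>(2)[OF p(1)[OF that(1)] p(2)[OF that(1)] _ that(2)] assms(2) p(1)[OF that(1)]
        unfolding eta_family_def by blast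
      show ?thesis
        using cont[OF \<tau> assms(2)] cont[OF \<tau> eta_std_family[OF assms(1)]] w
      proof eventually_elim
        case (elim \<sigma>)
        have tri: "cmod (Eta (p \<sigma>) t - eta_std d (p \<sigma>) t) < cmod (Eta (p \<tau>) t - eta_std d (p \<tau>) t) + \<delta>"
          "cmod (Eta (p \<tau>) t - eta_std d (p \<tau>) t) < cmod (Eta (p \<sigma>) t - eta_std d (p \<sigma>) t) + \<delta>" for t
        proof -
          have *: "cmod (x - y) < cmod (x' - y') + \<delta>" if "cmod (x - x') < \<delta> / 3" "cmod (y - y') < \<delta> / 3" for x y x' y'
            using norm_triangle_ineq[of "x' - y'" "(x - x') - (y - y')"] norm_triangle_ineq4[of "x - x'" "y - y'"] that \<delta>(1)
            by (simp add: algebra_simps)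
          show "cmod (Eta (p \<sigma>) t - eta_std d (p \<sigma>) t) < cmod (Eta (p \<tau>) t - eta_std d (p \<tau>) t) + \<delta>"
            using elim by (intro *) auto
          show "cmod (Eta (p \<tau>) t - eta_std d (p \<tau>) t) < cmod (Eta (p \<sigma>) t - eta_std d (p \<sigma>) t) + \<delta>"
            using elim by (intro *) (auto simp: norm_minus_commute)
        qed
        show ?case
        proof
          assume "Eta (p \<tau>) = eta_std d (p \<tau>)"
          then show "Eta (p \<sigma>) = eta_std d (p \<sigma>)" using tri(1) elim(3) by (intro rig) auto
        next
          assume "Eta (p \<sigma>) = eta_std d (p \<sigma>)"
          then show "Eta (p \<tau>) = eta_std d (p \<tau>)" using tri(2) \<tau> by (intro rig) auto
        qed
      qed
    qed
    have "(Eta (p 0) = eta_std d (p 0)) = (Eta (p 1) = eta_std d (p 1))"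
      by (rule connected_local_const[of "{0..1::real}" 0 1]) (use loc in auto)
    moreover have "p 0 = (\<lambda>_. 0)" "p 1 = a" by (auto simp: p_def)
    moreover have "Eta (\<lambda>_. 0) = eta_std d (\<lambda>_. 0)"
      using assms(2) eta_std_family[OF assms(1)] by (simp add: eta_family_def)
    ultimately show ?thesis by simp
  qed
qed

lemma eta_eq_std: assumes "d \<ge> 2" shows "eta d = eta_std d"
proof
  fix a
  have "(THE Eta. eta_family d Eta) = eta_std d"
    by (rule the_equality) (rule eta_std_family[OF assms], rule eta_family_unique[OF assms])
  then show "eta d a = eta_std d a" by (simp add: eta_def)
qed

lemma eta_fixed:
  assumes "d \<ge> 2" "a \<in> bparams d" "- real d * x = x + of_int n"
  shows "cmod (eta d a x) = 1" "antiblaschke d a (eta d a x) = eta d a x"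
proof -
  show "cmod (eta d a x) = 1" using assms by (simp add: eta_eq_std eta_std_def)
  have "antiblaschke d a (eta d a x) = circ (bl_H d a (- real d * x))"
    using assms(1,2) bl_H_conj(1)[OF assms(1,2), of x] by (simp add: eta_eq_std eta_std_def antiblaschke_circ)
  also have "\<dots> = eta d a x" unfolding assms(3) using assms(1,2)
    by (simp add: eta_eq_std eta_std_def bl_H_conj(2) circ_add)
  finally show "antiblaschke d a (eta d a x) = eta d a x" .
qed

text \<open>A fixed point is the value of the conjugacy at some x with (d + 1) x an integer.
  Rotation by l = circ (- x), a (d + 1)-st root of unity, turns the parameters into
  \<open>cnj l * a i\<close> and the lift of the conjugacy into H (t + x) - x, whose value at 0
  marks l \<zeta>.\<close>

lemma eta_rotate:
  assumes "d \<ge> 2" "a \<in> bparams d" "cmod \<zeta> = 1" "antiblaschke d a \<zeta> = \<zeta>"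
  shows "\<exists>l. cmod l = 1 \<and> l ^ (d + 1) = 1 \<and> (\<lambda>i. cnj l * a i) \<in> bparams d \<and> eta d (\<lambda>i. cnj l * a i) 0 = l * \<zeta>"
proof -
  obtain \<rho> where \<rho>: "0 \<le> \<rho>" "\<rho> < 1" "\<And>i. i < d - 1 \<Longrightarrow> cmod (a i) \<le> \<rho>" using bparams_rho[OF assms(2)] by blast
  interpret expanding_lift d "bl_lift d a" "bl_slope d a" "1 + (1 - \<rho>) / (1 + \<rho>)" "real (d - 1) * (4 * pi / (1 - \<rho>)\<^sup>2)"
    by (rule bl_expanding) (use assms \<rho> in auto)
  have "\<zeta> \<in> (\<lambda>t. circ (H t)) ` UNIV" unfolding circ_H_image using assms by simp
  then obtain x where x: "\<zeta> = circ (H x)" by auto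
  have "circ (H (- real d * x)) = circ (H x)"
    using antiblaschke_circ[OF _ assms(2), of "H x"] assms x H_conj[of x] by simp
  then obtain n :: int where n: "- real d * x = x + of_int n" using circ_H_eq by blast
  define l where "l = circ (- x)"
  let ?b = "\<lambda>i. cnj l * a i"
  have l1: "cmod l = 1" by (simp add: l_def)
  have b: "?b \<in> bparams d" using assms(2) l1 by (auto simp: bparams_def norm_mult)
  have "l ^ (d + 1) = cis (real (d + 1) * (2 * pi * (- x)))" unfolding l_def circ_def by (rule Complex.DeMoivre)
  also have "real (d + 1) * (2 * pi * (- x)) = 2 * pi * (- real d * x - x)" by (simp add: algebra_simps)
  also have "\<dots> = 2 * pi * of_int n" unfolding n by simp
  also have "cis \<dots> = 1" using circ_int[of n] by (simp add: circ_def)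
  finally have ln: "l ^ (d + 1) = 1" .
  have bl: "bl_lift d ?b t = bl_lift d a (t + x) + real d * x" for t
  proof -
    have *: "cnj l * a i * circ t = a i * circ (t + x)" for i by (simp add: l_def circ_minus[symmetric] circ_add)
    have "bl_lift d ?b t = - real d * t + (1 / pi) * (\<Sum>i<d - 1. Im (Ln (1 - a i * circ (t + x))))"
      unfolding bl_lift_def by (simp only: *)
    then show ?thesis by (simp add: bl_lift_def algebra_simps)
  qed
  have "H (0 + x) - x = bl_H d ?b 0"
  proof (rule bl_H_unique[OF assms(1) b])
    obtain C where C: "\<And>t. \<bar>H t - t\<bar> \<le> C" using H_near by blast
    have "\<bar>H (t + x) - x - t\<bar> \<le> C" for t using C[of "t + x"] by (simp add: algebra_simps)
    then show "bounded (range (\<lambda>t. H (t + x) - x - t))" unfolding bounded_iff by auto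
    fix t
    have "bl_lift d ?b (H (t + x) - x) = H (- real d * (t + x)) + real d * x"
      using H_conj[of "t + x"] by (simp add: bl)
    also have "- real d * (t + x) = (- real d * t + x) + of_int n" using n by (simp add: algebra_simps)
    also have "H \<dots> = H (- real d * t + x) + of_int n" by (rule H_shift_int)
    finally show "bl_lift d ?b (H (t + x) - x) = H (- real d * t + x) - x" using n by simp
  qed
  then have "eta d ?b 0 = circ (H x + - x)" using b assms(1) by (simp add: eta_eq_std eta_std_def)
  then have "eta d ?b 0 = l * \<zeta>" by (simp only: circ_add l_def x mult.commute)
  then show ?thesis using l1 ln b by blast
qed

section \<open>Factorisation of polynomials and derivatives of conjugated maps\<close>

lemma complex_poly_factor:
  fixes p :: "complex poly"
  shows "degree p = n \<Longrightarrow> \<exists>b. \<forall>z. poly p z = lead_coeff p * (\<Prod>i<n. z - b i)"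
proof (induction n arbitrary: p)
  case 0
  then obtain c where "p = [:c:]" by (metis degree_eq_zeroE)
  then show ?case by simp
next
  case (Suc n)
  then obtain x where "poly p x = 0" using fundamental_theorem_of_algebra_alt[of p] by fastforce
  then obtain q where q: "p = [:- x, 1:] * q" by (auto simp: poly_eq_0_iff_dvd)
  have "q \<noteq> 0" using q Suc by auto
  then have "degree p = 1 + degree q" unfolding q by (subst degree_mult_eq) auto
  then obtain b where b: "\<And>z. poly q z = lead_coeff q * (\<Prod>i<n. z - b i)" using Suc by auto
  have l: "lead_coeff p = lead_coeff q" unfolding q lead_coeff_mult by simp
  have "poly p z = lead_coeff p * (\<Prod>i<Suc n. z - (b(n := x)) i)" for z
    unfolding l by (simp add: q b) (simp add: algebra_simps)
  then show ?case by blast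
qed

lemma dbar_cnj:
  assumes "(B has_field_derivative D) (at z)" shows "dbar (\<lambda>z. cnj (B z)) z = cnj D"
proof -
  have 1: "((\<lambda>x. cnj (B (z + c * of_real x))) has_vector_derivative cnj (D * c)) (at 0)" for c
  proof -
    have "((\<lambda>x::real. of_real x :: complex) has_vector_derivative of_real 1) (at 0)"
      by (intro has_vector_derivative_of_real) (auto intro!: derivative_eq_intros)
    then have "((\<lambda>x::real. c * of_real x) has_vector_derivative c * of_real 1) (at 0)"
      by (rule has_vector_derivative_mult_right)
    then have "((\<lambda>x::real. z + c * of_real x) has_vector_derivative (0 + c * of_real 1)) (at 0)"
      by (intro has_vector_derivative_add has_vector_derivative_const)
    then have "((B \<circ> (\<lambda>x::real. z + c * of_real x)) has_vector_derivative (0 + c * of_real 1) * D) (at 0)"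
      by (rule field_vector_diff_chain_at) (use assms in simp)
    from bounded_linear.has_vector_derivative[OF bounded_linear_cnj this]
    show ?thesis by (simp add: o_def mult.commute)
  qed
  have "vector_derivative (\<lambda>x::real. cnj (B (z + of_real x))) (at 0) = cnj D"
    using vector_derivative_at[OF 1[of 1]] by simp
  moreover have "vector_derivative (\<lambda>x::real. cnj (B (z + \<i> * of_real x))) (at 0) = cnj (D * \<i>)"
    by (rule vector_derivative_at[OF 1[of \<i>]])
  moreover have "\<i> * cnj (D * \<i>) = - (\<i> * \<i>) * cnj D" by (simp only: complex_cnj_mult complex_cnj_i mult_ac mult_minus_right mult_minus_left)
  ultimately show ?thesis by (simp add: dbar_def)
qed

text \<open>As the numerator vanishes at \<open>z\<close>, continuity of the denominator is
  enough.\<close>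

lemma has_field_derivative_divide_zero:
  fixes f g :: "'a \<Rightarrow> 'a::real_normed_field"
  assumes "(f has_field_derivative f') (at z)" "f z = 0" "isCont g z" "g z \<noteq> 0"
  shows "((\<lambda>z. f z / g z) has_field_derivative f' / g z) (at z)"
proof -
  have "((\<lambda>x. (f x - f z) / (x - z) / g x) \<longlongrightarrow> f' / g z) (at z)"
    using assms by (intro tendsto_divide) (auto simp: has_field_derivative_iff isCont_def)
  then have "((\<lambda>x. (f x / g x - f z / g z) / (x - z)) \<longlongrightarrow> f' / g z) (at z)"
    using assms(2) by (simp add: divide_divide_eq_left mult.commute)
  then show ?thesis by (simp add: has_field_derivative_iff)
qed

section \<open>Anti-Blaschke products from balanced measures\<close>

text \<open>With \<open>S1 = \<Sum> w / (\<zeta> - z)\<close> and \<open>G = 1 + z S1\<close>, the map \<open>cnj (S1 / G)\<close> is an anti-Blaschke product up to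
  rotation. \<open>Nu\<close> and \<open>De\<close> are \<open>S1\<close> and \<open>G\<close> multiplied by \<open>W\<close>, which removes the singularities on the circle.\<close>

locale circle_measure =
  fixes I :: "'e set" and \<zeta> :: "'e \<Rightarrow> complex" and w :: "'e \<Rightarrow> real" and d :: nat
  assumes d2: "d \<ge> 2" and finI: "finite I" and cardI: "card I = d + 1"
    and inj: "inj_on \<zeta> I" and norm\<zeta>: "e \<in> I \<Longrightarrow> cmod (\<zeta> e) = 1"
    and wpos: "e \<in> I \<Longrightarrow> 0 < w e" and wsum: "(\<Sum>e\<in>I. w e) = 1"
    and bary: "(\<Sum>e\<in>I. of_real (w e) * \<zeta> e) = 0"
begin

definition "S1 z = (\<Sum>e\<in>I. of_real (w e) / (\<zeta> e - z))"
definition "G z = (\<Sum>e\<in>I. of_real (w e) * \<zeta> e / (\<zeta> e - z))"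
definition "Nu z = (\<Sum>e\<in>I. of_real (w e) * (\<Prod>k\<in>I-{e}. \<zeta> k - z))"
definition "De z = (\<Sum>e\<in>I. of_real (w e) * \<zeta> e * (\<Prod>k\<in>I-{e}. \<zeta> k - z))"
definition "W z = (\<Prod>k\<in>I. \<zeta> k - z)"

lemma \<zeta>nz: "e \<in> I \<Longrightarrow> \<zeta> e \<noteq> 0" using norm\<zeta> by fastforce
lemma Wsplit: "e \<in> I \<Longrightarrow> W z = (\<zeta> e - z) * (\<Prod>k\<in>I-{e}. \<zeta> k - z)"
  unfolding W_def by (rule prod.remove[OF finI])

lemma S1G: assumes "z \<notin> \<zeta> ` I" shows "Nu z = W z * S1 z" "De z = W z * G z" "W z \<noteq> 0" "G z = 1 + z * S1 z"
proof -
  have nz: "\<zeta> e - z \<noteq> 0" if "e \<in> I" for e using assms that by auto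
  show "W z \<noteq> 0" unfolding W_def using nz finI by simp
  show "Nu z = W z * S1 z" "De z = W z * G z" unfolding Nu_def De_def S1_def G_def sum_distrib_left
    by (rule sum.cong[OF refl]; use Wsplit nz in simp)+
  have "G z = (\<Sum>e\<in>I. of_real (w e) + z * (of_real (w e) / (\<zeta> e - z)))"
    unfolding G_def by (rule sum.cong[OF refl]) (use nz in \<open>simp add: field_simps\<close>)
  also have "\<dots> = of_real (\<Sum>e\<in>I. w e) + z * S1 z" by (simp add: sum.distrib sum_distrib_left S1_def)
  finally show "G z = 1 + z * S1 z" by (simp add: wsum)
qed

lemma De_eq: "De z = z * Nu z + W z"
proof -
  have "De z = (\<Sum>e\<in>I. z * (of_real (w e) * (\<Prod>k\<in>I-{e}. \<zeta> k - z)) + of_real (w e) * W z)"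
    unfolding De_def by (rule sum.cong[OF refl]) (simp add: Wsplit algebra_simps)
  also have "\<dots> = z * Nu z + of_real (\<Sum>e\<in>I. w e) * W z"
    by (simp add: sum.distrib Nu_def sum_distrib_left sum_distrib_right)
  finally show ?thesis by (simp add: wsum)
qed

lemma W_at: "e \<in> I \<Longrightarrow> W (\<zeta> e) = 0" unfolding W_def using finI by auto

lemma sum_at: assumes "j \<in> I"
  shows "(\<Sum>e\<in>I. g e * (\<Prod>k\<in>I-{e}. \<zeta> k - \<zeta> j)) = g j * (\<Prod>k\<in>I-{j}. \<zeta> k - \<zeta> j)"
proof -
  have "(\<Sum>e\<in>I. g e * (\<Prod>k\<in>I-{e}. \<zeta> k - \<zeta> j)) = g j * (\<Prod>k\<in>I-{j}. \<zeta> k - \<zeta> j) + (\<Sum>e\<in>I-{j}. g e * (\<Prod>k\<in>I-{e}. \<zeta> k - \<zeta> j))"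
    by (rule sum.remove[OF finI assms])
  moreover have "(\<Sum>e\<in>I-{j}. g e * (\<Prod>k\<in>I-{e}. \<zeta> k - \<zeta> j)) = 0"
    using finI assms by (intro sum.neutral) (auto intro!: prod_zero bexI[of _ j])
  ultimately show ?thesis by simp
qed

lemma prod_at_nz: assumes "j \<in> I" shows "(\<Prod>k\<in>I-{j}. \<zeta> k - \<zeta> j) \<noteq> 0"
  using inj finI assms by (auto simp: inj_on_def)

lemma De_at: assumes "j \<in> I" shows "De (\<zeta> j) = of_real (w j) * \<zeta> j * (\<Prod>k\<in>I-{j}. \<zeta> k - \<zeta> j)"
  unfolding De_def by (rule sum_at[OF assms])

lemma De_at_nz: assumes "j \<in> I" shows "De (\<zeta> j) \<noteq> 0"
  using De_at[OF assms] prod_at_nz[OF assms] wpos[OF assms] \<zeta>nz[OF assms] by auto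

text \<open>The map sending z to u / (u - z) takes the disc to the half plane Re > 1 / 2 and the
  circle to its boundary line.\<close>

lemma Re_kernel: assumes "cmod u = 1" "cmod z \<le> 1" "u \<noteq> z" shows "Re (u / (u - z)) \<ge> 1 / 2"
proof -
  have "(cmod z)\<^sup>2 \<le> 1" using assms by (simp add: power_le_one)
  then have z: "(Re z)\<^sup>2 + (Im z)\<^sup>2 \<le> 1" by (simp add: cmod_power2)
  have u: "(Re u)\<^sup>2 + (Im u)\<^sup>2 = 1" using assms(1) cmod_power2[of u] by simp
  have p: "(cmod (u - z))\<^sup>2 > 0" using assms(3) by simp
  have "Re (u / (u - z)) = (Re u * Re (u - z) + Im u * Im (u - z)) / (cmod (u - z))\<^sup>2"
    by (simp add: Re_divide cmod_power2)
  moreover have "(cmod (u - z))\<^sup>2 \<le> 2 * (Re u * Re (u - z) + Im u * Im (u - z))"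
    unfolding cmod_power2 using u z by (simp add: power2_eq_square algebra_simps)
  ultimately show ?thesis using p by (simp only: le_divide_eq) simp
qed

lemma G_Re: assumes "cmod z \<le> 1" "z \<notin> \<zeta> ` I" shows "Re (G z) \<ge> 1 / 2"
proof -
  have "(\<Sum>e\<in>I. w e * (1 / 2)) \<le> (\<Sum>e\<in>I. w e * Re (\<zeta> e / (\<zeta> e - z)))"
    using assms norm\<zeta> wpos by (intro sum_mono mult_left_mono Re_kernel) (auto intro: less_imp_le)
  moreover have "Re (G z) = (\<Sum>e\<in>I. w e * Re (\<zeta> e / (\<zeta> e - z)))"
    unfolding G_def Re_sum by (rule sum.cong[OF refl]) (simp add: times_divide_eq_right[symmetric] del: times_divide_eq_right)
  moreover have "(\<Sum>e\<in>I. w e * (1 / 2)) = 1 / 2" using wsum by (simp flip: sum_divide_distrib)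
  ultimately show ?thesis by simp
qed

text \<open>Away from the atoms Re G \<ge> 1 / 2, and at an atom only the summand of that atom
  survives. Hence Nu / De has no pole in the closed disc.\<close>

lemma De_nz: assumes "cmod z \<le> 1" shows "De z \<noteq> 0"
proof (cases "z \<in> \<zeta> ` I")
  case True then show ?thesis using De_at_nz by auto
next
  case False
  have "G z \<noteq> 0" using G_Re[OF assms False] by auto
  then show ?thesis using S1G[OF False] by simp
qed

text \<open>On the circle 1 / \<zeta> is conj \<zeta>, so the value is the product of the atoms
  times the conjugate of the barycentre.\<close>

lemma Nu_0: "Nu 0 = 0"
proof -
  have "Nu 0 = (\<Prod>k\<in>I. \<zeta> k) * cnj (\<Sum>e\<in>I. of_real (w e) * \<zeta> e)"
    unfolding Nu_def cnj_sum sum_distrib_left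
  proof (rule sum.cong[OF refl])
    fix e assume e: "e \<in> I"
    have "\<zeta> e * cnj (\<zeta> e) = 1" using norm\<zeta>[OF e] complex_norm_square[of "\<zeta> e"] by simp
    then show "of_real (w e) * (\<Prod>k\<in>I - {e}. \<zeta> k - 0) = (\<Prod>k\<in>I. \<zeta> k) * cnj (of_real (w e) * \<zeta> e)"
      using prod.remove[OF finI e, of \<zeta>] by (simp add: mult_ac)
  qed
  then show ?thesis using bary by simp
qed

text \<open>Reflection in the circle exchanges the two polynomials up to a monomial, which is why
  |Nu / De| = 1 on the circle.\<close>

lemma De_reflect: assumes "z \<noteq> 0"
  shows "De z = (-1) ^ d * (\<Prod>k\<in>I. \<zeta> k) * z ^ d * cnj (Nu (1 / cnj z))"
  unfolding De_def Nu_def cnj_sum sum_distrib_left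
proof (rule sum.cong[OF refl])
  fix e assume e: "e \<in> I"
  have c: "card (I - {e}) = d" using e cardI finI by simp
  have "\<zeta> k - z = (- z * \<zeta> k) * cnj (\<zeta> k - 1 / cnj z)" if "k \<in> I" for k
  proof -
    have "\<zeta> k * cnj (\<zeta> k) = 1" using norm\<zeta>[OF that] complex_norm_square[of "\<zeta> k"] by simp
    then show ?thesis using assms by (simp add: algebra_simps)
  qed
  then have "(\<Prod>k\<in>I-{e}. \<zeta> k - z) = (\<Prod>k\<in>I-{e}. (- z * \<zeta> k) * cnj (\<zeta> k - 1 / cnj z))"
    by (intro prod.cong) auto
  also have "\<dots> = (- z) ^ d * (\<Prod>k\<in>I-{e}. \<zeta> k) * cnj (\<Prod>k\<in>I-{e}. \<zeta> k - 1 / cnj z)"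
    by (simp only: prod.distrib prod_constant c cnj_prod)
  finally show "of_real (w e) * \<zeta> e * (\<Prod>k\<in>I-{e}. \<zeta> k - z)
     = (-1) ^ d * (\<Prod>k\<in>I. \<zeta> k) * z ^ d * cnj (of_real (w e) * (\<Prod>k\<in>I-{e}. \<zeta> k - 1 / cnj z))"
    using prod.remove[OF finI e, of \<zeta>] by (simp add: mult_ac power_minus[of z])
qed

lemma Nu_poly: "\<exists>p. degree p = d \<and> lead_coeff p = (-1) ^ d \<and> (\<forall>z. poly p z = Nu z)"
proof -
  define q where "q e = (\<Prod>k\<in>I-{e}. [:\<zeta> k, -1:])" for e
  have lq: "lead_coeff (q e) = (-1) ^ d" "degree (q e) = d" if e: "e \<in> I" for e
  proof -
    have c: "card (I - {e}) = d" using e cardI finI by simp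
    show "lead_coeff (q e) = (-1) ^ d" unfolding q_def lead_coeff_prod using c by simp
    show "degree (q e) = d" unfolding q_def by (subst degree_prod_eq_sum_degree) (auto simp: c)
  qed
  define p where "p = (\<Sum>e\<in>I. smult (of_real (w e)) (q e))"
  have "coeff p d = (\<Sum>e\<in>I. of_real (w e) * (-1) ^ d)"
    unfolding p_def coeff_sum by (rule sum.cong[OF refl]) (use lq in force)
  also have "\<dots> = of_real (\<Sum>e\<in>I. w e) * (-1) ^ d" by (simp add: sum_distrib_right)
  finally have c: "coeff p d = (-1) ^ d" by (simp add: wsum)
  have "degree p \<le> d" unfolding p_def
    by (intro degree_sum_le finI) (use lq in \<open>auto intro: order_trans[OF degree_smult_le]\<close>)
  moreover have "d \<le> degree p" using c by (intro le_degree) auto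
  ultimately have "degree p = d" by simp
  moreover have "poly p z = Nu z" for z
    by (simp add: p_def q_def Nu_def poly_sum poly_prod)
  ultimately show ?thesis using c by (intro exI[of _ p]) auto
qed

text \<open>\<open>Nu\<close> has degree d and a zero at 0; if b_i are its other zeros, reflection
  makes \<open>De\<close> a multiple of the product of the 1 - conj(b_i) z. A zero b_i outside the
  open disc would give \<open>De\<close> a zero in the closed disc. The condition on the product of
  the atoms normalises the remaining unimodular factor to 1.\<close>

lemma antiblaschke_form:
  assumes prd: "(\<Prod>k\<in>I. \<zeta> k) = (-1) ^ d"
  shows "\<exists>a\<in>bparams d. \<forall>z. antiblaschke d a z = cnj (Nu z / De z)"
proof -
  obtain p where p: "degree p = d" "lead_coeff p = (-1) ^ d" "\<And>z. poly p z = Nu z" using Nu_poly by blast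
  obtain q where q: "p = [:0, 1:] * q" using p(3)[of 0] Nu_0 by (auto simp: poly_eq_0_iff_dvd)
  have q0: "q \<noteq> 0" using q p d2 by auto
  then have "degree p = 1 + degree q" unfolding q by (subst degree_mult_eq) auto
  then obtain b where b: "\<And>z. poly q z = lead_coeff q * (\<Prod>i<d-1. z - b i)"
    using complex_poly_factor[of q "d - 1"] p d2 by auto
  have lq: "lead_coeff q = (-1) ^ d" using p(2) unfolding q lead_coeff_mult by simp
  have Nu: "Nu z = (-1) ^ d * (z * (\<Prod>i<d-1. z - b i))" for z
  proof -
    have "Nu z = z * poly q z" using p(3)[of z] by (simp add: q)
    also have "\<dots> = (-1) ^ d * (z * (\<Prod>i<d-1. z - b i))" unfolding b lq by (rule mult.left_commute)
    finally show ?thesis .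
  qed
  have De: "De z = (-1) ^ d * (\<Prod>i<d-1. 1 - cnj (b i) * z)" for z
  proof (cases "z = 0")
    case True
    then show ?thesis using De_eq[of 0] by (simp add: W_def prd)
  next
    case False
    have "(\<Prod>i<d-1. 1 - cnj (b i) * z) = (\<Prod>i<d-1. z * (1 / z - cnj (b i)))"
      by (rule prod.cong[OF refl]) (use False in \<open>simp add: algebra_simps\<close>)
    then have 1: "(\<Prod>i<d-1. 1 - cnj (b i) * z) = z ^ (d - 1) * (\<Prod>i<d-1. 1 / z - cnj (b i))"
      by (simp add: prod.distrib)
    have "cnj (Nu (1 / cnj z)) = (-1) ^ d * (1 / z * (\<Prod>i<d-1. 1 / z - cnj (b i)))"
      by (simp add: Nu)
    then have "De z = (-1) ^ d * (-1) ^ d * z ^ d * ((-1) ^ d * (1 / z * (\<Prod>i<d-1. 1 / z - cnj (b i))))"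
      using De_reflect[OF False] prd by simp
    also have "z ^ d = z * z ^ (d - 1)" using d2 by (cases d) auto
    finally show ?thesis unfolding 1 using False by (simp flip: power_mult_distrib)
  qed
  have b1: "cmod (b i) < 1" if i: "i < d - 1" for i
  proof (rule ccontr)
    assume "\<not> cmod (b i) < 1"
    then have bi: "cmod (b i) \<ge> 1" by simp
    then have "b i \<noteq> 0" by auto
    then have "De (1 / cnj (b i)) = 0" unfolding De using i by (auto intro!: prod_zero bexI[of _ i])
    moreover have "cmod (1 / cnj (b i)) \<le> 1" using bi by (simp add: norm_divide divide_le_eq)
    ultimately show False using De_nz by blast
  qed
  define a where "a i = (if i < d - 1 then cnj (b i) else 0)" for i
  have "a \<in> bparams d" using b1 by (simp add: bparams_def a_def)
  moreover have "antiblaschke d a z = cnj (Nu z / De z)" for z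
  proof -
    have "(-1 :: complex) ^ d \<noteq> 0" by simp
    then have "Nu z / De z = z * (\<Prod>i<d-1. (z - b i) / (1 - cnj (b i) * z))"
      unfolding Nu De by (simp add: prod_dividef)
    then show ?thesis by (simp add: antiblaschke_def a_def)
  qed
  ultimately show ?thesis by blast
qed

lemma Nu_holo: "Nu holomorphic_on A" and De_holo: "De holomorphic_on A"
  unfolding Nu_def[abs_def] De_def[abs_def] by (intro holomorphic_intros)+

lemma W_deriv: assumes "j \<in> I" shows "(W has_field_derivative - (\<Prod>k\<in>I-{j}. \<zeta> k - \<zeta> j)) (at (\<zeta> j))"
proof -
  let ?P = "\<lambda>z. \<Prod>k\<in>I-{j}. \<zeta> k - z"
  have "?P holomorphic_on UNIV" by (intro holomorphic_intros)
  then have "(?P has_field_derivative deriv ?P (\<zeta> j)) (at (\<zeta> j))" by (rule holomorphic_derivI) auto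
  moreover have "((\<lambda>z. \<zeta> j - z) has_field_derivative -1) (at (\<zeta> j))" by (auto intro!: derivative_eq_intros)
  ultimately have "((\<lambda>z. (\<zeta> j - z) * ?P z) has_field_derivative -1 * ?P (\<zeta> j) + deriv ?P (\<zeta> j) * (\<zeta> j - \<zeta> j)) (at (\<zeta> j))"
    by (rule DERIV_mult[rotated])
  moreover have "W = (\<lambda>z. (\<zeta> j - z) * ?P z)" using Wsplit[OF assms] by auto
  ultimately show ?thesis by simp
qed

context
  fixes f :: "complex \<Rightarrow> complex" assumes f: "\<And>z. f z = cnj (Nu z / De z)"
begin

lemma f_fix: assumes "j \<in> I" shows "f (\<zeta> j) = \<zeta> j"
proof -
  have "De (\<zeta> j) = \<zeta> j * Nu (\<zeta> j)" using De_eq W_at[OF assms] by simp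
  then have "Nu (\<zeta> j) / De (\<zeta> j) = 1 / \<zeta> j" using De_at_nz[OF assms] \<zeta>nz[OF assms] by auto
  also have "\<dots> = cnj (\<zeta> j)" using norm\<zeta>[OF assms] complex_norm_square[of "\<zeta> j"] \<zeta>nz[OF assms] by (simp add: field_simps)
  finally show ?thesis by (simp add: f)
qed

text \<open>On the circle a fixed point satisfies z Nu z = De z, and De z - z Nu z = W z vanishes at
  the atoms only.\<close>

lemma f_fix_only: assumes "cmod z = 1" "f z = z" shows "z \<in> \<zeta> ` I"
proof (rule ccontr)
  assume "z \<notin> \<zeta> ` I"
  then have W: "W z \<noteq> 0" by (rule S1G)
  have D: "De z \<noteq> 0" using De_nz assms by simp
  have "cnj (cnj (Nu z / De z)) = cnj z" using assms(2) unfolding f by simp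
  then have "Nu z = cnj z * De z" using D by (simp add: field_simps)
  then have "z * Nu z = (z * cnj z) * De z" by simp
  also have "z * cnj z = 1" using assms(1) complex_norm_square[of z] by simp
  finally show False using De_eq[of z] W by simp
qed

text \<open>The function 1 - z Nu / De equals W / De, and the derivative of \<open>W\<close> at its
  simple zero cancels the product in \<open>De_at\<close>. Comparing both derivatives at the atom
  gives the multiplier.\<close>

lemma f_dbar: assumes "j \<in> I" shows "cmod (dbar f (\<zeta> j)) = 1 / w j - 1"
proof -
  let ?P = "\<Prod>k\<in>I-{j}. \<zeta> k - \<zeta> j" and ?z = "\<zeta> j"
  have Dnz: "De ?z \<noteq> 0" by (rule De_at_nz[OF assms])
  have hD: "(De has_field_derivative deriv De ?z) (at ?z)" "(Nu has_field_derivative deriv Nu ?z) (at ?z)"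
    using holomorphic_derivI[OF De_holo open_UNIV] holomorphic_derivI[OF Nu_holo open_UNIV] by auto
  define B' where "B' = (deriv Nu ?z * De ?z - Nu ?z * deriv De ?z) / (De ?z * De ?z)"
  have B: "((\<lambda>z. Nu z / De z) has_field_derivative B') (at ?z)"
    unfolding B'_def by (rule DERIV_divide[OF hD(2,1) Dnz])
  have "((\<lambda>z. z * (Nu z / De z)) has_field_derivative (1 * (Nu ?z / De ?z) + B' * ?z)) (at ?z)"
    by (rule DERIV_mult[OF DERIV_ident B])
  then have 1: "((\<lambda>z. 1 - z * (Nu z / De z)) has_field_derivative (0 - (1 * (Nu ?z / De ?z) + B' * ?z))) (at ?z)"
    by (intro DERIV_diff DERIV_const)
  have cD: "isCont De ?z" using hD(1) DERIV_isCont by blast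
  have 2: "((\<lambda>z. W z / De z) has_field_derivative - ?P / De ?z) (at ?z)"
    by (rule has_field_derivative_divide_zero[OF W_deriv[OF assms] W_at[OF assms] cD Dnz])
  have "open {z. De z \<noteq> 0}"
    by (intro open_Collect_neq holomorphic_on_imp_continuous_on De_holo continuous_on_const)
  then have ev: "eventually (\<lambda>z. De z \<noteq> 0) (nhds ?z)"
    unfolding eventually_nhds using Dnz by blast
  have ev2: "eventually (\<lambda>z. W z / De z = 1 - z * (Nu z / De z)) (nhds ?z)"
    using ev by eventually_elim (use De_eq in \<open>simp add: field_simps\<close>)
  then have "((\<lambda>z. 1 - z * (Nu z / De z)) has_field_derivative - ?P / De ?z) (at ?z)"
    using 2 iffD1[OF DERIV_cong_ev[OF refl ev2 refl]] by blast
  with 1 have e: "- ?P / De ?z = 0 - (1 * (Nu ?z / De ?z) + B' * ?z)" by (rule DERIV_unique[rotated])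
  have Nz: "Nu ?z / De ?z = cnj ?z" using f_fix[OF assms] unfolding f by (metis complex_cnj_cnj)
  have "?P / De ?z = 1 / (of_real (w j) * ?z)" unfolding De_at[OF assms] using prod_at_nz[OF assms] by simp
  also have "\<dots> = of_real (1 / w j) * cnj ?z"
    using norm\<zeta>[OF assms] complex_norm_square[of "\<zeta> j"] \<zeta>nz[OF assms] wpos[OF assms] by (simp add: field_simps)
  finally have "B' * ?z = of_real (1 / w j - 1) * cnj ?z" using e Nz by (simp add: algebra_simps)
  then have "cmod (B' * ?z) = cmod (of_real (1 / w j - 1) * cnj ?z)" by simp
  then have "cmod B' = \<bar>1 / w j - 1\<bar>" using norm\<zeta>[OF assms] by (simp only: norm_mult norm_of_real complex_mod_cnj mult_1_right)
  moreover have "w j \<le> 1" using member_le_sum[of j I w] assms wsum wpos finI by (auto intro: less_imp_le)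
  moreover have "dbar f ?z = cnj B'" using dbar_cnj[OF B] f by (metis (no_types, lifting) ext)
  ultimately show ?thesis using wpos[OF assms] by (simp add: field_simps)
qed

text \<open>As the barycentre is 0, w_j is the modulus of the weighted sum over the other atoms.
  There are at least two of these, at distinct points, so the triangle inequality is strict and w_j
  < 1 - w_j. This makes the multipliers exceed 1.\<close>

lemma w_less: assumes "j \<in> I" shows "w j < 1 / 2"
proof -
  have ne: "I - {j} \<noteq> {}" using cardI d2 assms by (metis card.empty card_Diff_singleton finI add_diff_cancel_right' not_numeral_le_zero)
  obtain k where k: "k \<in> I" "k \<noteq> j" using ne by blast
  have "card (I - {j, k}) = d - 1" using cardI assms k finI by (simp add: card_Diff_subset)
  then have "card (I - {j, k}) \<noteq> 0" using d2 by simp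
  then have "I - {j, k} \<noteq> {}" by (metis card.empty)
  then obtain l where l: "l \<in> I" "l \<noteq> j" "l \<noteq> k" by blast
  have sj: "(\<Sum>e\<in>I-{j}. w e) = 1 - w j" using sum.remove[OF finI assms, of w] wsum by simp
  have "of_real (w j) * \<zeta> j = - (\<Sum>e\<in>I-{j}. of_real (w e) * \<zeta> e)"
    using sum.remove[OF finI assms, of "\<lambda>e. of_real (w e) * \<zeta> e"] bary by (simp add: eq_neg_iff_add_eq_0)
  then have "cmod (of_real (w j) * \<zeta> j) = cmod (\<Sum>e\<in>I-{j}. of_real (w e) * \<zeta> e)" by simp
  then have wj: "w j = cmod (\<Sum>e\<in>I-{j}. of_real (w e) * \<zeta> e)" using wpos[OF assms] norm\<zeta>[OF assms] by (simp add: norm_mult)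
  let ?R = "I - {j} - {k} - {l}"
  have split: "(\<Sum>e\<in>I-{j}. g e) = g k + (g l + sum g ?R)" for g :: "'e \<Rightarrow> 'x::comm_monoid_add"
    using finI k l by (simp add: sum.remove[of "I - {j}" k] sum.remove[of "I - {j} - {k}" l])
  have R: "cmod (\<Sum>e\<in>?R. of_real (w e) * \<zeta> e) \<le> sum w ?R"
    by (rule order_trans[OF norm_sum]) (auto intro!: sum_mono simp: norm_mult norm\<zeta> wpos less_imp_le abs_of_pos)
  have "cmod (of_real (w k) * \<zeta> k + of_real (w l) * \<zeta> l) < w k + w l"
  proof -
    have "cmod (of_real (w k) * \<zeta> k + of_real (w l) * \<zeta> l) \<le> cmod (of_real (w k) * \<zeta> k) + cmod (of_real (w l) * \<zeta> l)"
      by (rule norm_triangle_ineq)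
    moreover have "cmod (of_real (w k) * \<zeta> k + of_real (w l) * \<zeta> l) \<noteq> cmod (of_real (w k) * \<zeta> k) + cmod (of_real (w l) * \<zeta> l)"
    proof
      assume "cmod (of_real (w k) * \<zeta> k + of_real (w l) * \<zeta> l) = cmod (of_real (w k) * \<zeta> k) + cmod (of_real (w l) * \<zeta> l)"
      then have "cmod (of_real (w k) * \<zeta> k) *\<^sub>R (of_real (w l) * \<zeta> l) = cmod (of_real (w l) * \<zeta> l) *\<^sub>R (of_real (w k) * \<zeta> k)"
        by (rule norm_triangle_eq[THEN iffD1])
      then have "\<zeta> l = \<zeta> k" using wpos[OF k(1)] wpos[OF l(1)] norm\<zeta>[OF k(1)] norm\<zeta>[OF l(1)]
        by (simp add: norm_mult scaleR_conv_of_real mult_ac)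
      then show False using inj k l by (auto simp: inj_on_def)
    qed
    ultimately show ?thesis using wpos[OF k(1)] wpos[OF l(1)] norm\<zeta>[OF k(1)] norm\<zeta>[OF l(1)] by (simp add: norm_mult)
  qed
  then have "w j < (w k + w l) + sum w ?R"
    unfolding wj split add.assoc[symmetric, of "of_real _ * _ :: complex"] using R norm_triangle_ineq[of "of_real (w k) * \<zeta> k + of_real (w l) * \<zeta> l" "\<Sum>e\<in>?R. of_real (w e) * \<zeta> e"]
    by linarith
  then have "w j < 1 - w j" using sj split[of w] by simp
  then show ?thesis by simp
qed

lemma rep_fix: "rep_fix_circle f = \<zeta> ` I"
proof -
  have "cmod (dbar f (\<zeta> j)) > 1" if "j \<in> I" for j
  proof -
    have "2 < 1 / w j" using w_less[OF that] wpos[OF that] by (simp add: field_simps)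
    then show ?thesis using f_dbar[OF that] by linarith
  qed
  then show ?thesis unfolding rep_fix_circle_def using f_fix f_fix_only norm\<zeta> by auto
qed

text \<open>The conjugate of mob x \<zeta> is (1 - |x|^2) / (\<zeta> - x) - conj x, affine in 1 /
  (\<zeta> - x), so its average is the same expression in \<open>S1 x\<close>. Moving S1 / (1 + x
  S1) by the Moebius map produces this expression as well.\<close>

lemma f_mob:
  assumes "cmod x < 1"
  shows "mob x (f x) = (\<Sum>e\<in>I. of_real (w e) * mob x (\<zeta> e))"
proof -
  have nin: "x \<notin> \<zeta> ` I" using norm\<zeta> assms by auto
  have G0: "G x \<noteq> 0" using G_Re[OF _ nin] assms by fastforce
  have fx: "f x = cnj (S1 x / (1 + x * S1 x))"
    unfolding f using S1G[OF nin] G0 by simp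
  let ?b = "\<Sum>e\<in>I. of_real (w e) * mob x (\<zeta> e)"
  have cb: "cnj ?b = (1 - x * cnj x) * S1 x - cnj x"
  proof -
    have "cnj (mob x (\<zeta> e)) = (1 - x * cnj x) / (\<zeta> e - x) - cnj x" if e: "e \<in> I" for e
    proof -
      have ne: "\<zeta> e - x \<noteq> 0" using nin e by auto
      have uu: "\<zeta> e * cnj (\<zeta> e) = 1" using norm\<zeta>[OF e] complex_norm_square[of "\<zeta> e"] by simp
      have n1: "1 - x * cnj (\<zeta> e) \<noteq> 0"
        using one_minus_cnj_mult_nz(1)[of x "\<zeta> e"] assms norm\<zeta>[OF e]
        by (metis complex_cnj_cnj complex_cnj_diff complex_cnj_mult complex_cnj_one complex_cnj_zero_iff order_refl)
      have "\<zeta> e * (cnj (\<zeta> e) - cnj x) = 1 - cnj x * \<zeta> e" "\<zeta> e * (1 - x * cnj (\<zeta> e)) = \<zeta> e - x"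
        using uu by (simp_all add: algebra_simps)
      then have "cnj (mob x (\<zeta> e)) = (1 - cnj x * \<zeta> e) / (\<zeta> e - x)"
        unfolding mob_def using \<zeta>nz[OF e] n1
        by (simp) (metis mult_divide_mult_cancel_left)
      also have "1 - cnj x * \<zeta> e = (1 - x * cnj x) - cnj x * (\<zeta> e - x)" by (simp add: algebra_simps)
      finally show ?thesis using ne by (simp add: diff_divide_distrib)
    qed
    then have "cnj ?b = (\<Sum>e\<in>I. of_real (w e) * ((1 - x * cnj x) / (\<zeta> e - x) - cnj x))"
      by (simp add: cnj_sum)
    also have "\<dots> = (1 - x * cnj x) * S1 x - of_real (\<Sum>e\<in>I. w e) * cnj x"
      by (simp add: S1_def sum_distrib_left sum_distrib_right sum_subtractf right_diff_distrib mult_ac)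
    finally show ?thesis by (simp add: wsum)
  qed
  have G1: "1 + x * S1 x \<noteq> 0" using G0 S1G(4)[OF nin] by simp
  have "cnj (mob x (f x)) = (S1 x / (1 + x * S1 x) - cnj x) / (1 - x * (S1 x / (1 + x * S1 x)))"
    by (simp add: mob_def fx)
  also have "S1 x / (1 + x * S1 x) - cnj x = cnj ?b / (1 + x * S1 x)"
    unfolding cb using G1 by (simp add: field_simps)
  also have "1 - x * (S1 x / (1 + x * S1 x)) = 1 / (1 + x * S1 x)" using G1 by (simp add: field_simps)
  finally have "cnj (mob x (f x)) = cnj ?b" using G1 by simp
  then show ?thesis by (metis complex_cnj_cnj)
qed

end

end

section \<open>Critical points near a branch point\<close>

text \<open>The derivative of \<open>S1 / G\<close> is \<open>vker / G\<^sup>2\<close>. Being the variance of \<open>1 / (\<zeta> - z)\<close>, the function \<open>vker\<close> is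
  Moebius covariant, so its zeros may be counted from any base point.\<close>

definition vker :: "'e set \<Rightarrow> ('e \<Rightarrow> complex) \<Rightarrow> ('e \<Rightarrow> real) \<Rightarrow> complex \<Rightarrow> complex" where
  "vker I \<zeta> w u = (\<Sum>e\<in>I. of_real (w e) / (\<zeta> e - u)\<^sup>2) - (\<Sum>e\<in>I. of_real (w e) / (\<zeta> e - u))\<^sup>2"

text \<open>In the pair form only differences of the r occur; both the Moebius covariance and the
  positivity on the circle are read off from it.\<close>

lemma variance_pairs:
  fixes r :: "'e \<Rightarrow> complex" and w :: "'e \<Rightarrow> real"
  assumes "(\<Sum>e\<in>I. w e) = 1"
  shows "(\<Sum>e\<in>I. of_real (w e) * (r e)\<^sup>2) - (\<Sum>e\<in>I. of_real (w e) * r e)\<^sup>2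
     = (\<Sum>i\<in>I. \<Sum>j\<in>I. of_real (w i * w j) * (r i - r j)\<^sup>2) / 2"
proof -
  let ?A = "\<Sum>e\<in>I. of_real (w e) * (r e)\<^sup>2" and ?B = "\<Sum>e\<in>I. of_real (w e) * r e"
  have w1: "(\<Sum>e\<in>I. of_real (w e)) = (1::complex)" using assms by (metis of_real_1 of_real_sum)
  have "(\<Sum>i\<in>I. \<Sum>j\<in>I. of_real (w i * w j) * (r i - r j)\<^sup>2)
    = (\<Sum>i\<in>I. \<Sum>j\<in>I. (of_real (w i) * (r i)\<^sup>2) * of_real (w j) + of_real (w i) * (of_real (w j) * (r j)\<^sup>2)
        - 2 * ((of_real (w i) * r i) * (of_real (w j) * r j)))"
    by (intro sum.cong refl) (simp add: power2_eq_square algebra_simps)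
  also have "\<dots> = ?A * 1 + 1 * ?A - 2 * (?B * ?B)"
    by (simp only: sum.distrib sum_subtractf sum_distrib_left[symmetric] sum_distrib_right[symmetric] w1)
  finally show ?thesis by (simp add: power2_eq_square)
qed

text \<open>Turns the squared differences in \<open>npol\<close> into nonnegative numbers times
  monomials when all points lie on the circle.\<close>

lemma circle_sq_diff:
  assumes "cmod a = 1" "cmod b = 1" shows "(a - b)\<^sup>2 = - a * b * of_real ((cmod (a - b))\<^sup>2)"
proof -
  have "a * cnj a = 1" "b * cnj b = 1" using assms complex_norm_square[of a] complex_norm_square[of b] by auto
  moreover have "of_real ((cmod (a - b))\<^sup>2) = (a - b) * (cnj a - cnj b)"
    using complex_norm_square[of "a - b"] by simp
  ultimately show ?thesis by (simp only:) (simp add: power2_eq_square algebra_simps; metis mult.assoc mult.commute mult_1_right)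
qed

text \<open>\<open>npol\<close> is \<open>vker\<close> cleared of denominators. On the unit circle it equals \<open>u^(card J - 2)\<close> times a constant
  times the positive function \<open>ppol\<close>; hence it has \<open>card J - 2\<close> zeros in the disc.\<close>

definition npol :: "'i set \<Rightarrow> ('i \<Rightarrow> complex) \<Rightarrow> ('i \<Rightarrow> real) \<Rightarrow> complex \<Rightarrow> complex" where
  "npol J C w u = (\<Sum>i\<in>J. \<Sum>j\<in>J. of_real (w i * w j) * ((C i - C j)\<^sup>2 * (\<Prod>l\<in>J-{i,j}. (C l - u)\<^sup>2))) / 2"

definition ppol :: "'i set \<Rightarrow> ('i \<Rightarrow> complex) \<Rightarrow> ('i \<Rightarrow> real) \<Rightarrow> complex \<Rightarrow> real" where
  "ppol J C w u = (\<Sum>i\<in>J. \<Sum>j\<in>J. w i * w j * ((cmod (C i - C j))\<^sup>2 * (\<Prod>l\<in>J-{i,j}. (cmod (C l - u))\<^sup>2))) / 2"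

lemma vker_npol:
  assumes "finite J" "(\<Sum>i\<in>J. w i) = 1" "\<And>i. i \<in> J \<Longrightarrow> C i \<noteq> u"
  shows "vker J C w u * (\<Prod>l\<in>J. (C l - u)\<^sup>2) = npol J C w u"
proof -
  let ?P = "\<Prod>l\<in>J. (C l - u)\<^sup>2"
  have "vker J C w u = (\<Sum>i\<in>J. \<Sum>j\<in>J. of_real (w i * w j) * (1 / (C i - u) - 1 / (C j - u))\<^sup>2) / 2"
    using variance_pairs[OF assms(2), of "\<lambda>i. 1 / (C i - u)"] by (simp add: vker_def power_divide)
  then have "vker J C w u * ?P = (\<Sum>i\<in>J. \<Sum>j\<in>J. of_real (w i * w j) * ((1 / (C i - u) - 1 / (C j - u))\<^sup>2 * ?P)) / 2"
    by (simp only: times_divide_eq_left sum_distrib_right mult.assoc)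
  also have "\<dots> = npol J C w u"
    unfolding npol_def
  proof (intro arg_cong[of _ _ "\<lambda>x. x / 2"] sum.cong refl)
    fix i j assume ij: "i \<in> J" "j \<in> J"
    show "of_real (w i * w j) * ((1 / (C i - u) - 1 / (C j - u))\<^sup>2 * ?P) =
      of_real (w i * w j) * ((C i - C j)\<^sup>2 * (\<Prod>l\<in>J-{i,j}. (C l - u)\<^sup>2))"
    proof (cases "i = j")
      case False
      have "?P = (C i - u)\<^sup>2 * ((C j - u)\<^sup>2 * (\<Prod>l\<in>J-{i}-{j}. (C l - u)\<^sup>2))"
        using ij False assms(1) by (simp add: prod.remove[of J i] prod.remove[of "J - {i}" j])
      moreover have "J - {i} - {j} = J - {i,j}" by auto
      moreover have "(1 / a - 1 / b) * (a * b) = b - a" if "a \<noteq> 0" "b \<noteq> 0" for a b :: complex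
        using that by (simp add: field_simps)
      from this[of "C i - u" "C j - u"] have "(1 / (C i - u) - 1 / (C j - u)) * ((C i - u) * (C j - u)) = C j - C i"
        using assms(3)[OF ij(1)] assms(3)[OF ij(2)] by simp
      then have "(1 / (C i - u) - 1 / (C j - u))\<^sup>2 * ((C i - u)\<^sup>2 * (C j - u)\<^sup>2) = (C i - C j)\<^sup>2"
        by (metis power_mult_distrib power2_commute)
      ultimately show ?thesis by (simp add: mult.assoc[symmetric])
    qed simp
  qed
  finally show ?thesis .
qed

text \<open>Each pair leaves card J - 2 squared chords ending at z. Every term therefore has the
  same power of z and the same product of all centres, up to a nonnegative factor.\<close>

lemma npol_circle:
  assumes "finite J" "card J \<ge> 2" "\<And>i. i \<in> J \<Longrightarrow> cmod (C i) = 1" "cmod z = 1"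
  shows "npol J C w z = ((-1) ^ (card J - 1) * (\<Prod>l\<in>J. C l)) * z ^ (card J - 2) * of_real (ppol J C w z)"
proof -
  let ?\<kappa> = "(-1) ^ (card J - 1) * (\<Prod>l\<in>J. C l)"
  have t: "of_real (w i * w j) * ((C i - C j)\<^sup>2 * (\<Prod>l\<in>J-{i,j}. (C l - z)\<^sup>2))
     = ?\<kappa> * z ^ (card J - 2) * of_real (w i * w j * ((cmod (C i - C j))\<^sup>2 * (\<Prod>l\<in>J-{i,j}. (cmod (C l - z))\<^sup>2)))"
    if ij: "i \<in> J" "j \<in> J" for i j
  proof (cases "i = j")
    case False
    have c: "card (J - {i,j}) = card J - 2" using ij False assms(1) by (simp add: card_Diff_subset)
    have s: "J - {i} - {j} = J - {i,j}" by auto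
    have P: "(\<Prod>l\<in>J. C l) = C i * (C j * (\<Prod>l\<in>J-{i,j}. C l))"
      using ij False assms(1) by (simp add: prod.remove[of J i] prod.remove[of "J - {i}" j] s)
    have "(\<Prod>l\<in>J-{i,j}. (C l - z)\<^sup>2) = (\<Prod>l\<in>J-{i,j}. (- z) * (C l * of_real ((cmod (C l - z))\<^sup>2)))"
      by (rule prod.cong[OF refl]) (use circle_sq_diff[OF assms(3) assms(4)] in \<open>simp add: mult_ac\<close>)
    also have "\<dots> = (- z) ^ (card J - 2) * ((\<Prod>l\<in>J-{i,j}. C l) * of_real (\<Prod>l\<in>J-{i,j}. (cmod (C l - z))\<^sup>2))"
      by (simp only: prod.distrib prod_constant c of_real_prod)
    finally have Q: "(\<Prod>l\<in>J-{i,j}. (C l - z)\<^sup>2) = (-1) ^ (card J - 2) * z ^ (card J - 2) * ((\<Prod>l\<in>J-{i,j}. C l) * of_real (\<Prod>l\<in>J-{i,j}. (cmod (C l - z))\<^sup>2))"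
      by (simp only: power_minus[of z])
    have "card J - 1 = Suc (card J - 2)" using assms(2) by simp
    then have m: "(-1::complex) ^ (card J - 1) = - ((-1) ^ (card J - 2))" by simp
    show ?thesis unfolding Q circle_sq_diff[OF assms(3)[OF ij(1)] assms(3)[OF ij(2)]] P m
      by (simp only: of_real_mult mult_ac mult_minus_left mult_minus_right)
  qed simp
  show ?thesis unfolding npol_def ppol_def of_real_divide of_real_sum times_divide_eq_right sum_distrib_left of_real_numeral
    by (intro arg_cong[of _ _ "\<lambda>x. x / 2"] sum.cong refl) (rule t)
qed

lemma ppol_upper:
  assumes "finite J" "\<And>i. i \<in> J \<Longrightarrow> cmod (C i) = 1" "cmod z = 1" "\<And>i. i \<in> J \<Longrightarrow> 0 \<le> w i" "(\<Sum>i\<in>J. w i) = 1"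
  shows "ppol J C w z \<le> 2 * 4 ^ card J"
proof -
  have q: "(cmod (C i - x))\<^sup>2 \<le> 4" if "i \<in> J" "cmod x = 1" for i x
    using power_mono[of "cmod (C i - x)" 2 2] norm_triangle_ineq4[of "C i" x] assms(2)[OF that(1)] that by simp
  have "(\<Sum>i\<in>J. \<Sum>j\<in>J. w i * w j * ((cmod (C i - C j))\<^sup>2 * (\<Prod>l\<in>J-{i,j}. (cmod (C l - z))\<^sup>2)))
     \<le> (\<Sum>i\<in>J. \<Sum>j\<in>J. w i * w j * (4 * 4 ^ card J))"
  proof (intro sum_mono mult_left_mono mult_mono q)
    fix i j assume ij: "i \<in> J" "j \<in> J"
    have "(\<Prod>l\<in>J-{i,j}. (cmod (C l - z))\<^sup>2) \<le> (\<Prod>l\<in>J-{i,j}. 4)"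
      using q assms(3) by (intro prod_mono) auto
    also have "\<dots> \<le> 4 ^ card J" using assms(1) by (simp add: power_increasing card_mono)
    finally show "(\<Prod>l\<in>J-{i,j}. (cmod (C l - z))\<^sup>2) \<le> 4 ^ card J" .
  qed (use assms in \<open>auto intro!: prod_nonneg\<close>)
  also have "\<dots> = (\<Sum>i\<in>J. w i) * (\<Sum>j\<in>J. w j) * (4 * 4 ^ card J)"
    by (simp only: sum_distrib_left[symmetric] sum_distrib_right[symmetric])
  finally show ?thesis using assms(5) by (simp add: ppol_def)
qed

text \<open>By compactness a nonzero term at each z is enough. As \<open>C\<close> is injective, at
  most one centre equals z; putting it into the pair removes the factor that vanishes.\<close>

lemma ppol_lower:
  assumes "finite J" "card J \<ge> 2" "\<And>i. i \<in> J \<Longrightarrow> cmod (C i) = 1" "inj_on C J"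
  shows "\<exists>p0>0. \<forall>z. cmod z = 1 \<longrightarrow> p0 \<le> ppol J C (\<lambda>_. 1) z"
proof -
  have "continuous_on (sphere 0 1) (ppol J C (\<lambda>_. 1))"
    unfolding ppol_def by (intro continuous_intros) auto
  moreover have "sphere (0::complex) 1 \<noteq> {}" "compact (sphere (0::complex) 1)" by auto
  ultimately obtain z0 where z0: "z0 \<in> sphere 0 1" "\<And>z. z \<in> sphere 0 1 \<Longrightarrow> ppol J C (\<lambda>_. 1) z0 \<le> ppol J C (\<lambda>_. 1) z"
    using continuous_attains_inf by metis
  have nonneg: "0 \<le> 1 * 1 * ((cmod (C i - C j))\<^sup>2 * (\<Prod>l\<in>J-{i,j}. (cmod (C l - z0))\<^sup>2))" for i j
    by (intro mult_nonneg_nonneg prod_nonneg) auto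
  have "\<exists>i\<in>J. \<exists>j\<in>J. i \<noteq> j \<and> (\<forall>l\<in>J-{i,j}. C l \<noteq> z0)"
  proof -
    have two: "\<exists>j\<in>J. i \<noteq> j" if "i \<in> J" for i
      using assms(1,2) that by (metis One_nat_def card_1_singleton_iff card.empty insert_absorb is_singletonI is_singleton_def numeral_le_one_iff singletonI subset_singletonD subsetI semiring_norm(69))
    show ?thesis
    proof (cases "\<exists>i\<in>J. C i = z0")
      case True
      then obtain i where i: "i \<in> J" "C i = z0" by blast
      obtain j where "j \<in> J" "i \<noteq> j" using two[OF i(1)] by blast
      moreover have "C l \<noteq> z0" if "l \<in> J - {i,j}" for l using assms(4) i that by (auto simp: inj_on_def)
      ultimately show ?thesis using i by blast
    next
      case False
      have "J \<noteq> {}" using assms(2) by auto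
      then obtain i where i: "i \<in> J" by blast
      then obtain j where "j \<in> J" "i \<noteq> j" using two[OF i] by blast
      then show ?thesis using False i by blast
    qed
  qed
  then obtain i j where ij: "i \<in> J" "j \<in> J" "i \<noteq> j" "\<And>l. l \<in> J - {i,j} \<Longrightarrow> C l \<noteq> z0" by blast
  have "C i \<noteq> C j" using ij assms(4) by (auto simp: inj_on_def)
  then have "0 < 1 * 1 * ((cmod (C i - C j))\<^sup>2 * (\<Prod>l\<in>J-{i,j}. (cmod (C l - z0))\<^sup>2))"
  proof -
    have "0 < (cmod (C l - z0))\<^sup>2" if "l \<in> J - {i,j}" for l using ij(4)[OF that] by simp
    then have "0 < (\<Prod>l\<in>J-{i,j}. (cmod (C l - z0))\<^sup>2)" by (intro prod_pos) blast
    then show ?thesis using \<open>C i \<noteq> C j\<close> by simp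
  qed
  then have "0 < (\<Sum>j\<in>J. 1 * 1 * ((cmod (C i - C j))\<^sup>2 * (\<Prod>l\<in>J-{i,j}. (cmod (C l - z0))\<^sup>2)))"
    by (rule sum_pos2[OF assms(1) ij(2)]) (rule nonneg)
  then have "0 < (\<Sum>i\<in>J. \<Sum>j\<in>J. 1 * 1 * ((cmod (C i - C j))\<^sup>2 * (\<Prod>l\<in>J-{i,j}. (cmod (C l - z0))\<^sup>2)))"
    by (rule sum_pos2[OF assms(1) ij(1)]) (intro sum_nonneg nonneg)
  then have "0 < ppol J C (\<lambda>_. 1) z0" by (simp add: ppol_def)
  then show ?thesis using z0(2) by auto
qed

lemma ppol_weights:
  assumes "finite J" "\<And>i. i \<in> J \<Longrightarrow> \<delta> \<le> w i" "0 \<le> \<delta>"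
  shows "\<delta>\<^sup>2 * ppol J C (\<lambda>_. 1) z \<le> ppol J C w z"
proof -
  have "(\<Sum>i\<in>J. \<Sum>j\<in>J. (\<delta> * \<delta>) * (1 * 1 * ((cmod (C i - C j))\<^sup>2 * (\<Prod>l\<in>J-{i,j}. (cmod (C l - z))\<^sup>2))))
    \<le> (\<Sum>i\<in>J. \<Sum>j\<in>J. w i * w j * ((cmod (C i - C j))\<^sup>2 * (\<Prod>l\<in>J-{i,j}. (cmod (C l - z))\<^sup>2)))"
    unfolding mult_1 using assms by (intro sum_mono mult_right_mono mult_mono)
      (auto intro!: mult_nonneg_nonneg prod_nonneg intro: order_trans)
  then show ?thesis by (simp add: ppol_def power2_eq_square sum_distrib_left[symmetric])
qed

text \<open>The differences C l - u are halved to have modulus at most 1, as the telescoping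
  estimate for products requires; the powers of 4 restore the scale.\<close>

lemma npol_lipschitz:
  assumes "finite J" "\<And>i. i \<in> J \<Longrightarrow> cmod (C i) = 1" "cmod u \<le> 1" "cmod z \<le> 1"
    "\<And>i. i \<in> J \<Longrightarrow> 0 \<le> w i" "(\<Sum>i\<in>J. w i) = 1"
  shows "cmod (npol J C w u - npol J C w z) \<le> 2 * 4 ^ card J * real (card J) * cmod (u - z)"
proof -
  let ?T = "\<lambda>i j u. \<Prod>l\<in>J-{i,j}. (C l - u)\<^sup>2"
  have T: "cmod (?T i j u - ?T i j z) \<le> 4 ^ card J * real (card J) * cmod (u - z)" for i j
  proof -
    let ?A = "J - {i,j}"
    have s: "?T i j x = 4 ^ card ?A * (\<Prod>l\<in>?A. ((C l - x) / 2)\<^sup>2)" for x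
      by (simp add: power_divide prod_dividef)
    have n: "cmod (((C l - x) / 2)\<^sup>2) \<le> 1" if "l \<in> ?A" "cmod x \<le> 1" for l x
    proof -
      have "cmod ((C l - x) / 2) \<le> 1" using norm_triangle_ineq4[of "C l" x] assms(2)[of l] that by (simp add: norm_divide)
      then show ?thesis by (simp add: norm_power power_le_one)
    qed
    have "cmod ((\<Prod>l\<in>?A. ((C l - u) / 2)\<^sup>2) - (\<Prod>l\<in>?A. ((C l - z) / 2)\<^sup>2)) \<le> (\<Sum>l\<in>?A. cmod (((C l - u) / 2)\<^sup>2 - ((C l - z) / 2)\<^sup>2))"
      using n assms by (intro norm_prod_diff) auto
    also have "\<dots> \<le> (\<Sum>l\<in>?A. cmod (u - z))"
    proof (rule sum_mono)
      fix l assume l: "l \<in> ?A"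
      have "((C l - u) / 2)\<^sup>2 - ((C l - z) / 2)\<^sup>2 = (u - z) * ((u + z - 2 * C l) / 4)"
        by (simp add: power2_eq_square field_simps)
      then have "cmod (((C l - u) / 2)\<^sup>2 - ((C l - z) / 2)\<^sup>2) = cmod (u - z) * (cmod (u + z - 2 * C l) / 4)"
        by (simp only: norm_mult norm_divide norm_numeral)
      also have "cmod (u + z - 2 * C l) \<le> 4"
        using norm_triangle_ineq4[of "u + z" "2 * C l"] norm_triangle_ineq[of u z] assms l by (simp add: norm_mult)
      then have "cmod (u - z) * (cmod (u + z - 2 * C l) / 4) \<le> cmod (u - z) * 1" by (intro mult_left_mono) auto
      finally show "cmod (((C l - u) / 2)\<^sup>2 - ((C l - z) / 2)\<^sup>2) \<le> cmod (u - z)" by simp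
    qed
    also have "\<dots> \<le> real (card J) * cmod (u - z)" using assms(1) by (simp add: mult_right_mono card_mono)
    finally have 1: "cmod ((\<Prod>l\<in>?A. ((C l - u) / 2)\<^sup>2) - (\<Prod>l\<in>?A. ((C l - z) / 2)\<^sup>2)) \<le> real (card J) * cmod (u - z)" .
    have "cmod (?T i j u - ?T i j z) = 4 ^ card ?A * cmod ((\<Prod>l\<in>?A. ((C l - u) / 2)\<^sup>2) - (\<Prod>l\<in>?A. ((C l - z) / 2)\<^sup>2))"
      unfolding s right_diff_distrib[symmetric] norm_mult norm_power by simp
    also have "\<dots> \<le> 4 ^ card J * (real (card J) * cmod (u - z))"
      using 1 assms(1) by (intro mult_mono) (auto intro!: power_increasing card_mono)
    finally show ?thesis by (simp add: mult.assoc)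
  qed
  let ?K = "4 ^ card J * real (card J) * cmod (u - z)"
  have "npol J C w u - npol J C w z = (\<Sum>i\<in>J. \<Sum>j\<in>J. of_real (w i * w j) * ((C i - C j)\<^sup>2 * (?T i j u - ?T i j z))) / 2"
    unfolding npol_def diff_divide_distrib[symmetric] sum_subtractf[symmetric] right_diff_distrib[symmetric] ..
  then have "cmod (npol J C w u - npol J C w z) \<le> (\<Sum>i\<in>J. \<Sum>j\<in>J. cmod (of_real (w i * w j) * ((C i - C j)\<^sup>2 * (?T i j u - ?T i j z)))) / 2"
    by (simp only: norm_divide norm_numeral)
      (intro divide_right_mono order_trans[OF norm_sum] sum_mono norm_sum; simp)
  also have "\<dots> \<le> (\<Sum>i\<in>J. \<Sum>j\<in>J. (w i * w j) * (4 * ?K)) / 2"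
  proof (intro divide_right_mono sum_mono)
    fix i j assume ij: "i \<in> J" "j \<in> J"
    have "cmod ((C i - C j)\<^sup>2) \<le> 4"
      using power_mono[of "cmod (C i - C j)" 2 2] norm_triangle_ineq4[of "C i" "C j"] assms(2) ij by (simp add: norm_power)
    then have "cmod ((C i - C j)\<^sup>2) * cmod (?T i j u - ?T i j z) \<le> 4 * ?K" using T by (intro mult_mono) auto
    then show "cmod (of_real (w i * w j) * ((C i - C j)\<^sup>2 * (?T i j u - ?T i j z))) \<le> (w i * w j) * (4 * ?K)"
      using assms(5) ij by (simp only: norm_mult norm_of_real abs_of_nonneg mult_nonneg_nonneg) (intro mult_left_mono; simp)
  qed simp
  also have "\<dots> = (\<Sum>i\<in>J. w i) * (\<Sum>j\<in>J. w j) * (4 * ?K) / 2"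
    by (simp only: sum_distrib_left[symmetric] sum_distrib_right[symmetric])
  finally show ?thesis using assms(6) by (simp add: mult_ac)
qed

text \<open>Both terms of \<open>vker\<close> are built from weighted averages, so the number of
  atoms does not enter; only the distance of u from the circle does.\<close>

lemma vker_perturb:
  assumes "finite I" "\<And>e. e \<in> I \<Longrightarrow> 0 \<le> w e" "(\<Sum>e\<in>I. w e) = 1"
    "\<And>e. e \<in> I \<Longrightarrow> cmod (\<zeta> e) = 1" "\<And>e. e \<in> I \<Longrightarrow> cmod (\<xi> e) = 1" "\<And>e. e \<in> I \<Longrightarrow> cmod (\<zeta> e - \<xi> e) \<le> \<omega>"
    "cmod u \<le> r" "r < 1"
  shows "cmod (vker I \<zeta> w u - vker I \<xi> w u) \<le> 4 * \<omega> / (1 - r) ^ 3"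
proof -
  let ?a = "\<lambda>e. 1 / (\<zeta> e - u)" and ?b = "\<lambda>e. 1 / (\<xi> e - u)"
  have r1: "1 - r > 0" using assms by simp
  have far: "1 - r \<le> cmod (\<zeta> e - u)" "1 - r \<le> cmod (\<xi> e - u)" if "e \<in> I" for e
    using norm_triangle_ineq2[of "\<zeta> e" u] norm_triangle_ineq2[of "\<xi> e" u] assms(4,5)[OF that] assms(7) by auto
  have nz: "\<zeta> e - u \<noteq> 0" "\<xi> e - u \<noteq> 0" if "e \<in> I" for e using far[OF that] r1 by auto
  have na: "cmod (?a e) \<le> 1 / (1 - r)" "cmod (?b e) \<le> 1 / (1 - r)" if "e \<in> I" for e
    using far[OF that] r1 by (auto simp: norm_divide intro!: divide_left_mono mult_pos_pos)
  have ab: "cmod (?a e - ?b e) \<le> \<omega> / (1 - r)\<^sup>2" if e: "e \<in> I" for e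
  proof -
    have "?a e - ?b e = (\<xi> e - \<zeta> e) / ((\<zeta> e - u) * (\<xi> e - u))"
      using nz[OF e] by (simp add: diff_frac_eq)
    then have "cmod (?a e - ?b e) = cmod (\<zeta> e - \<xi> e) / (cmod (\<zeta> e - u) * cmod (\<xi> e - u))"
      by (simp add: norm_divide norm_mult norm_minus_commute)
    also have "\<dots> \<le> \<omega> / ((1 - r) * (1 - r))"
      using far[OF e] r1 assms(6)[OF e] order_trans[OF norm_ge_zero assms(6)[OF e]] by (intro frac_le mult_mono) auto
    finally show ?thesis by (simp add: power2_eq_square)
  qed
  have wsum: "cmod (\<Sum>e\<in>I. of_real (w e) * g e) \<le> B" if "\<And>e. e \<in> I \<Longrightarrow> cmod (g e) \<le> B" for g B
  proof -
    have "cmod (\<Sum>e\<in>I. of_real (w e) * g e) \<le> (\<Sum>e\<in>I. w e * B)"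
      using assms(2) that by (intro sum_norm_le) (auto simp: norm_mult intro!: mult_left_mono)
    also have "\<dots> = B" using assms(3) by (simp flip: sum_distrib_right)
    finally show ?thesis .
  qed
  have cube: "\<omega> / (1 - r)\<^sup>2 * (1 / (1 - r) + 1 / (1 - r)) = 2 * \<omega> / (1 - r) ^ 3"
    using r1 by (simp add: field_simps power2_eq_square power3_eq_cube)
  have 1: "cmod (\<Sum>e\<in>I. of_real (w e) * ((?a e)\<^sup>2 - (?b e)\<^sup>2)) \<le> 2 * \<omega> / (1 - r) ^ 3"
  proof (rule wsum)
    fix e assume e: "e \<in> I"
    have "cmod ((?a e)\<^sup>2 - (?b e)\<^sup>2) = cmod (?a e - ?b e) * cmod (?a e + ?b e)"
      by (simp only: norm_mult[symmetric]) (simp add: power2_eq_square algebra_simps)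
    also have "\<dots> \<le> \<omega> / (1 - r)\<^sup>2 * (1 / (1 - r) + 1 / (1 - r))"
      using ab[OF e] na[OF e] order_trans[OF norm_ge_zero ab[OF e]]
      by (intro mult_mono order_trans[OF norm_triangle_ineq] add_mono) auto
    finally show "cmod ((?a e)\<^sup>2 - (?b e)\<^sup>2) \<le> 2 * \<omega> / (1 - r) ^ 3" by (simp only: cube)
  qed
  let ?A = "\<Sum>e\<in>I. of_real (w e) * ?a e" and ?B = "\<Sum>e\<in>I. of_real (w e) * ?b e"
  have "?A - ?B = (\<Sum>e\<in>I. of_real (w e) * (?a e - ?b e))" by (simp add: sum_subtractf right_diff_distrib)
  then have AB: "cmod (?A - ?B) \<le> \<omega> / (1 - r)\<^sup>2" using wsum[OF ab] by simp
  have 2: "cmod (?A\<^sup>2 - ?B\<^sup>2) \<le> 2 * \<omega> / (1 - r) ^ 3"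
  proof -
    have "cmod (?A\<^sup>2 - ?B\<^sup>2) = cmod (?A - ?B) * cmod (?A + ?B)"
      by (simp only: norm_mult[symmetric]) (simp only: power2_eq_square algebra_simps; simp)
    also have "\<dots> \<le> \<omega> / (1 - r)\<^sup>2 * (1 / (1 - r) + 1 / (1 - r))"
      using AB wsum[OF na(1)] wsum[OF na(2)] order_trans[OF norm_ge_zero AB]
      by (intro mult_mono order_trans[OF norm_triangle_ineq] add_mono) auto
    finally show ?thesis by (simp only: cube)
  qed
  have eq: "vker I \<zeta> w u - vker I \<xi> w u = (\<Sum>e\<in>I. of_real (w e) * ((?a e)\<^sup>2 - (?b e)\<^sup>2)) - (?A\<^sup>2 - ?B\<^sup>2)"
    unfolding vker_def right_diff_distrib sum_subtractf by (simp add: power_divide)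
  moreover have "4 * \<omega> / (1 - r) ^ 3 = 2 * \<omega> / (1 - r) ^ 3 + 2 * \<omega> / (1 - r) ^ 3" by simp
  ultimately show ?thesis unfolding eq
    using 1 2 norm_triangle_ineq4[of "\<Sum>e\<in>I. of_real (w e) * ((?a e)\<^sup>2 - (?b e)\<^sup>2)" "?A\<^sup>2 - ?B\<^sup>2"] by linarith
qed

lemma vker_cluster:
  assumes "finite I" "finite J" "\<And>e. e \<in> I \<Longrightarrow> cl e \<in> J"
  shows "vker I (\<lambda>e. C (cl e)) w u = vker J C (\<lambda>i. \<Sum>e\<in>{e\<in>I. cl e = i}. w e) u"
proof -
  have "(\<Sum>e\<in>I. of_real (w e) / g (cl e)) = (\<Sum>i\<in>J. of_real (\<Sum>e\<in>{e\<in>I. cl e = i}. w e) / g i)" for g :: "_ \<Rightarrow> complex"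
  proof -
    have "(\<Sum>i\<in>J. of_real (\<Sum>e\<in>{e\<in>I. cl e = i}. w e) / g i) = (\<Sum>i\<in>J. \<Sum>e\<in>{e\<in>I. cl e = i}. of_real (w e) / g (cl e))"
      by (intro sum.cong refl) (auto simp: sum_divide_distrib intro!: sum.cong)
    also have "\<dots> = (\<Sum>e\<in>I. of_real (w e) / g (cl e))" using assms by (intro sum.group) auto
    finally show ?thesis by simp
  qed
  from this[of "\<lambda>i. (C i - u)\<^sup>2"] this[of "\<lambda>i. C i - u"] show ?thesis unfolding vker_def by (simp only:)
qed

text \<open>Rouche's theorem on |u| = r compares \<open>vker\<close> times the squares (C l - u)^2
  with a multiple of u^(k - 2). For the measure collapsed to the centres, on the unit circle, this
  function is \<kappa> z^(k - 2) times a number between m0 and L, hence within L - m0 of the value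
  with L. Passing from the circle to radius r and from the atoms to the centres costs less than m0
  in all.\<close>

lemma cluster_count:
  fixes C :: "'i \<Rightarrow> complex"
  assumes J: "finite J" "card J \<ge> 2" "\<And>i. i \<in> J \<Longrightarrow> cmod (C i) = 1" "inj_on C J" and \<delta>: "\<delta> > 0"
  shows "\<exists>r0<1. \<forall>r. r0 < r \<longrightarrow> r < 1 \<longrightarrow> (\<exists>\<omega>>0. \<forall>(I::'e set) \<zeta> w cl.
     finite I \<and> (\<forall>e\<in>I. 0 \<le> w e \<and> cmod (\<zeta> e) = 1 \<and> cl e \<in> J \<and> cmod (\<zeta> e - C (cl e)) \<le> \<omega>) \<and> (\<Sum>e\<in>I. w e) = 1
       \<and> (\<forall>i\<in>J. \<delta> \<le> (\<Sum>e\<in>{e\<in>I. cl e = i}. w e)) \<longrightarrow>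
     finite {u. cmod u < r \<and> vker I \<zeta> w u = 0} \<and>
     (\<Sum>u\<in>{u. cmod u < r \<and> vker I \<zeta> w u = 0}. nat (zorder (vker I \<zeta> w) u)) = card J - 2)"
proof -
  obtain p0 where p0: "p0 > 0" "\<And>z. cmod z = 1 \<Longrightarrow> p0 \<le> ppol J C (\<lambda>_. 1) z" using ppol_lower[OF J] by blast
  define k where "k = card J"
  \<comment> \<open>Each pair of clusters enters \<open>ppol\<close> with the product of two weights
    that are at least \<delta>.\<close>
  define m0 where "m0 = \<delta>\<^sup>2 * p0"
  have m0: "m0 > 0" using p0 \<delta> by (simp add: m0_def)
  define A where "A = 2 * 4 ^ k * real k"
  have A: "A > 0" using J(2) by (simp add: A_def k_def)
  define L :: real where "L = 2 * 4 ^ k"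
  have L: "L > 0" by (simp add: L_def)
  \<comment> \<open>\<open>A\<close> is the Lipschitz constant of \<open>npol\<close>; beyond r0 the
    passage from radius r to the circle costs less than m0 / 2.\<close>
  define r0 where "r0 = max 0 (1 - m0 / (2 * A))"
  have r01: "r0 < 1" using m0 A by (simp add: r0_def)
  have "\<exists>\<omega>>0. \<forall>(I::'e set) \<zeta> w cl.
     finite I \<and> (\<forall>e\<in>I. 0 \<le> w e \<and> cmod (\<zeta> e) = 1 \<and> cl e \<in> J \<and> cmod (\<zeta> e - C (cl e)) \<le> \<omega>) \<and> (\<Sum>e\<in>I. w e) = 1
       \<and> (\<forall>i\<in>J. \<delta> \<le> (\<Sum>e\<in>{e\<in>I. cl e = i}. w e)) \<longrightarrow>
     finite {u. cmod u < r \<and> vker I \<zeta> w u = 0} \<and>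
     (\<Sum>u\<in>{u. cmod u < r \<and> vker I \<zeta> w u = 0}. nat (zorder (vker I \<zeta> w) u)) = card J - 2" if r: "r0 < r" "r < 1" for r
  proof -
    have r0: "r > 0" using r by (simp add: r0_def)
    have "1 - r < m0 / (2 * A)" using r(1) by (simp add: r0_def)
    then have Ar: "A * (1 - r) < m0 / 2" using A by (simp add: field_simps)
    \<comment> \<open>\<open>vker_perturb\<close> gives 4 \<omega> / (1 - r)^3 and the cleared
      denominators are at most 4^k; together this is m0 / 2.\<close>
    define \<omega> where "\<omega> = m0 * (1 - r) ^ 3 / (8 * 4 ^ k)"
    have \<omega>: "\<omega> > 0" using m0 r by (simp add: \<omega>_def)
    show ?thesis
    proof (rule exI[of _ \<omega>], intro conjI[OF \<omega>] allI impI, elim conjE)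
      fix I :: "'e set" and \<zeta> w cl
      assume I: "finite I" and e: "\<forall>e\<in>I. 0 \<le> w e \<and> cmod (\<zeta> e) = 1 \<and> cl e \<in> J \<and> cmod (\<zeta> e - C (cl e)) \<le> \<omega>"
        and w1: "(\<Sum>e\<in>I. w e) = 1" and cw: "\<forall>i\<in>J. \<delta> \<le> (\<Sum>e\<in>{e\<in>I. cl e = i}. w e)"
      define W where "W i = (\<Sum>e\<in>{e\<in>I. cl e = i}. w e)" for i
      have W0: "0 \<le> W i" "i \<in> J \<Longrightarrow> \<delta> \<le> W i" for i using e cw by (auto simp: W_def intro!: sum_nonneg)
      have W1: "(\<Sum>i\<in>J. W i) = 1" unfolding W_def w1[symmetric] using I J e by (intro sum.group) auto
      define V where "V = vker I \<zeta> w"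
      define P where "P u = (\<Prod>l\<in>J. (C l - u)\<^sup>2)" for u
      define H where "H u = V u * P u" for u
      define \<kappa> where "\<kappa> = (-1) ^ (k - 1) * (\<Prod>l\<in>J. C l)"
      have \<kappa>: "cmod \<kappa> = 1" by (simp add: \<kappa>_def norm_mult norm_power prod_norm[symmetric] J(3))
      have V_holo: "V holomorphic_on ball 0 1" unfolding V_def vker_def[abs_def]
        using e by (intro holomorphic_intros) (auto simp: norm_minus_commute)
      have P_holo: "P holomorphic_on UNIV" unfolding P_def[abs_def] by (intro holomorphic_intros)
      have P_nz: "P u \<noteq> 0" if "cmod u < 1" for u unfolding P_def using J that by auto
      have H_holo: "H holomorphic_on ball 0 1" unfolding H_def[abs_def]
        by (intro holomorphic_intros V_holo holomorphic_on_subset[OF P_holo]) auto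
      have H_near: "cmod (H u - \<kappa> * of_real L * (u / of_real r) ^ (k - 2)) < L" if u: "cmod u = r" for u
      proof -
        define z where "z = u / of_real r"
        have z: "cmod z = 1" using u r0 by (simp add: z_def norm_divide)
        have uz: "cmod (u - z) = 1 - r"
        proof -
          have "u - z = z * of_real (r - 1)" using r0 by (simp add: z_def field_simps)
          then have "cmod (u - z) = \<bar>r - 1\<bar>" using z by (simp only: norm_mult norm_of_real) simp
          then show ?thesis using r by simp
        qed
        have nu: "C i \<noteq> u" if "i \<in> J" for i using J(3)[OF that] u r by auto
        have "vker I (\<lambda>e. C (cl e)) w u = vker J C W u" unfolding W_def by (rule vker_cluster) (use I J e in auto)
        then have cJ: "vker I (\<lambda>e. C (cl e)) w u * P u = npol J C W u" unfolding P_def using vker_npol[OF J(1) W1 nu] by simp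
        have "cmod (V u - vker I (\<lambda>e. C (cl e)) w u) \<le> 4 * \<omega> / (1 - r) ^ 3"
          unfolding V_def using e J I w1 u r by (intro vker_perturb) auto
        moreover have "cmod (P u) \<le> 4 ^ k"
        proof -
          have "cmod (P u) = (\<Prod>l\<in>J. (cmod (C l - u))\<^sup>2)" by (simp add: P_def prod_norm[symmetric] norm_power)
          also have "\<dots> \<le> (\<Prod>l\<in>J. 4)"
          proof (intro prod_mono conjI)
            fix l assume "l \<in> J"
            then have "cmod (C l - u) \<le> 2" using norm_triangle_ineq4[of "C l" u] J(3)[of l] u r by simp
            then show "(cmod (C l - u))\<^sup>2 \<le> 4" using power_mono[of "cmod (C l - u)" 2 2] by simp
          qed simp
          finally show ?thesis by (simp add: k_def)
        qed
        ultimately have "cmod ((V u - vker I (\<lambda>e. C (cl e)) w u) * P u) \<le> 4 * \<omega> / (1 - r) ^ 3 * 4 ^ k"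
          unfolding norm_mult using \<omega> r by (intro mult_mono) auto
        also have "\<dots> = m0 / 2" using r by (simp add: \<omega>_def)
        finally have e1: "cmod (H u - npol J C W u) \<le> m0 / 2" unfolding H_def cJ[symmetric] by (simp add: left_diff_distrib)
        have "cmod (npol J C W u - npol J C W z) \<le> A * (1 - r)"
          using npol_lipschitz[of J C u z W] J W0(1) W1 u r z uz by (simp add: A_def k_def)
        then have e2: "cmod (npol J C W u - npol J C W z) < m0 / 2" using Ar by simp
        have pp: "m0 \<le> ppol J C W z" "ppol J C W z \<le> L"
        proof -
          have "\<delta>\<^sup>2 * p0 \<le> \<delta>\<^sup>2 * ppol J C (\<lambda>_. 1) z" using p0(2)[OF z] by (intro mult_left_mono) auto
          also have "\<dots> \<le> ppol J C W z" using W0 \<delta> by (intro ppol_weights J) auto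
          finally show "m0 \<le> ppol J C W z" by (simp add: m0_def)
          show "ppol J C W z \<le> L" unfolding L_def k_def by (intro ppol_upper J z W0 W1)
        qed
        have "npol J C W z - \<kappa> * of_real L * z ^ (k - 2) = \<kappa> * z ^ (k - 2) * of_real (ppol J C W z - L)"
          using npol_circle[where w = W, OF J(1-3) z] by (simp add: \<kappa>_def k_def algebra_simps)
        then have "cmod (npol J C W z - \<kappa> * of_real L * z ^ (k - 2)) = \<bar>ppol J C W z - L\<bar>"
          using \<kappa> z by (simp only: norm_mult norm_power norm_of_real) simp
        then have e3: "cmod (npol J C W z - \<kappa> * of_real L * z ^ (k - 2)) \<le> L - m0" using pp by simp
        have "H u - \<kappa> * of_real L * z ^ (k - 2) = (H u - npol J C W u) + ((npol J C W u - npol J C W z) + (npol J C W z - \<kappa> * of_real L * z ^ (k - 2)))" by simp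
        moreover have "cmod (a + (b + c)) \<le> cmod a + (cmod b + cmod c)" for a b c :: complex
          using norm_triangle_ineq[of a "b + c"] norm_triangle_ineq[of b c] by linarith
        ultimately have "cmod (H u - \<kappa> * of_real L * z ^ (k - 2)) \<le> cmod (H u - npol J C W u) + (cmod (npol J C W u - npol J C W z) + cmod (npol J C W z - \<kappa> * of_real L * z ^ (k - 2)))"
          by (simp only:)
        then show ?thesis using e1 e2 e3 unfolding z_def by linarith
      qed
      \<comment> \<open>Rouche's theorem needs an open domain containing the circle |u| = r on which
        both functions are holomorphic.\<close>
      define s where "s = (1 + r) / 2"
      have s: "r < s" "s < 1" using r by (auto simp: s_def)
      define F where "F u = \<kappa> * of_real L * (u / of_real r) ^ (k - 2)" for u
      define D where "D u = H u - F u" for u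
      have F_holo: "F holomorphic_on ball 0 s" unfolding F_def[abs_def] using r0 by (intro holomorphic_intros) auto
      have HD: "H holomorphic_on ball 0 s" using H_holo by (rule holomorphic_on_subset) (use s in auto)
      have FN: "cmod (F u) = L" if "cmod u = r" for u
        using that \<kappa> L r0 by (simp add: F_def norm_mult norm_power norm_divide)
      have Fz: "F u = 0 \<longleftrightarrow> u = 0 \<and> k > 2" for u using \<kappa> L r0 by (auto simp: F_def)
      have HF: "cmod (H u - F u) < L" if "cmod u = r" for u using H_near[OF that] unfolding F_def .
      have Hb: "H p \<noteq> 0" if "cmod p = r" for p
      proof
        assume "H p = 0"
        then show False using HF[OF that] FN[OF that] by simp
      qed
      have Hr: "H (of_real r) \<noteq> 0" using Hb[of "of_real r"] r0 by simp
      have finH: "finite {p \<in> ball 0 s. H p = 0}"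
      proof (cases "H constant_on ball 0 1")
        case True
        then obtain c where c: "\<And>x. x \<in> ball 0 1 \<Longrightarrow> H x = c" unfolding constant_on_def by blast
        have "c \<noteq> 0" using Hr c[of "of_real r"] r r0 by simp
        then have "{p \<in> ball 0 s. H p = 0} = {}" using c s by auto
        then show ?thesis by (simp only: finite.emptyI)
      next
        case False
        have "finite {p \<in> cball 0 s. H p = 0}"
          by (rule holomorphic_compact_finite_zeros[OF H_holo _ _ _ _ False]) (use s in auto)
        then show ?thesis by (rule rev_finite_subset) auto
      qed
      have eqH: "(\<lambda>p. F p + D p) = H" by (auto simp: D_def)
      have R: "(\<Sum>p\<in>{p \<in> ball 0 s. F p + D p = 0}. winding_number (circlepath 0 r) p * zorder (\<lambda>p. F p + D p) p)
          = (\<Sum>p\<in>{p \<in> ball 0 s. F p = 0}. winding_number (circlepath 0 r) p * zorder F p)"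
      proof (rule Rouche_theorem)
        show "finite {p \<in> ball 0 s. F p + D p = 0}" using finH by (simp add: D_def)
        have "{p \<in> ball 0 s. F p = 0} \<subseteq> {0}" using Fz by auto
        then show "finite {p \<in> ball 0 s. F p = 0}" by (rule finite_subset) simp
        show "D holomorphic_on ball 0 s" unfolding D_def[abs_def] by (intro holomorphic_intros HD F_holo)
        show "path_image (circlepath 0 r) \<subseteq> ball 0 s" using r0 s by auto
        show "\<forall>z\<in>path_image (circlepath 0 r). cmod (D z) < cmod (F z)"
          using HF FN r0 by (auto simp: D_def)
        show "\<forall>z. z \<notin> ball 0 s \<longrightarrow> winding_number (circlepath 0 r) z = 0"
          using s r0 by (intro allI impI winding_number_zero_outside[of _ "cball 0 r"]) auto
      qed (use F_holo in auto)
      have VH: "{u. cmod u < r \<and> V u = 0} = {p \<in> ball 0 s. H p = 0 \<and> cmod p < r}"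
        using P_nz r s by (auto simp: H_def)
      have fin: "finite {u. cmod u < r \<and> V u = 0}" unfolding VH by (rule rev_finite_subset[OF finH]) auto
      have wn: "winding_number (circlepath 0 r) p = (if cmod p < r then 1 else 0)" if "H p = 0" for p
      proof (cases "cmod p < r")
        case True then show ?thesis by (simp add: winding_number_circlepath)
      next
        case False
        then have "p \<notin> cball 0 r" using Hb[of p] that by auto
        then show ?thesis using False r0 by (auto intro!: winding_number_zero_outside[of _ "cball 0 r"])
      qed
      have nontriv: "eventually (\<lambda>z. H z \<noteq> 0) (at p)" if "cmod p < 1" for p
      proof -
        have "eventually (\<lambda>z. H z \<noteq> 0 \<and> z \<in> ball 0 1) (at p)"
          by (rule non_zero_neighbour_alt[OF H_holo, of p "of_real r"]) (use that r r0 Hr in auto)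
        then show ?thesis by (rule eventually_mono) simp
      qed
      \<comment> \<open>\<open>P\<close> has no zeros in the disc and changes no order; the orders
        of \<open>V\<close> are nonnegative, so \<open>nat\<close> loses nothing.\<close>
      have zo: "zorder H p = zorder V p" "zorder V p \<ge> 0" if p: "cmod p < 1" "V p = 0" for p
      proof -
        have an: "V analytic_on {p}" "P analytic_on {p}"
        proof -
          show "V analytic_on {p}" unfolding analytic_at using V_holo p by (intro exI[of _ "ball 0 1"]) simp
          show "P analytic_on {p}" unfolding analytic_at using P_holo by (intro exI[of _ UNIV]) simp
        qed
        have "zorder H p = zorder V p + zorder P p" unfolding H_def[abs_def]
          by (rule zorder_times_analytic[OF an]) (use nontriv[OF p(1)] in \<open>simp add: H_def\<close>)
        moreover have "zorder P p = 0" using an(2) P_nz[OF p(1)] by (rule zorder_eq_0I)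
        ultimately show "zorder H p = zorder V p" by simp
        have "\<exists>\<^sub>F z in at p. V z \<noteq> 0"
          using nontriv[OF p(1)] by (intro eventually_frequently) (auto simp: H_def elim!: eventually_mono)
        then show "zorder V p \<ge> 0" using an(1) by (intro zorder_ge_0)
      qed
      have "(\<Sum>p\<in>{p \<in> ball 0 s. H p = 0}. winding_number (circlepath 0 r) p * zorder H p)
        = (\<Sum>p\<in>{u. cmod u < r \<and> V u = 0}. of_int (zorder V p))"
      proof (rule sum.mono_neutral_cong_right[OF finH])
        show "{u. cmod u < r \<and> V u = 0} \<subseteq> {p \<in> ball 0 s. H p = 0}" unfolding VH by blast
        show "\<forall>p\<in>{p \<in> ball 0 s. H p = 0} - {u. cmod u < r \<and> V u = 0}. winding_number (circlepath 0 r) p * zorder H p = 0"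
          unfolding VH using wn by auto
        fix p assume p: "p \<in> {u. cmod u < r \<and> V u = 0}"
        then have "H p = 0" unfolding VH by blast
        then show "winding_number (circlepath 0 r) p * zorder H p = of_int (zorder V p)"
          using wn[of p] zo(1)[of p] p r by simp
      qed
      moreover have "(\<Sum>p\<in>{p \<in> ball 0 s. F p = 0}. winding_number (circlepath 0 r) p * zorder F p) = of_nat (k - 2)"
      proof (cases "k > 2")
        case True
        then have "p \<in> {p \<in> ball 0 s. F p = 0} \<longleftrightarrow> p \<in> {0}" for p using Fz[of p] s r0 by auto
        then have "{p \<in> ball 0 s. F p = 0} = {0}" by blast
        moreover have "zorder F 0 = int (k - 2)"
        proof (rule zorder_eqI[of UNIV 0 "\<lambda>_. \<kappa> * of_real L / of_real r ^ (k - 2)"])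
          show "\<kappa> * complex_of_real L / complex_of_real r ^ (k - 2) \<noteq> 0" using \<kappa> L r0 by auto
          show "F u = \<kappa> * complex_of_real L / complex_of_real r ^ (k - 2) * (u - 0) powi int (k - 2)" for u
            by (simp add: F_def power_divide)
        qed auto
        moreover have "winding_number (circlepath 0 r) 0 = 1" using r0 by (simp add: winding_number_circlepath)
        ultimately show ?thesis by (simp only: sum.insert finite.emptyI empty_iff not_False_eq_True sum.empty) simp
      next
        case False
        then have "p \<notin> {p \<in> ball 0 s. F p = 0}" for p using Fz[of p] by auto
        then have e: "{p \<in> ball 0 s. F p = 0} = {}" by blast
        show ?thesis unfolding e using False by simp
      qed
      ultimately have "(\<Sum>p\<in>{u. cmod u < r \<and> V u = 0}. of_int (zorder V p)) = (of_nat (k - 2) :: complex)"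
        using R unfolding eqH by (simp add: D_def)
      then have "(of_int (\<Sum>p\<in>{u. cmod u < r \<and> V u = 0}. zorder V p) :: complex) = of_int (int (k - 2))" by simp
      then have "(\<Sum>p\<in>{u. cmod u < r \<and> V u = 0}. zorder V p) = int (k - 2)" by (simp only: of_int_eq_iff)
      moreover have "(\<Sum>p\<in>{u. cmod u < r \<and> V u = 0}. zorder V p) = int (\<Sum>p\<in>{u. cmod u < r \<and> V u = 0}. nat (zorder V p))"
        unfolding of_nat_sum by (rule sum.cong[OF refl]) (use zo r in auto)
      ultimately have "(\<Sum>p\<in>{u. cmod u < r \<and> V u = 0}. nat (zorder V p)) = k - 2" by linarith
      then show "finite {u. cmod u < r \<and> vker I \<zeta> w u = 0} \<and> 
         (\<Sum>u\<in>{u. cmod u < r \<and> vker I \<zeta> w u = 0}. nat (zorder (vker I \<zeta> w) u)) = card J - 2"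
        using fin by (simp add: V_def k_def)
    qed
  qed
  then show ?thesis using r01 by blast
qed

context circle_measure begin

lemma vker_pairs: "vker I \<zeta> w z = (\<Sum>i\<in>I. \<Sum>j\<in>I. of_real (w i * w j) * (1 / (\<zeta> i - z) - 1 / (\<zeta> j - z))\<^sup>2) / 2"
  using variance_pairs[OF wsum, of "\<lambda>e. 1 / (\<zeta> e - z)"] by (simp add: vker_def power_divide)

lemma vker_holo: "vker I \<zeta> w holomorphic_on ball 0 1"
  unfolding vker_def[abs_def] using norm\<zeta> by (intro holomorphic_intros) (auto simp: norm_minus_commute)

lemma ball_notin: "cmod z < 1 \<Longrightarrow> z \<notin> \<zeta> ` I" using norm\<zeta> by auto

lemma S1_deriv: assumes "cmod z < 1"
  shows "(S1 has_field_derivative (\<Sum>e\<in>I. of_real (w e) / (\<zeta> e - z)\<^sup>2)) (at z)"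
  unfolding S1_def[abs_def]
proof (rule DERIV_sum)
  fix e assume "e \<in> I"
  then have nz: "\<zeta> e - z \<noteq> 0" using ball_notin[OF assms] by auto
  then have "((\<lambda>z. of_real (w e) / (\<zeta> e - z)) has_field_derivative (0 * (\<zeta> e - z) - of_real (w e) * (0 - 1)) / ((\<zeta> e - z) * (\<zeta> e - z))) (at z)"
    by (intro DERIV_divide DERIV_const DERIV_diff DERIV_ident)
  then show "((\<lambda>z. of_real (w e) / (\<zeta> e - z)) has_field_derivative of_real (w e) / (\<zeta> e - z)\<^sup>2) (at z)"
    by (simp add: power2_eq_square)
qed

lemma G_nz: "cmod z < 1 \<Longrightarrow> G z \<noteq> 0"
  using G_Re[of z] ball_notin[of z] by fastforce

lemma G_holo: "G holomorphic_on ball 0 1"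
  unfolding G_def[abs_def] using norm\<zeta> by (intro holomorphic_intros) (auto simp: norm_minus_commute)

context
  fixes f :: "complex \<Rightarrow> complex" assumes f: "\<And>z. f z = cnj (Nu z / De z)"
begin

lemma f_dbar_disc: assumes "cmod z < 1" shows "dbar f z = cnj (vker I \<zeta> w z * (1 / (G z)\<^sup>2))"
proof -
  let ?S2 = "\<Sum>e\<in>I. of_real (w e) / (\<zeta> e - z)\<^sup>2"
  have G1: "1 + z * S1 z \<noteq> 0" using G_nz[OF assms] S1G(4)[OF ball_notin[OF assms]] by simp
  have "((\<lambda>z. S1 z / (1 + z * S1 z)) has_field_derivative
     (?S2 * (1 + z * S1 z) - S1 z * (0 + (1 * S1 z + ?S2 * z))) / ((1 + z * S1 z) * (1 + z * S1 z))) (at z)"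
    by (intro DERIV_divide DERIV_add DERIV_const DERIV_mult DERIV_ident S1_deriv assms G1)
  moreover have "(?S2 * (1 + z * S1 z) - S1 z * (0 + (1 * S1 z + ?S2 * z))) / ((1 + z * S1 z) * (1 + z * S1 z)) = vker I \<zeta> w z * (1 / (G z)\<^sup>2)"
  proof -
    have "A * (1 + z * S) - S * (0 + (1 * S + A * z)) = A - S\<^sup>2" for A S
      by (simp add: power2_eq_square algebra_simps)
    from this[of ?S2 "S1 z"] show ?thesis
      unfolding vker_def S1_def[symmetric] S1G(4)[OF ball_notin[OF assms]] by (simp add: power2_eq_square)
  qed
  ultimately have D: "((\<lambda>z. S1 z / (1 + z * S1 z)) has_field_derivative vker I \<zeta> w z * (1 / (G z)\<^sup>2)) (at z)" by simp
  have "((\<lambda>z. Nu z / De z) has_field_derivative vker I \<zeta> w z * (1 / (G z)\<^sup>2)) (at z)"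
    by (rule has_field_derivative_transform_within_open[OF D open_ball[of 0 1]]) 
      (use assms S1G ball_notin in auto)
  from dbar_cnj[OF this] show ?thesis using f by (metis (no_types, lifting) ext)
qed

end

text \<open>In the new coordinate 1 / (\<zeta> - z) is an affine function of 1 / (\<zeta>' - u) with
  coefficients independent of the atom. The variance ignores the constant term and is multiplied by
  the square of the slope. The rotation \<open>t\<close> serves to turn the atoms onto a standard
  configuration.\<close>

lemma vker_moebius:
  assumes c: "cmod c < 1" and t: "cmod t = 1" and u: "cmod u < 1"
  defines "\<zeta>' \<equiv> \<lambda>e. cnj t * mob c (\<zeta> e)"
  shows "vker I \<zeta> w (mob_inv c (t * u)) = (cnj t * (1 + cnj c * (t * u))\<^sup>2 / (1 - cnj c * c))\<^sup>2 * vker I \<zeta>' w u"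
proof -
  have tt: "t * cnj t = 1" using t complex_norm_square[of t] by simp
  let ?y = "t * u" and ?q = "1 - cnj c * c"
  have y1: "cmod ?y < 1" using t u by (simp add: norm_mult)
  have q: "?q \<noteq> 0" using one_minus_cnj_mult_nz[OF c, of c] c by simp
  have r: "1 / (\<zeta> e - mob_inv c ?y) = (1 + cnj c * ?y) * cnj c / ?q + (1 + cnj c * ?y)\<^sup>2 / ?q * (cnj t * (1 / (\<zeta>' e - u)))"
    if e: "e \<in> I" for e
  proof -
    let ?x = "mob c (\<zeta> e)"
    have x1: "cmod ?x = 1" using norm_mob_eq[OF c norm\<zeta>[OF e]] .
    have ze: "\<zeta> e = mob_inv c ?x" using mob_inv_mob[OF c] norm\<zeta>[OF e] by simp
    have xy: "?x - ?y \<noteq> 0" using x1 y1 by auto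
    have n: "1 + cnj c * ?x \<noteq> 0" "1 + cnj c * ?y \<noteq> 0" using one_minus_cnj_mult_nz[OF c] x1 y1 by auto
    have "\<zeta> e - mob_inv c ?y = (?x - ?y) * ?q / ((1 + cnj c * ?x) * (1 + cnj c * ?y))"
      using mob_diff[of "- c" ?x ?y] c x1 y1 ze by (simp add: mob_inv_eq_mob)
    then have "1 / (\<zeta> e - mob_inv c ?y) = (1 + cnj c * ?y) / ?q * ((1 + cnj c * ?x) / (?x - ?y))"
      using n xy q by (simp add: mult_ac)
    also have "1 + cnj c * ?x = cnj c * (?x - ?y) + (1 + cnj c * ?y)" by (simp add: algebra_simps)
    also have "(cnj c * (?x - ?y) + (1 + cnj c * ?y)) / (?x - ?y) = cnj c + (1 + cnj c * ?y) * (1 / (?x - ?y))"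
      using xy by (simp add: add_divide_distrib)
    also have "?x - ?y = t * (\<zeta>' e - u)" using tt by (simp add: \<zeta>'_def algebra_simps)
    also have "1 / (t * (\<zeta>' e - u)) = cnj t * (1 / (\<zeta>' e - u))"
    proof -
      have "t \<noteq> 0" using t by auto
      then have "1 / t = cnj t" using tt by (simp add: field_simps)
      then show ?thesis by (metis (no_types, lifting) mult_1_right times_divide_times_eq)
    qed
    finally show ?thesis by (simp add: algebra_simps power2_eq_square add_divide_distrib)
  qed
  let ?K = "cnj t * (1 + cnj c * ?y)\<^sup>2 / ?q"
  have "vker I \<zeta> w (mob_inv c ?y) = (\<Sum>i\<in>I. \<Sum>j\<in>I. of_real (w i * w j) * (1 / (\<zeta> i - mob_inv c ?y) - 1 / (\<zeta> j - mob_inv c ?y))\<^sup>2) / 2"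
    by (rule vker_pairs)
  also have "\<dots> = (\<Sum>i\<in>I. \<Sum>j\<in>I. ?K\<^sup>2 * (of_real (w i * w j) * (1 / (\<zeta>' i - u) - 1 / (\<zeta>' j - u))\<^sup>2)) / 2"
  proof (intro arg_cong[of _ _ "\<lambda>x. x / 2"] sum.cong refl)
    fix i j assume ij: "i \<in> I" "j \<in> I"
    have "1 / (\<zeta> i - mob_inv c ?y) - 1 / (\<zeta> j - mob_inv c ?y) = ?K * (1 / (\<zeta>' i - u) - 1 / (\<zeta>' j - u))"
    proof -
      have "(A + B / q * (T * x)) - (A + B / q * (T * y)) = (T * B / q) * (x - y)" for A B q T x y :: complex
        by (simp add: algebra_simps diff_divide_distrib)
      then show ?thesis unfolding r[OF ij(1)] r[OF ij(2)] by blast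
    qed
    then show "of_real (w i * w j) * (1 / (\<zeta> i - mob_inv c ?y) - 1 / (\<zeta> j - mob_inv c ?y))\<^sup>2 =
       ?K\<^sup>2 * (of_real (w i * w j) * (1 / (\<zeta>' i - u) - 1 / (\<zeta>' j - u))\<^sup>2)"
      by (simp only: power_mult_distrib mult_ac)
  qed
  also have "\<dots> = ?K\<^sup>2 * ((\<Sum>i\<in>I. \<Sum>j\<in>I. of_real (w i * w j) * (1 / (\<zeta>' i - u) - 1 / (\<zeta>' j - u))\<^sup>2) / 2)"
    by (simp only: sum_distrib_left[symmetric] times_divide_eq_right)
  also have "(\<Sum>i\<in>I. \<Sum>j\<in>I. of_real (w i * w j) * (1 / (\<zeta>' i - u) - 1 / (\<zeta>' j - u))\<^sup>2) / 2 = vker I \<zeta>' w u"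
    using variance_pairs[OF wsum, of "\<lambda>e. 1 / (\<zeta>' e - u)"] by (simp add: vker_def power_divide)
  finally show ?thesis .
qed

text \<open>Orders of zeros survive each step: 1 / G^2 and K^2 have no zeros in the disc, and the
  change of variable has order 1 at every point. The radius 2 artanh r is the hyperbolic radius of
  the disc |u| < r.\<close>

lemma num_crit_eq:
  assumes f: "\<And>z. f z = cnj (Nu z / De z)"
    and c: "cmod c < 1" and t: "cmod t = 1" and r: "0 < r" "r < 1"
    and fin: "finite {u. cmod u < r \<and> vker I (\<lambda>e. cnj t * mob c (\<zeta> e)) w u = 0}"
  shows "num_crit f (hball c (2 * artanh r)) =
     (\<Sum>u\<in>{u. cmod u < r \<and> vker I (\<lambda>e. cnj t * mob c (\<zeta> e)) w u = 0}. nat (zorder (vker I (\<lambda>e. cnj t * mob c (\<zeta> e)) w) u))"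
proof -
  define \<zeta>' where "\<zeta>' = (\<lambda>e. cnj t * mob c (\<zeta> e))"
  define V V' where "V = vker I \<zeta> w" and "V' = vker I \<zeta>' w"
  define h where "h u = mob_inv c (t * u)" for u
  define K where "K u = cnj t * (1 + cnj c * (t * u))\<^sup>2 / (1 - cnj c * c)" for u
  have tt: "cnj t * t = 1" using t complex_norm_square[of t] by (simp add: mult.commute)
  have tu: "cmod (t * u) = cmod u" "cmod (cnj t * u) = cmod u" for u using t by (simp_all add: norm_mult)
  have h1: "cmod (h u) < 1" if "cmod u < 1" for u unfolding h_def using c that tu by (intro norm_mob_inv_less) auto
  have VK: "V (h u) = (K u)\<^sup>2 * V' u" if "cmod u < 1" for u
    unfolding V_def V'_def h_def K_def \<zeta>'_def by (rule vker_moebius[OF c t that])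
  have q: "1 - cnj c * c \<noteq> 0" using one_minus_cnj_mult_nz[OF c, of c] c by simp
  have n1: "1 + cnj c * (t * u) \<noteq> 0" if "cmod u < 1" for u
    using one_minus_cnj_mult_nz(2)[OF c, of "t * u"] that tu by simp
  have Knz: "K u \<noteq> 0" if "cmod u < 1" for u using n1[OF that] q t by (auto simp: K_def)
  have h_inv: "cnj t * mob c (h u) = u" if "cmod u < 1" for u
    unfolding h_def using mob_mob_inv[OF c, of "t * u"] that tu tt by (simp add: mult.assoc[symmetric])
  have inv_h: "h (cnj t * mob c z) = z" if "cmod z < 1" for z
    unfolding h_def using mob_inv_mob[OF c, of z] that tt by (simp add: mult.assoc[symmetric] mult.commute[of t])
  have V'_nz: "\<zeta>' e - x \<noteq> 0" if "e \<in> I" "x \<in> ball 0 1" for e x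
  proof -
    have "cmod (\<zeta>' e) = 1" using tu(2) norm_mob_eq[OF c norm\<zeta>[OF that(1)]] by (simp add: \<zeta>'_def)
    then show ?thesis using that(2) by auto
  qed
  have V'_holo: "V' holomorphic_on ball 0 1"
    unfolding V'_def vker_def[abs_def] by (intro holomorphic_intros) (use V'_nz in auto)
  have V_holo: "V holomorphic_on ball 0 1" unfolding V_def by (rule vker_holo)
  \<comment> \<open>Finiteness of the zero set yields a point where the kernel is nonzero, so it
    does not vanish identically and the orders are meaningful.\<close>
  obtain \<beta>' where \<beta>': "cmod \<beta>' < r" "V' \<beta>' \<noteq> 0"
  proof -
    have "infinite (ball (0::complex) r)" using uncountable_ball[OF r(1), of "0::complex"] countable_finite by blast
    then have "\<not> ball (0::complex) r \<subseteq> {u. cmod u < r \<and> V' u = 0}"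
      using fin finite_subset unfolding V'_def \<zeta>'_def by blast
    then obtain x where "x \<in> ball 0 r" "x \<notin> {u. cmod u < r \<and> V' u = 0}" by blast
    then show ?thesis by (intro that[of x]) auto
  qed
  have \<beta>: "cmod (h \<beta>') < 1" "V (h \<beta>') \<noteq> 0" using h1[of \<beta>'] VK[of \<beta>'] Knz[of \<beta>'] \<beta>' r by auto
  have evV: "eventually (\<lambda>z. V z \<noteq> 0) (at p)" if "cmod p < 1" for p
  proof -
    have "eventually (\<lambda>z. V z \<noteq> 0 \<and> z \<in> ball 0 1) (at p)"
      by (rule non_zero_neighbour_alt[OF V_holo, of p "h \<beta>'"]) (use that \<beta> in auto)
    then show ?thesis by (rule eventually_mono) simp
  qed
  have anV: "V analytic_on {p}" if "cmod p < 1" for p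
    unfolding analytic_at using V_holo that by (intro exI[of _ "ball 0 1"]) auto
  have anG: "(\<lambda>z. 1 / (G z)\<^sup>2) analytic_on {p}" if "cmod p < 1" for p
    unfolding analytic_at using G_holo G_nz that by (intro exI[of _ "ball 0 1"]) (auto intro!: holomorphic_intros)
  have evball: "eventually (\<lambda>z. z \<in> ball 0 1) (at p)" if "cmod p < 1" for p :: complex
    using that by (intro eventually_at_in_open') auto
  have z1: "zorder (\<lambda>w. cnj (dbar f w)) p = zorder V p" if p: "cmod p < 1" for p
  proof -
    have "zorder (\<lambda>w. cnj (dbar f w)) p = zorder (\<lambda>z. V z * (1 / (G z)\<^sup>2)) p"
    proof (rule zorder_cong)
      show "eventually (\<lambda>z. cnj (dbar f z) = V z * (1 / (G z)\<^sup>2)) (at p)"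
        using evball[OF p] by eventually_elim (simp add: f_dbar_disc[OF f] V_def)
    qed simp
    also have "\<dots> = zorder V p + zorder (\<lambda>z. 1 / (G z)\<^sup>2) p"
    proof (rule zorder_times_analytic[OF anV[OF p] anG[OF p]])
      show "eventually (\<lambda>z. V z * (1 / (G z)\<^sup>2) \<noteq> 0) (at p)"
        using evV[OF p] evball[OF p] by eventually_elim (use G_nz in auto)
    qed
    also have "zorder (\<lambda>z. 1 / (G z)\<^sup>2) p = 0" using anG[OF p] G_nz[OF p] by (intro zorder_eq_0I) auto
    finally show ?thesis by simp
  qed
  have z2: "zorder V (h u) = zorder V' u" if u: "cmod u < 1" for u
  proof -
    have hol_h: "h holomorphic_on ball 0 1" unfolding h_def mob_inv_def using n1 by (intro holomorphic_intros) auto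
    have an_h: "h analytic_on {u}" unfolding analytic_at using hol_h u by (intro exI[of _ "ball 0 1"]) auto
    have hd: "h x - h u = (t * (1 - cnj c * c) / ((1 + cnj c * (t * x)) * (1 + cnj c * (t * u)))) * (x - u)"
      if "cmod x < 1" for x
      using mob_diff[of "- c" "t * x" "t * u"] c tu u that by (simp add: h_def mob_inv_eq_mob algebra_simps)
    have "zorder (\<lambda>x. h x - h u) u = 1"
    proof (rule zorder_eqI[of "ball 0 1" u "\<lambda>x. t * (1 - cnj c * c) / ((1 + cnj c * (t * x)) * (1 + cnj c * (t * u)))"])
      show "(\<lambda>x. t * (1 - cnj c * c) / ((1 + cnj c * (t * x)) * (1 + cnj c * (t * u)))) holomorphic_on ball 0 1"
        using n1 u by (intro holomorphic_intros) auto
      show "t * (1 - cnj c * c) / ((1 + cnj c * (t * u)) * (1 + cnj c * (t * u))) \<noteq> 0" using n1[OF u] q t by auto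
      show "h x - h u = t * (1 - cnj c * c) / ((1 + cnj c * (t * x)) * (1 + cnj c * (t * u))) * (x - u) powi 1"
        if "x \<in> ball 0 1" for x using hd[of x] that by simp
    qed (use u in auto)
    moreover have "zorder (V \<circ> h) u = zorder V (h u) * zorder (\<lambda>x. h x - h u) u"
    proof (rule zorder_compose'[OF _ _ an_h evV[OF h1[OF u]]])
      show "isolated_singularity_at V (h u)" using anV[OF h1[OF u]] by (rule isolated_singularity_at_analytic)
      show "not_essential V (h u)" using anV[OF h1[OF u]] by (rule not_essential_analytic)
      show "eventually (\<lambda>x. h x \<noteq> h u) (at u)"
        using evball[OF u] eventually_neq_at_within[of u] 
      proof eventually_elim
        case (elim x)
        then show ?case using h_inv[of x] h_inv[OF u] by auto
      qed
    qed
    ultimately have "zorder (V \<circ> h) u = zorder V (h u)" by simp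
    moreover have "zorder (V \<circ> h) u = zorder (\<lambda>x. (K x)\<^sup>2 * V' x) u"
      by (rule zorder_cong) (use evball[OF u] in \<open>auto elim!: eventually_mono simp: VK\<close>)
    moreover have "zorder (\<lambda>x. (K x)\<^sup>2 * V' x) u = zorder (\<lambda>x. (K x)\<^sup>2) u + zorder V' u"
    proof (rule zorder_times_analytic)
      show "(\<lambda>x. (K x)\<^sup>2) analytic_on {u}" unfolding K_def using q by (intro analytic_intros) auto
      show "V' analytic_on {u}" unfolding analytic_at using V'_holo u by (intro exI[of _ "ball 0 1"]) auto
      have "eventually (\<lambda>z. V' z \<noteq> 0 \<and> z \<in> ball 0 1) (at u)"
        by (rule non_zero_neighbour_alt[OF V'_holo, of u "\<beta>'"]) (use u \<beta>' r in auto)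
      then show "eventually (\<lambda>z. (K z)\<^sup>2 * V' z \<noteq> 0) (at u)" by eventually_elim (use Knz in auto)
    qed
    moreover have "zorder (\<lambda>x. (K x)\<^sup>2) u = 0"
      using Knz[OF u] q by (intro zorder_eq_0I) (auto simp: K_def intro!: analytic_intros)
    ultimately show ?thesis by simp
  qed
  have dz: "dbar f z = 0 \<longleftrightarrow> V z = 0" if "cmod z < 1" for z
    using f_dbar_disc[OF f that] G_nz[OF that] by (simp add: V_def)
  have hb: "z \<in> hball c (2 * artanh r) \<longleftrightarrow> cmod z < 1 \<and> cmod (mob c z) < r" for z
    using hdist_less_iff[of z c r] c r by (auto simp: hball_def hdist_commute[of c])
  have bij: "bij_betw h {u. cmod u < r \<and> V' u = 0} {z \<in> hball c (2 * artanh r). dbar f z = 0}"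
  proof (rule bij_betw_byWitness[where f' = "\<lambda>z. cnj t * mob c z"])
    show "\<forall>u\<in>{u. cmod u < r \<and> V' u = 0}. cnj t * mob c (h u) = u" using h_inv r by auto
    show "\<forall>z\<in>{z \<in> hball c (2 * artanh r). dbar f z = 0}. h (cnj t * mob c z) = z" using inv_h by (auto simp: hb)
    show "h ` {u. cmod u < r \<and> V' u = 0} \<subseteq> {z \<in> hball c (2 * artanh r). dbar f z = 0}"
    proof
      fix z assume "z \<in> h ` {u. cmod u < r \<and> V' u = 0}"
      then obtain u where u: "z = h u" "cmod u < r" "V' u = 0" by auto
      have u1: "cmod u < 1" using u r by simp
      have "cmod (mob c z) = cmod u" using h_inv[OF u1] tu(2)[of "mob c z"] u by simp
      then show "z \<in> {z \<in> hball c (2 * artanh r). dbar f z = 0}"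
        using u u1 h1[OF u1] VK[OF u1] by (auto simp: hb dz)
    qed
    show "(\<lambda>z. cnj t * mob c z) ` {z \<in> hball c (2 * artanh r). dbar f z = 0} \<subseteq> {u. cmod u < r \<and> V' u = 0}"
    proof
      fix u assume "u \<in> (\<lambda>z. cnj t * mob c z) ` {z \<in> hball c (2 * artanh r). dbar f z = 0}"
      then obtain z where z': "z \<in> hball c (2 * artanh r)" "dbar f z = 0" and zu: "u = cnj t * mob c z" by blast
      have z: "u = cnj t * mob c z" "cmod z < 1" "cmod (mob c z) < r" "V z = 0"
        using zu z' hb[of z] dz[of z] by auto
      have u1: "cmod u < r" using z tu by simp
      have "V (h u) = 0" using inv_h[OF z(2)] z by simp
      then show "u \<in> {u. cmod u < r \<and> V' u = 0}" using VK[of u] Knz[of u] u1 r by simp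
    qed
  qed
  have "num_crit f (hball c (2 * artanh r)) = (\<Sum>u\<in>{u. cmod u < r \<and> V' u = 0}. nat (zorder (\<lambda>w. cnj (dbar f w)) (h u)))"
    unfolding num_crit_def by (rule sum.reindex_bij_betw[OF bij, symmetric])
  also have "\<dots> = (\<Sum>u\<in>{u. cmod u < r \<and> V' u = 0}. nat (zorder V' u))"
    by (rule sum.cong[OF refl]) (use z1 z2 h1 r in auto)
  finally show ?thesis unfolding V'_def \<zeta>'_def .
qed

text \<open>Mass \<delta> is set aside at each of the two separated atoms. By the parallelogram law
  their sum has modulus at most sqrt (4 - s^2) instead of 2; the remaining mass is estimated
  trivially. The barycentre therefore stays in a disc of radius less than 1.\<close>

lemma displacement:
  assumes f: "\<And>z. f z = cnj (Nu z / De z)" and x: "cmod x < 1"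
    and e: "a \<in> I" "b \<in> I" "a \<noteq> b" "\<delta> \<le> w a" "\<delta> \<le> w b" "0 < \<delta>"
    and s: "0 < s" "s \<le> cmod (mob x (\<zeta> a) - mob x (\<zeta> b))"
  shows "hdist (f x) x \<le> 2 * artanh (1 - \<delta> * (2 - sqrt (4 - s\<^sup>2)))"
proof -
  let ?u = "\<lambda>e. mob x (\<zeta> e)"
  have u1: "cmod (?u e) = 1" if "e \<in> I" for e using norm_mob_eq[OF x norm\<zeta>[OF that]] .
  have "s \<le> 2" using s norm_triangle_ineq4[of "?u a" "?u b"] u1 e by simp
  then have s4: "0 \<le> 4 - s\<^sup>2" "sqrt (4 - s\<^sup>2) < 2"
    using power_mono[of s 2 2] s real_sqrt_less_mono[of "4 - s\<^sup>2" 4] by auto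
  have "(cmod (p + q))\<^sup>2 + (cmod (p - q))\<^sup>2 = 2 * (cmod p)\<^sup>2 + 2 * (cmod q)\<^sup>2" for p q
    unfolding cmod_power2 by (simp add: power2_eq_square algebra_simps)
  from this[of "?u a" "?u b"] have "(cmod (?u a + ?u b))\<^sup>2 + (cmod (?u a - ?u b))\<^sup>2 = 4"
    using u1[OF e(1)] u1[OF e(2)] by simp
  moreover have "s\<^sup>2 \<le> (cmod (?u a - ?u b))\<^sup>2" using s by (intro power_mono) auto
  ultimately have "(cmod (?u a + ?u b))\<^sup>2 \<le> 4 - s\<^sup>2" by linarith
  then have ab: "cmod (?u a + ?u b) \<le> sqrt (4 - s\<^sup>2)" by (rule real_le_rsqrt)
  let ?R = "I - {a} - {b}"
  have split: "sum g I = g a + (g b + sum g ?R)" for g :: "'e \<Rightarrow> 'x::comm_monoid_add"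
    using finI e by (simp add: sum.remove[of I a] sum.remove[of "I - {a}" b])
  have "(\<Sum>e\<in>I. of_real (w e) * ?u e) = of_real \<delta> * (?u a + ?u b) + (of_real (w a - \<delta>) * ?u a + (of_real (w b - \<delta>) * ?u b
      + (\<Sum>e\<in>?R. of_real (w e) * ?u e)))"
    unfolding split by (simp add: algebra_simps)
  then have "cmod (\<Sum>e\<in>I. of_real (w e) * ?u e) \<le> cmod (of_real \<delta> * (?u a + ?u b)) + (cmod (of_real (w a - \<delta>) * ?u a)
     + (cmod (of_real (w b - \<delta>) * ?u b) + cmod (\<Sum>e\<in>?R. of_real (w e) * ?u e)))"
    by (simp only:) (intro order_trans[OF norm_triangle_ineq] add_left_mono norm_triangle_ineq; simp add: norm_triangle_le norm_triangle_ineq)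
  also have "\<dots> \<le> \<delta> * sqrt (4 - s\<^sup>2) + ((w a - \<delta>) + ((w b - \<delta>) + sum w ?R))"
  proof (intro add_mono)
    show "cmod (of_real \<delta> * (?u a + ?u b)) \<le> \<delta> * sqrt (4 - s\<^sup>2)" using ab e by (simp add: norm_mult)
    show "cmod (of_real (w a - \<delta>) * ?u a) \<le> w a - \<delta>" unfolding norm_mult norm_of_real u1[OF e(1)] using e by simp
    show "cmod (of_real (w b - \<delta>) * ?u b) \<le> w b - \<delta>" unfolding norm_mult norm_of_real u1[OF e(2)] using e by simp
    show "cmod (\<Sum>e\<in>?R. of_real (w e) * ?u e) \<le> sum w ?R"
      by (rule order_trans[OF norm_sum]) (auto intro!: sum_mono simp: norm_mult u1 wpos less_imp_le abs_of_pos)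
  qed
  also have "\<dots> = 1 - \<delta> * (2 - sqrt (4 - s\<^sup>2))" using split[of w] wsum by (simp add: algebra_simps)
  finally have 1: "cmod (\<Sum>e\<in>I. of_real (w e) * ?u e) \<le> 1 - \<delta> * (2 - sqrt (4 - s\<^sup>2))" .
  have lt: "1 - \<delta> * (2 - sqrt (4 - s\<^sup>2)) < 1" using s4 e by simp
  show ?thesis unfolding hdist_mob_eq f_mob[OF f x]
    using artanh_mono[OF norm_ge_zero 1 lt] by simp
qed

text \<open>\<open>eta\<close> maps the fixed points in question to fixed points on the circle,
  which are atoms, and there the multiplier is at most 1 / \<delta>.\<close>

lemma in_BK_measure:
  assumes f: "\<And>z. antiblaschke d a z = cnj (Nu z / De z)" and a: "a \<in> bparams d"
    and \<delta>: "0 < \<delta>" "\<And>e. e \<in> I \<Longrightarrow> \<delta> \<le> w e"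
  shows "in_BK d (ln (1 / \<delta>)) a"
  unfolding in_BK_def
proof (intro conjI a allI impI)
  fix x :: real assume "\<exists>n::int. - real d * x = x + of_int n"
  then obtain n :: int where n: "- real d * x = x + of_int n" by blast
  have "eta d a x \<in> \<zeta> ` I"
    by (rule f_fix_only[of "antiblaschke d a"]) (use f eta_fixed[OF d2 a n] in auto)
  then obtain j where j: "j \<in> I" "eta d a x = \<zeta> j" by blast
  have c: "cmod (dbar (antiblaschke d a) (eta d a x)) = 1 / w j - 1"
    unfolding j(2) by (rule f_dbar[OF f j(1)])
  have "1 / w j - 1 > 0" using w_less[OF f j(1)] wpos[OF j(1)] by (simp add: field_simps)
  moreover have "1 / w j - 1 \<le> 1 / \<delta>" using \<delta> j(1) by (smt (verit) frac_le)
  ultimately show "ln (cmod (dbar (antiblaschke d a) (eta d a x))) \<le> ln (1 / \<delta>)"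
    unfolding c using \<delta> by (subst ln_le_cancel_iff) auto
qed

lemma rotated: assumes "cmod l = 1" shows "circle_measure I (\<lambda>e. l * \<zeta> e) w d"
proof
  show "inj_on (\<lambda>e. l * \<zeta> e) I" using inj assms by (auto simp: inj_on_def)
  show "(\<Sum>e\<in>I. of_real (w e) * (l * \<zeta> e)) = 0"
    using bary by (simp add: mult.left_commute flip: sum_distrib_left)
qed (use d2 finI cardI norm\<zeta> wpos wsum assms in \<open>auto simp: norm_mult\<close>)

end

text \<open>Rotating the measure normalises the unimodular factor, and the remaining freedom of a
  \<open>(d + 1)\<close>-st root of unity moves the marking to any prescribed point.\<close>

lemma circle_measure_realize:
  assumes "circle_measure I \<zeta> w d" "m \<in> I"
  shows "\<exists>l a. cmod l = 1 \<and> a \<in> bparams d \<and> eta d a 0 = l * \<zeta> m \<and> circle_measure I (\<lambda>e. l * \<zeta> e) w d \<and>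
    (\<forall>z. antiblaschke d a z = cnj (circle_measure.Nu I (\<lambda>e. l * \<zeta> e) w z / circle_measure.De I (\<lambda>e. l * \<zeta> e) w z))"
proof -
  interpret A: circle_measure I \<zeta> w d by fact
  \<comment> \<open>The factor that turns the product of the atoms into (- 1)^d. There are d + 1
    atoms, so a (d + 1)-st root of it is the rotation wanted.\<close>
  define X where "X = (-1) ^ d * cnj (\<Prod>k\<in>I. \<zeta> k)"
  have pn: "cmod (\<Prod>k\<in>I. \<zeta> k) = 1" by (simp add: prod_norm[symmetric] A.norm\<zeta>)
  then have "cmod X = 1" unfolding X_def norm_mult norm_power complex_mod_cnj by simp
  then obtain t where t: "circ t = X" using circ_surj by blast
  define l0 where "l0 = circ (t / real (d + 1))"
  have l0: "cmod l0 = 1" by (simp add: l0_def)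
  have "l0 ^ (d + 1) = cis (real (d + 1) * (2 * pi * (t / real (d + 1))))" unfolding l0_def circ_def by (rule Complex.DeMoivre)
  also have "real (d + 1) * (2 * pi * (t / real (d + 1))) = 2 * pi * t" by simp
  finally have l0d: "l0 ^ (d + 1) = X" using t by (simp add: circ_def)
  let ?z1 = "\<lambda>e. l0 * \<zeta> e"
  interpret B: circle_measure I ?z1 w d by (rule A.rotated[OF l0])
  have "(\<Prod>k\<in>I. ?z1 k) = X * (\<Prod>k\<in>I. \<zeta> k)" by (simp only: prod.distrib prod_constant A.cardI l0d)
  also have "\<dots> = (-1) ^ d * ((\<Prod>k\<in>I. \<zeta> k) * cnj (\<Prod>k\<in>I. \<zeta> k))" by (simp add: X_def)
  also have "(\<Prod>k\<in>I. \<zeta> k) * cnj (\<Prod>k\<in>I. \<zeta> k) = 1" using pn complex_norm_square[of "\<Prod>k\<in>I. \<zeta> k"] by simp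
  finally obtain a0 where a0: "a0 \<in> bparams d" "\<And>z. antiblaschke d a0 z = cnj (B.Nu z / B.De z)"
    using B.antiblaschke_form by auto
  have fx: "antiblaschke d a0 (?z1 m) = ?z1 m" by (rule B.f_fix[OF a0(2) assms(2)])
  obtain l1 where l1: "cmod l1 = 1" "l1 ^ (d + 1) = 1" "(\<lambda>i. cnj l1 * a0 i) \<in> bparams d"
     "eta d (\<lambda>i. cnj l1 * a0 i) 0 = l1 * ?z1 m"
    using eta_rotate[OF A.d2 a0(1) B.norm\<zeta>[OF assms(2)] fx] by blast
  define l where "l = l1 * l0"
  let ?a = "\<lambda>i. cnj l1 * a0 i"
  have l: "cmod l = 1" using l0 l1 by (simp add: l_def norm_mult)
  have le: "(\<lambda>e. l * \<zeta> e) = (\<lambda>e. l1 * ?z1 e)" by (simp add: l_def mult.assoc)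
  interpret D: circle_measure I "\<lambda>e. l * \<zeta> e" w d by (rule A.rotated[OF l])
  have ll: "l1 * cnj l1 = 1" using l1 complex_norm_square[of l1] by simp
  have l1nz: "l1 \<noteq> 0" using l1 by auto
  \<comment> \<open>Rotation by a (d + 1)-st root of unity keeps the normalisation, and the rotated
    measure belongs to the conjugated map l1 f (conj l1 z).\<close>
  have "antiblaschke d ?a z = cnj (D.Nu z / D.De z)" for z
  proof -
    define y where "y = cnj l1 * z"
    have zy: "z = l1 * y" using ll by (simp add: y_def mult.assoc[symmetric])
    have pr: "(\<Prod>k\<in>I-{e}. l * \<zeta> k - z) = l1 ^ d * (\<Prod>k\<in>I-{e}. ?z1 k - y)" if "e \<in> I" for e
    proof -
      have "card (I - {e}) = d" using that A.cardI A.finI by simp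
      moreover have "(\<Prod>k\<in>I-{e}. l * \<zeta> k - z) = (\<Prod>k\<in>I-{e}. l1 * (?z1 k - y))"
        by (rule prod.cong[OF refl]) (simp add: zy l_def algebra_simps)
      ultimately show ?thesis by (simp add: prod.distrib)
    qed
    have N: "D.Nu z = l1 ^ d * B.Nu y"
      unfolding D.Nu_def B.Nu_def sum_distrib_left by (rule sum.cong[OF refl]) (simp add: pr mult_ac)
    have "D.De z = l1 ^ (d + 1) * B.De y"
      unfolding D.De_def B.De_def sum_distrib_left by (rule sum.cong[OF refl]) (simp add: pr, simp add: l_def mult_ac)
    then have De: "D.De z = B.De y" by (simp only: l1(2) mult_1)
    have pw: "cnj (l1 ^ d) = l1"
    proof -
      have "l1 ^ d * l1 = 1" using l1(2) by (simp add: mult.commute)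
      then have "l1 ^ d = cnj l1" using ll l1nz by (metis mult.commute mult_right_cancel)
      then show ?thesis by simp
    qed
    have "cnj (D.Nu z / D.De z) = cnj (l1 ^ d) * cnj (B.Nu y / B.De y)" by (simp add: N De)
    also have "\<dots> = l1 * antiblaschke d a0 y" unfolding pw a0(2) ..
    finally have 1: "cnj (D.Nu z / D.De z) = l1 * antiblaschke d a0 y" .
    have cy: "cnj y = l1 * cnj z" by (simp add: y_def)
    have "(\<Prod>i<d-1. (cnj y - a0 i) / (1 - cnj (a0 i * y))) = (\<Prod>i<d-1. l1 * ((cnj z - ?a i) / (1 - cnj (?a i * z))))"
    proof (rule prod.cong[OF refl])
      fix i
      have "cnj y - a0 i = l1 * (cnj z - ?a i)" using ll by (simp add: cy right_diff_distrib mult.assoc[symmetric])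
      moreover have "a0 i * y = ?a i * z" by (simp add: y_def)
      ultimately show "(cnj y - a0 i) / (1 - cnj (a0 i * y)) = l1 * ((cnj z - ?a i) / (1 - cnj (?a i * z)))"
        by (simp only: times_divide_eq_right)
    qed
    also have "\<dots> = l1 ^ (d - 1) * (\<Prod>i<d-1. (cnj z - ?a i) / (1 - cnj (?a i * z)))" by (simp only: prod.distrib prod_constant card_lessThan)
    finally have "antiblaschke d a0 y = (l1 * l1 ^ (d - 1)) * antiblaschke d ?a z"
      unfolding antiblaschke_def cy by (simp only: mult_ac)
    moreover have "l1 * (l1 * l1 ^ (d - 1)) = l1 ^ (d + 1)" using A.d2 by (cases d) auto
    ultimately have "l1 * antiblaschke d a0 y = antiblaschke d ?a z" using l1(2) by (metis mult.assoc mult_1)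
    then show ?thesis using 1 by simp
  qed
  then show ?thesis using l l1 D.circle_measure_axioms
    by (intro exI[of _ l] exI[of _ ?a]) (simp add: l_def mult.assoc)
qed

lemma adj_iff: "(x, y) \<in> adj E \<longleftrightarrow> {x, y} \<in> E" by (simp add: adj_def)

lemma adj_rtrancl_sym: "(x, y) \<in> (adj E)\<^sup>* \<Longrightarrow> (y, x) \<in> (adj E)\<^sup>*"
proof -
  have "sym (adj E)" by (auto simp: sym_def adj_iff insert_commute)
  then have "sym ((adj E)\<^sup>*)" by (rule sym_rtrancl)
  then show "(x, y) \<in> (adj E)\<^sup>* \<Longrightarrow> (y, x) \<in> (adj E)\<^sup>*" by (auto simp: sym_def)
qed

lemma adj_rtrancl_mono: "(x, y) \<in> (adj E)\<^sup>* \<Longrightarrow> E \<subseteq> F \<Longrightarrow> (x, y) \<in> (adj F)\<^sup>*"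
  using rtrancl_mono[of "adj E" "adj F"] by (auto simp: adj_def)

section \<open>Finite trees\<close>

text \<open>The half of the tree ahead when the edge is crossed from u to v. All statements about
  ends seen from a vertex or an edge are phrased through these halves.\<close>

definition side :: "'v set set \<Rightarrow> 'v \<Rightarrow> 'v \<Rightarrow> 'v set" where
  "side E u v = {w. (v, w) \<in> (adj (E - {{u, v}}))\<^sup>*}"

text \<open>\<open>nbwalk E u v x y n\<close>: a walk without backtracking whose first step is \<open>(u, v)\<close> and whose last step,
  \<open>n\<close> steps later, is \<open>(x, y)\<close>.\<close>

inductive nbwalk :: "'v set set \<Rightarrow> 'v \<Rightarrow> 'v \<Rightarrow> 'v \<Rightarrow> 'v \<Rightarrow> nat \<Rightarrow> bool" for E u v where
  nb0: "{u, v} \<in> E \<Longrightarrow> nbwalk E u v u v 0"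
| nbS: "nbwalk E u v x y n \<Longrightarrow> {y, z} \<in> E \<Longrightarrow> z \<noteq> x \<Longrightarrow> nbwalk E u v y z (Suc n)"

locale finite_tree =
  fixes V :: "'v set" and E :: "'v set set"
  assumes tree: "is_tree V E"
begin

lemma finV: "finite V" using tree by (simp add: is_tree_def)
lemma edgeV: "{x, y} \<in> E \<Longrightarrow> x \<in> V \<and> y \<in> V \<and> x \<noteq> y"
  using tree by (auto simp: is_tree_def is_graph_def doubleton_eq_iff dest!: subsetD)
lemma conn: "x \<in> V \<Longrightarrow> y \<in> V \<Longrightarrow> (x, y) \<in> (adj E)\<^sup>*"
  using tree by (simp add: is_tree_def graph_connected_def)
lemma bridge: "{x, y} \<in> E \<Longrightarrow> (x, y) \<notin> (adj (E - {{x, y}}))\<^sup>*"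
  using tree by (simp add: is_tree_def)

lemma side_self: "v \<in> side E u v" by (simp add: side_def)

lemma side_step: "x \<in> side E u v \<Longrightarrow> {x, y} \<in> E \<Longrightarrow> {x, y} \<noteq> {u, v} \<Longrightarrow> y \<in> side E u v"
  unfolding side_def mem_Collect_eq by (erule rtrancl.rtrancl_into_rtrancl) (simp add: adj_iff)

lemma side_induct [consumes 1, case_names base step]:
  assumes "x \<in> side E u v" "P v"
    "\<And>y z. y \<in> side E u v \<Longrightarrow> P y \<Longrightarrow> {y, z} \<in> E \<Longrightarrow> {y, z} \<noteq> {u, v} \<Longrightarrow> P z"
  shows "P x"
proof -
  have "(v, x) \<in> (adj (E - {{u, v}}))\<^sup>*" using assms(1) by (simp add: side_def)
  then show ?thesis
  proof (induction rule: rtrancl_induct)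
    case base then show ?case by (rule assms(2))
  next
    case (step y z) then show ?case using assms(3)[of y z] by (auto simp: side_def adj_iff)
  qed
qed

lemma side_disj: assumes "{u, v} \<in> E" shows "x \<in> side E u v \<Longrightarrow> x \<notin> side E v u"
proof
  assume a: "x \<in> side E u v" "x \<in> side E v u"
  then have "(v, x) \<in> (adj (E - {{u, v}}))\<^sup>*" "(u, x) \<in> (adj (E - {{u, v}}))\<^sup>*"
    by (auto simp: side_def insert_commute)
  then have "(u, v) \<in> (adj (E - {{u, v}}))\<^sup>*" by (metis adj_rtrancl_sym rtrancl_trans)
  then show False using bridge[OF assms] by contradiction
qed

lemma side_cover: assumes "{u, v} \<in> E" "x \<in> V" shows "x \<in> side E u v \<or> x \<in> side E v u"
proof -
  have "(u, x) \<in> (adj E)\<^sup>*" using conn edgeV[OF assms(1)] assms(2) by blast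
  then show ?thesis
  proof (induction rule: rtrancl_induct)
    case base then show ?case by (simp add: side_self)
  next
    case (step y z)
    show ?case
    proof (cases "{y, z} = {u, v}")
      case True then show ?thesis by (auto simp: doubleton_eq_iff side_self)
    next
      case False
      then have F: "{y, z} \<noteq> {v, u}" by (simp add: insert_commute)
      have e: "{y, z} \<in> E" using step.hyps(2) by (simp add: adj_iff)
      show ?thesis using step.IH side_step[OF _ e False] side_step[OF _ e F] by blast
    qed
  qed
qed

text \<open>Walking on without turning back shrinks the half tree ahead, so an end ahead of the last
  edge of a walk is ahead of all its edges.\<close>

lemma side_nest:
  assumes "{u, v} \<in> E" "{v, w} \<in> E" "u \<noteq> w" "x \<in> side E v w" shows "x \<in> side E u v"
  using assms(4)
proof (induction rule: side_induct)
  case base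
  show ?case using side_step[OF side_self assms(2)] assms(3) by (auto simp: doubleton_eq_iff)
next
  case (step y z)
  have "y \<noteq> v" using side_disj[OF assms(2) step.hyps(1)] side_self by blast
  then show ?case using side_step[OF step.IH step.hyps(2)] side_self by (cases "{y, z} = {u, v}") (auto simp: doubleton_eq_iff)
qed

lemma nb_side: "nbwalk E u v x y n \<Longrightarrow> {u, v} \<in> E \<and> {x, y} \<in> E \<and> side E x y \<subseteq> side E u v"
  by (induction rule: nbwalk.induct) (use side_nest in blast)+

text \<open>A path is made free of backtracking by cancelling a step that returns along the previous
  edge. It cannot return along the initial edge, because the paths that define \<open>side\<close>
  avoid it.\<close>

lemma nb_reach: assumes "{u, v} \<in> E" shows "w \<in> side E u v \<Longrightarrow> \<exists>x n. nbwalk E u v x w n"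
proof (induction rule: side_induct)
  case base then show ?case using nb0[of u v E] assms by blast
next
  case (step y z)
  obtain x n where xn: "nbwalk E u v x y n" using step.IH by blast
  show ?case
  proof (cases "z = x")
    case False then show ?thesis using nbS[OF xn step.hyps(2)] by blast
  next
    case True
    from xn show ?thesis
    proof (cases rule: nbwalk.cases)
      case nb0 then show ?thesis using step.hyps(3) True by (simp add: insert_commute)
    next
      case (nbS x0 n0) then show ?thesis using True by blast
    qed
  qed
qed

lemma nb_to_edge:
  assumes "{u, v} \<in> E" "{x, y} \<in> E" "{x, y} \<noteq> {u, v}" "x \<in> side E u v"
  shows "\<exists>a b n. {a, b} = {x, y} \<and> nbwalk E u v a b (Suc n)"
proof -
  obtain a n where a: "nbwalk E u v a x n" using nb_reach[OF assms(1,4)] by blast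
  show ?thesis
  proof (cases "y = a")
    case False then show ?thesis using nbS[OF a assms(2)] by blast
  next
    case True
    have "n \<noteq> 0"
    proof
      assume "n = 0"
      then have "a = u \<and> x = v" using a by (auto elim: nbwalk.cases)
      then show False using True assms(3) by (simp add: insert_commute)
    qed
    then obtain k where "n = Suc k" by (cases n) auto
    then show ?thesis using a True by (intro exI[of _ y] exI[of _ x] exI[of _ k]) (auto simp: insert_commute)
  qed
qed

text \<open>Suitably oriented, two different edges are the first and the last of a single directed
  path, along which Busemann functions can be followed.\<close>

lemma nb_edges:
  assumes "{u, v} \<in> E" "{x, y} \<in> E" "{x, y} \<noteq> {u, v}"
  shows "\<exists>a b a' b' n. {a, b} = {u, v} \<and> {a', b'} = {x, y} \<and> nbwalk E a b a' b' (Suc n)"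
proof -
  have "x \<in> side E u v \<or> x \<in> side E v u" using side_cover[OF assms(1)] edgeV[OF assms(2)] by blast
  then show ?thesis
  proof
    assume "x \<in> side E u v"
    then show ?thesis using nb_to_edge[OF assms] by blast
  next
    assume x: "x \<in> side E v u"
    have "{v, u} \<in> E" "{x, y} \<noteq> {v, u}" using assms by (simp_all add: insert_commute)
    then obtain a b n where "{a, b} = {x, y} \<and> nbwalk E v u a b (Suc n)" using nb_to_edge[OF _ assms(2) _ x] by blast
    then show ?thesis by (intro exI[of _ v] exI[of _ u] exI[of _ a] exI[of _ b] exI[of _ n]) (simp add: insert_commute)
  qed
qed

text \<open>Deleting an end leaves its neighbours connected; two of them would close a cycle through
  the end, against the bridge condition.\<close>

lemma ends_nbr_unique:
  assumes "v \<in> tree_ends V E" "{v, a} \<in> E" "{v, b} \<in> E" shows "a = b"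
proof (rule ccontr)
  assume ne: "a \<noteq> b"
  have "a \<in> V - {v}" "b \<in> V - {v}" using edgeV assms by blast+
  then have "(a, b) \<in> (adj (del_vertex_E v E))\<^sup>*" using assms(1) by (simp add: tree_ends_def graph_connected_def)
  then have "(a, b) \<in> (adj (E - {{v, a}}))\<^sup>*" by (rule adj_rtrancl_mono) (auto simp: del_vertex_E_def)
  moreover have "(b, v) \<in> adj (E - {{v, a}})" using assms ne by (auto simp: adj_iff insert_commute doubleton_eq_iff)
  ultimately have "(a, v) \<in> (adj (E - {{v, a}}))\<^sup>*" by (rule rtrancl.rtrancl_into_rtrancl)
  then have "(v, a) \<in> (adj (E - {{v, a}}))\<^sup>*" by (rule adj_rtrancl_sym)
  then show False using bridge[OF assms(2)] by contradiction
qed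

lemma finite_nbrs: "finite (nbrs E v)"
  by (rule finite_subset[OF _ finV]) (use edgeV in \<open>auto simp: nbrs_def\<close>)

lemma valence_nbrs: "valence E v = card (nbrs E v)"
proof -
  have "bij_betw (\<lambda>a. {v, a}) (nbrs E v) {e \<in> E. v \<in> e}"
    unfolding bij_betw_def
  proof
    show "inj_on (\<lambda>a. {v, a}) (nbrs E v)" by (auto simp: inj_on_def doubleton_eq_iff)
    show "(\<lambda>a. {v, a}) ` nbrs E v = {e \<in> E. v \<in> e}"
    proof (intro equalityI subsetI)
      fix e assume e: "e \<in> {e \<in> E. v \<in> e}"
      have "E \<subseteq> {{x, y} | x y. x \<in> V \<and> y \<in> V \<and> x \<noteq> y}" using tree by (simp add: is_tree_def is_graph_def)
      then obtain x y where xy: "e = {x, y}" using e by blast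
      then have "e = {v, y} \<or> e = {v, x}" using e by blast
      then obtain a where a: "e = {v, a}" by blast
      then have "a \<in> nbrs E v" using e by (simp add: nbrs_def)
      then show "e \<in> (\<lambda>a. {v, a}) ` nbrs E v" using a by blast
    qed (auto simp: nbrs_def)
  qed
  then show ?thesis unfolding valence_def by (rule bij_betw_same_card[symmetric])
qed

text \<open>Every component left after deleting \<open>v\<close> contains a neighbour of
  \<open>v\<close>.\<close>

lemma branch_nbrs: assumes "v \<in> branch_points V E" shows "3 \<le> card (nbrs E v)"
proof -
  let ?D = "del_vertex_E v E" and ?W = "V - {v}"
  let ?R = "{(x, y). x \<in> ?W \<and> y \<in> ?W \<and> (x, y) \<in> (adj ?D)\<^sup>*}"
  have v: "v \<in> V" using assms by (simp add: branch_points_def)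
  have "?W // ?R \<subseteq> (\<lambda>a. ?R `` {a}) ` nbrs E v"
  proof
    fix X assume "X \<in> ?W // ?R"
    then obtain x where x: "x \<in> ?W" "X = ?R `` {x}" by (auto elim: quotientE)
    have "(v, x) \<in> (adj E)\<^sup>*" using conn v x by blast
    then have "x = v \<or> (\<exists>a\<in>nbrs E v. (a, x) \<in> (adj ?D)\<^sup>*)"
    proof (induction rule: rtrancl_induct)
      case (step y z)
      show ?case
      proof (cases "y = v \<or> z = v")
        case True
        then show ?thesis using step(2) by (auto simp: adj_iff nbrs_def)
      next
        case False
        then have yz: "(y, z) \<in> adj ?D" using step(2) by (auto simp: adj_iff del_vertex_E_def)
        obtain a where "a \<in> nbrs E v" "(a, y) \<in> (adj ?D)\<^sup>*" using step.IH False by blast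
        then show ?thesis using rtrancl.rtrancl_into_rtrancl[OF _ yz] by blast
      qed
    qed simp
    then obtain a where a: "a \<in> nbrs E v" "(a, x) \<in> (adj ?D)\<^sup>*" using x by blast
    have aW: "a \<in> ?W" using a edgeV by (auto simp: nbrs_def)
    have "?R `` {a} = ?R `` {x}"
      using a(2) aW x(1) adj_rtrancl_sym[OF a(2)] by (auto intro: rtrancl_trans)
    then show "X \<in> (\<lambda>a. ?R `` {a}) ` nbrs E v" using a x by blast
  qed
  then have "card (?W // ?R) \<le> card (nbrs E v)"
    using finite_nbrs by (meson card_image_le card_mono finite_imageI order_trans)
  then show ?thesis using assms by (simp add: branch_points_def num_components_def)
qed

lemma branch_not_end: "v \<in> branch_points V E \<Longrightarrow> v \<notin> tree_ends V E"
proof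
  assume v: "v \<in> branch_points V E" "v \<in> tree_ends V E"
  have "card (nbrs E v) \<le> 1"
    using ends_nbr_unique[OF v(2)] by (intro card_le_Suc0_iff_eq[THEN iffD2, unfolded One_nat_def[symmetric]] finite_nbrs) (auto simp: nbrs_def)
  then show False using branch_nbrs[OF v(1)] by simp
qed

lemma graph_dist_le: "(a, b) \<in> adj E ^^ n \<Longrightarrow> graph_dist E a b \<le> n"
  unfolding graph_dist_def by (rule Least_le)

lemma graph_dist_walk: "a \<in> V \<Longrightarrow> b \<in> V \<Longrightarrow> (a, b) \<in> adj E ^^ graph_dist E a b"
  unfolding graph_dist_def by (rule LeastI_ex) (use conn[of a b] in \<open>auto simp: rtrancl_power\<close>)

lemma graph_dist_bound: "\<exists>N. \<forall>a\<in>V. \<forall>b\<in>V. graph_dist E a b \<le> N"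
proof -
  have "finite ((\<lambda>(a, b). graph_dist E a b) ` (V \<times> V))" using finV by simp
  then have "graph_dist E a b \<le> Max ((\<lambda>(a, b). graph_dist E a b) ` (V \<times> V))" if "a \<in> V" "b \<in> V" for a b
    by (rule Max_ge) (use that in force)
  then show ?thesis by blast
qed

end

locale rooted_tree = finite_tree +
  fixes pu pv :: 'v
  assumes pedge: "{pu, pv} \<in> E" and VBE: "V = branch_points V E \<union> tree_ends V E"
begin

abbreviation "B \<equiv> branch_points V E"
abbreviation "Ends \<equiv> tree_ends V E"
text \<open>Cutting the edge that carries the base point leaves two rooted trees.\<close>

definition "E' = E - {{pu, pv}}"

text \<open>The distance to the cut edge. A vertex is reachable from only one of the two roots when
  that edge is avoided, so the minimum refers to its own root.\<close>

definition dep :: "'v \<Rightarrow> nat" where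
  "dep v = (LEAST n. (pu, v) \<in> adj E' ^^ n \<or> (pv, v) \<in> adj E' ^^ n)"

definition par :: "'v \<Rightarrow> 'v" where
  "par v = (SOME u. {u, v} \<in> E' \<and> Suc (dep u) = dep v)"

lemma E'_sub: "{x, y} \<in> E' \<Longrightarrow> {x, y} \<in> E" by (simp add: E'_def)
lemma puv: "pu \<in> V" "pv \<in> V" "pu \<noteq> pv" using edgeV[OF pedge] by auto

lemma dep_ex: assumes "v \<in> V" shows "(pu, v) \<in> adj E' ^^ dep v \<or> (pv, v) \<in> adj E' ^^ dep v"
proof -
  have "\<exists>n. (pu, v) \<in> adj E' ^^ n \<or> (pv, v) \<in> adj E' ^^ n"
    using side_cover[OF pedge assms] by (auto simp: side_def E'_def rtrancl_power insert_commute)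
  then show ?thesis unfolding dep_def by (rule LeastI_ex)
qed

lemma dep_le: "(pu, v) \<in> adj E' ^^ n \<or> (pv, v) \<in> adj E' ^^ n \<Longrightarrow> dep v \<le> n"
  unfolding dep_def by (rule Least_le)

lemma dep_root [simp]: "dep pu = 0" "dep pv = 0"
  using dep_le[of pu 0] dep_le[of pv 0] by auto

lemma dep_0: "v \<in> V \<Longrightarrow> dep v = 0 \<Longrightarrow> v = pu \<or> v = pv"
  using dep_ex[of v] by auto

lemma par_edge: assumes "v \<in> V" "v \<noteq> pu" "v \<noteq> pv" shows "{par v, v} \<in> E'" "Suc (dep (par v)) = dep v"
proof -
  have "dep v \<noteq> 0" using dep_0 assms by blast
  then obtain n where n: "dep v = Suc n" by (cases "dep v") auto
  obtain r where r: "r = pu \<or> r = pv" "(r, v) \<in> adj E' ^^ Suc n" using dep_ex[OF assms(1)] n by auto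
  then obtain u where u: "(r, u) \<in> adj E' ^^ n" "(u, v) \<in> adj E'" by auto
  have "dep u \<le> n" using dep_le[of u n] u r by auto
  moreover have "dep v \<le> Suc (dep u)"
  proof (rule dep_le)
    have "u \<in> V" using u(2) edgeV by (auto simp: adj_iff E'_def)
    then show "(pu, v) \<in> adj E' ^^ Suc (dep u) \<or> (pv, v) \<in> adj E' ^^ Suc (dep u)"
      using dep_ex[of u] u(2) by auto
  qed
  ultimately have "{u, v} \<in> E' \<and> Suc (dep u) = dep v" using u n by (auto simp: adj_iff)
  then have "{par v, v} \<in> E' \<and> Suc (dep (par v)) = dep v" unfolding par_def by (rule someI)
  then show "{par v, v} \<in> E'" "Suc (dep (par v)) = dep v" by auto
qed

lemma parV: "v \<in> V \<Longrightarrow> v \<noteq> pu \<Longrightarrow> v \<noteq> pv \<Longrightarrow> par v \<in> V"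
  using par_edge(1) edgeV E'_sub by blast

lemma dep_induct [consumes 1, case_names root1 root2 step]:
  assumes "x \<in> V" "P pu" "P pv" "\<And>x. x \<in> V \<Longrightarrow> x \<noteq> pu \<Longrightarrow> x \<noteq> pv \<Longrightarrow> P (par x) \<Longrightarrow> P x"
  shows "P x"
  using assms(1)
proof (induction "dep x" arbitrary: x rule: less_induct)
  case less
  show ?case
  proof (cases "x = pu \<or> x = pv")
    case True then show ?thesis using assms by auto
  next
    case False
    then show ?thesis using assms(4)[of x] less par_edge(2)[of x] parV[of x] by force
  qed
qed

text \<open>The parent edges together with the cut edge already connect all vertices. Any further
  edge could be deleted without separating its endpoints and would not be a bridge.\<close>

lemma edge_par:
  assumes "{x, y} \<in> E'"
  shows "(x = par y \<and> y \<noteq> pu \<and> y \<noteq> pv) \<or> (y = par x \<and> x \<noteq> pu \<and> x \<noteq> pv)"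
proof (rule ccontr)
  assume c: "\<not> ?thesis"
  let ?F = "E - {{x, y}}"
  have xy: "{x, y} \<in> E" "{x, y} \<noteq> {pu, pv}" using assms by (auto simp: E'_def)
  have pq: "(pu, pv) \<in> (adj ?F)\<^sup>*" using pedge xy by (intro r_into_rtrancl) (auto simp: adj_iff)
  have *: "(pu, z) \<in> (adj ?F)\<^sup>*" if "z \<in> V" for z
    using that
  proof (induction rule: dep_induct)
    case (step z)
    have "{par z, z} \<noteq> {x, y}" using c step by (auto simp: doubleton_eq_iff)
    then have "(par z, z) \<in> adj ?F" using par_edge(1)[OF step(1-3)] by (auto simp: adj_iff E'_def)
    with step(4) show ?case by (rule rtrancl.rtrancl_into_rtrancl)
  qed (use pq in auto)
  have "(x, pu) \<in> (adj ?F)\<^sup>*" "(pu, y) \<in> (adj ?F)\<^sup>*"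
    using *[of x] *[of y] edgeV[OF xy(1)] by (auto intro: adj_rtrancl_sym)
  then have "(x, y) \<in> (adj ?F)\<^sup>*" by (rule rtrancl_trans)
  then show False using bridge[OF xy(1)] by contradiction
qed

text \<open>The ancestor relation: x lies below w or equals it. Chains of parents stop at the two
  roots.\<close>

inductive bel :: "'v \<Rightarrow> 'v \<Rightarrow> bool" for w where
  bel_refl: "bel w w"
| bel_step: "x \<in> V \<Longrightarrow> x \<noteq> pu \<Longrightarrow> x \<noteq> pv \<Longrightarrow> bel w (par x) \<Longrightarrow> bel w x"

lemma bel_V: "bel w x \<Longrightarrow> w \<in> V \<Longrightarrow> x \<in> V" by (induction rule: bel.induct) auto

lemma bel_trans: "bel w x \<Longrightarrow> bel a w \<Longrightarrow> bel a x"
  by (induction rule: bel.induct) (auto intro: bel_step)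

lemma bel_root: "bel w x \<Longrightarrow> x = pu \<or> x = pv \<Longrightarrow> w = x" by (auto elim: bel.cases)

text \<open>Common part of two cases: a vertex with its parent, and a root with the other root in
  the place of a parent.\<close>

lemma bel_side_gen:
  assumes "w \<in> V" "{u, w} \<in> E" "\<And>x. x \<in> V \<Longrightarrow> x \<noteq> pu \<Longrightarrow> x \<noteq> pv \<Longrightarrow> {par x, x} = {u, w} \<Longrightarrow> x = w"
    "\<And>y z. bel w y \<Longrightarrow> {y, z} \<in> E \<Longrightarrow> {y, z} \<noteq> {u, w} \<Longrightarrow> bel w z"
  shows "x \<in> side E u w \<longleftrightarrow> bel w x"
proof
  assume "x \<in> side E u w"
  then show "bel w x" by (induction rule: side_induct) (use assms(4) bel_refl in auto)
next
  assume "bel w x"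
  then show "x \<in> side E u w"
  proof (induction rule: bel.induct)
    case bel_refl then show ?case by (rule side_self)
  next
    case (bel_step x)
    show ?case
    proof (cases "{par x, x} = {u, w}")
      case True then show ?thesis using assms(3)[of x] bel_step side_self by blast
    next
      case False
      then show ?thesis using side_step[OF bel_step(5)] E'_sub[OF par_edge(1)[OF bel_step(1-3)]] by blast
    qed
  qed
qed

lemma bel_side:
  assumes "w \<in> V" "w \<noteq> pu" "w \<noteq> pv" shows "x \<in> side E (par w) w \<longleftrightarrow> bel w x"
proof (rule bel_side_gen[OF assms(1) E'_sub[OF par_edge(1)[OF assms]]])
  fix x assume x: "x \<in> V" "x \<noteq> pu" "x \<noteq> pv" "{par x, x} = {par w, w}"
  then show "x = w" using par_edge(2)[of x] par_edge(2)[OF assms] by (auto simp: doubleton_eq_iff)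
next
  fix y z assume yz: "bel w y" "{y, z} \<in> E" "{y, z} \<noteq> {par w, w}"
  show "bel w z"
  proof (cases "{y, z} = {pu, pv}")
    case True
    then have "w = y" using bel_root[OF yz(1)] by (auto simp: doubleton_eq_iff)
    then show ?thesis using True assms by (auto simp: doubleton_eq_iff)
  next
    case False
    then have "{y, z} \<in> E'" using yz by (simp add: E'_def)
    from edge_par[OF this] show ?thesis
    proof
      assume "y = par z \<and> z \<noteq> pu \<and> z \<noteq> pv"
      then show ?thesis using bel_step[of z w] yz edgeV by blast
    next
      assume p: "z = par y \<and> y \<noteq> pu \<and> y \<noteq> pv"
      from yz(1) show ?thesis
      proof cases
        case bel_refl then show ?thesis using p yz(3) by (simp add: insert_commute)
      next
        case bel_step then show ?thesis using p by simp
      qed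
    qed
  qed
qed

lemma bel_side_root:
  shows "x \<in> side E pv pu \<longleftrightarrow> bel pu x" "x \<in> side E pu pv \<longleftrightarrow> bel pv x"
proof -
  have *: "x \<in> side E u w \<longleftrightarrow> bel w x" if uw: "w = pu \<and> u = pv \<or> w = pv \<and> u = pu" for u w
  proof (rule bel_side_gen)
    show "w \<in> V" "{u, w} \<in> E" using uw puv pedge by (auto simp: insert_commute)
    fix x assume "x \<in> V" "x \<noteq> pu" "x \<noteq> pv" "{par x, x} = {u, w}"
    then show "x = w" using uw by (auto simp: doubleton_eq_iff)
  next
    fix y z assume yz: "bel w y" "{y, z} \<in> E" "{y, z} \<noteq> {u, w}"
    have "{u, w} = {pu, pv}" using uw by auto
    then have "{y, z} \<in> E'" using yz by (simp add: E'_def)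
    from edge_par[OF this] show "bel w z"
    proof
      assume "y = par z \<and> z \<noteq> pu \<and> z \<noteq> pv"
      then show ?thesis using bel_step[of z w] yz edgeV by blast
    next
      assume p: "z = par y \<and> y \<noteq> pu \<and> y \<noteq> pv"
      from yz(1) show ?thesis
      proof cases
        case bel_refl then show ?thesis using p uw by auto
      next
        case bel_step then show ?thesis using p by simp
      qed
    qed
  qed
  show "x \<in> side E pv pu \<longleftrightarrow> bel pu x" "x \<in> side E pu pv \<longleftrightarrow> bel pv x" using * by auto
qed

lemma bel_cover: "x \<in> V \<Longrightarrow> bel pu x \<or> bel pv x"
  using side_cover[OF pedge] bel_side_root by blast

lemma bel_excl: "bel pu x \<Longrightarrow> \<not> bel pv x"
  using side_disj[OF pedge] bel_side_root by blast

text \<open>At a root the other root takes the place of the missing parent.\<close>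

lemma nbrs_eq:
  assumes "v \<in> V"
  shows "nbrs E v = {w \<in> V. w \<noteq> pu \<and> w \<noteq> pv \<and> par w = v} \<union> {if v = pu then pv else if v = pv then pu else par v}"
    (is "_ = ?C \<union> {?p}")
proof (intro equalityI subsetI)
  fix w assume "w \<in> nbrs E v"
  then have vw: "{v, w} \<in> E" by (simp add: nbrs_def)
  show "w \<in> ?C \<union> {?p}"
  proof (cases "{v, w} = {pu, pv}")
    case True then show ?thesis by (auto simp: doubleton_eq_iff)
  next
    case False
    then have "{v, w} \<in> E'" using vw by (simp add: E'_def)
    from edge_par[OF this] show ?thesis using edgeV[OF vw] by auto
  qed
next
  fix w assume w: "w \<in> ?C \<union> {?p}"
  show "w \<in> nbrs E v"
  proof (cases "w \<in> ?C")
    case True then show ?thesis using E'_sub[OF par_edge(1)[of w]] by (auto simp: nbrs_def)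
  next
    case False
    then have "w = ?p" using w by blast
    then show ?thesis using pedge E'_sub[OF par_edge(1)[OF assms]] by (auto simp: nbrs_def insert_commute)
  qed
qed

definition "children v = {w \<in> V. w \<noteq> pu \<and> w \<noteq> pv \<and> par w = v}"

lemma finite_children: "finite (children v)" unfolding children_def using finV by simp

lemma up_notin_children: assumes "v \<in> V"
  shows "(if v = pu then pv else if v = pv then pu else par v) \<notin> children v"
  using par_edge(2)[OF assms] par_edge(2)[of "par v"] by (auto simp: children_def)

lemma branch_children: assumes "v \<in> B" shows "2 \<le> card (children v)"
proof -
  have v: "v \<in> V" using assms by (simp add: branch_points_def)
  have "card (nbrs E v) = card (children v) + 1"
    unfolding nbrs_eq[OF v] children_def[symmetric]
    using up_notin_children[OF v] finite_children by simp
  then show ?thesis using branch_nbrs[OF assms] by simp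
qed

lemma end_no_children: assumes "e \<in> Ends" shows "children e = {}"
proof -
  have v: "e \<in> V" using assms by (simp add: tree_ends_def)
  show ?thesis
  proof (rule ccontr)
    assume "children e \<noteq> {}"
    then obtain w where w: "w \<in> children e" by blast
    let ?p = "if e = pu then pv else if e = pv then pu else par e"
    have "w \<in> nbrs E e" "?p \<in> nbrs E e" using w nbrs_eq[OF v] unfolding children_def[symmetric] by blast+
    then have "w = ?p" using ends_nbr_unique[OF assms] by (simp add: nbrs_def)
    then show False using w up_notin_children[OF v] by simp
  qed
qed

text \<open>A descendant of maximal depth has no children, whereas a branch point always has
  some.\<close>

lemma bel_end: assumes "w \<in> V" shows "\<exists>e\<in>Ends. bel w e"
proof -
  let ?S = "{x. bel w x}"
  have fin: "finite (dep ` ?S)" by (intro finite_imageI finite_subset[OF _ finV]) (use bel_V assms in blast)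
  have "Max (dep ` ?S) \<in> dep ` ?S" by (rule Max_in[OF fin]) (use bel_refl in blast)
  then obtain x where x0: "x \<in> ?S" "dep x = Max (dep ` ?S)" by force
  have x: "x \<in> ?S" "\<And>y. y \<in> ?S \<Longrightarrow> dep y \<le> dep x"
    using x0(1) Max_ge[OF fin] unfolding x0(2) by blast+
  have "x \<notin> B"
  proof
    assume "x \<in> B"
    then have "children x \<noteq> {}" using branch_children by fastforce
    then obtain z where z: "z \<in> V" "z \<noteq> pu" "z \<noteq> pv" "par z = x" by (auto simp: children_def)
    then have "bel w z" using x bel_step[of z w] by simp
    then show False using x(2)[of z] par_edge(2)[of z] z by simp
  qed
  moreover have "x \<in> V" using x bel_V assms by blast
  ultimately show ?thesis using x VBE by blast
qed

lemma side_end: assumes "{u, v} \<in> E" shows "\<exists>e\<in>Ends. e \<in> side E u v"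
proof (cases "{u, v} = {pu, pv}")
  case True
  then show ?thesis using bel_end[OF puv(1)] bel_end[OF puv(2)] bel_side_root by (auto simp: doubleton_eq_iff)
next
  case False
  then have "{u, v} \<in> E'" using assms by (simp add: E'_def)
  from edge_par[OF this] show ?thesis
  proof
    assume "u = par v \<and> v \<noteq> pu \<and> v \<noteq> pv"
    then show ?thesis using bel_end[of v] bel_side[of v] edgeV[OF assms] by auto
  next
    \<comment> \<open>Looking upwards from \<open>u\<close>, every end of the other rooted tree lies
      ahead.\<close>
    assume p: "v = par u \<and> u \<noteq> pu \<and> u \<noteq> pv"
    have uV: "u \<in> V" using edgeV[OF assms] by blast
    obtain r r' where r: "bel r u" "(r = pu \<and> r' = pv) \<or> (r = pv \<and> r' = pu)" using bel_cover[OF uV] by blast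
    obtain e where e: "e \<in> Ends" "bel r' e" using bel_end[of r'] r puv by blast
    have "\<not> bel u e" using bel_trans[OF _ r(1)] e bel_excl r by blast
    then have "e \<notin> side E v u" using bel_side[of u e] uV p by simp
    moreover have "e \<in> V" using e by (simp add: tree_ends_def)
    ultimately show ?thesis using side_cover[OF assms] e by blast
  qed
qed

end

section \<open>Positions of the vertices and ends\<close>

text \<open>The Cayley map from the upper half plane to the disc; real points go to the circle and
  infinity goes to 1.\<close>

definition cay :: "complex \<Rightarrow> complex" where "cay y = (y - \<i>) / (y + \<i>)"

lemma norm_le_parts: "cmod (of_real a - \<i> * of_real b) \<le> \<bar>a\<bar> + \<bar>b\<bar>"
  using norm_triangle_ineq4[of "of_real a" "\<i> * of_real b"] by (simp add: norm_mult)

lemma norm_gt_Im: "0 < Im z \<Longrightarrow> 0 < cmod (of_real a - z)"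
  by (auto simp: complex_eq_iff)

lemma one_plus_sq_pos: "0 < 1 + (x::real)\<^sup>2"
  by (simp add: add_pos_nonneg)

lemma plus_i_nz: "Im y \<ge> 0 \<Longrightarrow> y + \<i> \<noteq> 0"
  by (auto simp: complex_eq_iff)

lemma cay_diff: assumes "Im y \<ge> 0" "Im Y \<ge> 0" shows "cay y - cay Y = 2 * \<i> * (y - Y) / ((y + \<i>) * (Y + \<i>))"
  unfolding cay_def using plus_i_nz[OF assms(1)] plus_i_nz[OF assms(2)] by (simp add: diff_frac_eq) (simp add: algebra_simps)

lemma cay_add: assumes "Im y \<ge> 0" "Im Y \<ge> 0" shows "cay y + cay Y = 2 * (1 + y * Y) / ((y + \<i>) * (Y + \<i>))"
  unfolding cay_def using plus_i_nz[OF assms(1)] plus_i_nz[OF assms(2)] by (simp add: add_frac_eq) (simp add: algebra_simps)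

lemma one_minus_cay_sq: assumes "Im Y \<ge> 0" shows "1 - (cmod (cay Y))\<^sup>2 = 4 * Im Y / (cmod (Y + \<i>))\<^sup>2"
proof -
  have "(cmod (Y + \<i>))\<^sup>2 \<noteq> 0" using plus_i_nz[OF assms] by simp
  moreover have "(cmod (Y + \<i>))\<^sup>2 - (cmod (Y - \<i>))\<^sup>2 = 4 * Im Y" unfolding cmod_power2 by (simp add: power2_eq_square algebra_simps)
  moreover have "1 - a / b = q / b" if "b \<noteq> 0" "b - a = q" for a b q :: real using that by (auto simp: diff_divide_distrib)
  ultimately show ?thesis unfolding cay_def norm_divide power_divide by blast
qed

lemma norm_cay_less: assumes "Im Y > 0" shows "cmod (cay Y) < 1"
proof -
  have "1 - (cmod (cay Y))\<^sup>2 > 0" unfolding one_minus_cay_sq[OF less_imp_le[OF assms]]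
    using assms plus_i_nz[of Y] by (intro divide_pos_pos) auto
  then show ?thesis by (simp add: abs_square_less_1)
qed

lemma norm_cay_real [simp]: "cmod (cay (of_real y)) = 1"
  using one_minus_cay_sq[of "of_real y"] by (simp add: power2_eq_1_iff) (smt (verit) norm_ge_zero)

lemma norm_real_plus_i: "(cmod (of_real y + \<i>))\<^sup>2 = 1 + y\<^sup>2" unfolding cmod_power2 by simp

text \<open>In the half plane the kernel is height over squared distance, up to a factor that
  depends on the ideal point only and cancels in differences of Busemann functions. The second form
  is for ideal points of the tree placed on the opposite side of the disc.\<close>

lemma pker_cay: assumes "Im Y > 0"
  shows "pker (cay Y) (cay (of_real y)) = Im Y * (1 + y\<^sup>2) / (cmod (of_real y - Y))\<^sup>2"
    and "pker (cay Y) (- cay (of_real y)) = Im Y * (1 + y\<^sup>2) / (cmod (1 + of_real y * Y))\<^sup>2"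
proof -
  have Y: "(cmod (Y + \<i>))\<^sup>2 \<noteq> 0" using plus_i_nz[of Y] assms by simp
  have y: "1 + y\<^sup>2 \<noteq> 0" by (metis add_nonneg_eq_0_iff zero_le_one zero_le_power2 zero_neq_one)
  have g: "(4 * a / b) / (4 * q / (s * b)) = a * s / q" if "b \<noteq> 0" for a b q s :: real
    using that by simp
  have "(cmod (cay (of_real y) - cay Y))\<^sup>2 = 4 * (cmod (of_real y - Y))\<^sup>2 / ((1 + y\<^sup>2) * (cmod (Y + \<i>))\<^sup>2)"
    using cay_diff[of "of_real y" Y] assms norm_real_plus_i[of y] by (simp add: norm_mult norm_divide power_mult_distrib power_divide)
  then show "pker (cay Y) (cay (of_real y)) = Im Y * (1 + y\<^sup>2) / (cmod (of_real y - Y))\<^sup>2"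
    unfolding pker_def one_minus_cay_sq[OF less_imp_le[OF assms]] by (simp only: g[OF Y])
  have m: "- cay (of_real y) - cay Y = - (cay (of_real y) + cay Y)" by simp
  have "cay (of_real y) + cay Y = 2 * (1 + of_real y * Y) / ((of_real y + \<i>) * (Y + \<i>))"
    using assms by (intro cay_add) auto
  then have "cmod (- cay (of_real y) - cay Y) = 2 * cmod (1 + of_real y * Y) / (cmod (of_real y + \<i>) * cmod (Y + \<i>))"
    by (simp only: m norm_minus_cancel norm_mult norm_divide norm_numeral)
  then have "(cmod (- cay (of_real y) - cay Y))\<^sup>2 = 4 * (cmod (1 + of_real y * Y))\<^sup>2 / ((1 + y\<^sup>2) * (cmod (Y + \<i>))\<^sup>2)"
    by (simp only: power_mult_distrib power_divide norm_real_plus_i) simp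
  then show "pker (cay Y) (- cay (of_real y)) = Im Y * (1 + y\<^sup>2) / (cmod (1 + of_real y * Y))\<^sup>2"
    unfolding pker_def one_minus_cay_sq[OF less_imp_le[OF assms]] by (simp only: g[OF Y])
qed

text \<open>The unimodular factor between the disc map \<open>mob (cay Y)\<close> and the half-plane
  map (y - Y) / (y - conj Y).\<close>

definition cay_rot :: "complex \<Rightarrow> complex" where "cay_rot Y = - (cnj Y - \<i>) / (Y + \<i>)"

lemma norm_cay_rot: assumes "Im Y > 0" shows "cmod (cay_rot Y) = 1"
proof -
  have "cnj Y - \<i> = cnj (Y + \<i>)" by simp
  then have "cmod (cnj Y - \<i>) = cmod (Y + \<i>)" by (metis complex_mod_cnj)
  then have "cmod (cay_rot Y) = cmod (Y + \<i>) / cmod (Y + \<i>)" by (simp only: cay_rot_def norm_divide norm_minus_cancel)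
  then show ?thesis using plus_i_nz[of Y] assms by simp
qed

lemma one_minus_cay_mult: assumes "Im Y > 0" "Im y \<ge> 0"
  shows "1 - cnj (cay Y) * cay y = - 2 * \<i> * (y - cnj Y) / ((cnj Y - \<i>) * (y + \<i>))"
    and "1 + cnj (cay Y) * cay y = 2 * (1 + y * cnj Y) / ((cnj Y - \<i>) * (y + \<i>))"
    and "cnj Y - \<i> \<noteq> 0"
proof -
  show c: "cnj Y - \<i> \<noteq> 0" using assms by (auto simp: complex_eq_iff)
  have y: "y + \<i> \<noteq> 0" by (rule plus_i_nz[OF assms(2)])
  have cc: "cnj (cay Y) = (cnj Y + \<i>) / (cnj Y - \<i>)" by (simp add: cay_def)
  have n: "(cnj Y - \<i>) * (y + \<i>) \<noteq> 0" using c y by simp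
  have "(cnj Y + \<i>) / (cnj Y - \<i>) * ((y - \<i>) / (y + \<i>)) = ((cnj Y + \<i>) * (y - \<i>)) / ((cnj Y - \<i>) * (y + \<i>))" by simp
  moreover have "1 = ((cnj Y - \<i>) * (y + \<i>)) / ((cnj Y - \<i>) * (y + \<i>))" using n by simp
  ultimately have "1 - cnj (cay Y) * cay y = ((cnj Y - \<i>) * (y + \<i>) - (cnj Y + \<i>) * (y - \<i>)) / ((cnj Y - \<i>) * (y + \<i>))"
    "1 + cnj (cay Y) * cay y = ((cnj Y - \<i>) * (y + \<i>) + (cnj Y + \<i>) * (y - \<i>)) / ((cnj Y - \<i>) * (y + \<i>))"
    unfolding cc cay_def[of y] diff_divide_distrib add_divide_distrib by (simp_all only:)
  then show "1 - cnj (cay Y) * cay y = - 2 * \<i> * (y - cnj Y) / ((cnj Y - \<i>) * (y + \<i>))"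
    "1 + cnj (cay Y) * cay y = 2 * (1 + y * cnj Y) / ((cnj Y - \<i>) * (y + \<i>))" by (simp_all add: algebra_simps)
qed

lemma mob_cay:
  assumes "Im Y > 0" "Im y \<ge> 0" 
  shows "mob (cay Y) (cay y) = cay_rot Y * ((y - Y) / (y - cnj Y))"
proof -
  have 1: "y - cnj Y \<noteq> 0" "y + \<i> \<noteq> 0" "Y + \<i> \<noteq> 0" using assms by (auto simp: complex_eq_iff)
  have g: "(2 * i * a / (p * q)) / (- 2 * i * b / (r * p)) = - r / q * (a / b)"
    if "i \<noteq> 0" "p \<noteq> 0" "q \<noteq> 0" "r \<noteq> 0" "b \<noteq> 0" for i a b p q r :: complex
    using that by (simp add: field_simps)
  show ?thesis unfolding mob_def cay_rot_def
    using g[of \<i> "y + \<i>" "Y + \<i>" "cnj Y - \<i>" "y - cnj Y" "y - Y"] 1 one_minus_cay_mult[OF assms] cay_diff[of y Y] assms by simp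
qed

lemma mob_cay_neg:
  assumes "Im Y > 0" "cmod (1 + of_real y * cnj Y) > 0"
  shows "mob (cay Y) (- cay (of_real y)) = cay_rot Y * ((1 + of_real y * Y) / (1 + of_real y * cnj Y))"
proof -
  have 1: "of_real y + \<i> \<noteq> 0" "Y + \<i> \<noteq> 0" "1 + of_real y * cnj Y \<noteq> 0" using assms by (auto simp: complex_eq_iff)
  have g: "(- (2 * a / (p * q))) / (2 * b / (r * p)) = - r / q * (a / b)"
    if "p \<noteq> 0" "q \<noteq> 0" "r \<noteq> 0" "b \<noteq> 0" for a b p q r :: complex
    using that by (simp add: field_simps)
  have "mob (cay Y) (- cay (of_real y)) = (- (cay (of_real y) + cay Y)) / (1 + cnj (cay Y) * cay (of_real y))"
    by (simp add: mob_def)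
  then show ?thesis unfolding cay_rot_def
    using g[of "of_real y + \<i>" "Y + \<i>" "cnj Y - \<i>" "1 + of_real y * cnj Y" "1 + of_real y * Y"] 1
      one_minus_cay_mult[of Y "of_real y"] cay_add[of "of_real y" Y] assms by simp
qed

text \<open>The identity |Y - conj Z|^2 - |Y - Z|^2 = 4 Im Y Im Z expresses 1 - |mob|^2 through the
  heights and the distance to the reflected point.\<close>

lemma hdist_cay_le:
  assumes "Im Y > 0" "Im Z > 0"
  shows "hdist (cay Y) (cay Z) \<le> ln ((cmod (Y - cnj Z))\<^sup>2 / (Im Y * Im Z))"
proof -
  have n: "(cmod (Y - cnj Z))\<^sup>2 > 0" using assms by (auto simp: complex_eq_iff)
  have "cmod (mob (cay Z) (cay Y)) = cmod (Y - Z) / cmod (Y - cnj Z)"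
    using mob_cay[of Z Y] norm_cay_rot[of Z] assms by (simp add: norm_mult norm_divide)
  then have "1 - (cmod (mob (cay Z) (cay Y)))\<^sup>2 = ((cmod (Y - cnj Z))\<^sup>2 - (cmod (Y - Z))\<^sup>2) / (cmod (Y - cnj Z))\<^sup>2"
    using n by (simp add: power_divide diff_divide_distrib)
  also have "(cmod (Y - cnj Z))\<^sup>2 - (cmod (Y - Z))\<^sup>2 = 4 * (Im Y * Im Z)"
    unfolding cmod_power2 by (simp add: power2_eq_square algebra_simps)
  finally have "4 / (1 - (cmod (mob (cay Z) (cay Y)))\<^sup>2) = (cmod (Y - cnj Z))\<^sup>2 / (Im Y * Im Z)" using assms by simp
  then show ?thesis using hdist_le_ln[of "cay Y" "cay Z"] norm_cay_less assms by simp
qed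

lemma cay_real_lipschitz: "cmod (cay (of_real a) - cay (of_real b)) \<le> 2 * \<bar>a - b\<bar>"
proof -
  have g: "1 \<le> cmod (of_real x + \<i>)" for x using abs_Im_le_cmod[of "of_real x + \<i>"] by simp
  have "cmod (cay (of_real a) - cay (of_real b)) = 2 * \<bar>a - b\<bar> / (cmod (of_real a + \<i>) * cmod (of_real b + \<i>))"
    using cay_diff[of "of_real a" "of_real b"]
    by (simp add: norm_mult norm_divide) (metis norm_of_real of_real_diff)
  also have "\<dots> \<le> 2 * \<bar>a - b\<bar> / (1 * 1)" using g by (intro frac_le mult_mono) auto
  finally show ?thesis by simp
qed

text \<open>Distant real points are seen near the image of infinity; this is how the ends above a
  vertex will cluster.\<close>

lemma cay_real_near_1: assumes "a \<noteq> 0" shows "cmod (cay (of_real a) - 1) \<le> 2 / \<bar>a\<bar>"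
proof -
  have n: "of_real a + \<i> \<noteq> 0" using plus_i_nz[of "of_real a"] by simp
  then have "cay (of_real a) - 1 = - (2 * \<i>) / (of_real a + \<i>)" by (simp add: cay_def field_simps)
  then have "cmod (cay (of_real a) - 1) = 2 / cmod (of_real a + \<i>)" by (simp add: norm_divide norm_mult)
  also have "\<dots> \<le> 2 / \<bar>a\<bar>" using abs_Re_le_cmod[of "of_real a + \<i>"] assms n by (intro divide_left_mono mult_pos_pos) auto
  finally show ?thesis .
qed

lemma cay_real_ne_1: "cay (of_real a) \<noteq> 1"
proof
  assume "cay (of_real a) = 1"
  then have "complex_of_real a - \<i> = of_real a + \<i>"
    unfolding cay_def using right_inverse_eq[of "of_real a + \<i>"] plus_i_nz[of "of_real a"] by simp
  then show False by (simp add: complex_eq_iff)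
qed

lemma cay_real_inj: "cay (of_real a) = cay (of_real b) \<Longrightarrow> a = b"
  using cay_diff[of "of_real a" "of_real b"] plus_i_nz[of "of_real a"] plus_i_nz[of "of_real b"] by simp

lemma cay_real_parts: "Re (cay (of_real y)) = - ((1 - y\<^sup>2) / (1 + y\<^sup>2))" "Im (cay (of_real y)) = - (2 * (y / (1 + y\<^sup>2)))"
proof -
  have "Re (cay (of_real y)) = (y * y - 1) / (1 + y * y)" "Im (cay (of_real y)) = - (y + y) / (1 + y * y)"
    by (simp_all add: cay_def Re_divide Im_divide power2_eq_square add.commute)
  then show "Re (cay (of_real y)) = - ((1 - y\<^sup>2) / (1 + y\<^sup>2))" "Im (cay (of_real y)) = - (2 * (y / (1 + y\<^sup>2)))"
    by (simp_all only: minus_divide_left power2_eq_square times_divide_eq_right mult_2 minus_diff_eq)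
qed

lemma ratio_bounds: assumes "0 \<le> t" "t \<le> (1 / 4)\<^sup>2"
  shows "1 / 2 \<le> (1 - t) / (1 + t)" "(1 - t) / (1 + t) \<le> (1::real)"
proof -
  have "t \<le> 1 / 16" using assms(2) by (simp add: power2_eq_square)
  then show "1 / 2 \<le> (1 - t) / (1 + t)" "(1 - t) / (1 + t) \<le> 1" using assms(1) by (auto simp: le_divide_eq divide_le_eq)
qed

context rooted_tree begin

lemma sub01: "0 \<le> t \<Longrightarrow> t \<le> 1 \<Longrightarrow> \<bar>2 * t - 1\<bar> \<le> (1::real)" by linarith

text \<open>The digits of the children of a vertex are equally spaced from -1 to 1, so 1 / card V
  bounds all gaps. The extreme digits are used to balance the weights at a root.\<close>

lemma digits: "\<exists>c g. 0 < g \<and> g \<le> (1::real) \<and> (\<forall>x. \<bar>c x\<bar> \<le> (1::real)) \<and>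
   (\<forall>v. \<forall>x\<in>children v. \<forall>y\<in>children v. x \<noteq> y \<longrightarrow> g \<le> \<bar>c x - c y\<bar>) \<and>
   (\<forall>v\<in>B. \<exists>x\<in>children v. \<exists>y\<in>children v. c x = -1 \<and> c y = 1)"
proof -
  have "\<exists>h. bij_betw h (children v) {0..<card (children v)}" for v
    using ex_bij_betw_finite_nat[OF finite_children] by blast
  then obtain h where h: "\<And>v. bij_betw (h v) (children v) {0..<card (children v)}" by metis
  define k where "k v = card (children v)" for v
  \<comment> \<open>An only child gets the digit -1, since 0 / 0 = 0.\<close>
  define c where "c x = (if x \<in> children (par x) then 2 * (real (h (par x) x) / real (k (par x) - 1)) - 1 else 0)" for x
  have cx: "c x = 2 * (real (h v x) / real (k v - 1)) - 1" if "x \<in> children v" for x v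
    using that by (auto simp: c_def children_def)
  have hx: "h v x < k v" if "x \<in> children v" for x v using bij_betwE[OF h[of v]] that by (auto simp: k_def)
  have cle: "\<bar>c x\<bar> \<le> 1" for x
  proof (cases "x \<in> children (par x)")
    case True
    have "real (h (par x) x) / real (k (par x) - 1) \<le> 1" using hx[OF True] by (simp add: divide_le_eq_1) linarith
    moreover have "0 \<le> real (h (par x) x) / real (k (par x) - 1)" by simp
    ultimately show ?thesis unfolding cx[OF True] using sub01 by blast
  qed (simp add: c_def)
  define g where "g = 1 / real (card V)"
  have cV: "card V \<ge> 1" using finV puv by (metis One_nat_def Suc_leI card_gt_0_iff empty_iff)
  have cg: "g \<le> \<bar>c x - c y\<bar>" if xy: "x \<in> children v" "y \<in> children v" "x \<noteq> y" for v x y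
  proof -
    have "h v x \<noteq> h v y" using h[of v] xy by (auto simp: bij_betw_def inj_on_def)
    then have d: "1 \<le> \<bar>real (h v x) - real (h v y)\<bar>" by linarith
    have kv: "2 \<le> k v" using hx[OF xy(1)] hx[OF xy(2)] \<open>h v x \<noteq> h v y\<close> by linarith
    have "k v \<le> card V" unfolding k_def by (intro card_mono finV) (auto simp: children_def)
    then have le: "real (k v - 1) \<le> 2 * real (card V)" by linarith
    have "c x - c y = (2 * (real (h v x) - real (h v y))) / real (k v - 1)"
      unfolding cx[OF xy(1)] cx[OF xy(2)] by (simp add: diff_divide_distrib)
    then have "\<bar>c x - c y\<bar> = 2 * \<bar>real (h v x) - real (h v y)\<bar> / real (k v - 1)"
      by (simp only: abs_divide abs_mult abs_numeral abs_of_nat)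
    moreover have "2 * 1 / (2 * real (card V)) \<le> 2 * \<bar>real (h v x) - real (h v y)\<bar> / real (k v - 1)"
      using d le kv by (intro frac_le mult_left_mono) auto
    ultimately show ?thesis by (simp add: g_def)
  qed
  have cb: "\<exists>x\<in>children v. \<exists>y\<in>children v. c x = -1 \<and> c y = 1" if v: "v \<in> B" for v
  proof -
    have kv: "2 \<le> k v" using branch_children[OF v] by (simp add: k_def)
    have im: "h v ` children v = {0..<k v}" using h[of v] by (auto simp: bij_betw_def k_def)
    have "0 \<in> h v ` children v" "k v - 1 \<in> h v ` children v" unfolding im using kv by auto
    then obtain x y where xy: "x \<in> children v" "h v x = 0" "y \<in> children v" "h v y = k v - 1" by (metis imageE)
    then have "c x = -1" "c y = 1" using kv by (auto simp: cx)
    then show ?thesis using xy by blast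
  qed
  have g0: "0 < g" unfolding g_def using cV by simp
  have g1: "g \<le> 1" unfolding g_def using cV by simp
  show ?thesis
  proof (intro exI[of _ c] exI[of _ g] conjI allI ballI impI)
    show "0 < g" by (rule g0)
    show "g \<le> 1" by (rule g1)
    show "\<bar>c x\<bar> \<le> 1" for x by (rule cle)
    show "g \<le> \<bar>c x - c y\<bar>" if "x \<in> children v" "y \<in> children v" "x \<noteq> y" for v x y by (rule cg[OF that])
    show "\<exists>x\<in>children v. \<exists>y\<in>children v. c x = -1 \<and> c y = 1" if "v \<in> B" for v by (rule cb[OF that])
  qed
qed

lemma bel_child: "bel v e \<Longrightarrow> e = v \<or> (\<exists>w\<in>children v. bel w e)"
proof (induction rule: bel.induct)
  case (bel_step x)
  then show ?case by (metis (mono_tags, lifting) children_def mem_Collect_eq bel.bel_refl bel.bel_step)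
qed simp

end

text \<open>In the upper half plane a vertex of depth \<open>n\<close> is placed at height \<open>\<epsilon>^n\<close> over the real number with digits
  \<open>c\<close> in base \<open>\<epsilon>\<close> read off along its branch; an end is placed on the real line. The two rooted
  trees are scaled by \<open>\<eta>1\<close> and \<open>\<eta>2\<close> and put into the disc on opposite sides of \<open>0\<close>.\<close>

locale tree_positions = rooted_tree V E pu pv for V :: "'v set" and E pu pv +
  fixes c :: "'v \<Rightarrow> real" and g \<epsilon> \<kappa> \<eta>1 \<eta>2 :: real
  assumes g: "0 < g" "g \<le> 1" and c1: "\<bar>c x\<bar> \<le> 1"
    and cgap: "x \<in> children v \<Longrightarrow> y \<in> children v \<Longrightarrow> x \<noteq> y \<Longrightarrow> g \<le> \<bar>c x - c y\<bar>"
    and cpm: "v \<in> B \<Longrightarrow> \<exists>x\<in>children v. \<exists>y\<in>children v. c x = -1 \<and> c y = 1"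
    and e0: "0 < \<epsilon>" and ek: "\<epsilon> \<le> \<kappa>" and kg: "\<kappa> \<le> g / 8"
    and eta1: "0 < \<eta>1" "\<eta>1 \<le> \<kappa>" and eta2: "0 < \<eta>2" "\<eta>2 \<le> \<kappa>"
begin

lemma small: "\<kappa> \<le> 1 / 8" "0 < \<kappa>" "\<epsilon> \<le> 1 / 8" "\<epsilon> \<le> g / 8"
  using e0 ek kg g by auto

primrec Xn :: "nat \<Rightarrow> 'v \<Rightarrow> real" where
  "Xn 0 x = 0" | "Xn (Suc n) x = Xn n (par x) + c x * \<epsilon> ^ n"

definition "X x = Xn (dep x) x"
definition "et x = (if bel pv x then \<eta>1 else \<eta>2)"
definition sg :: "'v \<Rightarrow> real" where "sg x = (if bel pv x then 1 else -1)"
definition "Y x = of_real (et x) * (of_real (X x) + \<i> * of_real (\<epsilon> ^ dep x))"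
definition "pos x = of_real (sg x) * cay (Y x)"
definition "zeta x = of_real (sg x) * cay (of_real (et x * X x))"

lemma X_root: "X pu = 0" "X pv = 0" by (simp_all add: X_def)

lemma X_par: assumes "x \<in> V" "x \<noteq> pu" "x \<noteq> pv" shows "X x = X (par x) + c x * \<epsilon> ^ dep (par x)"
  unfolding X_def par_edge(2)[OF assms, symmetric] by simp

lemma et_pos: "0 < et x" "et x \<le> \<kappa>" using eta1 eta2 by (auto simp: et_def)

lemma same_side: assumes "bel r x" "bel r y" "r = pu \<or> r = pv" shows "et x = et y" "sg x = sg y"
proof -
  have "bel pv x \<longleftrightarrow> bel pv y" using assms bel_excl by blast
  then show "et x = et y" "sg x = sg y" by (auto simp: et_def sg_def)
qed

lemma par_side: assumes "x \<in> V" "x \<noteq> pu" "x \<noteq> pv" shows "et (par x) = et x" "sg (par x) = sg x"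
proof -
  obtain r where r: "bel r x" "r = pu \<or> r = pv" using bel_cover[OF assms(1)] by blast
  have "bel r (par x)" using r(1) assms r(2) by (metis bel.cases)
  from same_side[OF this r] show "et (par x) = et x" "sg (par x) = sg x" .
qed

lemma bel_side_eq: assumes "bel w x" "w \<in> V" shows "et w = et x" "sg w = sg x"
proof -
  obtain r where r: "bel r w" "r = pu \<or> r = pv" using bel_cover[OF assms(2)] by blast
  from same_side[OF r(1) bel_trans[OF assms(1) r(1)] r(2)] show "et w = et x" "sg w = sg x" .
qed

text \<open>The tail of a digit expansion is a geometric series. Subtracting the term at x makes the
  bound inductive: one more digit adds at most \<epsilon>^n, and \<epsilon> \<le> 1 / 8 makes this
  smaller than 2 (\<epsilon>^n - \<epsilon>^(n + 1)).\<close>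

lemma X_bel: "bel w x \<Longrightarrow> \<bar>X x - X w\<bar> \<le> 2 * (\<epsilon> ^ dep w - \<epsilon> ^ dep x)"
proof (induction rule: bel.induct)
  case (bel_step x)
  let ?q = "\<epsilon> ^ dep (par x)"
  have d: "\<epsilon> ^ dep x = \<epsilon> * ?q" using par_edge(2)[OF bel_step(1-3)] by (metis power_Suc)
  have q: "?q > 0" using e0 by simp
  have "\<bar>c x * ?q\<bar> \<le> 1 * ?q" unfolding abs_mult using c1[of x] q by (intro mult_mono) auto
  moreover have "\<epsilon> * ?q \<le> 1 / 8 * ?q" using small q by (intro mult_right_mono) auto
  moreover have "\<bar>X x - X w\<bar> \<le> \<bar>X (par x) - X w\<bar> + \<bar>c x * ?q\<bar>"
    unfolding X_par[OF bel_step(1-3)] using abs_triangle_ineq[of "X (par x) - X w" "c x * ?q"] by (simp add: algebra_simps)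
  moreover have "\<bar>X (par x) - X w\<bar> \<le> 2 * \<epsilon> ^ dep w - 2 * ?q" using bel_step(5) by (simp add: right_diff_distrib)
  ultimately have "\<bar>X x - X w\<bar> \<le> 2 * \<epsilon> ^ dep w - 2 * (\<epsilon> * ?q)" using q by linarith
  then show ?case unfolding d by (simp only: right_diff_distrib)
qed simp

lemma X_bel': assumes "bel w x" shows "\<bar>X x - X w\<bar> \<le> 2 * \<epsilon> ^ dep w"
proof -
  have "0 < \<epsilon> ^ dep x" using e0 by simp
  then show ?thesis using X_bel[OF assms] unfolding right_diff_distrib by linarith
qed

lemma X_le_2: assumes "x \<in> V" shows "\<bar>X x\<bar> \<le> 2"
  using bel_cover[OF assms] X_bel'[of pu x] X_bel'[of pv x] X_root by auto

text \<open>Where the branches of \<open>e\<close> and \<open>w\<close> part, the digits differ by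
  at least g, and later digits contribute less. If the parent of \<open>w\<close> is not above
  \<open>e\<close> either, the estimate for the parent holds at a scale larger by 1 / \<epsilon> and
  absorbs the digit of \<open>w\<close>.\<close>

lemma X_far:
  assumes "e \<in> Ends" "r = pu \<or> r = pv" "bel r e"
  shows "w \<in> V \<Longrightarrow> w \<noteq> pu \<Longrightarrow> w \<noteq> pv \<Longrightarrow> bel r w \<Longrightarrow> \<not> bel w e \<Longrightarrow> g / 2 * \<epsilon> ^ dep (par w) \<le> \<bar>X e - X w\<bar>"
proof (induction "dep w" arbitrary: w rule: less_induct)
  case less
  define v where "v = par w"
  have vV: "v \<in> V" using parV less by (simp add: v_def)
  have wv: "w \<in> children v" using less by (simp add: children_def v_def)
  have rv: "bel r v" using less.prems assms(2) by (auto simp: v_def elim: bel.cases)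
  let ?q = "\<epsilon> ^ dep v"
  have q: "?q > 0" using e0 by simp
  have dw: "Suc (dep v) = dep w" using par_edge(2)[of w] less by (simp add: v_def)
  have Xw: "X w = X v + c w * ?q" using X_par[of w] less by (simp add: v_def)
  show ?case
  proof (cases "bel v e")
    case True
    have "e \<noteq> v" using wv end_no_children[OF assms(1)] by auto
    then obtain w' where w': "w' \<in> children v" "bel w' e" using bel_child[OF True] by blast
    have nw: "w' \<noteq> w" using w' less by blast
    have Xw': "X w' = X v + c w' * ?q" "Suc (dep v) = dep w'" using X_par[of w'] par_edge(2)[of w'] w'(1) by (auto simp: children_def)
    have "g * ?q \<le> \<bar>c w' - c w\<bar> * ?q" using cgap[OF w'(1) wv nw] q by (intro mult_right_mono) auto
    also have "\<dots> = \<bar>X w' - X w\<bar>" unfolding Xw Xw' using q by (simp add: abs_mult flip: left_diff_distrib)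
    finally have 1: "g * ?q \<le> \<bar>X w' - X w\<bar>" .
    have 2: "\<bar>X e - X w'\<bar> \<le> 2 * (\<epsilon> * ?q)" using X_bel'[OF w'(2)] unfolding Xw'(2)[symmetric] by simp
    have "\<epsilon> * ?q \<le> g / 8 * ?q" using small q by (intro mult_right_mono) auto
    then have "g / 2 * ?q \<le> \<bar>X e - X w\<bar>" using 1 2 mult_pos_pos[OF g(1) q] by linarith
    then show ?thesis by (simp add: v_def)
  next
    case False
    have vr: "v \<noteq> pu" "v \<noteq> pv" using False rv bel_root[OF rv] assms by auto
    have IH: "g / 2 * \<epsilon> ^ dep (par v) \<le> \<bar>X e - X v\<bar>" using less.hyps[of v] dw vV vr rv False by simp
    have dv: "?q = \<epsilon> * \<epsilon> ^ dep (par v)" using par_edge(2)[OF vV vr] by (metis power_Suc)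
    let ?p = "\<epsilon> ^ dep (par v)"
    have p: "?p > 0" using e0 by simp
    have "\<bar>c w * ?q\<bar> \<le> 1 * ?q" unfolding abs_mult using c1[of w] q by (intro mult_mono) auto
    then have "\<bar>X w - X v\<bar> \<le> ?q" unfolding Xw by simp
    moreover have "?q \<le> g / 8 * ?p" unfolding dv using small p by (intro mult_right_mono) auto
    moreover have "g / 2 * ?q \<le> 1 * ?q" using g q by (intro mult_right_mono) auto
    moreover have "0 < g * ?p" using g p by simp
    ultimately have "g / 2 * ?q \<le> \<bar>X e - X w\<bar>" using IH by linarith
    then show ?thesis by (simp add: v_def)
  qed
qed

lemma Y_parts: "Re (Y x) = et x * X x" "Im (Y x) = et x * \<epsilon> ^ dep x" by (simp_all add: Y_def)
lemma Im_Y: "Im (Y x) > 0" using et_pos e0 by (simp add: Y_parts)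

lemma sg_cases: "sg x = 1 \<or> sg x = -1" by (simp add: sg_def)

lemma norm_pos: "cmod (pos x) < 1"
  using norm_cay_less[OF Im_Y] sg_cases[of x] by (auto simp: pos_def)

lemma norm_zeta: "cmod (zeta x) = 1" using sg_cases[of x] by (auto simp: zeta_def simp del: of_real_mult)

lemma pker_neg: "pker (- z) (- \<xi>) = pker z \<xi>" unfolding pker_def by (simp add: norm_minus_commute)

lemma pker_same: assumes "et x = et e" "sg x = sg e"
  shows "pker (pos x) (zeta e) = Im (Y x) * (1 + (et e * X e)\<^sup>2) / (cmod (of_real (et e * X e) - Y x))\<^sup>2"
  using pker_cay(1)[OF Im_Y, of x "et e * X e"] sg_cases[of e] assms(2) by (auto simp: pos_def zeta_def pker_neg)

lemma pker_opp: assumes "sg x = - sg e"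
  shows "pker (pos x) (zeta e) = Im (Y x) * (1 + (et e * X e)\<^sup>2) / (cmod (1 + of_real (et e * X e) * Y x))\<^sup>2"
  using pker_cay(2)[OF Im_Y, of x "et e * X e"] pker_neg[of "cay (Y x)" "- cay (of_real (et e * X e))"] sg_cases[of e] assms
  by (auto simp: pos_def zeta_def)

lemma hdist_neg: "hdist (- z) (- w) = hdist z w" unfolding hdist_def by (simp add: norm_divide norm_minus_commute)

lemma norm_Y_le: assumes "x \<in> V" shows "cmod (Y x) \<le> 3 * et x"
proof -
  have "\<epsilon> ^ dep x \<le> 1" using e0 small by (intro power_le_one) auto
  then have "cmod (of_real (X x) + \<i> * of_real (\<epsilon> ^ dep x)) \<le> 2 + 1"
    using X_le_2[OF assms] e0 by (intro order_trans[OF norm_triangle_ineq] add_mono) (auto simp: norm_mult norm_power)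
  then show ?thesis using et_pos[of x] by (simp add: Y_def norm_mult mult.commute mult_right_mono)
qed

lemma opp_bound: assumes "x \<in> V" "e \<in> V"
  shows "cmod (of_real (et e * X e) * Y x) \<le> 6 * \<kappa> * \<kappa>" "cmod (of_real (et e * X e) * Y x) \<le> 1 / 2"
proof -
  have "cmod (of_real (et e * X e) * Y x) = (et e * \<bar>X e\<bar>) * cmod (Y x)"
    using et_pos[of e] by (simp add: norm_mult abs_mult)
  also have "\<dots> \<le> (\<kappa> * 2) * (3 * \<kappa>)"
    using et_pos[of e] et_pos[of x] X_le_2[OF assms(2)] norm_Y_le[OF assms(1)] small
    by (intro mult_mono) auto
  finally show 1: "cmod (of_real (et e * X e) * Y x) \<le> 6 * \<kappa> * \<kappa>" by simp
  have "\<kappa> * \<kappa> \<le> 1 / 8 * (1 / 8)" using small by (intro mult_mono) auto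
  then show "cmod (of_real (et e * X e) * Y x) \<le> 1 / 2" using 1 by simp
qed

lemma one_plus_bounds: assumes "cmod a \<le> 1 / 2" shows "1 / 2 \<le> cmod (1 + a)" "cmod (1 + a) \<le> 3 / 2"
  using norm_triangle_ineq2[of 1 "- a"] norm_triangle_ineq[of 1 a] assms by auto

text \<open>In units of the height of the parent, the horizontal distance is at most 1 and the
  vertical distance to the reflected point is 1 + \<epsilon> \<le> 2, whence 5 = 1 + 4.\<close>

lemma hdist_edge: assumes "w \<in> V" "w \<noteq> pu" "w \<noteq> pv" shows "hdist (pos (par w)) (pos w) \<le> ln (1 / \<epsilon>) + ln 5"
proof -
  let ?v = "par w" and ?q = "\<epsilon> ^ dep (par w)" and ?h = "et w"
  have d: "\<epsilon> ^ dep w = \<epsilon> * ?q" using par_edge(2)[OF assms] by (metis power_Suc)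
  have q: "?q > 0" using e0 by simp
  have h: "?h > 0" by (rule et_pos)
  have "hdist (pos ?v) (pos w) = hdist (cay (Y ?v)) (cay (Y w))"
    using sg_cases[of w] par_side(2)[OF assms] hdist_neg by (auto simp: pos_def)
  also have "\<dots> \<le> ln ((cmod (Y ?v - cnj (Y w)))\<^sup>2 / (Im (Y ?v) * Im (Y w)))" by (intro hdist_cay_le Im_Y)
  also have "\<dots> \<le> ln (1 / \<epsilon> * 5)"
  proof -
    have "(cmod (Y ?v - cnj (Y w)))\<^sup>2 = (?h * ?q)\<^sup>2 * ((c w)\<^sup>2 + (1 + \<epsilon>)\<^sup>2)"
      unfolding cmod_power2 using X_par[OF assms] par_side(1)[OF assms] d
      by (simp add: Y_parts power2_eq_square algebra_simps)
    also have "\<dots> \<le> (?h * ?q)\<^sup>2 * 5"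
    proof (intro mult_left_mono)
      have "(c w)\<^sup>2 \<le> 1" using c1[of w] by (simp add: abs_square_le_1)
      moreover have "(1 + \<epsilon>)\<^sup>2 \<le> 2\<^sup>2" using small e0 by (intro power_mono) auto
      ultimately show "(c w)\<^sup>2 + (1 + \<epsilon>)\<^sup>2 \<le> 5" by simp
    qed simp
    finally have "(cmod (Y ?v - cnj (Y w)))\<^sup>2 / (Im (Y ?v) * Im (Y w)) \<le> (?h * ?q)\<^sup>2 * 5 / (Im (Y ?v) * Im (Y w))"
      using Im_Y[of ?v] Im_Y[of w] by (intro divide_right_mono) auto
    also have "\<dots> = 1 / \<epsilon> * 5" using q h e0 par_side(1)[OF assms] d by (simp add: Y_parts power2_eq_square)
    finally have "(cmod (Y ?v - cnj (Y w)))\<^sup>2 / (Im (Y ?v) * Im (Y w)) \<le> 1 / \<epsilon> * 5" .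
    moreover have "0 < (cmod (Y ?v - cnj (Y w)))\<^sup>2 / (Im (Y ?v) * Im (Y w))"
      using Im_Y[of ?v] Im_Y[of w] by (auto simp: complex_eq_iff intro!: divide_pos_pos)
    ultimately show ?thesis using e0 by (subst ln_le_cancel_iff) auto
  qed
  also have "\<dots> = ln (1 / \<epsilon>) + ln 5" using e0 by (subst ln_mult) auto
  finally show ?thesis .
qed

lemma pos_root: assumes "r = pu \<or> r = pv" shows "cmod (pos r) = (1 - et r) / (1 + et r)" "hdist 0 (pos r) = ln (1 / et r)"
proof -
  have Yr: "Y r = \<i> * of_real (et r)" using assms X_root by (auto simp: Y_def)
  have h: "0 < et r" "et r \<le> 1 / 8" using et_pos[of r] small by auto
  have "cay (Y r) = of_real ((et r - 1) / (et r + 1))"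
  proof -
    have "cay (Y r) = (\<i> * of_real (et r - 1)) / (\<i> * of_real (et r + 1))" by (simp add: cay_def Yr algebra_simps)
    then show ?thesis by simp
  qed
  then have "cmod (cay (Y r)) = \<bar>(et r - 1) / (et r + 1)\<bar>" by (simp only: norm_of_real)
  moreover have "\<bar>et r - 1\<bar> = 1 - et r" "\<bar>et r + 1\<bar> = 1 + et r" using h by auto
  moreover have "cmod (pos r) = cmod (cay (Y r))" using sg_cases[of r] by (auto simp: pos_def)
  ultimately show n: "cmod (pos r) = (1 - et r) / (1 + et r)" by (simp only: abs_divide)
  have "1 + (1 - et r) / (1 + et r) = 2 / (1 + et r)" "1 - (1 - et r) / (1 + et r) = 2 * et r / (1 + et r)"
    using h by (simp_all add: field_simps)
  moreover have "(2 / a) / (2 * b / a) = 1 / b" if "0 < a" for a b :: real using that by simp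
  ultimately have "(1 + (1 - et r) / (1 + et r)) / (1 - (1 - et r) / (1 + et r)) = 1 / et r" using h by (simp only: add_pos_pos)
  then show "hdist 0 (pos r) = ln (1 / et r)" unfolding hdist_0 n artanh_def by (simp only:)
qed

text \<open>Along an edge the height changes by the factor \<epsilon>. For an end below
  \<open>w\<close> the squared distance shrinks by \<epsilon>^2 up to constants, so the kernel gains
  1 / \<epsilon> on the way to \<open>w\<close>. For any other end the distances from both endpoints
  are comparable, with ratio at most 5 / g, so the kernel follows the height; the constant is the
  square of this ratio.\<close>

lemma bus_edge:
  assumes w: "w \<in> V" "w \<noteq> pu" "w \<noteq> pv" and e: "e \<in> Ends"
  shows "bel w e \<Longrightarrow> ln (1 / \<epsilon>) - ln (25 / g\<^sup>2) \<le> bus (zeta e) (pos w) - bus (zeta e) (pos (par w))"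
    and "\<not> bel w e \<Longrightarrow> ln (1 / \<epsilon>) - ln (25 / g\<^sup>2) \<le> bus (zeta e) (pos (par w)) - bus (zeta e) (pos w)"
proof -
  let ?v = "par w" and ?q = "\<epsilon> ^ dep (par w)" and ?h = "et w" and ?y = "et e * X e"
  let ?P = "\<lambda>x. pker (pos x) (zeta e)"
  have d: "\<epsilon> ^ dep w = \<epsilon> * ?q" using par_edge(2)[OF w] by (metis power_Suc)
  have q: "?q > 0" using e0 by simp
  have h: "?h > 0" by (rule et_pos)
  have eV: "e \<in> V" using e by (simp add: tree_ends_def)
  have Imv: "Im (Y ?v) = ?h * ?q" "Im (Y w) = \<epsilon> * (?h * ?q)" using par_side(1)[OF w] d by (simp_all add: Y_parts)
  have hq: "?h * ?q > 0" using h q by simp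
  have Pp: "?P x > 0" for x by (rule pker_pos[OF norm_pos norm_zeta])
  have ln_ge: "ln (1 / \<epsilon>) - ln (25 / g\<^sup>2) \<le> bus (zeta e) (pos a) - bus (zeta e) (pos b)"
    if "(1 / \<epsilon>) * (g\<^sup>2 / 25) * ?P b \<le> ?P a" for a b
  proof -
    have "ln ((1 / \<epsilon>) * (g\<^sup>2 / 25) * ?P b) \<le> ln (?P a)" using that Pp e0 g by (subst ln_le_cancel_iff) auto
    moreover have "ln ((1 / \<epsilon>) * (g\<^sup>2 / 25) * ?P b) = ln (1 / \<epsilon>) + ln (g\<^sup>2 / 25) + ln (?P b)"
    proof -
      have p: "0 < 1 / \<epsilon>" "0 < g\<^sup>2 / 25" "0 < (1 / \<epsilon>) * (g\<^sup>2 / 25)" using e0 g by auto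
      show ?thesis unfolding ln_mult_pos[OF p(3) Pp[of b]] ln_mult_pos[OF p(1,2)] ..
    qed
    moreover have "ln (g\<^sup>2 / 25) = - ln (25 / g\<^sup>2)" using g by (simp add: ln_div)
    ultimately show ?thesis by (simp add: bus_def)
  qed
  have g2: "g\<^sup>2 \<le> 1" using g by (simp add: power_le_one)
  define a where "a = 1 + ?y\<^sup>2"
  have a: "a > 0" by (simp add: a_def add_pos_nonneg)
  have YY: "cmod (Y ?v - Y w) \<le> 2 * (?h * ?q)"
  proof -
    have "Y ?v - Y w = of_real (?h * ?q) * (of_real (- c w) + \<i> * of_real (1 - \<epsilon>))"
      using X_par[OF w] par_side(1)[OF w] d by (simp add: complex_eq_iff Y_parts algebra_simps)
    moreover have "cmod (of_real (- c w) + \<i> * of_real (1 - \<epsilon>)) \<le> 1 + 1"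
      using c1[of w] e0 small by (intro order_trans[OF norm_triangle_ineq] add_mono) (simp_all only: norm_mult norm_of_real norm_ii, auto)
    ultimately have "cmod (Y ?v - Y w) \<le> (?h * ?q) * (1 + 1)"
      using hq by (simp only: norm_mult norm_of_real abs_of_pos mult_left_mono less_imp_le)
    then show ?thesis by simp
  qed
  { assume b: "bel w e"
    have s: "et e = ?h" "sg e = sg w" using bel_side_eq[OF b w(1)] by auto
    have P: "?P w = \<epsilon> * (?h * ?q) * a / (cmod (of_real ?y - Y w))\<^sup>2" "?P ?v = (?h * ?q) * a / (cmod (of_real ?y - Y ?v))\<^sup>2"
      using pker_same[of w e] pker_same[of ?v e] s par_side[OF w] Imv by (simp_all add: a_def)
    have 1: "?h * ?q \<le> cmod (of_real ?y - Y ?v)" using abs_Im_le_cmod[of "of_real ?y - Y ?v"] hq by (simp add: Imv)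
    have 2: "cmod (of_real ?y - Y w) \<le> 3 * (\<epsilon> * (?h * ?q))"
    proof -
      have "of_real ?y - Y w = of_real ?h * (of_real (X e - X w) - \<i> * of_real (\<epsilon> * ?q))"
        using s d by (simp add: complex_eq_iff Y_parts algebra_simps)
      moreover have "\<bar>X e - X w\<bar> \<le> 2 * (\<epsilon> * ?q)" "\<bar>\<epsilon> * ?q\<bar> = \<epsilon> * ?q"
        using X_bel'[OF b] d e0 q by auto
      then have "cmod (of_real (X e - X w) - \<i> * of_real (\<epsilon> * ?q)) \<le> 2 * (\<epsilon> * ?q) + \<epsilon> * ?q"
        using norm_le_parts[of "X e - X w" "\<epsilon> * ?q"] by linarith
      ultimately have "cmod (of_real ?y - Y w) \<le> ?h * (2 * (\<epsilon> * ?q) + \<epsilon> * ?q)"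
        using h by (simp only: norm_mult norm_of_real abs_of_pos mult_left_mono less_imp_le)
      then show ?thesis by (simp add: algebra_simps)
    qed
    have ne: "cmod (of_real ?y - Y w) > 0" by (rule norm_gt_Im[OF Im_Y])
    have "?P ?v \<le> (?h * ?q) * a / (?h * ?q)\<^sup>2" unfolding P
      using 1 hq h e0 a norm_gt_Im[OF Im_Y[of ?v], of ?y] by (intro divide_left_mono power_mono mult_pos_pos zero_less_power) auto
    also have "\<dots> = a / (?h * ?q)" using hq by (simp add: power2_eq_square)
    finally have Pv: "?P ?v \<le> a / (?h * ?q)" .
    have "a / (?h * ?q) * (1 / \<epsilon>) / 9 = \<epsilon> * (?h * ?q) * a / (3 * (\<epsilon> * (?h * ?q)))\<^sup>2"
      using hq e0 by (simp add: power2_eq_square field_simps)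
    also have "\<dots> \<le> ?P w" unfolding P
      using 2 ne hq h a e0 by (intro divide_left_mono power_mono mult_pos_pos zero_less_power) auto
    finally have Pw: "a / (?h * ?q) * (1 / \<epsilon>) / 9 \<le> ?P w" .
    have "(1 / \<epsilon>) * (g\<^sup>2 / 25) * ?P ?v \<le> (1 / \<epsilon>) * (1 / 9) * (a / (?h * ?q))"
      using Pv g2 e0 Pp[of ?v] by (intro mult_mono) auto
    also have "\<dots> = a / (?h * ?q) * (1 / \<epsilon>) / 9" by simp
    also note Pw
    finally show "ln (1 / \<epsilon>) - ln (25 / g\<^sup>2) \<le> bus (zeta e) (pos w) - bus (zeta e) (pos ?v)" by (rule ln_ge) }
  { assume nb: "\<not> bel w e"
    show "ln (1 / \<epsilon>) - ln (25 / g\<^sup>2) \<le> bus (zeta e) (pos ?v) - bus (zeta e) (pos w)"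
    proof (rule ln_ge)
      obtain r where r: "bel r w" "r = pu \<or> r = pv" using bel_cover[OF w(1)] by blast
      show "(1 / \<epsilon>) * (g\<^sup>2 / 25) * ?P w \<le> ?P ?v"
      proof (cases "bel r e")
        case True
        have s: "et e = ?h" "sg e = sg w" using same_side[OF True r] by auto
        have P: "?P w = \<epsilon> * (?h * ?q) * a / (cmod (of_real ?y - Y w))\<^sup>2" "?P ?v = (?h * ?q) * a / (cmod (of_real ?y - Y ?v))\<^sup>2"
          using pker_same[of w e] pker_same[of ?v e] s par_side[OF w] Imv by (simp_all add: a_def)
        let ?A = "cmod (of_real ?y - Y w)" and ?B = "cmod (of_real ?y - Y ?v)"
        have "?h * (g / 2 * ?q) \<le> ?h * \<bar>X e - X w\<bar>"
          using X_far[OF e r(2) True w r(1) nb] h by (intro mult_left_mono) auto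
        also have "\<dots> = \<bar>Re (of_real ?y - Y w)\<bar>" using h s by (simp add: Y_parts abs_mult flip: right_diff_distrib)
        also have "\<dots> \<le> ?A" by (rule abs_Re_le_cmod)
        finally have A: "g / 2 * (?h * ?q) \<le> ?A" by (simp add: mult_ac)
        have "?B \<le> ?A + cmod (Y ?v - Y w)"
          using norm_triangle_ineq4[of "of_real ?y - Y w" "Y ?v - Y w"] by simp
        then have "?B \<le> ?A + 2 * (?h * ?q)" using YY by simp
        then have "g * ?B \<le> g * ?A + 2 * (g * (?h * ?q))" using mult_left_mono[of ?B "?A + 2 * (?h * ?q)" g] g by (simp add: algebra_simps)
        moreover have "g * ?A \<le> 1 * ?A" using g by (intro mult_right_mono) auto
        ultimately have "g * ?B \<le> 5 * ?A" using A by simp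
        then have gB: "(g * ?B)\<^sup>2 \<le> (5 * ?A)\<^sup>2" using g by (intro power_mono) auto
        have Ap: "?A > 0" using A g hq by (smt (verit) mult_pos_pos half_gt_zero)
        have Bp: "?B > 0" by (rule norm_gt_Im[OF Im_Y])
        have "(1 / \<epsilon>) * (g\<^sup>2 / 25) * ?P w = (?h * ?q) * a * (g\<^sup>2 / (25 * ?A\<^sup>2))" unfolding P using e0 by simp
        also have "\<dots> \<le> (?h * ?q) * a * (1 / ?B\<^sup>2)"
        proof (intro mult_left_mono)
          show "g\<^sup>2 / (25 * ?A\<^sup>2) \<le> 1 / ?B\<^sup>2" using gB Ap Bp by (simp add: field_simps power_mult_distrib)
        qed (use hq a in auto)
        finally show ?thesis unfolding P by simp
      next
        case False
        then have so: "sg w = - sg e" using r bel_cover[OF eV] bel_excl by (auto simp: sg_def)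
        have so2: "sg ?v = - sg e" using so par_side(2)[OF w] by simp
        have P: "?P w = \<epsilon> * (?h * ?q) * a / (cmod (1 + of_real ?y * Y w))\<^sup>2" "?P ?v = (?h * ?q) * a / (cmod (1 + of_real ?y * Y ?v))\<^sup>2"
          using pker_opp[OF so] pker_opp[OF so2] Imv by (simp_all add: a_def)
        have vV: "?v \<in> V" using parV[OF w] .
        let ?A = "cmod (1 + of_real ?y * Y w)" and ?B = "cmod (1 + of_real ?y * Y ?v)"
        have AB: "1 / 2 \<le> ?A" "?B \<le> 3 / 2" "1 / 2 \<le> ?B"
          using one_plus_bounds[OF opp_bound(2)[OF w(1) eV]] one_plus_bounds[OF opp_bound(2)[OF vV eV]] by auto
        have AB0: "0 < ?A" "0 < ?B" "0 < ?A\<^sup>2 * (1 / 2)\<^sup>2" using AB by (auto intro!: mult_pos_pos zero_less_power simp del: norm_eq_zero)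
        have "(1 / \<epsilon>) * (g\<^sup>2 / 25) * ?P w = (?h * ?q) * a * (g\<^sup>2 / 25 * (1 / ?A\<^sup>2))" unfolding P using e0 by simp
        also have "\<dots> \<le> (?h * ?q) * a * (1 / 25 * (1 / (1 / 2)\<^sup>2))"
          using AB AB0 g2 hq a by (intro mult_left_mono mult_mono divide_left_mono power_mono divide_right_mono) auto
        also have "\<dots> \<le> (?h * ?q) * a * (1 / (3 / 2)\<^sup>2)" using hq a by (intro mult_left_mono) (auto simp: power2_eq_square)
        also have "\<dots> \<le> (?h * ?q) * a * (1 / ?B\<^sup>2)"
          using AB hq a by (intro mult_left_mono divide_left_mono power_mono mult_pos_pos zero_less_power) auto
        finally show ?thesis unfolding P by simp
      qed
    qed }
qed

text \<open>The counterpart of \<open>bus_edge\<close> for the part of the base edge between 0 and a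
  root, where the Busemann function vanishes at 0 and the root has height
  \<open>et r\<close>.\<close>

lemma bus_root:
  assumes r: "r = pu \<or> r = pv" and e: "e \<in> Ends"
  shows "bel r e \<Longrightarrow> ln (1 / et r) - ln (25 / g\<^sup>2) \<le> bus (zeta e) (pos r)"
    and "\<not> bel r e \<Longrightarrow> bus (zeta e) (pos r) \<le> - ln (1 / et r) + ln (25 / g\<^sup>2)"
proof -
  let ?h = "et r" and ?y = "et e * X e"
  have h: "0 < ?h" "?h \<le> 1 / 8" using et_pos[of r] small by auto
  have eV: "e \<in> V" using e by (simp add: tree_ends_def)
  have rV: "r \<in> V" using r puv by auto
  have Xr: "X r = 0" "dep r = 0" using r X_root by auto
  have Pp: "pker (pos r) (zeta e) > 0" by (rule pker_pos[OF norm_pos norm_zeta])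
  have g2: "g\<^sup>2 \<le> 1" "0 < g\<^sup>2" using g by (simp_all add: power_le_one)
  have y: "?y\<^sup>2 \<le> 1"
  proof -
    have "\<bar>?y\<bar> \<le> 1 / 8 * 2" using et_pos[of e] small X_le_2[OF eV] unfolding abs_mult by (intro mult_mono) auto
    then show ?thesis by (simp add: abs_square_le_1)
  qed
  { assume b: "bel r e"
    have s: "et e = ?h" "sg e = sg r" using bel_side_eq[OF b rV] by auto
    have "of_real ?y - Y r = of_real ?h * (of_real (X e) - \<i>)" using s Xr by (simp add: Y_def algebra_simps)
    then have "(cmod (of_real ?y - Y r))\<^sup>2 = ?h\<^sup>2 * (1 + (X e)\<^sup>2)"
      by (simp only: norm_mult norm_of_real power_mult_distrib power2_abs) (simp add: cmod_power2)
    then have P: "pker (pos r) (zeta e) = ?h * (1 + ?y\<^sup>2) / (?h\<^sup>2 * (1 + (X e)\<^sup>2))"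
      using pker_same[of r e] s Xr by (simp add: Y_parts)
    have X5: "1 + (X e)\<^sup>2 \<le> 5" using X_le_2[OF eV] power_mono[of "\<bar>X e\<bar>" 2 2] by simp
    have "1 / ?h * (g\<^sup>2 / 25) \<le> 1 / ?h * (1 / 5)" using g2 h by (intro mult_left_mono) auto
    also have "\<dots> = ?h * 1 / (?h\<^sup>2 * 5)" using h by (simp add: power2_eq_square)
    also have "\<dots> \<le> pker (pos r) (zeta e)" unfolding P using h X5
      by (intro frac_le mult_left_mono mult_pos_pos zero_less_power add_pos_nonneg) auto
    finally have "ln (1 / ?h * (g\<^sup>2 / 25)) \<le> bus (zeta e) (pos r)" unfolding bus_def using Pp h g by (subst ln_le_cancel_iff) auto
    moreover have "ln (1 / ?h * (g\<^sup>2 / 25)) = ln (1 / ?h) - ln (25 / g\<^sup>2)" using h g by (simp add: ln_mult ln_div)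
    ultimately show "ln (1 / et r) - ln (25 / g\<^sup>2) \<le> bus (zeta e) (pos r)" by simp }
  { assume b: "\<not> bel r e"
    then have so: "sg r = - sg e" using r bel_cover[OF eV] bel_excl bel_root[of pv pu] bel_refl puv by (auto simp: sg_def)
    have "1 \<le> (cmod (1 + of_real ?y * Y r))\<^sup>2" unfolding cmod_power2 using Xr by (simp add: Y_parts)
    moreover have "Im (Y r) = ?h" using Xr by (simp add: Y_parts)
    moreover from calculation have "0 < (cmod (1 + of_real ?y * Y r))\<^sup>2" by linarith
    moreover have "0 \<le> ?h * (1 + ?y\<^sup>2)" using h by simp
    ultimately have "pker (pos r) (zeta e) \<le> ?h * (1 + ?y\<^sup>2) / 1"
      unfolding pker_opp[OF so] by (metis divide_left_mono mult.right_neutral)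
    also have "\<dots> \<le> ?h * 2" using y h by simp
    also have "\<dots> \<le> ?h * (25 / g\<^sup>2)" using g2 h by (intro mult_left_mono) (auto simp: le_divide_eq)
    finally have "bus (zeta e) (pos r) \<le> ln (?h * (25 / g\<^sup>2))" unfolding bus_def using Pp h g by (subst ln_le_cancel_iff) auto
    also have "\<dots> = - ln (1 / ?h) + ln (25 / g\<^sup>2)" using h g by (subst ln_mult) (auto simp: ln_div)
    finally show "bus (zeta e) (pos r) \<le> - ln (1 / et r) + ln (25 / g\<^sup>2)" . }
qed

definition "rot v = of_real (sg v) * cay_rot (Y v)"
text \<open>The standard configuration seen from a vertex: a child in the direction of its digit,
  all else at 1, the image of infinity. No scale enters, so constants derived from it are valid for
  all \<open>s\<close>.\<close>

definition "dir v w = (if w \<in> children v then cay (of_real (c w)) else 1)"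

lemma norm_rot: "cmod (rot v) = 1" using norm_cay_rot[OF Im_Y[of v]] sg_cases[of v] by (auto simp: rot_def)

lemma norm_dir: "cmod (dir v w) = 1" by (simp add: dir_def)

lemma dir_inj: assumes "v \<in> V" shows "inj_on (dir v) (nbrs E v)"
proof (rule inj_onI)
  fix x y assume xy: "x \<in> nbrs E v" "y \<in> nbrs E v" "dir v x = dir v y"
  have n: "z \<in> children v \<or> z = (if v = pu then pv else if v = pv then pu else par v)" if "z \<in> nbrs E v" for z
    using that nbrs_eq[OF assms] unfolding children_def[symmetric] by blast
  show "x = y"
  proof (cases "x \<in> children v \<longleftrightarrow> y \<in> children v")
    case True
    show ?thesis
    proof (cases "x \<in> children v")
      case x: True
      then have "c x = c y" using True xy(3) cay_real_inj by (simp add: dir_def)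
      then show ?thesis using cgap[of x v y] x True g by force
    next
      case False then show ?thesis using n[OF xy(1)] n[OF xy(2)] True by blast
    qed
  next
    case False
    then show ?thesis using xy(3) cay_real_ne_1 by (auto simp: dir_def split: if_splits)
  qed
qed

lemma mob_neg: "mob (- a) (- z) = - mob a z" unfolding mob_def by (simp add: minus_divide_left)

text \<open>In the coordinate (X e - X v) / \<epsilon>^(dep v) the ends below a child lie within 2
  \<epsilon> of its digit, and the remaining ends of the same tree lie beyond g / (2 \<epsilon>),
  close to infinity. Ends of the other tree are seen near 1 because the product of the two
  half-plane coordinates is of order \<kappa>^2.\<close>

lemma cluster:
  assumes v: "v \<in> V" and w: "w \<in> nbrs E v" and e: "e \<in> Ends" "e \<in> side E v w"
  shows "cmod (cnj (rot v) * mob (pos v) (zeta e) - dir v w) \<le> 8 * \<kappa> / g"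
proof -
  let ?y = "et e * X e" and ?q = "\<epsilon> ^ dep v" and ?h = "et v"
  have q: "?q > 0" using e0 by simp
  have h: "?h > 0" by (rule et_pos)
  have eV: "e \<in> V" using e by (simp add: tree_ends_def)
  have k: "8 * \<kappa> \<le> 8 * \<kappa> / g" using g small by (simp add: le_divide_eq mult_left_le)
  have rr: "cnj (rot v) * rot v = 1" using norm_rot[of v] complex_norm_square[of "rot v"] by (simp add: mult.commute)
  have same: "cnj (rot v) * mob (pos v) (zeta e) = cay (of_real ((X e - X v) / ?q))" if s: "et e = ?h" "sg e = sg v"
  proof -
    have "mob (pos v) (zeta e) = of_real (sg v) * mob (cay (Y v)) (cay (of_real ?y))"
      using sg_cases[of v] s(2) mob_neg by (auto simp: pos_def zeta_def)
    also have "\<dots> = rot v * ((of_real ?y - Y v) / (of_real ?y - cnj (Y v)))"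
      using mob_cay[OF Im_Y, of "of_real ?y" v] by (simp add: rot_def)
    also have "(of_real ?y - Y v) / (of_real ?y - cnj (Y v)) = cay (of_real ((X e - X v) / ?q))"
    proof -
      have "of_real ?y - Y v = of_real (?h * ?q) * (of_real ((X e - X v) / ?q) - \<i>)"
        "of_real ?y - cnj (Y v) = of_real (?h * ?q) * (of_real ((X e - X v) / ?q) + \<i>)"
      proof -
        have "?h * ?q * ((X e - X v) / ?q) = ?h * X e - ?h * X v"
        proof -
          have "(k * b) * ((x - y) / b) = k * x - k * y" if "b > 0" for k b x y :: real using that by (simp add: field_simps)
          then show ?thesis using q by blast
        qed
        then show "of_real ?y - Y v = of_real (?h * ?q) * (of_real ((X e - X v) / ?q) - \<i>)"
          "of_real ?y - cnj (Y v) = of_real (?h * ?q) * (of_real ((X e - X v) / ?q) + \<i>)"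
          unfolding complex_eq_iff by (simp_all add: Y_parts s(1) del: times_divide_eq_right)
      qed
      moreover have "of_real (?h * ?q) \<noteq> (0::complex)" using q h e0 by simp
      ultimately show ?thesis unfolding cay_def by (metis mult_divide_mult_cancel_left)
    qed
    finally show ?thesis using rr by (simp add: mult.assoc[symmetric])
  qed
  show ?thesis
  proof (cases "w \<in> children v")
    case True
    then have w': "w \<in> V" "w \<noteq> pu" "w \<noteq> pv" "par w = v" by (auto simp: children_def)
    have b: "bel w e" using bel_side[OF w'(1-3)] e w' by simp
    have s: "et e = ?h" "sg e = sg v" using bel_side_eq[OF b w'(1)] par_side[OF w'(1-3)] w'(4) by auto
    have d: "\<epsilon> ^ dep w = \<epsilon> * ?q" using par_edge(2)[OF w'(1-3)] w'(4) by (metis power_Suc)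
    have "(x - y) / b - z = (x - (y + z * b)) / b" if "0 < b" for x y z b :: real using that by (simp add: field_simps)
    then have "(X e - X v) / ?q - c w = (X e - X w) / ?q" using X_par[OF w'(1-3)] w'(4) q by metis
    moreover have "\<bar>(X e - X w) / ?q\<bar> \<le> 2 * \<epsilon>" using X_bel'[OF b] d q by (simp add: abs_divide divide_le_eq)
    ultimately have "\<bar>(X e - X v) / ?q - c w\<bar> \<le> 2 * \<epsilon>" by simp
    then have "cmod (cay (of_real ((X e - X v) / ?q)) - cay (of_real (c w))) \<le> 2 * (2 * \<epsilon>)"
      by (intro order_trans[OF cay_real_lipschitz] mult_left_mono) simp_all
    also have "\<dots> \<le> 8 * \<kappa> / g" using k ek small by linarith
    finally show ?thesis unfolding same[OF s] dir_def using True by simp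
  next
    case False
    then have wu: "w = (if v = pu then pv else if v = pv then pu else par v)"
      using w nbrs_eq[OF v] unfolding children_def[symmetric] by blast
    have vw: "{v, w} \<in> E" using w by (simp add: nbrs_def)
    have nb: "\<not> bel v e"
    proof -
      have "e \<notin> side E w v" using side_disj[OF vw e(2)] .
      then show ?thesis using wu bel_side[OF v, of e] bel_side_root[of e] by (auto split: if_splits)
    qed
    obtain r where r: "bel r v" "r = pu \<or> r = pv" using bel_cover[OF v] by blast
    show ?thesis
    proof (cases "bel r e")
      case True
      have s: "et e = ?h" "sg e = sg v" using same_side[OF True r] by auto
      have vr: "v \<noteq> pu" "v \<noteq> pv" using nb True r bel_root[OF r(1)] by auto
      have p: "?q = \<epsilon> * \<epsilon> ^ dep (par v)" using par_edge(2)[OF v vr] by (metis power_Suc)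
      have "g / 2 * \<epsilon> ^ dep (par v) \<le> \<bar>X e - X v\<bar>" by (rule X_far[OF e(1) r(2) True v vr r(1) nb])
      then have "g / 2 * ?q \<le> \<epsilon> * \<bar>X e - X v\<bar>" unfolding p using mult_left_mono[of "g / 2 * \<epsilon> ^ dep (par v)" "\<bar>X e - X v\<bar>" \<epsilon>] e0 by (simp add: mult_ac)
      then have far: "g / (2 * \<epsilon>) \<le> \<bar>(X e - X v) / ?q\<bar>" using q e0 by (simp add: abs_divide field_simps)
      have pos: "0 < g / (2 * \<epsilon>)" using g e0 by simp
      have "cmod (cay (of_real ((X e - X v) / ?q)) - 1) \<le> 2 / \<bar>(X e - X v) / ?q\<bar>"
        using far pos by (intro cay_real_near_1) auto
      also have "\<dots> \<le> 2 / (g / (2 * \<epsilon>))" using far pos by (intro divide_left_mono mult_pos_pos) auto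
      also have "\<dots> = 4 * \<epsilon> / g" using g e0 by simp
      also have "\<dots> \<le> 8 * \<kappa> / g" using ek small g by (intro divide_right_mono) auto
      finally show ?thesis unfolding same[OF s] dir_def using False by simp
    next
      case False2: False
      then have so: "sg e = - sg v" using r bel_cover[OF eV] bel_excl by (auto simp: sg_def)
      have ob: "cmod (of_real ?y * Y v) \<le> 1 / 2" "cmod (of_real ?y * Y v) \<le> 6 * \<kappa> * \<kappa>" using opp_bound[OF v eV] by auto
      have obc: "cmod (of_real ?y * cnj (Y v)) = cmod (of_real ?y * Y v)" by (simp add: norm_mult)
      have lo: "1 / 2 \<le> cmod (1 + of_real ?y * cnj (Y v))" by (rule one_plus_bounds(1)) (use ob obc in simp)
      then have nz: "1 + of_real ?y * cnj (Y v) \<noteq> 0" by (metis norm_zero not_one_le_zero half_gt_zero_iff linorder_not_le zero_less_one)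
      have "mob (pos v) (zeta e) = of_real (sg v) * mob (cay (Y v)) (- cay (of_real ?y))"
        using sg_cases[of v] so mob_neg[of "cay (Y v)" "- cay (of_real ?y)"] by (auto simp: pos_def zeta_def)
      also have "\<dots> = rot v * ((1 + of_real ?y * Y v) / (1 + of_real ?y * cnj (Y v)))"
        using mob_cay_neg[OF Im_Y, of "?y" v] nz by (simp add: rot_def)
      finally have "cnj (rot v) * mob (pos v) (zeta e) - 1 = (1 + of_real ?y * Y v) / (1 + of_real ?y * cnj (Y v)) - 1"
        using rr by (simp add: mult.assoc[symmetric])
      also have "\<dots> = (of_real ?y * Y v - of_real ?y * cnj (Y v)) / (1 + of_real ?y * cnj (Y v))" using nz by (simp add: field_simps)
      finally have "cmod (cnj (rot v) * mob (pos v) (zeta e) - 1) = cmod (of_real ?y * Y v - of_real ?y * cnj (Y v)) / cmod (1 + of_real ?y * cnj (Y v))"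
        by (simp only: norm_divide)
      also have "\<dots> \<le> (2 * (6 * \<kappa> * \<kappa>)) / (1 / 2)"
        using norm_triangle_ineq4[of "of_real ?y * Y v" "of_real ?y * cnj (Y v)"] ob obc lo by (intro frac_le) auto
      also have "\<dots> = (24 * \<kappa>) * \<kappa>" by simp
      also have "\<dots> \<le> 8 * \<kappa>" using small by simp
      finally show ?thesis unfolding dir_def using False k by simp
    qed
  qed
qed

text \<open>The ends of the two trees lie near opposite points of the circle: their real parts have
  opposite signs and modulus at least 1 / 2.\<close>

lemma zeta_opp: assumes "e \<in> V" "e' \<in> V" "sg e' = - sg e" shows "1 \<le> cmod (zeta e - zeta e')"
proof -
  have y: "1 / 2 \<le> (1 - (et x * X x)\<^sup>2) / (1 + (et x * X x)\<^sup>2)" if "x \<in> V" for x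
  proof -
    have "\<bar>et x * X x\<bar> \<le> 1 / 8 * 2" using et_pos[of x] small X_le_2[OF that] unfolding abs_mult by (intro mult_mono) auto
    then have "(et x * X x)\<^sup>2 \<le> (1 / 4)\<^sup>2" by (intro abs_le_square_iff[THEN iffD1]) simp
    then show ?thesis by (intro ratio_bounds(1)) simp
  qed
  define a where "a x = (1 - (et x * X x)\<^sup>2) / (1 + (et x * X x)\<^sup>2)" for x
  have "Re (zeta x) = - sg x * a x" for x unfolding zeta_def a_def by (simp add: cay_real_parts del: of_real_mult)
  then have "1 \<le> \<bar>Re (zeta e - zeta e')\<bar>"
    using y[OF assms(1)] y[OF assms(2)] sg_cases[of e] assms(3) unfolding a_def[symmetric] by auto
  then show ?thesis using abs_Re_le_cmod order_trans by blast
qed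

lemma zeta_inj: "inj_on zeta Ends"
proof (rule inj_onI)
  fix e e' assume e: "e \<in> Ends" "e' \<in> Ends" "zeta e = zeta e'"
  have V: "e \<in> V" "e' \<in> V" using e by (auto simp: tree_ends_def)
  show "e = e'"
  proof (rule ccontr)
    assume ne: "e \<noteq> e'"
    have "sg e' \<noteq> - sg e" using zeta_opp[OF V] e(3) by auto
    then have s: "sg e = sg e'" using sg_cases[of e] sg_cases[of e'] by auto
    then have bb: "bel pv e \<longleftrightarrow> bel pv e'" by (auto simp: sg_def split: if_splits)
    then obtain r where r: "r = pu \<or> r = pv" "bel r e" "bel r e'" using bel_cover[OF V(1)] bel_cover[OF V(2)] by blast
    have nb: "\<not> bel e' e" using bel_child[of e' e] ne end_no_children[OF e(2)] by auto
    have "r \<noteq> e'" using nb r(2) by blast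
    then have nr: "e' \<noteq> pu" "e' \<noteq> pv" using bel_root[OF r(3)] by auto
    have "g / 2 * \<epsilon> ^ dep (par e') \<le> \<bar>X e - X e'\<bar>" by (rule X_far[OF e(1) r(1,2) V(2) nr r(3) nb])
    moreover have "0 < g / 2 * \<epsilon> ^ dep (par e')" using g e0 by simp
    ultimately have X: "X e \<noteq> X e'" by auto
    have t: "et e = et e'" using same_side(1)[OF r(2,3,1)] .
    have "cay (of_real (et e * X e)) = cay (of_real (et e' * X e'))"
      using e(3) s sg_cases[of e] by (auto simp: zeta_def simp del: of_real_mult)
    then have "et e * X e = et e' * X e'" by (rule cay_real_inj)
    then show False using X t et_pos[of e'] by simp
  qed
qed

text \<open>A root that is a branch point has a child on either side of the imaginary axis, so increasing the weight of a single end
  cancels the vertical part of the barycentre; the horizontal parts of the two trees have opposite signs.\<close>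

lemma side_weights:
  assumes r: "r = pu \<or> r = pv"
  defines "I \<equiv> {e \<in> Ends. bel r e}"
  shows "\<exists>w. (\<forall>e\<in>I. 1 \<le> w e \<and> w e \<le> 1 + 8 * real (card Ends)) \<and> (\<Sum>e\<in>I. w e * (et e * X e / (1 + (et e * X e)\<^sup>2))) = 0"
proof -
  let ?h = "et r" and ?N = "real (card Ends)"
  let ?f = "\<lambda>e. et e * X e / (1 + (et e * X e)\<^sup>2)"
  have finE: "finite Ends" by (rule finite_subset[OF _ finV]) (auto simp: tree_ends_def)
  have fin: "finite I" using finE by (simp add: I_def)
  have rV: "r \<in> V" using r puv by auto
  have h: "0 < ?h" "?h \<le> 1 / 8" using et_pos[of r] small by auto
  have IV: "e \<in> V" "et e = ?h" if "e \<in> I" for e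
    using that bel_side_eq[OF _ rV, of e] by (auto simp: I_def tree_ends_def)
  consider "r \<in> Ends" | "r \<in> B" using rV VBE by blast
  then show ?thesis
  proof cases
    \<comment> \<open>A root that is an end is its own only descendant and has X = 0.\<close>
    case 1
    have "?f e = 0" if "e \<in> I" for e
    proof -
      have "e = r" using that bel_child[of r e] end_no_children[OF 1] by (auto simp: I_def)
      then show ?thesis using r X_root by auto
    qed
    then have "(\<Sum>e\<in>I. 1 * ?f e) = 0" by (intro sum.neutral) (metis mult_zero_right)
    then show ?thesis by (intro exI[of _ "\<lambda>_. 1"]) simp
  next
    case 2
    obtain x y where xy: "x \<in> children r" "y \<in> children r" "c x = -1" "c y = 1" using cpm[OF 2] by blast
    have near: "\<exists>e\<in>I. \<bar>X e - c z\<bar> \<le> 1 / 4" if z: "z \<in> children r" for z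
    proof -
      have z': "z \<in> V" "z \<noteq> pu" "z \<noteq> pv" "par z = r" using z by (auto simp: children_def)
      obtain e where e: "e \<in> Ends" "bel z e" using bel_end[OF z'(1)] by blast
      have "bel r z" using bel_step[of z r] z' bel_refl by simp
      then have "bel r e" using bel_trans[OF e(2)] by blast
      have d0: "dep r = 0" "X r = 0" using r X_root by auto
      have "dep z = 1" using par_edge(2)[OF z'(1-3)] z'(4) d0 by simp
      then have "\<bar>X e - X z\<bar> \<le> 2 * \<epsilon>" using X_bel'[OF e(2)] by simp
      moreover have "X z = c z" using X_par[OF z'(1-3)] z'(4) d0 by simp
      ultimately show ?thesis using e \<open>bel r e\<close> small by (intro bexI[of _ e]) (auto simp: I_def)
    qed
    obtain e1 e2 where e12: "e1 \<in> I" "\<bar>X e1 - -1\<bar> \<le> 1 / 4" "e2 \<in> I" "\<bar>X e2 - 1\<bar> \<le> 1 / 4"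
      using near[OF xy(1)] near[OF xy(2)] xy by auto
    have den: "1 \<le> 1 + (et e * X e)\<^sup>2" "1 + (et e * X e)\<^sup>2 \<le> 2" if "e \<in> I" for e
    proof -
      have "\<bar>et e * X e\<bar> \<le> 1 / 8 * 2" using et_pos[of e] small X_le_2[OF IV(1)[OF that]] unfolding abs_mult by (intro mult_mono) auto
      then show "1 + (et e * X e)\<^sup>2 \<le> 2" using abs_square_le_1[of "et e * X e"] by simp
    qed simp
    define T where "T = (\<Sum>e\<in>I. ?f e)"
    have fb: "\<bar>?f e\<bar> \<le> 2 * ?h" if "e \<in> I" for e
    proof -
      have "\<bar>?f e\<bar> = ?h * \<bar>X e\<bar> / (1 + (et e * X e)\<^sup>2)" using h IV[OF that] den(1)[OF that] by (simp add: abs_mult abs_divide)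
      also have "\<dots> \<le> ?h * 2 / 1" using den(1)[OF that] X_le_2[OF IV(1)[OF that]] h by (intro frac_le mult_left_mono) auto
      finally show ?thesis by simp
    qed
    have "\<bar>T\<bar> \<le> real (card I) * (2 * ?h)" unfolding T_def by (rule order_trans[OF sum_abs]) (use sum_bounded_above[of I "\<lambda>e. \<bar>?f e\<bar>" "2 * ?h"] fb in auto)
    also have "\<dots> \<le> ?N * (2 * ?h)" using h card_mono[OF finE, of I] by (intro mult_right_mono) (auto simp: I_def)
    finally have Tb: "\<bar>T\<bar> \<le> 2 * ?N * ?h" by (simp add: mult_ac)
    \<comment> \<open>The imbalance T is at most 2 N h in modulus and a suitable end e0 contributes
      at least h / 4 with the opposite sign, so raising its weight by at most 8 N cancels T.\<close>
    have "\<exists>e0\<in>I. \<exists>t. 0 \<le> t \<and> t \<le> 8 * ?N \<and> T + t * ?f e0 = 0"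
    proof -
      have *: "\<exists>t. 0 \<le> t \<and> t \<le> 8 * ?N \<and> T + t * ?f e0 = 0" if e0: "e0 \<in> I" and s: "?h / 4 \<le> \<bar>?f e0\<bar>" "T * ?f e0 \<le> 0" for e0
      proof -
        have nz: "?f e0 \<noteq> 0" using s(1) h by auto
        have "- T / ?f e0 = \<bar>T\<bar> / \<bar>?f e0\<bar>"
        proof (cases "?f e0 > 0")
          case True
          have "a \<le> 0" if "a * b \<le> 0" "0 < b" for a b :: real using that by (metis mult_pos_pos not_le)
          then have "T \<le> 0" using s(2) True by blast
          moreover have "- a / b = \<bar>a\<bar> / \<bar>b\<bar>" if "a \<le> 0" "b > 0" for a b :: real using that by simp
          ultimately show ?thesis using True by blast
        next
          case False
          then have "?f e0 < 0" using nz by linarith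
          have "a \<ge> 0" if "a * b \<le> 0" "b < 0" for a b :: real using that by (metis mult_neg_neg not_le)
          then have "T \<ge> 0" using s(2) \<open>?f e0 < 0\<close> by blast
          moreover have "- a / b = \<bar>a\<bar> / \<bar>b\<bar>" if "a \<ge> 0" "b < 0" for a b :: real using that by simp
          ultimately show ?thesis using \<open>?f e0 < 0\<close> by blast
        qed
        moreover have "\<bar>T\<bar> / \<bar>?f e0\<bar> \<le> (2 * ?N * ?h) / (?h / 4)" using Tb s h by (intro frac_le) auto
        moreover have "(2 * ?N * ?h) / (?h / 4) = 8 * ?N" using h by simp
        ultimately have "0 \<le> - T / ?f e0" "- T / ?f e0 \<le> 8 * ?N" by auto
        then show ?thesis using nz by (intro exI[of _ "- T / ?f e0"]) auto
      qed
      have low: "?h / 4 \<le> \<bar>?f e\<bar>" if "e \<in> I" "1 / 2 \<le> \<bar>X e\<bar>" for e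
      proof -
        have "?h * (1 / 2) / 2 \<le> ?h * \<bar>X e\<bar> / (1 + (et e * X e)\<^sup>2)"
          using den[OF that(1)] that(2) h by (intro frac_le mult_left_mono one_plus_sq_pos) auto
        also have "\<dots> = \<bar>?f e\<bar>" using h IV[OF that(1)] den(1)[OF that(1)] by (simp add: abs_mult abs_divide)
        finally show ?thesis by simp
      qed
      have X12: "X e1 \<le> - (1 / 2)" "1 / 2 \<le> X e2" using e12 by linarith+
      have f1: "?f e1 \<le> 0" using X12 h IV[OF e12(1)] den(1)[OF e12(1)] by (intro divide_nonpos_pos mult_nonneg_nonpos one_plus_sq_pos) auto
      have f2: "0 \<le> ?f e2" using X12 h IV[OF e12(3)] den(1)[OF e12(3)] by (intro divide_nonneg_pos mult_nonneg_nonneg one_plus_sq_pos) auto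
      show ?thesis
      proof (cases "T \<ge> 0")
        case True
        have "T * ?f e1 \<le> 0" using True f1 by (rule mult_nonneg_nonpos)
        then show ?thesis using *[OF e12(1) low[OF e12(1)]] X12 e12(1) by auto
      next
        case False
        then have "T * ?f e2 \<le> 0" using f2 by (intro mult_nonpos_nonneg) auto
        then show ?thesis using *[OF e12(3) low[OF e12(3)]] X12 e12(3) by auto
      qed
    qed
    then obtain e0 t where t: "e0 \<in> I" "0 \<le> t" "t \<le> 8 * ?N" "T + t * ?f e0 = 0" by blast
    define w where "w e = 1 + (if e = e0 then t else 0)" for e
    have "(\<Sum>e\<in>I. w e * ?f e) = (\<Sum>e\<in>I. ?f e + (if e = e0 then t * ?f e else 0))"
    proof (rule sum.cong[OF refl])
      have "(1 + (if P then t else 0)) * x = x + (if P then t * x else 0)" for P and x :: real by (simp add: distrib_right)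
      then show "w e * ?f e = ?f e + (if e = e0 then t * ?f e else 0)" for e by (simp only: w_def)
    qed
    also have "\<dots> = T + t * ?f e0" using fin t(1) by (simp add: sum.distrib T_def)
    finally have "(\<Sum>e\<in>I. w e * ?f e) = 0" using t by simp
    then show ?thesis using t by (intro exI[of _ w]) (auto simp: w_def)
  qed
qed

text \<open>With the weights of \<open>side_weights\<close> each tree has its weighted sum on the
  real axis, with opposite signs. Dividing by the modulus R of this sum makes the two cancel. R is
  at least half the mass of its tree, so the total T is at most 4; R is at most N (1 + 8 N). The
  quotient 1 / (R T) is bounded below by \<delta>.\<close>

lemma weights:
  assumes N: "\<delta> = 1 / (4 * real (card Ends) * (1 + 8 * real (card Ends)))"
  shows "\<exists>w. (\<forall>e\<in>Ends. \<delta> \<le> w e) \<and> (\<Sum>e\<in>Ends. w e) = 1 \<and> (\<Sum>e\<in>Ends. of_real (w e) * zeta e) = 0" and "\<delta> > 0"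
proof -
  let ?N = "real (card Ends)" and ?I = "\<lambda>r. {e \<in> Ends. bel r e}"
  let ?y = "\<lambda>e. et e * X e"
  have finE: "finite Ends" by (rule finite_subset[OF _ finV]) (auto simp: tree_ends_def)
  have "Ends \<noteq> {}" using bel_end[OF puv(1)] by auto
  then have N1: "1 \<le> ?N" using finE by (metis One_nat_def Suc_leI card_gt_0_iff of_nat_1 of_nat_mono)
  show "\<delta> > 0" using N1 by (simp add: N)
  obtain w1 where w1: "\<And>e. e \<in> ?I pv \<Longrightarrow> 1 \<le> w1 e \<and> w1 e \<le> 1 + 8 * ?N" "(\<Sum>e\<in>?I pv. w1 e * (?y e / (1 + (?y e)\<^sup>2))) = 0"
    using side_weights[of pv] by auto
  obtain w2 where w2: "\<And>e. e \<in> ?I pu \<Longrightarrow> 1 \<le> w2 e \<and> w2 e \<le> 1 + 8 * ?N" "(\<Sum>e\<in>?I pu. w2 e * (?y e / (1 + (?y e)\<^sup>2))) = 0"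
    using side_weights[of pu] by auto
  have EV: "e \<in> V" if "e \<in> Ends" for e using that by (simp add: tree_ends_def)
  have y: "1 / 2 \<le> (1 - (?y e)\<^sup>2) / (1 + (?y e)\<^sup>2)" "(1 - (?y e)\<^sup>2) / (1 + (?y e)\<^sup>2) \<le> 1" if "e \<in> Ends" for e
  proof -
    have "\<bar>?y e\<bar> \<le> 1 / 8 * 2" using et_pos[of e] small X_le_2[OF EV[OF that]] unfolding abs_mult by (intro mult_mono) auto
    then have "(?y e)\<^sup>2 \<le> (1 / 4)\<^sup>2" by (intro abs_le_square_iff[THEN iffD1]) simp
    from ratio_bounds[OF zero_le_power2 this]
    show "1 / 2 \<le> (1 - (?y e)\<^sup>2) / (1 + (?y e)\<^sup>2)" "(1 - (?y e)\<^sup>2) / (1 + (?y e)\<^sup>2) \<le> 1" .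
  qed
  have R: "\<exists>R. R > 0 \<and> (\<Sum>e\<in>?I r. w e) / 2 \<le> R \<and> R \<le> ?N * (1 + 8 * ?N) \<and>
      (\<Sum>e\<in>?I r. of_real (w e) * zeta e) = of_real (- s * R)"
    if r: "r = pu \<or> r = pv" and w: "\<And>e. e \<in> ?I r \<Longrightarrow> 1 \<le> w e \<and> w e \<le> 1 + 8 * ?N"
      and b: "(\<Sum>e\<in>?I r. w e * (?y e / (1 + (?y e)\<^sup>2))) = 0" and s: "\<And>e. e \<in> ?I r \<Longrightarrow> sg e = s" for r w s
  proof -
    let ?c = "\<lambda>e. (1 - (?y e)\<^sup>2) / (1 + (?y e)\<^sup>2)"
    define R where "R = (\<Sum>e\<in>?I r. w e * ?c e)"
    have fin: "finite (?I r)" using finE by simp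
    have ne: "?I r \<noteq> {}" using bel_end[of r] r puv by auto
    have "(\<Sum>e\<in>?I r. w e) / 2 = (\<Sum>e\<in>?I r. w e * (1 / 2))" by (simp flip: sum_divide_distrib)
    also have "\<dots> \<le> R" unfolding R_def
    proof (rule sum_mono)
      fix e assume e: "e \<in> ?I r"
      then have "1 / 2 \<le> ?c e" using y(1) by blast
      moreover have "0 \<le> w e" using w[OF e] by linarith
      ultimately show "w e * (1 / 2) \<le> w e * ?c e" by (rule mult_left_mono)
    qed
    finally have 1: "(\<Sum>e\<in>?I r. w e) / 2 \<le> R" .
    have "0 < (\<Sum>e\<in>?I r. w e)" by (rule sum_pos[OF fin ne]) (use w in force)
    then have Rp: "R > 0" using 1 by linarith
    have "R \<le> (\<Sum>e\<in>?I r. 1 + 8 * ?N)" unfolding R_def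
    proof (rule sum_mono)
      fix e assume e: "e \<in> ?I r"
      then have "1 / 2 \<le> ?c e" "?c e \<le> 1" using y by blast+
      then have "w e * ?c e \<le> (1 + 8 * ?N) * 1" using w[OF e] by (intro mult_mono) linarith+
      then show "w e * ?c e \<le> 1 + 8 * ?N" by simp
    qed
    also have "\<dots> \<le> ?N * (1 + 8 * ?N)" using card_mono[OF finE, of "?I r"] by (simp add: mult_right_mono)
    finally have 2: "R \<le> ?N * (1 + 8 * ?N)" .
    have "(\<Sum>e\<in>?I r. of_real (w e) * zeta e) = (\<Sum>e\<in>?I r. of_real s * (of_real (w e) * cay (of_real (?y e))))"
      by (rule sum.cong[OF refl]) (use s in \<open>auto simp: zeta_def mult_ac simp del: of_real_mult\<close>)
    also have "\<dots> = of_real s * (\<Sum>e\<in>?I r. of_real (w e) * cay (of_real (?y e)))" by (simp only: sum_distrib_left)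
    also have "(\<Sum>e\<in>?I r. of_real (w e) * cay (of_real (?y e))) = of_real (- R)"
    proof (rule complex_eqI)
      have "Re (\<Sum>e\<in>?I r. of_real (w e) * cay (of_real (?y e))) = (\<Sum>e\<in>?I r. - (w e * ?c e))"
        unfolding Re_sum by (rule sum.cong[OF refl]) (simp add: cay_real_parts del: of_real_mult)
      then show "Re (\<Sum>e\<in>?I r. of_real (w e) * cay (of_real (?y e))) = Re (of_real (- R))" by (simp only: sum_negf R_def Re_complex_of_real)
      have "Im (\<Sum>e\<in>?I r. of_real (w e) * cay (of_real (?y e))) = (\<Sum>e\<in>?I r. - 2 * (w e * (?y e / (1 + (?y e)\<^sup>2))))"
        unfolding Im_sum by (rule sum.cong[OF refl]) (simp add: cay_real_parts del: of_real_mult)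
      also have "\<dots> = - 2 * (\<Sum>e\<in>?I r. w e * (?y e / (1 + (?y e)\<^sup>2)))" by (simp only: sum_distrib_left)
      finally show "Im (\<Sum>e\<in>?I r. of_real (w e) * cay (of_real (?y e))) = Im (of_real (- R))" by (simp only: b) simp
    qed
    finally have "(\<Sum>e\<in>?I r. of_real (w e) * zeta e) = of_real (- s * R)" by simp
    then show ?thesis using Rp 1 2 by blast
  qed
  obtain R1 where R1: "R1 > 0" "(\<Sum>e\<in>?I pv. w1 e) / 2 \<le> R1" "R1 \<le> ?N * (1 + 8 * ?N)"
      "(\<Sum>e\<in>?I pv. of_real (w1 e) * zeta e) = of_real (- 1 * R1)"
    using R[of pv w1 1, OF _ w1] by (auto simp: sg_def)
  obtain R2 where R2: "R2 > 0" "(\<Sum>e\<in>?I pu. w2 e) / 2 \<le> R2" "R2 \<le> ?N * (1 + 8 * ?N)"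
      "(\<Sum>e\<in>?I pu. of_real (w2 e) * zeta e) = of_real (- (-1) * R2)"
    using R[of pu w2 "-1", OF _ w2] bel_excl by (auto simp: sg_def)
  define T where "T = (\<Sum>e\<in>?I pv. w1 e) / R1 + (\<Sum>e\<in>?I pu. w2 e) / R2"
  have s1: "0 < (\<Sum>e\<in>?I pv. w1 e)"
  proof (rule sum_pos)
    show "?I pv \<noteq> {}" using bel_end[OF puv(2)] by blast
    show "0 < w1 e" if "e \<in> ?I pv" for e using w1(1)[OF that] by linarith
  qed (use finE in simp)
  have s2: "0 < (\<Sum>e\<in>?I pu. w2 e)"
  proof (rule sum_pos)
    show "?I pu \<noteq> {}" using bel_end[OF puv(1)] by blast
    show "0 < w2 e" if "e \<in> ?I pu" for e using w2(1)[OF that] by linarith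
  qed (use finE in simp)
  have "T > 0" unfolding T_def by (intro add_pos_pos divide_pos_pos s1 s2 R1(1) R2(1))
  moreover have dv: "a / b \<le> 2" if "0 < b" "a / 2 \<le> b" for a b :: real using that by (simp add: divide_le_eq)
  have "T \<le> 4" unfolding T_def using dv[OF R1(1,2)] dv[OF R2(1,2)] by linarith
  ultimately have T: "T > 0" "T \<le> 4" by simp_all
  define w where "w e = (if bel pv e then w1 e / R1 else w2 e / R2) / T" for e
  have Es: "Ends = ?I pv \<union> ?I pu" "?I pv \<inter> ?I pu = {}" using bel_cover[OF EV] bel_excl by blast+
  have sumE: "sum f Ends = sum f (?I pv) + sum f (?I pu)" for f :: "'v \<Rightarrow> 'x::comm_monoid_add"
    by (subst Es(1), rule sum.union_disjoint) (use finE Es(2) in auto)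
  have wv: "w e = w1 e / (R1 * T)" if "e \<in> ?I pv" for e using that by (simp add: w_def)
  have wu: "w e = w2 e / (R2 * T)" if "e \<in> ?I pu" for e using that bel_excl by (auto simp: w_def)
  have "(\<Sum>e\<in>Ends. w e) = (\<Sum>e\<in>?I pv. w1 e / (R1 * T)) + (\<Sum>e\<in>?I pu. w2 e / (R2 * T))"
    unfolding sumE using wv wu by (intro arg_cong2[of _ _ _ _ "(+)"] sum.cong) auto
  also have "\<dots> = T / T" by (simp only: sum_divide_distrib[symmetric] T_def add_divide_distrib) (simp add: mult.commute)
  finally have sw: "(\<Sum>e\<in>Ends. w e) = 1" using T by simp
  have "(\<Sum>e\<in>Ends. of_real (w e) * zeta e) = (\<Sum>e\<in>?I pv. of_real (w1 e) * zeta e / of_real (R1 * T)) + (\<Sum>e\<in>?I pu. of_real (w2 e) * zeta e / of_real (R2 * T))"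
    unfolding sumE using wv wu by (intro arg_cong2[of _ _ _ _ "(+)"] sum.cong) auto
  also have "\<dots> = of_real (- 1 * R1) / of_real (R1 * T) + of_real (- (-1) * R2) / of_real (R2 * T)"
    by (simp only: sum_divide_distrib[symmetric] R1(4) R2(4))
  also have "\<dots> = 0" using R1(1) R2(1) T by simp
  finally have sz: "(\<Sum>e\<in>Ends. of_real (w e) * zeta e) = 0" .
  have "\<delta> \<le> w e" if e: "e \<in> Ends" for e
  proof -
    have k: "\<delta> \<le> x / (R * T)" if "1 \<le> x" "0 < R" "R \<le> ?N * (1 + 8 * ?N)" for x R
    proof -
      have "R * T \<le> (?N * (1 + 8 * ?N)) * 4" using that T N1 by (intro mult_mono) auto
      then have "1 / ((?N * (1 + 8 * ?N)) * 4) \<le> x / (R * T)" using that T by (intro frac_le) auto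
      then show ?thesis by (simp add: N mult_ac)
    qed
    show ?thesis
    proof (cases "e \<in> ?I pv")
      case True then show ?thesis unfolding wv[OF True] using w1(1)[OF True] R1 by (intro k) auto
    next
      case False
      then have "e \<in> ?I pu" using e Es by blast
      then show ?thesis using wu w2(1) R2 k by simp
    qed
  qed
  then show "\<exists>w. (\<forall>e\<in>Ends. \<delta> \<le> w e) \<and> (\<Sum>e\<in>Ends. w e) = 1 \<and> (\<Sum>e\<in>Ends. of_real (w e) * zeta e) = 0"
    using sw sz by blast
qed

end

section \<open>Directions at a vertex and lengths of walks\<close>

context finite_tree begin

lemma vside: assumes "v \<in> V" "e \<in> V" "e \<noteq> v" shows "\<exists>w. {v, w} \<in> E \<and> e \<in> side E v w"
proof -
  have "(v, e) \<in> (adj E)\<^sup>*" using assms by (intro conn)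
  then have "e = v \<or> (\<exists>w. {v, w} \<in> E \<and> e \<in> side E v w)"
  proof (induction rule: rtrancl_induct)
    case (step y x)
    have yx: "{y, x} \<in> E" using step(2) by (simp add: adj_iff)
    consider "y = v" | w where "{v, w} \<in> E" "y \<in> side E v w" using step(3) by blast
    then show ?case
    proof cases
      case 1 then show ?thesis using yx side_self by blast
    next
      case 2
      show ?thesis
      proof (cases "{y, x} = {v, w}")
        case True
        then have "x = v \<or> x = w" by (auto simp: doubleton_eq_iff)
        then show ?thesis using 2 side_self by blast
      next
        case False then show ?thesis using side_step[OF 2(2) yx False] 2(1) by blast
      qed
    qed
  qed simp
  then show ?thesis using assms by blast
qed

lemma side_end_eq: assumes "v \<in> tree_ends V E" "{u, v} \<in> E" shows "x \<in> side E u v \<Longrightarrow> x = v"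
proof (induction rule: side_induct)
  case (step y x)
  have "x = u" using ends_nbr_unique[OF assms(1), of x u] step assms(2) by (simp add: insert_commute)
  then show ?case using step by (simp add: insert_commute)
qed simp

lemma sideV: assumes "{u, v} \<in> E" shows "side E u v \<subseteq> V"
proof
  fix x assume "x \<in> side E u v"
  then show "x \<in> V" by (induction rule: side_induct) (use edgeV assms in blast)+
qed

text \<open>Each step removes at least one vertex from the half tree ahead.\<close>

lemma nb_card: "nbwalk E u v x y n \<Longrightarrow> n + card (side E x y) \<le> card (side E u v)"
proof (induction rule: nbwalk.induct)
  case (nbS x y n w)
  have xy: "{x, y} \<in> E" using nb_side[OF nbS(1)] by blast
  have "side E y w \<subseteq> side E x y" using side_nest[OF xy nbS(2)] nbS(3) by blast
  moreover have "y \<notin> side E y w" using side_disj[OF nbS(2), of y] side_self[of y w] by blast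
  ultimately have "side E y w \<subset> side E x y" using side_self[of y x] by blast
  then have "card (side E y w) < card (side E x y)"
    using finite_subset[OF sideV[OF xy] finV] by (intro psubset_card_mono)
  then show ?case using nbS(4) by linarith
qed simp

end

lemma int_pts_iff: "(u, v, t) \<in> int_pts V E \<longleftrightarrow> {u, v} \<in> E \<and> u \<in> branch_points V E \<and> 0 \<le> t \<and> (v \<in> branch_points V E \<longrightarrow> t \<le> 1)"
  by (simp add: int_pts_def)

lemma end_dists_iff: "(a, r) \<in> end_dists V E (u, v, t) \<longleftrightarrow> a = u \<and> r = t \<or> v \<in> branch_points V E \<and> a = v \<and> r = 1 - t"
  by (auto simp: end_dists_def)

section \<open>Maps of the tree into the disc\<close>

text \<open>The Busemann function of an end grows linearly along every edge pointing towards it. Since it is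
  1-Lipschitz, this bounds hyperbolic distances from below.\<close>

locale tree_map = rooted_tree V E pu pv for V :: "'v set" and E pu pv +
  fixes \<phi> :: "'v \<times> 'v \<times> real \<Rightarrow> complex" and \<zeta> z :: "'v \<Rightarrow> complex" and s C c0 :: real
  assumes s: "0 < s" and C: "0 \<le> C" and puB: "pu \<in> branch_points V E"
    and norm_phi: "x \<in> int_pts V E \<Longrightarrow> cmod (\<phi> x) < 1"
    and norm_zeta: "e \<in> tree_ends V E \<Longrightarrow> cmod (\<zeta> e) = 1"
    and sw: "{u, v} \<in> E \<Longrightarrow> u \<in> branch_points V E \<Longrightarrow> v \<in> branch_points V E \<Longrightarrow> 0 \<le> t \<Longrightarrow> t \<le> 1 \<Longrightarrow> \<phi> (v, u, 1 - t) = \<phi> (u, v, t)"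
    and vt: "{u, v} \<in> E \<Longrightarrow> u \<in> branch_points V E \<Longrightarrow> \<phi> (u, v, 0) = z u"
    and e1: "(u, v, t) \<in> int_pts V E \<Longrightarrow> (u, v, t') \<in> int_pts V E \<Longrightarrow> hdist (\<phi> (u, v, t)) (\<phi> (u, v, t')) \<le> s * \<bar>t - t'\<bar> + C"
    and e2: "(u, v, t) \<in> int_pts V E \<Longrightarrow> (u, v, t') \<in> int_pts V E \<Longrightarrow> t \<le> t' \<Longrightarrow> e \<in> tree_ends V E \<Longrightarrow> e \<in> side E u v \<Longrightarrow>
        s * (t' - t) - C \<le> bus (\<zeta> e) (\<phi> (u, v, t')) - bus (\<zeta> e) (\<phi> (u, v, t))"
    and e3: "(u, v, t) \<in> int_pts V E \<Longrightarrow> (u, v, t') \<in> int_pts V E \<Longrightarrow> t \<le> t' \<Longrightarrow> e \<in> tree_ends V E \<Longrightarrow> e \<in> side E v u \<Longrightarrow>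
        s * (t' - t) - C \<le> bus (\<zeta> e) (\<phi> (u, v, t)) - bus (\<zeta> e) (\<phi> (u, v, t'))"
    and sep: "u \<in> branch_points V E \<Longrightarrow> {u, v} \<in> E \<Longrightarrow> {u, w} \<in> E \<Longrightarrow> v \<noteq> w \<Longrightarrow> e \<in> tree_ends V E \<Longrightarrow> e \<in> side E u v \<Longrightarrow>
        e' \<in> tree_ends V E \<Longrightarrow> e' \<in> side E u w \<Longrightarrow> c0 \<le> cmod (mob (z u) (\<zeta> e) - mob (z u) (\<zeta> e'))"
    and c0: "0 < c0"
begin

abbreviation "P \<equiv> int_pts V E"

lemma vt1: "{u, v} \<in> E \<Longrightarrow> u \<in> B \<Longrightarrow> v \<in> B \<Longrightarrow> \<phi> (u, v, 1) = z v"
  using sw[of v u 0] vt[of v u] by (simp add: insert_commute)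

lemma two_nbrs: "{y, x} \<in> E \<Longrightarrow> {y, w} \<in> E \<Longrightarrow> x \<noteq> w \<Longrightarrow> y \<in> B"
  using edgeV[of y x] VBE ends_nbr_unique by blast

lemma norm_z: assumes "v \<in> B" shows "cmod (z v) < 1"
proof -
  obtain w where "w \<in> nbrs E v" using branch_nbrs[OF assms] by fastforce
  then have vw: "{v, w} \<in> E" by (simp add: nbrs_def)
  then show ?thesis using norm_phi[of "(v, w, 0)"] vt[OF vw assms] assms by (simp add: int_pts_iff)
qed

text \<open>A point may be represented from either endpoint of its edge, along or against the walk;
  the two cases exchange t and 1 - t. The same holds for \<open>from_vertex\<close>.\<close>

lemma to_vertex:
  assumes x: "x \<in> P" "x = (u, v, t)" "{u, v} = {a, b}" "b \<in> B"
  shows "\<exists>\<tau>. (b, \<tau>) \<in> end_dists V E x \<and> (\<forall>e\<in>Ends \<inter> side E a b. s * \<tau> - C \<le> bus (\<zeta> e) (z b) - bus (\<zeta> e) (\<phi> x))"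
proof -
  have uv: "{u, v} \<in> E" "u \<in> B" "0 \<le> t" "v \<in> B \<Longrightarrow> t \<le> 1" using x by (simp_all add: int_pts_iff)
  consider "u = b" "v = a" | "u = a" "v = b" using x(3) by (auto simp: doubleton_eq_iff)
  then show ?thesis
  proof cases
    case 1
    have "s * t - C \<le> bus (\<zeta> e) (z b) - bus (\<zeta> e) (\<phi> x)" if "e \<in> Ends \<inter> side E a b" for e
      using e3[of b a 0 t e] that uv 1 vt[of b a] x(2) by (simp add: int_pts_iff)
    then show ?thesis using 1 x(2) by (intro exI[of _ t]) (simp add: end_dists_iff)
  next
    case 2
    have "s * (1 - t) - C \<le> bus (\<zeta> e) (z b) - bus (\<zeta> e) (\<phi> x)" if "e \<in> Ends \<inter> side E a b" for e
      using e2[of a b t 1 e] that uv 2 vt1[of a b] x(2,4) by (simp add: int_pts_iff)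
    then show ?thesis using 2 x(2,4) by (intro exI[of _ "1 - t"]) (simp add: end_dists_iff)
  qed
qed

lemma from_vertex:
  assumes x: "x \<in> P" "x = (u, v, t)" "{u, v} = {a, b}" "a \<in> B"
  shows "\<exists>\<tau>. (a, \<tau>) \<in> end_dists V E x \<and> (\<forall>e\<in>Ends \<inter> side E a b. s * \<tau> - C \<le> bus (\<zeta> e) (\<phi> x) - bus (\<zeta> e) (z a))"
proof -
  have uv: "{u, v} \<in> E" "u \<in> B" "0 \<le> t" "v \<in> B \<Longrightarrow> t \<le> 1" using x by (simp_all add: int_pts_iff)
  consider "u = b" "v = a" | "u = a" "v = b" using x(3) by (auto simp: doubleton_eq_iff)
  then show ?thesis
  proof cases
    case 1
    have "s * (1 - t) - C \<le> bus (\<zeta> e) (\<phi> x) - bus (\<zeta> e) (z a)" if "e \<in> Ends \<inter> side E a b" for e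
      using e3[of b a t 1 e] that uv 1 vt1[of b a] x(2,4) by (simp add: int_pts_iff)
    then show ?thesis using 1 x(2,4) by (intro exI[of _ "1 - t"]) (simp add: end_dists_iff)
  next
    case 2
    have "s * t - C \<le> bus (\<zeta> e) (\<phi> x) - bus (\<zeta> e) (z a)" if "e \<in> Ends \<inter> side E a b" for e
      using e2[of a b 0 t e] that uv 2 vt[of a b] x(2) by (simp add: int_pts_iff)
    then show ?thesis using 2 x(2) by (intro exI[of _ t]) (simp add: end_dists_iff)
  qed
qed

text \<open>An end ahead of the last edge is ahead of every edge of the walk, so the gains of its
  Busemann function add up, each edge losing at most C.\<close>

lemma along_walk:
  "nbwalk E a b x y m \<Longrightarrow> 0 < m \<longrightarrow> b \<in> B \<and> x \<in> B \<and> (b, x) \<in> adj E ^^ (m - 1) \<and>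
    (\<forall>e\<in>Ends \<inter> side E x y. real (m - 1) * (s - C) \<le> bus (\<zeta> e) (z x) - bus (\<zeta> e) (z b))"
proof (induction rule: nbwalk.induct)
  case (nbS x y m w)
  have xy: "{x, y} \<in> E" using nb_side[OF nbS(1)] by blast
  have yB: "y \<in> B" using two_nbrs[of y x w] xy nbS(2,3) by (simp add: insert_commute) 
  show ?case
  proof (cases "m = 0")
    case True
    then have "x = a" "y = b" using nbS(1) by (auto elim: nbwalk.cases)
    then show ?thesis using yB True by simp
  next
    case False
    then have IH: "b \<in> B" "x \<in> B" "(b, x) \<in> adj E ^^ (m - 1)"
      "\<And>e. e \<in> Ends \<inter> side E x y \<Longrightarrow> real (m - 1) * (s - C) \<le> bus (\<zeta> e) (z x) - bus (\<zeta> e) (z b)" using nbS(4) by auto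
    have m: "m = Suc (m - 1)" using False by simp
    have "(b, y) \<in> adj E ^^ m" using IH(3) xy by (subst m) (auto simp: adj_iff simp del: diff_Suc_1)
    moreover have "real m * (s - C) \<le> bus (\<zeta> e) (z y) - bus (\<zeta> e) (z b)" if e: "e \<in> Ends \<inter> side E y w" for e
    proof -
      have es: "e \<in> Ends \<inter> side E x y" using e side_nest[OF xy nbS(2)] nbS(3) by blast
      have "s - C \<le> bus (\<zeta> e) (z y) - bus (\<zeta> e) (z x)"
        using e2[of x y 0 1 e] es xy IH(2) yB vt[of x y] vt1[of x y] by (simp add: int_pts_iff)
      moreover have "real m * (s - C) = real (m - 1) * (s - C) + (s - C)" by (subst m) (simp add: algebra_simps)
      ultimately show ?thesis using IH(4)[OF es] by linarith
    qed
    ultimately show ?thesis using IH(1) yB by simp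
  qed
qed simp

lemma end_dists_phi:
  assumes "x \<in> P" "(a, \<tau>) \<in> end_dists V E x"
  shows "a \<in> B" "0 \<le> \<tau>" "hdist (\<phi> x) (z a) \<le> s * \<tau> + C" "\<tau> = 0 \<Longrightarrow> \<phi> x = z a"
proof -
  obtain u v t where x: "x = (u, v, t)" by (cases x)
  have uv: "{u, v} \<in> E" "u \<in> B" "0 \<le> t" "v \<in> B \<Longrightarrow> t \<le> 1" using assms x by (simp_all add: int_pts_iff)
  consider "a = u" "\<tau> = t" | "v \<in> B" "a = v" "\<tau> = 1 - t" using assms(2) x by (auto simp: end_dists_iff)
  then have "a \<in> B \<and> 0 \<le> \<tau> \<and> hdist (\<phi> x) (z a) \<le> s * \<tau> + C \<and> (\<tau> = 0 \<longrightarrow> \<phi> x = z a)"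
  proof cases
    case 1
    then show ?thesis using e1[of u v t 0] uv vt[of u v] x by (auto simp: int_pts_iff)
  next
    case 2
    then show ?thesis using e1[of u v t 1] uv vt1[of u v] x by (auto simp: int_pts_iff)
  qed
  then show "a \<in> B" "0 \<le> \<tau>" "hdist (\<phi> x) (z a) \<le> s * \<tau> + C" "\<tau> = 0 \<Longrightarrow> \<phi> x = z a" by auto
qed

lemma tree_dist_Min:
  assumes "x = (u, v, t)" "y = (u', v', t')" "{u, v} \<noteq> {u', v'}"
  shows "(a, r) \<in> end_dists V E x \<Longrightarrow> (b, q) \<in> end_dists V E y \<Longrightarrow> tree_dist V E x y \<le> r + real (graph_dist E a b) + q"
    and "\<exists>a r b q. (a, r) \<in> end_dists V E x \<and> (b, q) \<in> end_dists V E y \<and> tree_dist V E x y = r + real (graph_dist E a b) + q"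
proof -
  let ?S = "{ta + real (graph_dist E a b) + tb | a ta b tb. (a, ta) \<in> end_dists V E x \<and> (b, tb) \<in> end_dists V E y}"
  have td: "tree_dist V E x y = Min ?S" using assms by (simp add: tree_dist_def)
  have "?S = (\<lambda>((a, ta), (b, tb)). ta + real (graph_dist E a b) + tb) ` (end_dists V E x \<times> end_dists V E y)" by force
  moreover have "finite (end_dists V E x)" "finite (end_dists V E y)" "end_dists V E x \<noteq> {}" "end_dists V E y \<noteq> {}"
    using assms by (auto simp: end_dists_def)
  ultimately have S: "finite ?S" "?S \<noteq> {}" by simp_all
  show "tree_dist V E x y \<le> r + real (graph_dist E a b) + q" if "(a, r) \<in> end_dists V E x" "(b, q) \<in> end_dists V E y"
    unfolding td by (rule Min_le[OF S(1)]) (use that in blast)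
  show "\<exists>a r b q. (a, r) \<in> end_dists V E x \<and> (b, q) \<in> end_dists V E y \<and> tree_dist V E x y = r + real (graph_dist E a b) + q"
    using Min_in[OF S] unfolding td[symmetric] by blast
qed

text \<open>Shortest walks for \<open>graph_dist\<close> are walks in the whole vertex set. Giving
  an end the position of its only neighbour lets the triangle inequality run along such a walk
  without excluding ends.\<close>

definition "zz v = (if v \<in> B then z v else z (SOME u. {u, v} \<in> E))"

text \<open>Two adjacent ends would form a whole component, without the branch point
  \<open>pu\<close>.\<close>

lemma edge_branch: assumes "{x, y} \<in> E" shows "x \<in> B \<or> y \<in> B"
proof (rule ccontr)
  assume "\<not> ?thesis"
  then have e: "x \<in> Ends" "y \<in> Ends" using edgeV[OF assms] VBE by auto
  have "(x, pu) \<in> (adj E)\<^sup>*" using edgeV[OF assms] puv by (intro conn) auto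
  then have "pu = x \<or> pu = y"
  proof (induction rule: rtrancl_induct)
    case (step a b)
    then show ?case using ends_nbr_unique[OF e(1)] ends_nbr_unique[OF e(2)] assms by (metis adj_iff insert_commute)
  qed simp
  then show False using e branch_not_end[OF puB] by blast
qed

lemma zz_edge: assumes "{x, y} \<in> E" shows "hdist (zz x) (zz y) \<le> s + C" and "cmod (zz x) < 1"
proof -
  have end_zz: "zz y = z x" if "{x, y} \<in> E" "y \<notin> B" for x y
  proof -
    have "y \<in> Ends" using that edgeV VBE by blast
    then have "u = x" if "{u, y} \<in> E" for u using ends_nbr_unique[of y u x] that \<open>{x, y} \<in> E\<close> by (simp add: insert_commute)
    then have "(SOME u. {u, y} \<in> E) = x" using that(1) by (metis (mono_tags, lifting) someI)
    then show ?thesis using that by (simp add: zz_def)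
  qed
  have yx: "{y, x} \<in> E" using assms by (simp add: insert_commute)
  consider "x \<in> B" "y \<in> B" | "x \<in> B" "y \<notin> B" | "x \<notin> B" "y \<in> B" using edge_branch[OF assms] by blast
  then show "hdist (zz x) (zz y) \<le> s + C"
  proof cases
    case 1
    then show ?thesis using e1[of x y 0 1] assms vt[of x y] vt1[of x y] by (simp add: int_pts_iff zz_def)
  next
    case 2
    then have "zz x = zz y" using end_zz[OF assms] by (simp add: zz_def)
    then show ?thesis using s C by (simp add: hdist_def)
  next
    case 3
    then have "zz x = zz y" using end_zz[OF yx] by (simp add: zz_def)
    then show ?thesis using s C by (simp add: hdist_def)
  qed
  show "cmod (zz x) < 1"
  proof (cases "x \<in> B")
    case True then show ?thesis using norm_z by (simp add: zz_def)
  next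
    case False
    then have "y \<in> B" using edge_branch[OF assms] by blast
    then show ?thesis using end_zz[OF yx False] norm_z by simp
  qed
qed

lemma zz_walk: "(a, b) \<in> adj E ^^ n \<Longrightarrow> a \<in> B \<Longrightarrow> cmod (zz b) < 1 \<and> hdist (zz a) (zz b) \<le> real n * (s + C)"
proof (induction n arbitrary: b)
  case 0
  then show ?case using norm_z by (simp add: zz_def hdist_def)
next
  case (Suc n)
  then obtain x where x: "(a, x) \<in> adj E ^^ n" "{x, b} \<in> E" by (auto simp: adj_iff)
  have bx: "{b, x} \<in> E" using x(2) by (simp add: insert_commute)
  have "cmod (zz a) < 1" using norm_z Suc(3) by (simp add: zz_def)
  then have "hdist (zz a) (zz b) \<le> hdist (zz a) (zz x) + hdist (zz x) (zz b)"
    by (intro hdist_triangle zz_edge(2)[OF x(2)] zz_edge(2)[OF bx])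
  then show ?case using Suc.IH[OF x(1) Suc(3)] zz_edge[OF x(2)] zz_edge(2)[OF bx] by (simp add: algebra_simps)
qed

lemma bus_le: "e \<in> Ends \<Longrightarrow> x \<in> P \<Longrightarrow> y \<in> P \<Longrightarrow> bus (\<zeta> e) (\<phi> y) - bus (\<zeta> e) (\<phi> x) \<le> hdist (\<phi> x) (\<phi> y)"
  using bus_lipschitz[OF norm_phi norm_phi norm_zeta, of x y e] by (simp add: abs_le_iff)

text \<open>For the lower bound, an end beyond \<open>y\<close> on the path from \<open>x\<close>
  has a Busemann function that rises along the whole path; every edge costs C, and the path has at
  most card V of them. The upper bound is the triangle inequality along a path that realises
  \<open>tree_dist\<close>. The bounds hold with multiplicative constant 1.\<close>

theorem qi_bounds:
  assumes N: "\<And>a b. a \<in> V \<Longrightarrow> b \<in> V \<Longrightarrow> graph_dist E a b \<le> N" and x: "x \<in> P" and y: "y \<in> P"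
  defines "K \<equiv> (real (card V) + real N + 3) * C"
  shows "s * tree_dist V E x y - K \<le> hdist (\<phi> x) (\<phi> y)" "hdist (\<phi> x) (\<phi> y) \<le> s * tree_dist V E x y + K"
    "0 \<le> tree_dist V E x y" "tree_dist V E x y = 0 \<Longrightarrow> \<phi> x = \<phi> y"
proof -
  obtain u v t u' v' t' where xy: "x = (u, v, t)" "y = (u', v', t')" by (cases x, cases y) 
  have u: "{u, v} \<in> E" "u \<in> B" "0 \<le> t" "v \<in> B \<Longrightarrow> t \<le> 1" "{u', v'} \<in> E" "u' \<in> B" "0 \<le> t'" "v' \<in> B \<Longrightarrow> t' \<le> 1"
    using x y xy by (simp_all add: int_pts_iff)
  have KC: "C \<le> K" "(real N + 2) * C \<le> K" unfolding K_def using C mult_right_mono[of 1 "real (card V) + real N + 3" C]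
    by (auto intro!: mult_right_mono)
  have "s * tree_dist V E x y - K \<le> hdist (\<phi> x) (\<phi> y) \<and> hdist (\<phi> x) (\<phi> y) \<le> s * tree_dist V E x y + K \<and>
    0 \<le> tree_dist V E x y \<and> (tree_dist V E x y = 0 \<longrightarrow> \<phi> x = \<phi> y)"
  proof (cases "{u, v} = {u', v'}")
    case True
    \<comment> \<open>Rewrites the second point in the orientation in which the first one is
      given.\<close>
    obtain r where r: "(u, v, r) \<in> P" "\<phi> y = \<phi> (u, v, r)" "tree_dist V E x y = \<bar>t - r\<bar>"
    proof (cases "u = u'")
      case eq: True
      then have "v = v'" using True by (auto simp: doubleton_eq_iff)
      then show ?thesis using that[of t'] eq y xy True by (simp add: tree_dist_def)
    next
      case False
      then have "v = u'" "u = v'" using True by (auto simp: doubleton_eq_iff)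
      then have vu: "u' = v" "v' = u" "v \<in> B" using u by auto
      have "\<phi> (v, u, 1 - (1 - t')) = \<phi> (u, v, 1 - t')" by (rule sw) (use u vu in auto)
      then show ?thesis using that[of "1 - t'"] False vu u xy True by (simp add: tree_dist_def int_pts_iff)
    qed
    obtain e where e: "e \<in> Ends" "e \<in> side E u v" using side_end[OF u(1)] by blast
    have rP: "(u, v, r) \<in> P" and tP: "(u, v, t) \<in> P" using r x xy by auto
    have "s * \<bar>t - r\<bar> - C \<le> hdist (\<phi> x) (\<phi> y)"
    proof (cases "t \<le> r")
      case True
      then show ?thesis using e2[OF tP rP True e] bus_le[OF e(1) tP rP] r(2) xy(1) by simp
    next
      case False
      then have "r \<le> t" by simp
      then show ?thesis using e2[OF rP tP _ e] bus_le[OF e(1) rP tP] r(2) xy(1) by (simp add: hdist_commute)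
    qed
    then show ?thesis using e1[OF tP rP] r(2,3) xy(1) KC by auto
  next
    case False
    obtain a b a' b' n where w: "{a, b} = {u, v}" "{a', b'} = {u', v'}" "nbwalk E a b a' b' (Suc n)"
      using nb_edges[OF u(1,5)] False by metis
    have al: "b \<in> B" "a' \<in> B" "(b, a') \<in> adj E ^^ n" "\<And>e. e \<in> Ends \<inter> side E a' b' \<Longrightarrow> real n * (s - C) \<le> bus (\<zeta> e) (z a') - bus (\<zeta> e) (z b)"
      using along_walk[OF w(3)] by simp_all
    have sub: "side E a' b' \<subseteq> side E a b" "{a', b'} \<in> E" "{a, b} \<in> E" using nb_side[OF w(3)] by auto
    obtain e where e: "e \<in> Ends" "e \<in> side E a' b'" using side_end[OF sub(2)] by blast
    obtain \<tau> where \<tau>: "(b, \<tau>) \<in> end_dists V E x" "s * \<tau> - C \<le> bus (\<zeta> e) (z b) - bus (\<zeta> e) (\<phi> x)"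
      using to_vertex[OF x xy(1) w(1)[symmetric] al(1)] e sub by blast
    obtain \<tau>' where \<tau>': "(a', \<tau>') \<in> end_dists V E y" "s * \<tau>' - C \<le> bus (\<zeta> e) (\<phi> y) - bus (\<zeta> e) (z a')"
      using from_vertex[OF y xy(2) w(2)[symmetric] al(2)] e by blast
    have "tree_dist V E x y \<le> \<tau> + real (graph_dist E b a') + \<tau>'" by (rule tree_dist_Min(1)[OF xy False \<tau>(1) \<tau>'(1)])
    also have "\<dots> \<le> \<tau> + real n + \<tau>'" using graph_dist_le[OF al(3)] by simp
    finally have "s * tree_dist V E x y \<le> s * (\<tau> + real n + \<tau>')" using s by simp
    moreover have "hdist (\<phi> x) (\<phi> y) \<ge> s * (\<tau> + real n + \<tau>') - (real n + 2) * C"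
      using bus_le[OF e(1) x y] \<tau>(2) \<tau>'(2) al(4)[of e] e by (simp add: algebra_simps)
    moreover have "real n \<le> real (card V)"
    proof -
      have "n \<le> card (side E a b)" using nb_card[OF w(3)] by linarith
      also have "\<dots> \<le> card V" by (rule card_mono[OF finV sideV[OF sub(3)]])
      finally show ?thesis by simp
    qed
    then have "(real n + 2) * C \<le> K" unfolding K_def using C by (intro mult_right_mono) auto
    ultimately have lo: "s * tree_dist V E x y - K \<le> hdist (\<phi> x) (\<phi> y)" by linarith
    obtain a r b q where ab: "(a, r) \<in> end_dists V E x" "(b, q) \<in> end_dists V E y" "tree_dist V E x y = r + real (graph_dist E a b) + q"
      using tree_dist_Min(2)[OF xy False] by blast
    note A = end_dists_phi[OF x ab(1)] and B' = end_dists_phi[OF y ab(2)]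
    have abV: "a \<in> V" "b \<in> V" using A(1) B'(1) VBE by auto
    note wk = graph_dist_walk[OF abV]
    have za: "cmod (z a) < 1" "cmod (z b) < 1" using A(1) B'(1) norm_z by auto
    have "hdist (z a) (z b) \<le> real (graph_dist E a b) * (s + C)" using zz_walk[OF wk A(1)] A(1) B'(1) by (simp add: zz_def)
    moreover have "hdist (\<phi> x) (\<phi> y) \<le> hdist (\<phi> x) (z a) + hdist (z a) (\<phi> y)"
      "hdist (z a) (\<phi> y) \<le> hdist (z a) (z b) + hdist (z b) (\<phi> y)"
      using norm_phi[OF x] norm_phi[OF y] za by (auto intro!: hdist_triangle)
    moreover have "hdist (z b) (\<phi> y) \<le> s * q + C" using B'(3) by (simp add: hdist_commute)
    moreover have "real (graph_dist E a b) * C \<le> real N * C" using N[OF abV] C by (intro mult_right_mono) auto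
    moreover have "s * tree_dist V E x y = s * r + real (graph_dist E a b) * s + s * q" unfolding ab(3) by (simp add: algebra_simps)
    ultimately have "hdist (\<phi> x) (\<phi> y) \<le> s * tree_dist V E x y + (real N + 2) * C"
      using A(3) by (simp add: algebra_simps)
    then have up: "hdist (\<phi> x) (\<phi> y) \<le> s * tree_dist V E x y + K" using KC by linarith
    have "\<phi> x = \<phi> y" if "tree_dist V E x y = 0"
    proof -
      have z0: "r = 0" "q = 0" "graph_dist E a b = 0" using that ab(3) A(2) B'(2) by linarith+
      then have "a = b" using wk by simp
      then show ?thesis using A(4) B'(4) z0 by simp
    qed
    then show ?thesis using lo up A(2) B'(2) ab(3) by auto
  qed
  then show "s * tree_dist V E x y - K \<le> hdist (\<phi> x) (\<phi> y)" "hdist (\<phi> x) (\<phi> y) \<le> s * tree_dist V E x y + K"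
    "0 \<le> tree_dist V E x y" "tree_dist V E x y = 0 \<Longrightarrow> \<phi> x = \<phi> y" by auto
qed

text \<open>The squared separation of two ends seen from a point is a constant times the product of
  their kernels. On the way from \<open>z u\<close> to \<open>\<phi> x\<close> the Busemann function
  of an end ahead gains at least s t - C, and that of an end behind loses at most s t + C; the
  product keeps the factor exp (- 2 C).\<close>

lemma separated_ends:
  assumes x: "x \<in> P"
  shows "\<exists>e\<in>Ends. \<exists>e'\<in>Ends. e \<noteq> e' \<and> c0 * exp (- C) \<le> cmod (mob (\<phi> x) (\<zeta> e) - mob (\<phi> x) (\<zeta> e'))"
proof -
  obtain u v t where xy: "x = (u, v, t)" by (cases x)
  have u: "{u, v} \<in> E" "u \<in> B" "0 \<le> t" "v \<in> B \<Longrightarrow> t \<le> 1" using x xy by (simp_all add: int_pts_iff)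
  have "nbrs E u - {v} \<noteq> {}"
  proof
    assume "nbrs E u - {v} = {}"
    then have "nbrs E u \<subseteq> {v}" by blast
    then have "card (nbrs E u) \<le> 1" using card_mono[of "{v}"] by fastforce
    then show False using branch_nbrs[OF u(2)] by simp
  qed
  then obtain w where w: "{u, w} \<in> E" "w \<noteq> v" by (auto simp: nbrs_def)
  obtain e where e: "e \<in> Ends" "e \<in> side E u v" using side_end[OF u(1)] by blast
  obtain e' where e': "e' \<in> Ends" "e' \<in> side E u w" using side_end[OF w(1)] by blast
  have c: "c0 \<le> cmod (mob (z u) (\<zeta> e) - mob (z u) (\<zeta> e'))" using sep[OF u(2,1) w(1) _ e e'] w(2) by blast
  have zP: "(u, v, 0) \<in> P" using u by (simp add: int_pts_iff)
  have zu: "\<phi> (u, v, 0) = z u" "cmod (z u) < 1" using vt[OF u(1,2)] norm_z[OF u(2)] by auto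
  have 1: "s * t - C \<le> bus (\<zeta> e) (\<phi> x) - bus (\<zeta> e) (z u)" using e2[OF zP _ u(3) e] x xy zu by simp
  have 2: "bus (\<zeta> e') (z u) - bus (\<zeta> e') (\<phi> x) \<le> s * t + C"
    using bus_le[OF e'(1) x zP] e1[of u v t 0] x zP xy u(3) zu(1) by simp
  have nz: "cmod (\<zeta> e) = 1" "cmod (\<zeta> e') = 1" using norm_zeta e(1) e'(1) by auto
  have pk: "pker y (\<zeta> k) = exp (bus (\<zeta> k) y)" if "cmod y < 1" "k \<in> Ends" for y k
    using pker_pos[OF that(1) norm_zeta[OF that(2)]] by (simp add: bus_def)
  have px: "cmod (\<phi> x) < 1" by (rule norm_phi[OF x])
  have "(c0 * exp (- C))\<^sup>2 = c0\<^sup>2 * exp (- 2 * C)" by (simp add: power_mult_distrib exp_double[symmetric])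
  also have "\<dots> \<le> (cmod (mob (z u) (\<zeta> e) - mob (z u) (\<zeta> e')))\<^sup>2 * exp (- 2 * C)"
    using c c0 by (intro mult_right_mono power_mono) auto
  also have "\<dots> = (cmod (\<zeta> e - \<zeta> e'))\<^sup>2 * exp (bus (\<zeta> e) (z u) + bus (\<zeta> e') (z u) - 2 * C)"
    using norm_mob_diff_circle[OF zu(2) nz] pk[OF zu(2)] e(1) e'(1) by (simp add: mult_exp_exp)
  also have "\<dots> \<le> (cmod (\<zeta> e - \<zeta> e'))\<^sup>2 * exp (bus (\<zeta> e) (\<phi> x) + bus (\<zeta> e') (\<phi> x))"
    using 1 2 by (intro mult_left_mono) auto
  also have "\<dots> = (cmod (mob (\<phi> x) (\<zeta> e) - mob (\<phi> x) (\<zeta> e')))\<^sup>2"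
    using norm_mob_diff_circle[OF px nz] pk[OF px] e(1) e'(1) by (simp add: mult_exp_exp)
  finally have "c0 * exp (- C) \<le> cmod (mob (\<phi> x) (\<zeta> e) - mob (\<phi> x) (\<zeta> e'))" by (rule power2_le_imp_le) simp
  moreover have "e \<noteq> e'" using c c0 by auto
  ultimately show ?thesis using e(1) e'(1) by blast
qed

end

section \<open>Geodesic interpolation between the vertices\<close>

lemma seg_dist:
  assumes "cmod a < 1" "cmod b < 1" "hdist a b \<le> l + D" "0 \<le> D" "0 \<le> r" "r \<le> q" "q \<le> 1"
  shows "hdist (gpt a b r) (gpt a b q) \<le> (q - r) * l + D"
proof -
  have "(q - r) * hdist a b \<le> (q - r) * (l + D)" using assms by (intro mult_left_mono) auto
  moreover have "(q - r) * D \<le> 1 * D" using assms by (intro mult_right_mono) auto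
  ultimately show ?thesis using assms by (simp add: hdist_gpt algebra_simps)
qed

text \<open>Growth at least l - D and length at most l + D leave a defect of 2 D in
  \<open>bus_gpt_mono\<close>; replacing the length by l costs another D.\<close>

lemma seg_up:
  assumes "cmod a < 1" "cmod b < 1" "cmod \<zeta> = 1" "hdist a b \<le> l + D" "l - D \<le> bus \<zeta> b - bus \<zeta> a" "0 \<le> D" "0 \<le> r" "r \<le> q" "q \<le> 1"
  shows "(q - r) * l - 3 * D \<le> bus \<zeta> (gpt a b q) - bus \<zeta> (gpt a b r)"
proof -
  have "(q - r) * hdist a b - 2 * D \<le> bus \<zeta> (gpt a b q) - bus \<zeta> (gpt a b r)"
    using assms by (intro bus_gpt_mono) auto
  moreover have "l - D \<le> hdist a b" using assms(5) bus_lipschitz[OF assms(1-3)] by linarith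
  then have "(q - r) * (l - D) \<le> (q - r) * hdist a b" using assms by (intro mult_left_mono) auto
  moreover have "(q - r) * D \<le> 1 * D" using assms by (intro mult_right_mono) auto
  ultimately show ?thesis by (simp add: algebra_simps)
qed

lemma seg_down:
  assumes "cmod a < 1" "cmod b < 1" "cmod \<zeta> = 1" "hdist a b \<le> l + D" "l - D \<le> bus \<zeta> a - bus \<zeta> b" "0 \<le> D" "0 \<le> r" "r \<le> q" "q \<le> 1"
  shows "(q - r) * l - 3 * D \<le> bus \<zeta> (gpt a b r) - bus \<zeta> (gpt a b q)"
proof -
  have "((1 - r) - (1 - q)) * l - 3 * D \<le> bus \<zeta> (gpt b a (1 - r)) - bus \<zeta> (gpt b a (1 - q))"
    using assms by (intro seg_up) (auto simp: hdist_commute)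
  then show ?thesis using gpt_swap[OF assms(1,2), of r] gpt_swap[OF assms(1,2), of q] assms by simp
qed

lemma ray_down:
  assumes "cmod a < 1" "cmod \<xi> = 1" "cmod \<zeta> = 1" "0 < c" "c \<le> cmod (mob a \<zeta> - mob a \<xi>)" "0 \<le> r" "r \<le> q"
  shows "(q - r) - ln (16 / c\<^sup>2) \<le> bus \<zeta> (gray a \<xi> r) - bus \<zeta> (gray a \<xi> q)"
proof -
  have "\<bar>bus \<zeta> (gray a \<xi> r) - bus \<zeta> (gray a \<xi> 0)\<bar> \<le> \<bar>r - 0\<bar>"
    using bus_lipschitz[OF norm_gray[OF assms(1,2)] norm_gray[OF assms(1,2)] assms(3), of r 0] hdist_gray[OF assms(1,2), of r 0] by simp
  moreover have "bus \<zeta> (gray a \<xi> q) \<le> bus \<zeta> a - q + ln (16 / c\<^sup>2)" using assms by (intro bus_gray_other) auto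
  ultimately show ?thesis using assms(6) by simp
qed

lemma image_rescale: assumes "0 < b" shows "(\<lambda>t. f ((t - a) / b)) ` {a..a + b} = f ` {0..1::real}"
proof -
  have "x \<in> (\<lambda>t. (t - a) / b) ` {a..a + b}" if "x \<in> {0..1}" for x
    using that assms by (intro image_eqI[of _ _ "a + b * x"]) (auto simp: mult_left_le)
  moreover have "(t - a) / b \<in> {0..1}" if "t \<in> {a..a + b}" for t using that assms by (auto simp: divide_le_eq)
  ultimately have "(\<lambda>t. (t - a) / b) ` {a..a + b} = {0..1}" by blast
  then show ?thesis by (metis image_image)
qed

text \<open>The assumptions are estimates at vertices and ends only. Those for the base edge are
  made for its two parts separately, because its image is broken at 0, which need not lie on the
  geodesic between the images of its endpoints.\<close>

locale tree_geodesics = rooted_tree V E pu pv for V :: "'v set" and E pu pv +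
  fixes z \<zeta> :: "'v \<Rightarrow> complex" and s pt D c0 :: real
  assumes s: "0 < s" and pt: "0 < pt" "pv \<in> branch_points V E \<Longrightarrow> pt < 1" and puB: "pu \<in> branch_points V E"
    and D: "0 \<le> D" and c0: "0 < c0" "c0 \<le> 1"
    and nz: "cmod (z v) < 1" and n\<zeta>: "cmod (\<zeta> e) = 1"
    and g1: "{u, v} \<in> E \<Longrightarrow> {u, v} \<noteq> {pu, pv} \<Longrightarrow> hdist (z u) (z v) \<le> s + D"
    and g2: "{u, v} \<in> E \<Longrightarrow> {u, v} \<noteq> {pu, pv} \<Longrightarrow> e \<in> tree_ends V E \<Longrightarrow> e \<in> side E u v \<Longrightarrow> s - D \<le> bus (\<zeta> e) (z v) - bus (\<zeta> e) (z u)"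
    and g3: "hdist (z pu) 0 \<le> s * pt + D"
    and g3u: "e \<in> tree_ends V E \<Longrightarrow> e \<in> side E pv pu \<Longrightarrow> s * pt - D \<le> bus (\<zeta> e) (z pu)"
    and g3d: "e \<in> tree_ends V E \<Longrightarrow> e \<in> side E pu pv \<Longrightarrow> s * pt - D \<le> - bus (\<zeta> e) (z pu)"
    and g4: "pv \<in> branch_points V E \<Longrightarrow> hdist 0 (z pv) \<le> s * (1 - pt) + D"
    and g4u: "pv \<in> branch_points V E \<Longrightarrow> e \<in> tree_ends V E \<Longrightarrow> e \<in> side E pu pv \<Longrightarrow> s * (1 - pt) - D \<le> bus (\<zeta> e) (z pv)"
    and g4d: "pv \<in> branch_points V E \<Longrightarrow> e \<in> tree_ends V E \<Longrightarrow> e \<in> side E pv pu \<Longrightarrow> s * (1 - pt) - D \<le> - bus (\<zeta> e) (z pv)"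
    and g5: "pv \<in> tree_ends V E \<Longrightarrow> e \<in> tree_ends V E \<Longrightarrow> e \<in> side E pv pu \<Longrightarrow> c0 \<le> cmod (\<zeta> e - \<zeta> pv)"
    and sep: "u \<in> branch_points V E \<Longrightarrow> {u, v} \<in> E \<Longrightarrow> {u, w} \<in> E \<Longrightarrow> v \<noteq> w \<Longrightarrow> e \<in> tree_ends V E \<Longrightarrow> e \<in> side E u v \<Longrightarrow>
        e' \<in> tree_ends V E \<Longrightarrow> e' \<in> side E u w \<Longrightarrow> c0 \<le> cmod (mob (z u) (\<zeta> e) - mob (z u) (\<zeta> e'))"
begin

definition "far t = (if pv \<in> B then gpt 0 (z pv) ((t - pt) / (1 - pt)) else gray 0 (\<zeta> pv) (s * (t - pt)))"
definition "pe t = (if t \<le> pt then gpt (z pu) 0 (t / pt) else far t)"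
definition "\<phi> x = (case x of (u, v, t) \<Rightarrow>
   if {u, v} = {pu, pv} then (if u = pu then pe t else pe (1 - t))
   else if v \<in> B then gpt (z u) (z v) t else gray (z u) (\<zeta> v) (s * t))"

text \<open>Each part of the base edge may contribute 3 D; the logarithm is the loss along a ray
  seen from another end.\<close>

definition "C = 6 * D + ln (16 / c0\<^sup>2)"

lemma lnc: "0 \<le> ln (16 / c0\<^sup>2)"
proof -
  have "c0\<^sup>2 \<le> 16" using c0 power_le_one[of c0 2] by simp
  then show ?thesis using c0 by (intro ln_ge_zero) (simp add: le_divide_eq)
qed

lemma C_ge: "D \<le> C" "2 * D \<le> C" "3 * D \<le> C" "6 * D \<le> C" "ln (16 / c0\<^sup>2) \<le> C" "0 \<le> C"
  using lnc D by (simp_all add: C_def)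

lemma pv_end: "pv \<notin> B \<Longrightarrow> pv \<in> Ends" using puv VBE by blast

lemma far_pt [simp]: "far pt = 0" by (simp add: far_def)
lemma pe_pt [simp]: "pe pt = 0" using pt nz[of pu] by (simp add: pe_def gpt_1)
lemma pe_far: "pt \<le> t \<Longrightarrow> pe t = far t" using pe_pt far_pt by (cases "t = pt") (simp_all add: pe_def)

lemma norm_pe: "cmod (pe t) < 1"
  by (simp add: pe_def far_def norm_gpt norm_gray nz n\<zeta>)

lemma pe_near_bounds:
  assumes "0 \<le> r" "r \<le> q" "q \<le> pt"
  shows "hdist (pe r) (pe q) \<le> s * (q - r) + D"
    and "e \<in> Ends \<Longrightarrow> e \<in> side E pu pv \<Longrightarrow> s * (q - r) - 3 * D \<le> bus (\<zeta> e) (pe q) - bus (\<zeta> e) (pe r)"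
    and "e \<in> Ends \<Longrightarrow> e \<in> side E pv pu \<Longrightarrow> s * (q - r) - 3 * D \<le> bus (\<zeta> e) (pe r) - bus (\<zeta> e) (pe q)"
proof -
  have pe: "pe r = gpt (z pu) 0 (r / pt)" "pe q = gpt (z pu) 0 (q / pt)" using assms by (simp_all add: pe_def)
  have rq: "0 \<le> r / pt" "r / pt \<le> q / pt" "q / pt \<le> 1" using assms pt by (simp_all add: divide_right_mono)
  have l: "(q / pt - r / pt) * (s * pt) = s * (q - r)" using pt by (simp add: field_simps)
  have z0: "cmod 0 < 1" by simp
  show "hdist (pe r) (pe q) \<le> s * (q - r) + D" using seg_dist[OF nz z0 g3 D rq] unfolding pe l .
  show "s * (q - r) - 3 * D \<le> bus (\<zeta> e) (pe q) - bus (\<zeta> e) (pe r)" if "e \<in> Ends" "e \<in> side E pu pv"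
    using seg_up[OF nz z0 n\<zeta> g3 _ D rq, of e] g3d[OF that] n\<zeta> unfolding pe l by simp
  show "s * (q - r) - 3 * D \<le> bus (\<zeta> e) (pe r) - bus (\<zeta> e) (pe q)" if "e \<in> Ends" "e \<in> side E pv pu"
    using seg_down[OF nz z0 n\<zeta> g3 _ D rq, of e] g3u[OF that] n\<zeta> unfolding pe l by simp
qed

lemma pe_far_bounds:
  assumes "pt \<le> r" "r \<le> q" "pv \<in> B \<longrightarrow> q \<le> 1"
  shows "hdist (pe r) (pe q) \<le> s * (q - r) + D"
    and "e \<in> Ends \<Longrightarrow> e \<in> side E pu pv \<Longrightarrow> s * (q - r) - 3 * D \<le> bus (\<zeta> e) (pe q) - bus (\<zeta> e) (pe r)"
    and "e \<in> Ends \<Longrightarrow> e \<in> side E pv pu \<Longrightarrow> s * (q - r) - (3 * D + ln (16 / c0\<^sup>2)) \<le> bus (\<zeta> e) (pe r) - bus (\<zeta> e) (pe q)"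
proof -
  have z0: "cmod 0 < 1" by simp
  have "hdist (pe r) (pe q) \<le> s * (q - r) + D \<and>
    (\<forall>e\<in>Ends. (e \<in> side E pu pv \<longrightarrow> s * (q - r) - 3 * D \<le> bus (\<zeta> e) (pe q) - bus (\<zeta> e) (pe r)) \<and>
      (e \<in> side E pv pu \<longrightarrow> s * (q - r) - (3 * D + ln (16 / c0\<^sup>2)) \<le> bus (\<zeta> e) (pe r) - bus (\<zeta> e) (pe q)))"
  proof (cases "pv \<in> B")
    case True
    have p1: "pt < 1" by (rule pt(2)[OF True])
    have pe: "pe r = gpt 0 (z pv) ((r - pt) / (1 - pt))" "pe q = gpt 0 (z pv) ((q - pt) / (1 - pt))"
      using assms True by (simp_all add: pe_far far_def)
    have rq: "0 \<le> (r - pt) / (1 - pt)" "(r - pt) / (1 - pt) \<le> (q - pt) / (1 - pt)" "(q - pt) / (1 - pt) \<le> 1"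
      using assms p1 True by (auto simp: divide_right_mono)
    have "(q - pt) / (1 - pt) - (r - pt) / (1 - pt) = (q - r) / (1 - pt)" by (simp add: diff_divide_distrib[symmetric])
    then have l: "((q - pt) / (1 - pt) - (r - pt) / (1 - pt)) * (s * (1 - pt)) = s * (q - r)" using p1 by simp
    have "hdist (pe r) (pe q) \<le> s * (q - r) + D" using seg_dist[OF z0 nz g4[OF True] D rq] unfolding pe l .
    moreover have "s * (q - r) - 3 * D \<le> bus (\<zeta> e) (pe q) - bus (\<zeta> e) (pe r)" if "e \<in> Ends" "e \<in> side E pu pv" for e
      using seg_up[OF z0 nz n\<zeta> g4[OF True] _ D rq, of e] g4u[OF True that] n\<zeta> unfolding pe l by simp
    moreover have "s * (q - r) - 3 * D \<le> bus (\<zeta> e) (pe r) - bus (\<zeta> e) (pe q)" if "e \<in> Ends" "e \<in> side E pv pu" for e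
      using seg_down[OF z0 nz n\<zeta> g4[OF True] _ D rq, of e] g4d[OF True that] n\<zeta> unfolding pe l by simp
    ultimately show ?thesis using lnc by fastforce
  next
    case False
    have pe: "pe r = gray 0 (\<zeta> pv) (s * (r - pt))" "pe q = gray 0 (\<zeta> pv) (s * (q - pt))"
      using assms False by (simp_all add: pe_far far_def)
    have l: "s * (q - pt) - s * (r - pt) = s * (q - r)" by (simp add: algebra_simps)
    have rq: "0 \<le> s * (r - pt)" "s * (r - pt) \<le> s * (q - pt)" using s assms by auto
    have "hdist (pe r) (pe q) = s * (q - r)" unfolding pe hdist_gray[OF z0 n\<zeta>] using rq l by simp
    then have "hdist (pe r) (pe q) \<le> s * (q - r) + D" using D by simp
    moreover have "s * (q - r) - 3 * D \<le> bus (\<zeta> e) (pe q) - bus (\<zeta> e) (pe r)" if "e \<in> side E pu pv" for e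
      using side_end_eq[OF pv_end[OF False] pedge that] bus_gray[OF z0 n\<zeta>] l D unfolding pe by simp
    moreover have "s * (q - r) - (3 * D + ln (16 / c0\<^sup>2)) \<le> bus (\<zeta> e) (pe r) - bus (\<zeta> e) (pe q)" if "e \<in> Ends" "e \<in> side E pv pu" for e
      using ray_down[OF z0 n\<zeta> n\<zeta> c0(1) _ rq, of e pv] g5[OF pv_end[OF False] that] l D unfolding pe by simp
    ultimately show ?thesis by blast
  qed
  then show "hdist (pe r) (pe q) \<le> s * (q - r) + D"
    "e \<in> Ends \<Longrightarrow> e \<in> side E pu pv \<Longrightarrow> s * (q - r) - 3 * D \<le> bus (\<zeta> e) (pe q) - bus (\<zeta> e) (pe r)"
    "e \<in> Ends \<Longrightarrow> e \<in> side E pv pu \<Longrightarrow> s * (q - r) - (3 * D + ln (16 / c0\<^sup>2)) \<le> bus (\<zeta> e) (pe r) - bus (\<zeta> e) (pe q)"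
    by blast+
qed

lemma pe_bounds:
  assumes rq: "0 \<le> r" "r \<le> q" "pv \<in> B \<longrightarrow> q \<le> 1"
  shows "hdist (pe r) (pe q) \<le> s * (q - r) + C"
    and "e \<in> Ends \<Longrightarrow> e \<in> side E pu pv \<Longrightarrow> s * (q - r) - C \<le> bus (\<zeta> e) (pe q) - bus (\<zeta> e) (pe r)"
    and "e \<in> Ends \<Longrightarrow> e \<in> side E pv pu \<Longrightarrow> s * (q - r) - C \<le> bus (\<zeta> e) (pe r) - bus (\<zeta> e) (pe q)"
proof -
  have sp: "s * (q - r) = s * (pt - r) + s * (q - pt)" by (simp add: algebra_simps)
  have tri: "hdist (pe r) (pe q) \<le> hdist (pe r) (pe pt) + hdist (pe pt) (pe q)" by (intro hdist_triangle norm_pe)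
  consider "q \<le> pt" | "pt \<le> r" | "r \<le> pt" "pt \<le> q" by linarith
  then have "hdist (pe r) (pe q) \<le> s * (q - r) + C \<and>
    (\<forall>e\<in>Ends. (e \<in> side E pu pv \<longrightarrow> s * (q - r) - C \<le> bus (\<zeta> e) (pe q) - bus (\<zeta> e) (pe r)) \<and>
      (e \<in> side E pv pu \<longrightarrow> s * (q - r) - C \<le> bus (\<zeta> e) (pe r) - bus (\<zeta> e) (pe q)))"
  proof cases
    case 1
    then show ?thesis using pe_near_bounds[OF rq(1,2) 1] C_ge by fastforce
  next
    case 2
    then show ?thesis using pe_far_bounds[OF 2 rq(2,3)] D lnc unfolding C_def by fastforce
  next
    case 3
    note A = pe_near_bounds[OF rq(1) 3(1) order_refl] and B' = pe_far_bounds[OF order_refl 3(2) rq(3)]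
    have "hdist (pe r) (pe q) \<le> s * (q - r) + C" using tri A(1) B'(1) C_ge(2) unfolding sp by linarith
    moreover have "s * (q - r) - C \<le> bus (\<zeta> e) (pe q) - bus (\<zeta> e) (pe r)" if "e \<in> Ends" "e \<in> side E pu pv" for e
      using A(2)[OF that] B'(2)[OF that] C_ge(4) unfolding sp by linarith
    moreover have "s * (q - r) - C \<le> bus (\<zeta> e) (pe r) - bus (\<zeta> e) (pe q)" if "e \<in> Ends" "e \<in> side E pv pu" for e
      using A(3)[OF that] B'(3)[OF that] unfolding sp C_def by linarith
    ultimately show ?thesis by blast
  qed
  then show "hdist (pe r) (pe q) \<le> s * (q - r) + C"
    "e \<in> Ends \<Longrightarrow> e \<in> side E pu pv \<Longrightarrow> s * (q - r) - C \<le> bus (\<zeta> e) (pe q) - bus (\<zeta> e) (pe r)"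
    "e \<in> Ends \<Longrightarrow> e \<in> side E pv pu \<Longrightarrow> s * (q - r) - C \<le> bus (\<zeta> e) (pe r) - bus (\<zeta> e) (pe q)" by blast+
qed

lemma phi_p: "\<phi> (pu, pv, t) = pe t" "\<phi> (pv, pu, t) = pe (1 - t)"
  using puv(3) by (auto simp: \<phi>_def insert_commute)

lemma phi_branch: "{u, v} \<noteq> {pu, pv} \<Longrightarrow> v \<in> B \<Longrightarrow> \<phi> (u, v, t) = gpt (z u) (z v) t"
  by (simp add: \<phi>_def)

lemma phi_end: "{u, v} \<noteq> {pu, pv} \<Longrightarrow> v \<notin> B \<Longrightarrow> \<phi> (u, v, t) = gray (z u) (\<zeta> v) (s * t)"
  by (simp add: \<phi>_def)

lemma norm_phi: "cmod (\<phi> x) < 1"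
  by (auto simp: \<phi>_def norm_pe norm_gpt norm_gray nz n\<zeta> split: prod.split)

lemma phi_0: assumes "u \<in> B" shows "\<phi> (u, v, 0) = z u"
proof -
  have "pe 1 = z pv" if "pv \<in> B" using pe_far[of 1] pt(2)[OF that] that by (simp add: far_def gpt_1 nz)
  moreover have "pe 0 = z pu" using pt by (simp add: pe_def)
  ultimately show ?thesis using assms by (auto simp: \<phi>_def doubleton_eq_iff)
qed

lemma edge_cases [consumes 1, case_names p q branch leaf]:
  assumes "(u, v, t) \<in> int_pts V E" 
    "u = pu \<Longrightarrow> v = pv \<Longrightarrow> thesis" "u = pv \<Longrightarrow> v = pu \<Longrightarrow> pv \<in> B \<Longrightarrow> thesis"
    "{u, v} \<noteq> {pu, pv} \<Longrightarrow> v \<in> B \<Longrightarrow> thesis" "{u, v} \<noteq> {pu, pv} \<Longrightarrow> v \<notin> B \<Longrightarrow> v \<in> Ends \<Longrightarrow> thesis"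
  shows thesis
proof -
  have u: "{u, v} \<in> E" "u \<in> B" using assms(1) by (simp_all add: int_pts_iff)
  have "v \<in> B \<or> v \<in> Ends" using edgeV[OF u(1)] VBE by blast
  then show ?thesis using assms(2-) u by (metis doubleton_eq_iff)
qed

lemma phi_bounds:
  assumes P: "(u, v, t) \<in> int_pts V E" "(u, v, t') \<in> int_pts V E" and tt: "t \<le> t'"
  shows "hdist (\<phi> (u, v, t)) (\<phi> (u, v, t')) \<le> s * (t' - t) + C"
    and "e \<in> Ends \<Longrightarrow> e \<in> side E u v \<Longrightarrow> s * (t' - t) - C \<le> bus (\<zeta> e) (\<phi> (u, v, t')) - bus (\<zeta> e) (\<phi> (u, v, t))"
    and "e \<in> Ends \<Longrightarrow> e \<in> side E v u \<Longrightarrow> s * (t' - t) - C \<le> bus (\<zeta> e) (\<phi> (u, v, t)) - bus (\<zeta> e) (\<phi> (u, v, t'))"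
proof -
  have u: "{u, v} \<in> E" "u \<in> B" "0 \<le> t" "v \<in> B \<Longrightarrow> t' \<le> 1" using P by (simp_all add: int_pts_iff)
  have "hdist (\<phi> (u, v, t)) (\<phi> (u, v, t')) \<le> s * (t' - t) + C \<and>
    (\<forall>e\<in>Ends. (e \<in> side E u v \<longrightarrow> s * (t' - t) - C \<le> bus (\<zeta> e) (\<phi> (u, v, t')) - bus (\<zeta> e) (\<phi> (u, v, t))) \<and>
      (e \<in> side E v u \<longrightarrow> s * (t' - t) - C \<le> bus (\<zeta> e) (\<phi> (u, v, t)) - bus (\<zeta> e) (\<phi> (u, v, t'))))"
    using P(1)
  proof (cases rule: edge_cases)
    case p
    then show ?thesis using pe_bounds[OF u(3) tt] u(4) unfolding p phi_p by blast
  next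
    case q
    have "0 \<le> 1 - t'" "1 - t' \<le> 1 - t" "pv \<in> B \<longrightarrow> 1 - t \<le> 1" using u q puB tt by auto
    note b = pe_bounds[OF this]
    have l: "(1 - t) - (1 - t') = t' - t" by simp
    show ?thesis using b unfolding q phi_p l hdist_commute[of "pe (1 - t)"] by blast
  next
    case branch
    note gg = g1[OF u(1) branch(1)]
    have l: "(t' - t) * s = s * (t' - t)" by simp
    have "hdist (gpt (z u) (z v) t) (gpt (z u) (z v) t') \<le> s * (t' - t) + C"
      using seg_dist[OF nz nz gg D u(3) tt u(4)[OF branch(2)]] C_ge(1) unfolding l by linarith
    moreover have "s * (t' - t) - C \<le> bus (\<zeta> e) (gpt (z u) (z v) t') - bus (\<zeta> e) (gpt (z u) (z v) t)" if "e \<in> Ends" "e \<in> side E u v" for e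
      using seg_up[OF nz nz n\<zeta> gg g2[OF u(1) branch(1) that] D u(3) tt u(4)[OF branch(2)]] C_ge(3) unfolding l by linarith
    moreover have "s * (t' - t) - C \<le> bus (\<zeta> e) (gpt (z u) (z v) t) - bus (\<zeta> e) (gpt (z u) (z v) t')" if "e \<in> Ends" "e \<in> side E v u" for e
    proof -
      have "{v, u} \<in> E" "{v, u} \<noteq> {pu, pv}" using u(1) branch(1) by (simp_all add: insert_commute)
      from g2[OF this that] show ?thesis
        using seg_down[OF nz nz n\<zeta> gg _ D u(3) tt u(4)[OF branch(2)], of e] C_ge(3) unfolding l by linarith
    qed
    ultimately show ?thesis unfolding phi_branch[OF branch] by blast
  next
    case leaf
    have l: "s * t' - s * t = s * (t' - t)" by (simp add: algebra_simps)
    have rq: "0 \<le> s * t" "s * t \<le> s * t'" using s u(3) tt by auto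
    have "hdist (gray (z u) (\<zeta> v) (s * t)) (gray (z u) (\<zeta> v) (s * t')) = s * (t' - t)" unfolding hdist_gray[OF nz n\<zeta>] using rq l by simp
    then have "hdist (gray (z u) (\<zeta> v) (s * t)) (gray (z u) (\<zeta> v) (s * t')) \<le> s * (t' - t) + C" using C_ge by simp
    moreover have "s * (t' - t) - C \<le> bus (\<zeta> e) (gray (z u) (\<zeta> v) (s * t')) - bus (\<zeta> e) (gray (z u) (\<zeta> v) (s * t))" if "e \<in> side E u v" for e
      using side_end_eq[OF leaf(3) u(1) that] bus_gray[OF nz n\<zeta>, of v u] l C_ge(6) by simp
    moreover have "s * (t' - t) - C \<le> bus (\<zeta> e) (gray (z u) (\<zeta> v) (s * t)) - bus (\<zeta> e) (gray (z u) (\<zeta> v) (s * t'))" if e: "e \<in> Ends" "e \<in> side E v u" for e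
    proof -
      \<comment> \<open>Being behind the ray, \<open>e\<close> lies in another direction
        \<open>w\<close> at \<open>u\<close>; the separation at \<open>u\<close> then controls the
        Busemann function along the ray.\<close>
      have "u \<noteq> e" "e \<in> V" "u \<in> V" using branch_not_end[OF u(2)] e(1) VBE u(2) by auto
      then obtain w where w: "{u, w} \<in> E" "e \<in> side E u w" using vside[of u e] by blast
      have "w \<noteq> v" using side_disj[OF u(1)] w(2) e(2) by blast
      then have "c0 \<le> cmod (mob (z u) (\<zeta> e) - mob (z u) (\<zeta> v))"
        using sep[OF u(2) w(1) u(1) _ e(1) w(2) leaf(3) side_self] by blast
      from ray_down[OF nz n\<zeta> n\<zeta> c0(1) this rq] show ?thesis using C_ge(5) unfolding l by linarith
    qed
    ultimately show ?thesis unfolding phi_end[OF leaf(1,2)] by blast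
  qed
  then show "hdist (\<phi> (u, v, t)) (\<phi> (u, v, t')) \<le> s * (t' - t) + C"
    "e \<in> Ends \<Longrightarrow> e \<in> side E u v \<Longrightarrow> s * (t' - t) - C \<le> bus (\<zeta> e) (\<phi> (u, v, t')) - bus (\<zeta> e) (\<phi> (u, v, t))"
    "e \<in> Ends \<Longrightarrow> e \<in> side E v u \<Longrightarrow> s * (t' - t) - C \<le> bus (\<zeta> e) (\<phi> (u, v, t)) - bus (\<zeta> e) (\<phi> (u, v, t'))" by blast+
qed

lemma phi_swap: assumes "{u, v} \<in> E" "u \<in> B" "v \<in> B" "0 \<le> t" "t \<le> 1" shows "\<phi> (v, u, 1 - t) = \<phi> (u, v, t)"
proof (cases "{u, v} = {pu, pv}")
  case True
  then consider "u = pu" "v = pv" | "u = pv" "v = pu" by (auto simp: doubleton_eq_iff)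
  then show ?thesis by cases (simp_all add: phi_p)
next
  case False
  then have "{v, u} \<noteq> {pu, pv}" by (simp add: insert_commute)
  then show ?thesis using phi_branch[OF False assms(3)] phi_branch[of v u] assms gpt_swap[OF nz nz assms(4,5)] by simp
qed

sublocale q: tree_map V E pu pv \<phi> \<zeta> z s C c0
proof
  show "hdist (\<phi> (u, v, t)) (\<phi> (u, v, t')) \<le> s * \<bar>t - t'\<bar> + C" if "(u, v, t) \<in> int_pts V E" "(u, v, t') \<in> int_pts V E" for u v t t'
  proof (cases "t \<le> t'")
    case True then show ?thesis using phi_bounds(1)[OF that] by simp
  next
    case False then show ?thesis using phi_bounds(1)[OF that(2,1)] by (simp add: hdist_commute)
  qed
  show "0 < s" "0 \<le> C" "pu \<in> B" "0 < c0" by (fact s C_ge(6) puB c0(1))+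
  show "cmod (\<phi> x) < 1" for x by (rule norm_phi)
  show "cmod (\<zeta> e) = 1" for e by (rule n\<zeta>)
  show "\<phi> (u, v, 0) = z u" if "u \<in> B" for u v by (rule phi_0[OF that])
qed (fact phi_swap phi_bounds(2) phi_bounds(3) sep)+

lemma phi_base: "\<phi> (pu, pv, pt) = 0" by (simp add: phi_p)

lemma continuous_pe: "continuous_on S pe"
proof -
  have c1: "continuous_on A (\<lambda>t. gpt a b (h t))" if "continuous_on A h" "cmod a < 1" for A a b h
    by (rule continuous_on_compose2[OF continuous_on_gpt[OF that(2), of UNIV] that(1)]) simp
  have c2: "continuous_on A (\<lambda>t. gray 0 (\<zeta> pv) (h t))" if "continuous_on A h" for A h
    by (rule continuous_on_compose2[OF continuous_on_gray[of 0 "\<zeta> pv" UNIV] that]) (simp_all add: n\<zeta>)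
  have "continuous_on A far" for A unfolding far_def
    by (cases "pv \<in> B") (auto intro!: c1 c2 continuous_intros pt(2) dest: pt(2))
  moreover have "continuous_on A (\<lambda>t. gpt (z pu) 0 (t / pt))" for A using pt by (intro c1 continuous_intros nz) auto
  ultimately show ?thesis unfolding pe_def
    by (intro continuous_on_cases_le) (use pe_pt far_pt pe_def in auto)
qed

lemma continuous_phi: "continuous_on S (\<lambda>t. \<phi> (u, v, t))"
proof -
  have c: "continuous_on S (\<lambda>t. pe (1 - t))" by (rule continuous_on_compose2[OF continuous_pe[of UNIV]]) (auto intro!: continuous_intros)
  have c2: "continuous_on S (\<lambda>t. gray (z u) (\<zeta> v) (s * t))"
    by (rule continuous_on_compose2[OF continuous_on_gray[OF nz n\<zeta>, of UNIV]]) (auto intro!: continuous_intros)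
  show ?thesis unfolding \<phi>_def using continuous_pe c c2 continuous_on_gpt[OF nz]
    by (cases "{u, v} = {pu, pv}"; cases "u = pu"; cases "v \<in> B") simp_all
qed

lemma phi_lim: assumes "e \<in> Ends" "{u, e} \<in> E" shows "((\<lambda>t. \<phi> (u, e, t)) \<longlongrightarrow> \<zeta> e) at_top"
proof -
  have eB: "e \<notin> B" using assms branch_not_end by blast
  have z0: "cmod 0 < 1" by simp
  show ?thesis
  proof (cases "{u, e} = {pu, pv}")
    case True
    then have ue: "u = pu" "e = pv" using eB puB by (auto simp: doubleton_eq_iff)
    have "filterlim (\<lambda>t. s * (- pt + t)) at_top at_top"
      by (intro filterlim_tendsto_pos_mult_at_top[OF tendsto_const s] filterlim_tendsto_add_at_top[OF tendsto_const filterlim_ident])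
    then have "((\<lambda>t. gray 0 (\<zeta> pv) (s * (- pt + t))) \<longlongrightarrow> \<zeta> pv) at_top"
      by (rule filterlim_compose[OF gray_tendsto[OF z0 n\<zeta>]])
    moreover have "eventually (\<lambda>t. gray 0 (\<zeta> pv) (s * (- pt + t)) = \<phi> (pu, pv, t)) at_top"
      using eventually_ge_at_top[of pt] by eventually_elim (use eB ue in \<open>simp add: phi_p pe_far far_def\<close>)
    ultimately show ?thesis unfolding ue by (rule Lim_transform_eventually)
  next
    case False
    have "filterlim (\<lambda>t. s * t) at_top at_top"
      by (intro filterlim_tendsto_pos_mult_at_top[OF tendsto_const s] filterlim_ident)
    then show ?thesis unfolding phi_end[OF False eB] by (rule filterlim_compose[OF gray_tendsto[OF nz n\<zeta>]])
  qed
qed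

lemma phi_images:
  shows "{u, v} \<in> E \<Longrightarrow> u \<in> B \<Longrightarrow> {u, v} \<noteq> {pu, pv} \<Longrightarrow> v \<in> B \<Longrightarrow> (\<lambda>t. \<phi> (u, v, t)) ` {0..1} = hseg (\<phi> (u, v, 0)) (\<phi> (u, v, 1))"
    and "u \<in> B \<Longrightarrow> {u, v} \<noteq> {pu, pv} \<Longrightarrow> v \<in> Ends \<Longrightarrow> (\<lambda>t. \<phi> (u, v, t)) ` {0..} = hray (\<phi> (u, v, 0)) (\<zeta> v)"
    and "(\<lambda>t. \<phi> (pu, pv, t)) ` {0..pt} = hseg (\<phi> (pu, pv, 0)) 0"
    and "pv \<in> B \<Longrightarrow> (\<lambda>t. \<phi> (pu, pv, t)) ` {pt..1} = hseg 0 (\<phi> (pu, pv, 1))"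
    and "pv \<in> Ends \<Longrightarrow> (\<lambda>t. \<phi> (pu, pv, t)) ` {pt..} = hray 0 (\<zeta> pv)"
proof -
  have z0: "cmod 0 < 1" by simp
  show "(\<lambda>t. \<phi> (u, v, t)) ` {0..1} = hseg (\<phi> (u, v, 0)) (\<phi> (u, v, 1))" if "{u, v} \<noteq> {pu, pv}" "v \<in> B"
    unfolding phi_branch[OF that] gpt_0 gpt_1[OF nz nz] hseg_eq_gpt[OF nz nz] ..
  show "(\<lambda>t. \<phi> (u, v, t)) ` {0..} = hray (\<phi> (u, v, 0)) (\<zeta> v)" if "{u, v} \<noteq> {pu, pv}" "v \<in> Ends"
  proof -
    have "v \<notin> B" using that branch_not_end by blast
    then show ?thesis unfolding phi_end[OF that(1) \<open>v \<notin> B\<close>] using hray_eq_gray[OF nz n\<zeta> s] by simp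
  qed
  have "pe ` {0..pt} = (\<lambda>t. gpt (z pu) 0 ((t - 0) / pt)) ` {0..0 + pt}" by (intro image_cong) (auto simp: pe_def)
  also have "\<dots> = hseg (z pu) 0" unfolding image_rescale[OF pt(1)] hseg_eq_gpt[OF nz z0] ..
  finally show "(\<lambda>t. \<phi> (pu, pv, t)) ` {0..pt} = hseg (\<phi> (pu, pv, 0)) 0" unfolding phi_0[OF puB] phi_p(1) .
  show "(\<lambda>t. \<phi> (pu, pv, t)) ` {pt..1} = hseg 0 (\<phi> (pu, pv, 1))" if "pv \<in> B"
  proof -
    have p1: "0 < 1 - pt" using pt(2)[OF that] by simp
    have "pe ` {pt..1} = (\<lambda>t. gpt 0 (z pv) ((t - pt) / (1 - pt))) ` {pt..pt + (1 - pt)}"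
      using that by (intro image_cong) (auto simp: pe_far far_def)
    also have "\<dots> = hseg 0 (z pv)" unfolding image_rescale[OF p1] hseg_eq_gpt[OF z0 nz] ..
    finally show ?thesis using q.vt1[OF pedge puB that] unfolding phi_p(1) by simp
  qed
  show "(\<lambda>t. \<phi> (pu, pv, t)) ` {pt..} = hray 0 (\<zeta> pv)" if "pv \<in> Ends"
  proof -
    have b: "pv \<notin> B" using that branch_not_end by blast
    have "pe ` {pt..} = (\<lambda>t. gray 0 (\<zeta> pv) (s * (t - pt))) ` {pt..}" using b by (intro image_cong) (auto simp: pe_far far_def)
    also have "\<dots> = (\<lambda>t. gray 0 (\<zeta> pv) (s * t)) ` ((\<lambda>t. t - pt) ` {pt..})" by (simp add: image_image)
    also have "(\<lambda>t. t - pt) ` {pt..} = {0..}"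
    proof
      show "{0..} \<subseteq> (\<lambda>t. t - pt) ` {pt..}" using image_eqI[of _ "\<lambda>t. t - pt" "_ + pt"] by (auto intro!: image_eqI[of _ "\<lambda>t. t - pt" "_ + pt"])
    qed auto
    also have "(\<lambda>t. gray 0 (\<zeta> pv) (s * t)) ` {0..} = hray 0 (\<zeta> pv)" using hray_eq_gray[OF z0 n\<zeta> s] by simp
    finally show ?thesis unfolding phi_p(1) .
  qed
qed

end

section \<open>Invariance under rotations\<close>

lemma unit_cnj: "cmod l = 1 \<Longrightarrow> cnj l * l = 1"
  using complex_norm_square[of l] by (simp add: mult.commute)

lemma mob_rot: assumes "cmod l = 1" shows "mob (l * a) (l * x) = l * mob a x"
proof -
  have "cnj (l * a) * (l * x) = (cnj l * l) * (cnj a * x)" by (simp only: complex_cnj_mult mult_ac)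
  then show ?thesis unfolding mob_def using unit_cnj[OF assms] by (simp add: right_diff_distrib[symmetric])
qed

lemma hdist_rot: assumes "cmod l = 1" shows "hdist (l * a) (l * b) = hdist a b"
  unfolding hdist_mob_eq mob_rot[OF assms] using assms by (simp add: norm_mult)

lemma bus_rot: assumes "cmod l = 1" shows "bus (l * \<zeta>) (l * x) = bus \<zeta> x"
  unfolding bus_def pker_def using assms by (simp add: norm_mult right_diff_distrib[symmetric])

section \<open>Realization\<close>

text \<open>What \<open>cluster_count\<close> provides, as a predicate in the radius and the
  tolerance: one radius is chosen for all branch points, with a tolerance for each.\<close>

definition cluster_ok :: "'i set \<Rightarrow> ('i \<Rightarrow> complex) \<Rightarrow> real \<Rightarrow> real \<Rightarrow> real \<Rightarrow> bool" where
  "cluster_ok J C \<delta> r \<omega> \<longleftrightarrow> (\<forall>(I::'i set) \<zeta> w cl.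
     finite I \<and> (\<forall>e\<in>I. 0 \<le> w e \<and> cmod (\<zeta> e) = 1 \<and> cl e \<in> J \<and> cmod (\<zeta> e - C (cl e)) \<le> \<omega>) \<and> (\<Sum>e\<in>I. w e) = 1
       \<and> (\<forall>i\<in>J. \<delta> \<le> (\<Sum>e\<in>{e\<in>I. cl e = i}. w e)) \<longrightarrow>
     finite {u. cmod u < r \<and> vker I \<zeta> w u = 0} \<and>
     (\<Sum>u\<in>{u. cmod u < r \<and> vker I \<zeta> w u = 0}. nat (zorder (vker I \<zeta> w) u)) = card J - 2)"

lemma positive_lower_bound:
  fixes f :: "'x \<Rightarrow> real" assumes "finite A" "\<And>x. x \<in> A \<Longrightarrow> 0 < f x"
  shows "\<exists>\<gamma>>0. \<gamma> \<le> 1 \<and> (\<forall>x\<in>A. \<gamma> \<le> f x)"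
proof -
  have fin: "finite (insert 1 (f ` A))" using assms(1) by simp
  have "0 < Min (insert 1 (f ` A))" using assms by (subst Min_gr_iff) auto
  moreover have "Min (insert 1 (f ` A)) \<le> 1" by (rule Min_le[OF fin]) simp
  moreover have "Min (insert 1 (f ` A)) \<le> f x" if "x \<in> A" for x by (rule Min_le[OF fin]) (use that in simp)
  ultimately show ?thesis by blast
qed

context tree_positions begin

lemma et_roots: "et pu = \<eta>2" "et pv = \<eta>1"
  using bel_root[of pv pu] puv bel_refl by (auto simp: et_def)

text \<open>The placement has scale \<sigma> but is compared with the metric of factor s. The excess
  is at most s0 on an edge and at most s0 pt or s0 on the two parts of the base edge;
  \<open>D\<close> collects it together with the constants of \<open>hdist_edge\<close>,
  \<open>bus_edge\<close> and \<open>bus_root\<close>. The summand 16 \<kappa> / g in the gap pays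
  for replacing two ends by the directions of their clusters.\<close>

lemma tree_geodesics_pos:
  assumes l: "cmod l = 1" and s: "0 < s" and pt: "0 < pt" "pv \<in> B \<longrightarrow> pt < 1" and puB: "pu \<in> B"
    and \<sigma>: "ln (1 / \<epsilon>) = \<sigma>" "s \<le> \<sigma>" "\<sigma> \<le> s + s0" "0 \<le> s0"
    and h: "ln (1 / \<eta>2) = \<sigma> * pt" "pv \<in> B \<longrightarrow> ln (1 / \<eta>1) = \<sigma> * (1 - pt)"
    and D: "D = s0 * (1 + pt) + ln 5 + ln (25 / g\<^sup>2)"
    and c0: "0 < c0" "c0 \<le> 1"
    and gap: "\<And>u v w. u \<in> B \<Longrightarrow> v \<in> nbrs E u \<Longrightarrow> w \<in> nbrs E u \<Longrightarrow> v \<noteq> w \<Longrightarrow> c0 + 16 * \<kappa> / g \<le> cmod (dir u v - dir u w)"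
  shows "tree_geodesics V E pu pv (\<lambda>v. l * pos v) (\<lambda>e. l * zeta e) s pt D c0"
proof -
  have lg: "0 \<le> ln (25 / g\<^sup>2)"
  proof -
    have "g\<^sup>2 \<le> 25" using g power_le_one[of g 2] by simp
    then show ?thesis using g by (intro ln_ge_zero) (simp add: le_divide_eq)
  qed
  have l5: "0 \<le> ln (5::real)" by simp
  have sp: "0 \<le> s0 * pt" using \<sigma> pt by simp
  have Ds: "s0 + ln 5 \<le> D" "ln (25 / g\<^sup>2) \<le> D" "s0 * pt \<le> D" "s0 \<le> D" "0 \<le> D"
    using lg l5 sp \<sigma>(4) unfolding D by (simp_all add: distrib_left)
  have spt: "s * pt \<le> \<sigma> * pt" "\<sigma> * pt \<le> s * pt + s0 * pt"
    using \<sigma> pt by (auto simp: mult_right_mono distrib_right[symmetric])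
  have spt1: "s * (1 - pt) \<le> \<sigma> * (1 - pt)" "\<sigma> * (1 - pt) \<le> s * (1 - pt) + s0" if "pv \<in> B"
  proof -
    have p: "0 \<le> 1 - pt" "1 - pt \<le> 1" using pt that by auto
    show "s * (1 - pt) \<le> \<sigma> * (1 - pt)" using \<sigma> p by (intro mult_right_mono) auto
    have "\<sigma> * (1 - pt) \<le> (s + s0) * (1 - pt)" using \<sigma> p by (intro mult_right_mono) auto
    moreover have "s0 * (1 - pt) \<le> s0 * 1" using \<sigma>(4) p by (intro mult_left_mono) auto
    ultimately show "\<sigma> * (1 - pt) \<le> s * (1 - pt) + s0" by (simp add: distrib_right)
  qed
  note rot = bus_rot[OF l] hdist_rot[OF l]
  have h0: "hdist (l * x) 0 = hdist 0 x" "hdist 0 (l * x) = hdist 0 x" for x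
    using rot(2)[of x 0] rot(2)[of 0 x] by (simp_all add: hdist_commute)
  have edge: "hdist (pos u) (pos v) \<le> s + D \<and> (\<forall>e\<in>Ends. e \<in> side E u v \<longrightarrow> s - D \<le> bus (zeta e) (pos v) - bus (zeta e) (pos u))"
    if uv: "{u, v} \<in> E" "{u, v} \<noteq> {pu, pv}" for u v
  proof -
    have VV: "u \<in> V" "v \<in> V" using edgeV[OF uv(1)] by auto
    consider "u = par v" "v \<noteq> pu" "v \<noteq> pv" | "v = par u" "u \<noteq> pu" "u \<noteq> pv"
      using edge_par[of u v] uv by (auto simp: E'_def)
    then show ?thesis
    proof cases
      case 1
      have "s - D \<le> bus (zeta e) (pos v) - bus (zeta e) (pos u)" if "e \<in> Ends" "e \<in> side E u v" for e
        using bus_edge(1)[OF VV(2) 1(2,3) that(1)] bel_side[OF VV(2) 1(2,3), of e] that 1(1) \<sigma> Ds by simp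
      then show ?thesis using hdist_edge[OF VV(2) 1(2,3)] 1(1) \<sigma> Ds by auto
    next
      case 2
      have "s - D \<le> bus (zeta e) (pos v) - bus (zeta e) (pos u)" if "e \<in> Ends" "e \<in> side E u v" for e
      proof -
        have "\<not> bel u e" using side_disj[OF uv(1) that(2)] bel_side[OF VV(1) 2(2,3), of e] 2(1) by simp
        then show ?thesis using bus_edge(2)[OF VV(1) 2(2,3) that(1)] 2(1) \<sigma> Ds by simp
      qed
      then show ?thesis using hdist_edge[OF VV(1) 2(2,3)] 2(1) \<sigma> Ds by (auto simp: hdist_commute)
    qed
  qed
  have root: "bel pu e \<longleftrightarrow> e \<in> side E pv pu" "bel pv e \<longleftrightarrow> e \<in> side E pu pv" for e using bel_side_root by blast+
  show ?thesis
  proof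
    show "0 < s" "0 < pt" "pu \<in> B" "0 \<le> D" "0 < c0" "c0 \<le> 1" by (fact s pt(1) puB Ds(5) c0)+
    show "pt < 1" if "pv \<in> B" using pt that by blast
    show "cmod (l * pos v) < 1" for v using norm_pos l by (simp add: norm_mult)
    show "cmod (l * zeta e) = 1" for e using norm_zeta l by (simp add: norm_mult)
    show "hdist (l * pos u) (l * pos v) \<le> s + D" if "{u, v} \<in> E" "{u, v} \<noteq> {pu, pv}" for u v
      using edge[OF that] by (simp add: rot)
    show "s - D \<le> bus (l * zeta e) (l * pos v) - bus (l * zeta e) (l * pos u)"
      if "{u, v} \<in> E" "{u, v} \<noteq> {pu, pv}" "e \<in> Ends" "e \<in> side E u v" for u v e
      using edge[OF that(1,2)] that(3,4) by (simp add: rot)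
    show "hdist (l * pos pu) 0 \<le> s * pt + D"
      using pos_root(2)[of pu] h(1) spt(2) Ds unfolding h0 et_roots by simp
    show "s * pt - D \<le> bus (l * zeta e) (l * pos pu)" if "e \<in> Ends" "e \<in> side E pv pu" for e
      using bus_root(1)[of pu e] that root[of e] h(1) spt(1) Ds unfolding rot et_roots by simp
    show "s * pt - D \<le> - bus (l * zeta e) (l * pos pu)" if "e \<in> Ends" "e \<in> side E pu pv" for e
    proof -
      have "\<not> bel pu e" using that(2) root[of e] bel_excl by blast
      then show ?thesis using bus_root(2)[of pu e] that(1) h(1) spt(1) Ds unfolding rot et_roots by simp
    qed
    show "hdist 0 (l * pos pv) \<le> s * (1 - pt) + D" if "pv \<in> B"
      using pos_root(2)[of pv] h(2) that spt1(2)[OF that] Ds unfolding h0 et_roots by simp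
    show "s * (1 - pt) - D \<le> bus (l * zeta e) (l * pos pv)" if "pv \<in> B" "e \<in> Ends" "e \<in> side E pu pv" for e
      using bus_root(1)[of pv e] that root[of e] h(2) spt1(1)[OF that(1)] Ds unfolding rot et_roots by simp
    show "s * (1 - pt) - D \<le> - bus (l * zeta e) (l * pos pv)" if "pv \<in> B" "e \<in> Ends" "e \<in> side E pv pu" for e
    proof -
      have "\<not> bel pv e" using that(3) root[of e] bel_excl by blast
      then show ?thesis using bus_root(2)[of pv e] that(1,2) h(2) spt1(1)[OF that(1)] Ds unfolding rot et_roots by simp
    qed
    show "c0 \<le> cmod (l * zeta e - l * zeta pv)" if "e \<in> Ends" "e \<in> side E pv pu" for e
    proof -
      have "\<not> bel pv e" using that(2) root[of e] bel_excl by blast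
      then have "sg pv = - sg e" by (simp add: sg_def bel_refl)
      then have "1 \<le> cmod (zeta e - zeta pv)" using that(1) VBE puv by (intro zeta_opp) auto
      then show ?thesis using c0 l by (simp add: norm_mult right_diff_distrib[symmetric])
    qed
    show "c0 \<le> cmod (mob (l * pos u) (l * zeta e) - mob (l * pos u) (l * zeta e'))"
      if "u \<in> B" "{u, v} \<in> E" "{u, w} \<in> E" "v \<noteq> w" "e \<in> Ends" "e \<in> side E u v" "e' \<in> Ends" "e' \<in> side E u w" for u v w e e'
    proof -
      have uV: "u \<in> V" using that(1) VBE by blast
      have n: "v \<in> nbrs E u" "w \<in> nbrs E u" using that(2,3) by (simp_all add: nbrs_def)
      let ?a = "cnj (rot u) * mob (pos u) (zeta e)" and ?b = "cnj (rot u) * mob (pos u) (zeta e')"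
      have "cmod (?a - dir u v) \<le> 8 * \<kappa> / g" "cmod (?b - dir u w) \<le> 8 * \<kappa> / g"
        using cluster[OF uV n(1) that(5,6)] cluster[OF uV n(2) that(7,8)] by auto
      moreover have "cmod (dir u v - dir u w) \<le> cmod (?a - ?b) + cmod (?a - dir u v) + cmod (?b - dir u w)"
      proof -
        have eq: "dir u v - dir u w = (?a - ?b) - (?a - dir u v) + (?b - dir u w)" by simp
        have "cmod (x - y + x') \<le> cmod x + cmod y + cmod x'" for x y x' :: complex
          using norm_triangle_ineq[of "x - y" x'] norm_triangle_ineq4[of x y] by linarith
        then show ?thesis by (subst eq)
      qed
      moreover have "cmod (?a - ?b) = cmod (mob (pos u) (zeta e) - mob (pos u) (zeta e'))"
        using norm_rot[of u] by (simp add: norm_mult right_diff_distrib[symmetric])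
      ultimately have "c0 \<le> cmod (mob (pos u) (zeta e) - mob (pos u) (zeta e'))"
        using gap[OF that(1) n that(4)] by simp
      then show ?thesis using l by (simp add: mob_rot norm_mult right_diff_distrib[symmetric])
    qed
  qed
qed

text \<open>The clusters are the directions at \<open>v\<close>. Each end lies in exactly one of
  them and each of them contains an end, so every cluster has weight at least \<delta>.\<close>

lemma cluster_apply:
  assumes v: "v \<in> B" and ok: "cluster_ok (nbrs E v) (dir v) \<delta> r \<omega>" and k: "8 * \<kappa> / g \<le> \<omega>"
    and w: "\<And>e. e \<in> Ends \<Longrightarrow> \<delta> \<le> w e" "0 < \<delta>" "(\<Sum>e\<in>Ends. w e) = 1"
  defines "F \<equiv> vker Ends (\<lambda>e. cnj (rot v) * mob (pos v) (zeta e)) w"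
  shows "finite {u. cmod u < r \<and> F u = 0}" "(\<Sum>u\<in>{u. cmod u < r \<and> F u = 0}. nat (zorder F u)) = valence E v - 2"
proof -
  have vV: "v \<in> V" using v VBE by blast
  have finE: "finite Ends" by (rule finite_subset[OF _ finV]) (auto simp: tree_ends_def)
  define cl where "cl e = (SOME u. {v, u} \<in> E \<and> e \<in> side E v u)" for e
  have cl: "{v, cl e} \<in> E \<and> e \<in> side E v (cl e)" if "e \<in> Ends" for e
  proof -
    have "e \<in> V" "e \<noteq> v" using that v branch_not_end VBE by auto
    then show ?thesis unfolding cl_def using vside[OF vV] by (intro someI_ex[of "\<lambda>u. {v, u} \<in> E \<and> e \<in> side E v u"]) blast
  qed
  have cl_eq: "cl e = i" if "e \<in> Ends" "{v, i} \<in> E" "e \<in> side E v i" for e i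
  proof (rule ccontr)
    assume ne: "cl e \<noteq> i"
    have "{i, v} \<in> E" using that(2) by (simp add: insert_commute)
    then have "e \<in> side E i v" using side_nest[of i v "cl e" e] cl[OF that(1)] ne by blast
    then show False using side_disj[OF that(2,3)] by blast
  qed
  have "0 \<le> w e \<and> cmod (cnj (rot v) * mob (pos v) (zeta e)) = 1 \<and> cl e \<in> nbrs E v \<and>
      cmod (cnj (rot v) * mob (pos v) (zeta e) - dir v (cl e)) \<le> \<omega>" if e: "e \<in> Ends" for e
  proof -
    have n: "cl e \<in> nbrs E v" using cl[OF e] by (simp add: nbrs_def)
    have "cmod (cnj (rot v) * mob (pos v) (zeta e) - dir v (cl e)) \<le> 8 * \<kappa> / g"
      using cluster[OF vV n e] cl[OF e] by blast
    then show ?thesis using n k w(1)[OF e] w(2) norm_rot norm_mob_eq[OF norm_pos norm_zeta] by (simp add: norm_mult)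
  qed
  moreover have "\<delta> \<le> (\<Sum>e\<in>{e\<in>Ends. cl e = i}. w e)" if "i \<in> nbrs E v" for i
  proof -
    have vi: "{v, i} \<in> E" using that by (simp add: nbrs_def)
    obtain e where e: "e \<in> Ends" "e \<in> side E v i" using side_end[OF vi] by blast
    have "w e \<le> (\<Sum>e\<in>{e\<in>Ends. cl e = i}. w e)"
    proof (rule member_le_sum)
      show "e \<in> {e \<in> Ends. cl e = i}" using e cl_eq[OF e(1) vi e(2)] by simp
      show "0 \<le> w x" if "x \<in> {e \<in> Ends. cl e = i} - {e}" for x using that w(1)[of x] w(2) by auto
    qed (use finE in simp)
    then show ?thesis using w(1)[OF e(1)] by linarith
  qed
  ultimately have "finite {u. cmod u < r \<and> F u = 0} \<and> (\<Sum>u\<in>{u. cmod u < r \<and> F u = 0}. nat (zorder F u)) = card (nbrs E v) - 2"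
    unfolding F_def using ok[unfolded cluster_ok_def, rule_format, of Ends w "\<lambda>e. cnj (rot v) * mob (pos v) (zeta e)" cl] finE w(3) by blast
  then show "finite {u. cmod u < r \<and> F u = 0}" "(\<Sum>u\<in>{u. cmod u < r \<and> F u = 0}. nat (zorder F u)) = valence E v - 2"
    by (simp_all add: valence_nbrs)
qed

end

theorem theorem3p16:
  fixes d :: nat and V :: "'v set" and E :: "'v set set" and rot :: "'v \<Rightarrow> 'v \<Rightarrow> 'v"
    and m :: 'v and p :: "'v tpt"
  assumes "d \<ge> 2"
    and "ext_pointed_tree d V E rot m p"
  shows "realizable d V E m p"
proof -
  obtain pu pv pt where p: "p = (pu, pv, pt)" by (cases p)
  have T: "marked_ribbon_tree d V E rot m" "{pu, pv} \<in> E" "pu \<in> branch_points V E" "0 < pt"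
    "pv \<in> branch_points V E \<longrightarrow> pt < 1"
    using assms(2) by (simp_all add: ext_pointed_tree_def p)
  interpret rooted_tree V E pu pv
    by unfold_locales (use T in \<open>auto simp: marked_ribbon_tree_def\<close>)
  have cardE: "card Ends = d + 1" and mE: "m \<in> Ends" using T(1) by (simp_all add: marked_ribbon_tree_def)
  have finE: "finite Ends" by (rule finite_subset[OF _ finV]) (auto simp: tree_ends_def)
  have finB: "finite B" by (rule finite_subset[OF _ finV]) (auto simp: branch_points_def)
  obtain c and g :: real where g: "0 < g" "g \<le> 1" and c1: "\<forall>x. \<bar>c x\<bar> \<le> (1::real)"
    and cgap': "\<forall>v. \<forall>x\<in>children v. \<forall>y\<in>children v. x \<noteq> y \<longrightarrow> g \<le> \<bar>c x - c y\<bar>"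
    and cpm': "\<forall>v\<in>B. \<exists>x\<in>children v. \<exists>y\<in>children v. c x = -1 \<and> c y = 1"
    using digits by (elim exE conjE) (rule that)
  note cgap = cgap'[rule_format] and cpm = cpm'[rule_format]
  \<comment> \<open>A placement with provisional scales. \<open>dir\<close> and the lower bound of
    the weights involve no scale, so they can be used before the final scales are chosen.\<close>
  interpret e0: tree_positions V E pu pv c g "g / 8" "g / 8" "g / 8" "g / 8"
  proof
    show "\<exists>x\<in>children v. \<exists>y\<in>children v. c x = -1 \<and> c y = 1" if "v \<in> B" for v by (rule cpm[OF that])
  qed (use g c1 in \<open>simp_all add: cgap\<close>)
  define \<delta> where "\<delta> = 1 / (4 * real (card Ends) * (1 + 8 * real (card Ends)))"
  have \<delta>: "0 < \<delta>" by (rule e0.weights(2)[OF \<delta>_def])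

  \<comment> \<open>The least gap between two directions at a branch point is positive because there
    are finitely many triples.\<close>
  let ?T = "{(u, v, w). u \<in> B \<and> v \<in> nbrs E u \<and> w \<in> nbrs E u \<and> v \<noteq> w}"
  have "?T \<subseteq> B \<times> (\<Union>u\<in>B. nbrs E u) \<times> (\<Union>u\<in>B. nbrs E u)" by blast
  then have "finite ?T" using finB finite_nbrs by (elim finite_subset) auto
  then have "\<exists>\<gamma>>0. \<gamma> \<le> 1 \<and> (\<forall>x\<in>?T. \<gamma> \<le> (case x of (u, v, w) \<Rightarrow> cmod (e0.dir u v - e0.dir u w)))"
  proof (rule positive_lower_bound)
    fix x assume "x \<in> ?T"
    then obtain u v w where x: "x = (u, v, w)" "u \<in> B" "v \<in> nbrs E u" "w \<in> nbrs E u" "v \<noteq> w" by blast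
    have "u \<in> V" using x(2) VBE by blast
    then have "e0.dir u v \<noteq> e0.dir u w" using e0.dir_inj[of u] x(3-5) by (auto dest: inj_onD)
    then show "0 < (case x of (u, v, w) \<Rightarrow> cmod (e0.dir u v - e0.dir u w))" using x(1) by simp
  qed
  then obtain \<gamma> where \<gamma>: "0 < \<gamma>" "\<gamma> \<le> 1"
    "\<And>u v w. u \<in> B \<Longrightarrow> v \<in> nbrs E u \<Longrightarrow> w \<in> nbrs E u \<Longrightarrow> v \<noteq> w \<Longrightarrow> \<gamma> \<le> cmod (e0.dir u v - e0.dir u w)"
    by fastforce

  have "\<exists>r0. r0 < 1 \<and> (\<forall>r. r0 < r \<longrightarrow> r < 1 \<longrightarrow> (\<exists>\<omega>>0. cluster_ok (nbrs E v) (e0.dir v) \<delta> r \<omega>))" if v: "v \<in> B" for v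
  proof -
    have vV: "v \<in> V" using v VBE by blast
    show ?thesis unfolding cluster_ok_def
      by (rule cluster_count[OF finite_nbrs _ e0.norm_dir e0.dir_inj[OF vV] \<delta>]) (use branch_nbrs[OF v] in simp)
  qed
  then obtain r0 where r0: "\<And>v. v \<in> B \<Longrightarrow> r0 v < 1"
    "\<And>v r. v \<in> B \<Longrightarrow> r0 v < r \<Longrightarrow> r < 1 \<Longrightarrow> \<exists>\<omega>>0. cluster_ok (nbrs E v) (e0.dir v) \<delta> r \<omega>" by metis
  have "\<exists>a>0. a \<le> 1 \<and> (\<forall>v\<in>B. a \<le> 1 - r0 v)" using r0(1) by (intro positive_lower_bound[OF finB]) simp
  then obtain a where a: "0 < a" "a \<le> 1" "\<And>v. v \<in> B \<Longrightarrow> a \<le> 1 - r0 v" by blast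
  \<comment> \<open>Larger than every r0 v, which is at most 1 - a.\<close>
  define r where "r = 1 - a / 2"
  have r: "0 < r" "r < 1" using a by (simp_all add: r_def)
  have "r0 v < r" if "v \<in> B" for v using a(1) a(3)[OF that] by (simp add: r_def)
  then have "\<And>v. v \<in> B \<Longrightarrow> \<exists>\<omega>>0. cluster_ok (nbrs E v) (e0.dir v) \<delta> r \<omega>" using r0(2) r(2) by blast
  then obtain \<omega> where \<omega>: "\<And>v. v \<in> B \<Longrightarrow> 0 < \<omega> v" "\<And>v. v \<in> B \<Longrightarrow> cluster_ok (nbrs E v) (e0.dir v) \<delta> r (\<omega> v)" by metis
  have "\<exists>b>0. b \<le> 1 \<and> (\<forall>v\<in>B. b \<le> \<omega> v)" by (rule positive_lower_bound[OF finB \<omega>(1)])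
  then obtain b where b: "0 < b" "\<And>v. v \<in> B \<Longrightarrow> b \<le> \<omega> v" by blast

  \<comment> \<open>The three bounds give \<kappa> \<le> g / 8 for the digit estimates, clusters
    within all tolerances, and the loss of at most half of the gap \<gamma>.\<close>
  define k where "k = min (1 / 8) (min (b / 8) (\<gamma> / 32))"
  define \<kappa> where "\<kappa> = g * k"
  have k: "0 < k" "k \<le> 1 / 8" "k \<le> b / 8" "k \<le> \<gamma> / 32" using b(1) \<gamma>(1) by (auto simp: k_def)
  have \<kappa>: "0 < \<kappa>" "\<kappa> \<le> g / 8" "8 * \<kappa> / g \<le> b" "16 * \<kappa> / g \<le> \<gamma> / 2"
    using k g by (auto simp: \<kappa>_def)
  have \<kappa>1: "\<kappa> < 1" using \<kappa>(2) g by simp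
  define c0 where "c0 = \<gamma> / 2"
  have c0: "0 < c0" "c0 \<le> 1" using \<gamma> by (simp_all add: c0_def)
  define L where "L = ln (1 / \<kappa>)"
  have L: "0 < L" unfolding L_def using \<kappa> \<kappa>1 by (intro ln_gt_zero) simp
  have exp_le: "exp (- x) \<le> \<kappa>" if "L \<le> x" for x
  proof -
    have "- x \<le> ln \<kappa>" using that \<kappa> by (simp add: L_def ln_div)
    then show ?thesis using \<kappa>(1) by (metis exp_le_cancel_iff exp_ln)
  qed
  \<comment> \<open>Any \<sigma> \<ge> s0 makes the exponents \<sigma>, \<sigma> pt and \<sigma> (1
    - pt) at least L, that is, the corresponding scales at most \<kappa>.\<close>
  define s0 where "s0 = L * (1 + 1 / pt + (if pv \<in> B then 1 / (1 - pt) else 0))"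
  have s0: "L \<le> s0" "L \<le> s0 * pt" "pv \<in> B \<Longrightarrow> L \<le> s0 * (1 - pt)"
  proof -
    have t: "0 < 1 / pt" "0 \<le> (if pv \<in> B then 1 / (1 - pt) else 0)" using T(4,5) by auto
    have ge: "L * x \<le> s0" if "x \<le> 1 + 1 / pt + (if pv \<in> B then 1 / (1 - pt) else 0)" for x
      unfolding s0_def using L that by (intro mult_left_mono) auto
    show "L \<le> s0" using ge[of 1] t by linarith
    have "L * (1 / pt) * pt \<le> s0 * pt" using ge[of "1 / pt"] t T(4) by (intro mult_right_mono) linarith+
    then show "L \<le> s0 * pt" using T(4) by simp
    show "L \<le> s0 * (1 - pt)" if "pv \<in> B"
    proof -
      have "L * (1 / (1 - pt)) * (1 - pt) \<le> s0 * (1 - pt)"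
        using ge[of "1 / (1 - pt)"] t T(5) that by (intro mult_right_mono) auto
      then show ?thesis using T(5) that by simp
    qed
  qed
  have s0p: "0 < s0" using s0(1) L by linarith
  define D where "D = s0 * (1 + pt) + ln 5 + ln (25 / g\<^sup>2)"
  define C where "C = 6 * D + ln (16 / c0\<^sup>2)"
  obtain N where N: "\<And>a b. a \<in> V \<Longrightarrow> b \<in> V \<Longrightarrow> graph_dist E a b \<le> N" using graph_dist_bound by blast
  define K' where "K' = (real (card V) + real N + 3) * C"
  define c2 where "c2 = c0 * exp (- C)"
  have c2: "0 < c2" using c0 by (simp add: c2_def)
  define M where "M = max 1 (max K' (2 * artanh (1 - \<delta> * (2 - sqrt (4 - c2\<^sup>2)))))"
  have M: "1 \<le> M" "K' \<le> M" "2 * artanh (1 - \<delta> * (2 - sqrt (4 - c2\<^sup>2))) \<le> M" by (auto simp: M_def)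
  define R where "R = 2 * artanh r"
  have R: "0 < R" unfolding R_def artanh_def using r by (simp add: ln_gt_zero)
  define K where "K = max 1 (ln (1 / \<delta>))"

  have "\<exists>a \<phi> \<psi>. in_BK d K a \<and> realizes d V E m p s M R a \<phi> \<psi>" if s: "0 < s" for s
  proof -
    \<comment> \<open>Below s0 the placement no longer changes with s; the discrepancy with the
      metric stays below s0 per edge between branch points.\<close>
    define \<sigma> where "\<sigma> = max s s0"
    have \<sigma>: "s \<le> \<sigma>" "s0 \<le> \<sigma>" "\<sigma> \<le> s + s0" using s s0p by (auto simp: \<sigma>_def)
    have \<sigma>L: "L \<le> \<sigma>" "L \<le> \<sigma> * pt" "pv \<in> B \<Longrightarrow> L \<le> \<sigma> * (1 - pt)"
    proof -
      show "L \<le> \<sigma>" using s0(1) \<sigma>(2) by linarith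
      have "s0 * pt \<le> \<sigma> * pt" using \<sigma>(2) T(4) by (intro mult_right_mono) auto
      then show "L \<le> \<sigma> * pt" using s0(2) by linarith
      show "L \<le> \<sigma> * (1 - pt)" if "pv \<in> B"
      proof -
        have "s0 * (1 - pt) \<le> \<sigma> * (1 - pt)" using \<sigma>(2) T(5) that by (intro mult_right_mono) auto
        then show ?thesis using s0(3)[OF that] by linarith
      qed
    qed
    define \<epsilon> where "\<epsilon> = exp (- \<sigma>)"
    define \<eta>2 where "\<eta>2 = exp (- (\<sigma> * pt))"
    \<comment> \<open>If \<open>pv\<close> is an end, its rooted tree is the single ideal point cay
      0 at any scale, so every admissible value will do.\<close>
    define \<eta>1 where "\<eta>1 = (if pv \<in> B then exp (- (\<sigma> * (1 - pt))) else \<kappa>)"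
    have pos: "0 < \<epsilon>" "\<epsilon> \<le> \<kappa>" "0 < \<eta>1" "\<eta>1 \<le> \<kappa>" "0 < \<eta>2" "\<eta>2 \<le> \<kappa>"
      using exp_le[OF \<sigma>L(1)] exp_le[OF \<sigma>L(2)] exp_le[OF \<sigma>L(3)] \<kappa>(1) by (auto simp: \<epsilon>_def \<eta>1_def \<eta>2_def)
    interpret em: tree_positions V E pu pv c g \<epsilon> \<kappa> \<eta>1 \<eta>2
    proof
      show "\<exists>x\<in>children v. \<exists>y\<in>children v. c x = -1 \<and> c y = 1" if "v \<in> B" for v by (rule cpm[OF that])
    qed (use g c1 pos \<kappa>(2) in \<open>simp_all add: cgap\<close>)
    obtain w where w: "\<And>e. e \<in> Ends \<Longrightarrow> \<delta> \<le> w e" "(\<Sum>e\<in>Ends. w e) = 1" "(\<Sum>e\<in>Ends. of_real (w e) * em.zeta e) = 0"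
      using em.weights(1)[OF \<delta>_def] by blast
    have wpos: "0 < w e" if "e \<in> Ends" for e using w(1)[OF that] \<delta> by linarith
    have "circle_measure Ends em.zeta w d"
      by unfold_locales (use assms(1) finE cardE em.zeta_inj em.norm_zeta wpos w in simp_all)
    from circle_measure_realize[OF this mE]
    obtain l a where l: "cmod l = 1" and a: "a \<in> bparams d" "eta d a 0 = l * em.zeta m"
      and cm: "circle_measure Ends (\<lambda>e. l * em.zeta e) w d"
      and f: "\<And>x. antiblaschke d a x = cnj (circle_measure.Nu Ends (\<lambda>e. l * em.zeta e) w x / circle_measure.De Ends (\<lambda>e. l * em.zeta e) w x)"
      by blast
    define \<psi> where "\<psi> = (\<lambda>e. l * em.zeta e)"
    define z where "z = (\<lambda>v. l * em.pos v)"
    interpret cm: circle_measure Ends \<psi> w d using cm by (simp add: \<psi>_def)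
    have f: "\<And>x. antiblaschke d a x = cnj (cm.Nu x / cm.De x)" using f by (simp add: \<psi>_def)
    interpret G: tree_geodesics V E pu pv z \<psi> s pt D c0
      unfolding z_def \<psi>_def
    proof (rule em.tree_geodesics_pos[OF l s T(4,5,3) _ \<sigma>(1,3) _ _ _ D_def c0])
      show "ln (1 / \<epsilon>) = \<sigma>" "ln (1 / \<eta>2) = \<sigma> * pt" "pv \<in> B \<longrightarrow> ln (1 / \<eta>1) = \<sigma> * (1 - pt)" "0 \<le> s0"
        using s0p by (simp_all add: \<epsilon>_def \<eta>1_def \<eta>2_def ln_div)
      show "c0 + 16 * \<kappa> / g \<le> cmod (em.dir u v - em.dir u w)"
        if "u \<in> B" "v \<in> nbrs E u" "w \<in> nbrs E u" "v \<noteq> w" for u v w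
        using \<gamma>(3)[OF that] \<kappa>(4) by (simp add: c0_def)
    qed
    have GC: "G.C = C" by (simp add: G.C_def C_def)
    have qi: "s * tree_dist V E x y / M - M \<le> hdist (G.\<phi> x) (G.\<phi> y)" "hdist (G.\<phi> x) (G.\<phi> y) \<le> M * (s * tree_dist V E x y) + M"
      "tree_dist V E x y = 0 \<Longrightarrow> G.\<phi> x = G.\<phi> y" if xy: "x \<in> int_pts V E" "y \<in> int_pts V E" for x y
    proof -
      have q: "s * tree_dist V E x y - K' \<le> hdist (G.\<phi> x) (G.\<phi> y)" "hdist (G.\<phi> x) (G.\<phi> y) \<le> s * tree_dist V E x y + K'"
        "0 \<le> tree_dist V E x y" "tree_dist V E x y = 0 \<Longrightarrow> G.\<phi> x = G.\<phi> y"
        unfolding K'_def GC[symmetric] by (erule G.q.qi_bounds[OF N xy] | rule G.q.qi_bounds[OF N xy]; assumption)+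
      show "G.\<phi> x = G.\<phi> y" if "tree_dist V E x y = 0" by (rule q(4)[OF that])
      have st: "0 \<le> s * tree_dist V E x y" using q(3) s by simp
      have "s * tree_dist V E x y / M \<le> s * tree_dist V E x y / 1" using st M(1) by (intro divide_left_mono) auto
      then show "s * tree_dist V E x y / M - M \<le> hdist (G.\<phi> x) (G.\<phi> y)" using q(1) M(2) by simp
      have "1 * (s * tree_dist V E x y) \<le> M * (s * tree_dist V E x y)" using st M(1) by (intro mult_right_mono) auto
      then show "hdist (G.\<phi> x) (G.\<phi> y) \<le> M * (s * tree_dist V E x y) + M" using q(2) M(2) by simp
    qed
    have disp: "hdist (antiblaschke d a (G.\<phi> x)) (G.\<phi> x) \<le> M" if x: "x \<in> int_pts V E" for x
    proof -
      obtain e e' where e: "e \<in> Ends" "e' \<in> Ends" "e \<noteq> e'" "c2 \<le> cmod (mob (G.\<phi> x) (\<psi> e) - mob (G.\<phi> x) (\<psi> e'))"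
        using G.q.separated_ends[OF x] unfolding GC c2_def by blast
      from cm.displacement[OF f G.norm_phi e(1-3) w(1)[OF e(1)] w(1)[OF e(2)] \<delta> c2 e(4)] M(3)
      show ?thesis by linarith
    qed
    have crit: "num_crit (antiblaschke d a) (hball (G.\<phi> (vpt E v)) R) = valence E v - 2" if v: "v \<in> B" for v
    proof -
      have zv: "G.\<phi> (vpt E v) = z v" unfolding vpt_def by (rule G.phi_0[OF v])
      have t: "cmod (l * em.rot v) = 1" using l em.norm_rot by (simp add: norm_mult)
      \<comment> \<open>The rotation by l cancels: seen from \<open>z v\<close>, the atoms are those
        of the unrotated placement, which lie close to \<open>dir\<close>.\<close>
      have eq: "(\<lambda>e. cnj (l * em.rot v) * mob (z v) (\<psi> e)) = (\<lambda>e. cnj (em.rot v) * mob (em.pos v) (em.zeta e))"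
      proof
        fix e
        have "cnj (l * em.rot v) * (l * mob (em.pos v) (em.zeta e)) = (cnj l * l) * (cnj (em.rot v) * mob (em.pos v) (em.zeta e))"
          by (simp only: complex_cnj_mult mult_ac)
        then show "cnj (l * em.rot v) * mob (z v) (\<psi> e) = cnj (em.rot v) * mob (em.pos v) (em.zeta e)"
          by (simp only: z_def \<psi>_def mob_rot[OF l] unit_cnj[OF l] mult_1)
      qed
      have kb: "8 * \<kappa> / g \<le> \<omega> v" using \<kappa>(3) b(2)[OF v] by linarith
      let ?F = "vker Ends (\<lambda>e. cnj (em.rot v) * mob (em.pos v) (em.zeta e)) w"
      have A: "finite {u. cmod u < r \<and> ?F u = 0}" "(\<Sum>u\<in>{u. cmod u < r \<and> ?F u = 0}. nat (zorder ?F u)) = valence E v - 2"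
        by (rule em.cluster_apply[OF v \<omega>(2)[OF v] kb w(1) \<delta> w(2)], assumption)+
      show ?thesis using cm.num_crit_eq[OF f G.nz t r, of v, unfolded eq, OF A(1)] A(2) unfolding zv R_def by simp
    qed
    have bij: "bij_betw \<psi> Ends (rep_fix_circle (antiblaschke d a))"
      unfolding cm.rep_fix[OF f] using cm.inj by (simp add: bij_betw_def)
    have "in_BK d (ln (1 / \<delta>)) a" by (rule cm.in_BK_measure[OF f a(1) \<delta> w(1)])
    then have "in_BK d K a" unfolding in_BK_def K_def by (meson max.coboundedI2)
    moreover have "realizes d V E m p s M R a G.\<phi> \<psi>"
      unfolding realizes_def Let_def p prod.case
    proof (intro conjI allI ballI impI)
      show "\<psi> m = eta d a 0" using a(2) by (simp add: \<psi>_def)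
      show "G.\<phi> x \<in> ball 0 1" for x using G.norm_phi by simp
      show "G.\<phi> x = G.\<phi> y" if "x \<in> int_pts V E" "y \<in> int_pts V E" "tree_dist V E x y = 0" for x y by (rule qi(3)[OF that])
      show "G.\<phi> (pu, pv, pt) = 0" by (rule G.phi_base)
      show "s * tree_dist V E x y / M - M \<le> hdist (G.\<phi> x) (G.\<phi> y)" if "x \<in> int_pts V E" "y \<in> int_pts V E" for x y
        by (rule qi(1)[OF that])
      show "hdist (G.\<phi> x) (G.\<phi> y) \<le> M * (s * tree_dist V E x y) + M" if "x \<in> int_pts V E" "y \<in> int_pts V E" for x y
        by (rule qi(2)[OF that])
      show "continuous_on {t. (u, v, t) \<in> int_pts V E} (\<lambda>t. G.\<phi> (u, v, t))" for u v by (rule G.continuous_phi)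
      show "((\<lambda>t. G.\<phi> (u, e, t)) \<longlongrightarrow> \<psi> e) at_top" if "e \<in> Ends" "{u, e} \<in> E" for u e by (rule G.phi_lim[OF that])
      show "bij_betw \<psi> Ends (rep_fix_circle (antiblaschke d a))" by (rule bij)
      show "(\<lambda>t. G.\<phi> (u, v, t)) ` {0..1} = hseg (G.\<phi> (u, v, 0)) (G.\<phi> (u, v, 1))"
        if "{u, v} \<in> E" "u \<in> B" "{u, v} \<noteq> {pu, pv}" "v \<in> B" for u v by (rule G.phi_images(1)[OF that])
      show "(\<lambda>t. G.\<phi> (u, v, t)) ` {0..} = hray (G.\<phi> (u, v, 0)) (\<psi> v)"
        if "u \<in> B" "{u, v} \<noteq> {pu, pv}" "v \<in> Ends" for u v by (rule G.phi_images(2)[OF that])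
      show "(\<lambda>t. G.\<phi> (pu, pv, t)) ` {0..pt} = hseg (G.\<phi> (pu, pv, 0)) 0" by (rule G.phi_images(3))
      show "(\<lambda>t. G.\<phi> (pu, pv, t)) ` {pt..1} = hseg 0 (G.\<phi> (pu, pv, 1))" if "pv \<in> B" by (rule G.phi_images(4)[OF that])
      show "(\<lambda>t. G.\<phi> (pu, pv, t)) ` {pt..} = hray 0 (\<psi> pv)" if "pv \<in> Ends" by (rule G.phi_images(5)[OF that])
      show "num_crit (antiblaschke d a) (hball (G.\<phi> (vpt E v)) R) = valence E v - 2" if "v \<in> B" for v by (rule crit[OF that])
      show "hdist (antiblaschke d a (G.\<phi> x)) (G.\<phi> x) \<le> M" if "x \<in> int_pts V E" for x by (rule disp[OF that])
    qed
    ultimately show ?thesis by blast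
  qed
  moreover have "0 < K" "0 < M" using M(1) by (simp_all add: K_def)
  ultimately show ?thesis unfolding realizable_def using R by blast
qed

end
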